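(* Let $(V,\langle\cdot,\cdot\rangle_V)$ be a (possibly degenerate) inner product space and let $M\hookrightarrow V$ be a full extrinsic symmetric space, where the origin $0\in V$ is chosen such that $0\in M$. Let $(\mathfrak g,\langle\cdot,\cdot\rangle,\Phi)$, $\Phi=(D,\theta)$, be the data constructed from $M\hookrightarrow V$ as described in part 3 of the context: $\mathfrak g=\mathfrak k\oplus V$ with bracket $[\cdot,\cdot]$, inner product $\langle\cdot,\cdot\rangle=\langle\cdot,\cdot\rangle_{\mathfrak k}\oplus\langle\cdot,\cdot\rangle_V$, involution $\theta$ and linear map $D$. Then $(\mathfrak g,\langle\cdot,\cdot\rangle,\Phi)$ is a weak extrinsic symmetric triple (in particular $[\cdot,\cdot]$ is a Lie bracket on $\mathfrak g$), and $M=M_{\mathfrak g,\Phi}$ as submanifolds of $\mathfrak g_-=V$. If $\langle\cdot,\cdot\rangle_V$ is non-degenerate, then $(\mathfrak g,\langle\cdot,\cdot\rangle,\Phi)$ is an extrinsic symmetric triple.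
   Context: All vector spaces and Lie algebras are real and finite-dimensional. 1. Extrinsic symmetric spaces. An inner product space $(V,\langle\cdot,\cdot\rangle)$ is a finite-dimensional real affine space whose associated vector space (also denoted $V$) carries a symmetric bilinear form $\langle\cdot,\cdot\rangle$, possibly degenerate. Isometries are invertible affine maps preserving the bilinear forms. All submanifolds are connected. A submanifold $M\hookrightarrow V$ is non-degenerate if $\langle\cdot,\cdot\rangle$ restricted to each tangent space $T_xM\subset V$ is non-degenerate; then $V=T_xM\oplus T_x^\perp M$ with $T_x^\perp M=(T_xM)^\perp$. The affine normal space is $\mathcal N_xM=x+T_x^\perp M$. The reflection $s_x:V\to V$ at $\mathcal N_xM$ is the affine map with $ds_x|_{T_xM}=-\mathrm{id}$ and $s_x|_{\mathcal N_xM}=\mathrm{id}$. A non-degenerate submanifold $M\hookrightarrow V$ is called extrinsic symmetric (an extrinsic symmetric space) if $s_x(M)=M$ for all $x\in M$. It is called full if $M$ is not contained in a proper affine subspace of $V$. The transvection group of $M\hookrightarrow V$ is $K=\langle s_x\circ s_y\mid x,y\in M\rangle$. 2. Weak extrinsic symmetric triples. For a Lie algebra $\mathfrak g$ with involution $\theta$, $\mathfrak g_\pm$ are the $\pm1$-eigenspaces of $\theta$. If $D$ is a derivation of $\mathfrak g$ with $D^3=-D$ and $D\theta=-\theta D$, put $\mathfrak g^+=\ker D$, $\mathfrak g^-=\{X\mid D^2X=-X\}$, and $\mathfrak g_+^+=\mathfrak g_+\cap\mathfrak g^+$, $\mathfrak g_+^-=\mathfrak g_+\cap\mathfrak g^-$,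 $\mathfrak g_-^+=\mathfrak g_-\cap\mathfrak g^+$, $\mathfrak g_-^-=\mathfrak g_-\cap\mathfrak g^-$. An extrinsic symmetric triple $(\mathfrak g,\langle\cdot,\cdot\rangle,\Phi)$ consists of a Lie algebra $\mathfrak g$, a non-degenerate $\operatorname{ad}(\mathfrak g)$-invariant symmetric bilinear form $\langle\cdot,\cdot\rangle$ on $\mathfrak g$ and a pair $\Phi=(D,\theta)$, where $\theta$ is an involutive automorphism of $\mathfrak g$ preserving $\langle\cdot,\cdot\rangle$ and $D$ is a derivation that is anti-symmetric with respect to $\langle\cdot,\cdot\rangle$ with $D^3=-D$, $D\theta=-\theta D$ and $[\mathfrak g_+^-,\mathfrak g_+^-]=\mathfrak g_+^+$. A weak extrinsic symmetric triple is defined in the same way, except that $\langle\cdot,\cdot\rangle$ is only required to be non-degenerate on $\mathfrak g_+\oplus\mathfrak g_-^-$ (it may be degenerate on $\mathfrak g$). Given a weak extrinsic symmetric triple, regard $\mathfrak g_-$ with the restriction of $\langle\cdot,\cdot\rangle$ as an inner product space, with isometry group $\mathrm{Iso}(\mathfrak g_-)=\mathrm O(\mathfrak g_-)\ltimes\mathfrak g_-$. The map $\phi:\mathfrak g_+\to\mathfrak{iso}(\mathfrak g_-)=\mathfrak{so}(\mathfrak g_-)\ltimes\mathfrak g_-$, $\phi(X)=(\operatorname{ad}(X)|_{\mathfrak g_-},-D(X))$, is an injective Lie algebra homomorphism. Let $G_+\subset\mathrm{Iso}(\mathfrak g_-)$ be the group generated by all $\exp(\phi(X))$, $X\in\mathfrak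 g_+$, and define $M_{\mathfrak g,\Phi}:=G_+(0)\subset\mathfrak g_-$ (the orbit of $0$). 3. Construction. Let $M\hookrightarrow V$ be full extrinsic symmetric with $0\in M$. Put $V_-=T_0M$, $V_+=T_0^\perp M$, so $V=V_+\oplus V_-$. Let $\mathfrak k$ be the Lie algebra of $K$, with involution $s$ induced by $k\mapsto s_0ks_0$ on $K$, and eigenspaces $\mathfrak k_\pm$ of $s$. Elements $A\in\mathfrak k$ are regarded as affine maps $A:V\to V$ (infinitesimal affine isometries $A(x)=\frac{d}{dt}(\exp tA)(x)|_{t=0}$), with linear part $dA\in\mathfrak o(V,\langle\cdot,\cdot\rangle_V)$. The map $\mathfrak k_-\to V_-$, $X\mapsto X(0)$, is a linear isomorphism; let $T:V_-\to\mathfrak k_-$, $u\mapsto T_u$, be its inverse. Since $M$ is full, $\mathfrak k$ is isomorphic to the Lie algebra of the ordinary transvection group of the pseudo-Riemannian symmetric space $M$. Choose the inner product on $\mathfrak k_-$ such that $T:V_-\to\mathfrak k_-$ is an isometry; it extends uniquely to a non-degenerate inner product $\langle\cdot,\cdot\rangle_{\mathfrak k}$ on $\mathfrak k$ invariant under $\operatorname{ad}(\mathfrak k)$ and $s$. Put $\mathfrak g=\mathfrak k\oplus V$ and $\langle\cdot,\cdot\rangle=\langle\cdot,\cdot\rangle_{\mathfrak k}\oplus\langle\cdot,\cdot\rangle_V$. The antisymmetric bilinear map $[\cdot,\cdot]:\mathfrak g\times\mathfrak g\to\mathfrak g$ is defined by: (i) on $\mathfrak k\times\mathfrak k$ it is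 the Lie bracket of $\mathfrak k$; (ii) $[A,v]=dA(v)$ for $A\in\mathfrak k$, $v\in V$; (iii) $[V,V]\subset\mathfrak k$ and $\langle A,[x,y]\rangle=\langle[A,x],y\rangle$ for all $A\in\mathfrak k$, $x,y\in V$. The involution $\theta$ is given by $\mathfrak g_+=\mathfrak k$, $\mathfrak g_-=V$. The linear map $D:\mathfrak g\to\mathfrak g$ is given by $D|_{\mathfrak k_-}=-T^{-1}$, $D|_{V_-}=T$, $D|_{\mathfrak k_+\oplus V_+}=0$. *)

theory Defs
  imports "HOL-Analysis.Analysis" "HOL-Algebra.Bij" "HOL-Algebra.Generated_Groups"
begin

section \<open>Affine maps of a vector space\<close>

text \<open>The pair \<open>(L, c)\<close> stands for the affine map \<open>x \<mapsto> L x + c\<close>. The same type is used for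
  affine transformations and for infinitesimal ones (elements of the Lie algebra of the affine
  group), so that \<open>fst A\<close> is the linear part \<open>dA\<close>.\<close>

type_synonym 'a aff = "('a \<Rightarrow>\<^sub>L 'a) \<times> 'a"

definition aff_app :: "'a::real_normed_vector aff \<Rightarrow> 'a \<Rightarrow> 'a" where
  "aff_app A x = blinfun_apply (fst A) x + snd A"

definition aff_comp :: "'a::real_normed_vector aff \<Rightarrow> 'a aff \<Rightarrow> 'a aff" where
  "aff_comp A B = (fst A o\<^sub>L fst B, blinfun_apply (fst A) (snd B) + snd A)"

definition aff_id :: "'a::real_normed_vector aff" where
  "aff_id = (id_blinfun, 0)"

text \<open>The commutator of the matrices of \<open>A\<close> and \<open>B\<close> in homogeneous coordinates, i.e. the bracket
  of the semidirect product of linear maps and translations (not the bracket of vector fields,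
  which has the opposite sign).\<close>

definition aff_bracket :: "'a::real_normed_vector aff \<Rightarrow> 'a aff \<Rightarrow> 'a aff" where
  "aff_bracket A B =
     ((fst A o\<^sub>L fst B) - (fst B o\<^sub>L fst A),
      blinfun_apply (fst A) (snd B) - blinfun_apply (fst B) (snd A))"

text \<open>The exponential of the infinitesimal affine map \<open>y \<mapsto> L y + c\<close>, computed as the exponential
  series of the linear map \<open>(z, t) \<mapsto> (L z + t c, 0)\<close> applied to \<open>(y, 1)\<close>. Here \<open>L\<close> is a plain
  function because it may be meaningful on a subspace only.\<close>

definition affine_exp :: "('g::real_normed_vector \<Rightarrow> 'g) \<times> 'g \<Rightarrow> 'g \<Rightarrow> 'g" where
  "affine_exp F y =
     fst (\<Sum>n. (((\<lambda>(z, t). (fst F z + t *\<^sub>R snd F, 0::real)) ^^ n) (y, 1)) /\<^sub>R fact n)"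


section \<open>Submanifolds\<close>

primrec Ck_on :: "nat \<Rightarrow> ('a::real_normed_vector \<Rightarrow> 'b::real_normed_vector) \<Rightarrow> 'a set \<Rightarrow> bool" where
  "Ck_on 0 f S \<longleftrightarrow> continuous_on S f"
| "Ck_on (Suc n) f S \<longleftrightarrow>
     (\<forall>x\<in>S. f differentiable (at x)) \<and>
     (\<forall>v. Ck_on n (\<lambda>x. frechet_derivative f (at x) v) S)"

text \<open>To be used for open \<open>S\<close> in finite dimension.\<close>

definition smooth_on :: "'a set \<Rightarrow> ('a::real_normed_vector \<Rightarrow> 'b::real_normed_vector) \<Rightarrow> bool" where
  "smooth_on S f \<longleftrightarrow> (\<forall>n. Ck_on n f S)"

text \<open>Connected embedded smooth submanifolds, by slice charts.\<close>

definition submanifold :: "'a::euclidean_space set \<Rightarrow> bool" where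
  "submanifold M \<longleftrightarrow>
     M \<noteq> {} \<and> connected M \<and>
     (\<forall>x\<in>M. \<exists>(U :: 'a set) (W :: 'a set) f g E. open U \<and> open W \<and> x \<in> U \<and> homeomorphism U W f g \<and>
        smooth_on U f \<and> smooth_on W g \<and> subspace E \<and> f ` (M \<inter> U) = E \<inter> W)"

text \<open>The velocities at \<open>p\<close> of the \<open>C\<^sup>1\<close> curves in \<open>S\<close> through \<open>p\<close>. For a submanifold this is the
  tangent space; for a subgroup of a linear (or affine) group and \<open>p\<close> the identity it is the
  Lie algebra of the subgroup.\<close>

definition velocities :: "'b::real_normed_vector set \<Rightarrow> 'b \<Rightarrow> 'b set" where
  "velocities S p =
     {v. \<exists>e>0. \<exists>c :: real \<Rightarrow> 'b. c C1_differentiable_on {-e<..<e} \<and> c ` {-e<..<e} \<subseteq> S \<and>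
           c 0 = p \<and> (c has_vector_derivative v) (at 0)}"

definition tangent_space :: "'a::euclidean_space set \<Rightarrow> 'a \<Rightarrow> 'a set" where
  "tangent_space M x = velocities M x"


section \<open>Bilinear forms\<close>

definition nondegenerate_on :: "'v::real_vector set \<Rightarrow> ('v \<Rightarrow> 'v \<Rightarrow> real) \<Rightarrow> bool" where
  "nondegenerate_on U B \<longleftrightarrow> (\<forall>x\<in>U. (\<forall>y\<in>U. B x y = 0) \<longrightarrow> x = 0)"

definition linear_on_set :: "'v::real_vector set \<Rightarrow> ('v \<Rightarrow> 'w::real_vector) \<Rightarrow> bool" where
  "linear_on_set U f \<longleftrightarrow>
     (\<forall>x\<in>U. \<forall>y\<in>U. f (x + y) = f x + f y) \<and> (\<forall>r. \<forall>x\<in>U. f (r *\<^sub>R x) = r *\<^sub>R f x)"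

definition bilinear_on_set :: "'v::real_vector set \<Rightarrow> ('v \<Rightarrow> 'v \<Rightarrow> 'w::real_vector) \<Rightarrow> bool" where
  "bilinear_on_set U f \<longleftrightarrow>
     (\<forall>x\<in>U. linear_on_set U (f x)) \<and> (\<forall>y\<in>U. linear_on_set U (\<lambda>x. f x y))"

definition sym_bilinear_on :: "'v::real_vector set \<Rightarrow> ('v \<Rightarrow> 'v \<Rightarrow> real) \<Rightarrow> bool" where
  "sym_bilinear_on U B \<longleftrightarrow> bilinear_on_set U B \<and> (\<forall>x\<in>U. \<forall>y\<in>U. B x y = B y x)"

text \<open>A possibly degenerate inner product on the whole space. The inner product of the type class
  \<open>euclidean_space\<close> plays no role; the class only provides finite dimension and the topology.\<close>

definition inner_product :: "('a::euclidean_space \<Rightarrow> 'a \<Rightarrow> real) \<Rightarrow> bool" where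
  "inner_product b \<longleftrightarrow> sym_bilinear_on UNIV b"


section \<open>Extrinsic symmetric spaces\<close>

definition normal_space :: "('a::euclidean_space \<Rightarrow> 'a \<Rightarrow> real) \<Rightarrow> 'a set \<Rightarrow> 'a \<Rightarrow> 'a set" where
  "normal_space b M x = {v. \<forall>u\<in>tangent_space M x. b u v = 0}"

definition nondegenerate_submanifold :: "('a::euclidean_space \<Rightarrow> 'a \<Rightarrow> real) \<Rightarrow> 'a set \<Rightarrow> bool" where
  "nondegenerate_submanifold b M \<longleftrightarrow>
     submanifold M \<and> (\<forall>x\<in>M. nondegenerate_on (tangent_space M x) b)"

definition reflection :: "('a::euclidean_space \<Rightarrow> 'a \<Rightarrow> real) \<Rightarrow> 'a set \<Rightarrow> 'a \<Rightarrow> 'a aff" where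
  "reflection b M x =
     (THE S. (\<forall>v\<in>tangent_space M x. blinfun_apply (fst S) v = - v) \<and>
             (\<forall>v\<in>normal_space b M x. aff_app S (x + v) = x + v))"

definition extrinsic_symmetric :: "('a::euclidean_space \<Rightarrow> 'a \<Rightarrow> real) \<Rightarrow> 'a set \<Rightarrow> bool" where
  "extrinsic_symmetric b M \<longleftrightarrow>
     nondegenerate_submanifold b M \<and> (\<forall>x\<in>M. aff_app (reflection b M x) ` M = M)"

definition full :: "'a::euclidean_space set \<Rightarrow> bool" where
  "full M \<longleftrightarrow> \<not> (\<exists>W. affine W \<and> W \<noteq> UNIV \<and> M \<subseteq> W)"

definition transvection_group ::
    "('a::euclidean_space \<Rightarrow> 'a \<Rightarrow> real) \<Rightarrow> 'a set \<Rightarrow> ('a \<Rightarrow> 'a) set" where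
  "transvection_group b M =
     generate (BijGroup UNIV)
       {aff_app (reflection b M x) \<circ> aff_app (reflection b M y) | x y. x \<in> M \<and> y \<in> M}"


section \<open>Weak extrinsic symmetric triples\<close>

definition lie_algebra :: "'g::real_vector set \<Rightarrow> ('g \<Rightarrow> 'g \<Rightarrow> 'g) \<Rightarrow> bool" where
  "lie_algebra \<gg> br \<longleftrightarrow>
     subspace \<gg> \<and> (\<exists>Bs. finite Bs \<and> \<gg> = span Bs) \<and>
     bilinear_on_set \<gg> br \<and>
     (\<forall>x\<in>\<gg>. \<forall>y\<in>\<gg>. br x y \<in> \<gg>) \<and>
     (\<forall>x\<in>\<gg>. br x x = 0) \<and>
     (\<forall>x\<in>\<gg>. \<forall>y\<in>\<gg>. \<forall>z\<in>\<gg>. br x (br y z) + br y (br z x) + br z (br x y) = 0)"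

definition ad_invariant ::
    "'g::real_vector set \<Rightarrow> ('g \<Rightarrow> 'g \<Rightarrow> 'g) \<Rightarrow> ('g \<Rightarrow> 'g \<Rightarrow> real) \<Rightarrow> bool" where
  "ad_invariant \<gg> br B \<longleftrightarrow> (\<forall>x\<in>\<gg>. \<forall>y\<in>\<gg>. \<forall>z\<in>\<gg>. B (br x y) z + B y (br x z) = 0)"

definition involutive_automorphism ::
    "'g::real_vector set \<Rightarrow> ('g \<Rightarrow> 'g \<Rightarrow> 'g) \<Rightarrow> ('g \<Rightarrow> 'g) \<Rightarrow> bool" where
  "involutive_automorphism \<gg> br \<theta> \<longleftrightarrow>
     linear_on_set \<gg> \<theta> \<and> (\<forall>x\<in>\<gg>. \<theta> x \<in> \<gg>) \<and> (\<forall>x\<in>\<gg>. \<theta> (\<theta> x) = x) \<and>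
     (\<forall>x\<in>\<gg>. \<forall>y\<in>\<gg>. \<theta> (br x y) = br (\<theta> x) (\<theta> y))"

definition derivation ::
    "'g::real_vector set \<Rightarrow> ('g \<Rightarrow> 'g \<Rightarrow> 'g) \<Rightarrow> ('g \<Rightarrow> 'g) \<Rightarrow> bool" where
  "derivation \<gg> br D \<longleftrightarrow>
     linear_on_set \<gg> D \<and> (\<forall>x\<in>\<gg>. D x \<in> \<gg>) \<and>
     (\<forall>x\<in>\<gg>. \<forall>y\<in>\<gg>. D (br x y) = br (D x) y + br x (D y))"

definition plus_space :: "'g::real_vector set \<Rightarrow> ('g \<Rightarrow> 'g) \<Rightarrow> 'g set" where
  "plus_space \<gg> \<theta> = {x\<in>\<gg>. \<theta> x = x}"

definition minus_space :: "'g::real_vector set \<Rightarrow> ('g \<Rightarrow> 'g) \<Rightarrow> 'g set" where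
  "minus_space \<gg> \<theta> = {x\<in>\<gg>. \<theta> x = - x}"

definition D_plus :: "'g::real_vector set \<Rightarrow> ('g \<Rightarrow> 'g) \<Rightarrow> 'g set" where
  "D_plus \<gg> D = {x\<in>\<gg>. D x = 0}"

definition D_minus :: "'g::real_vector set \<Rightarrow> ('g \<Rightarrow> 'g) \<Rightarrow> 'g set" where
  "D_minus \<gg> D = {x\<in>\<gg>. D (D x) = - x}"

text \<open>Everything in the definition of a (weak) extrinsic symmetric triple except the
  non-degeneracy of the form.\<close>

definition pre_triple ::
    "'g::real_vector set \<Rightarrow> ('g \<Rightarrow> 'g \<Rightarrow> 'g) \<Rightarrow> ('g \<Rightarrow> 'g \<Rightarrow> real) \<Rightarrow> ('g \<Rightarrow> 'g) \<Rightarrow> ('g \<Rightarrow> 'g) \<Rightarrow> bool"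
  where
  "pre_triple \<gg> br B D \<theta> \<longleftrightarrow>
     lie_algebra \<gg> br \<and>
     sym_bilinear_on \<gg> B \<and> ad_invariant \<gg> br B \<and>
     involutive_automorphism \<gg> br \<theta> \<and> (\<forall>x\<in>\<gg>. \<forall>y\<in>\<gg>. B (\<theta> x) (\<theta> y) = B x y) \<and>
     derivation \<gg> br D \<and> (\<forall>x\<in>\<gg>. \<forall>y\<in>\<gg>. B (D x) y = - B x (D y)) \<and>
     (\<forall>x\<in>\<gg>. D (D (D x)) = - D x) \<and> (\<forall>x\<in>\<gg>. D (\<theta> x) = - \<theta> (D x)) \<and>
     span {br x y | x y. x \<in> plus_space \<gg> \<theta> \<inter> D_minus \<gg> D \<and> y \<in> plus_space \<gg> \<theta> \<inter> D_minus \<gg> D}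
       = plus_space \<gg> \<theta> \<inter> D_plus \<gg> D"

definition extrinsic_symmetric_triple ::
    "'g::real_vector set \<Rightarrow> ('g \<Rightarrow> 'g \<Rightarrow> 'g) \<Rightarrow> ('g \<Rightarrow> 'g \<Rightarrow> real) \<Rightarrow> ('g \<Rightarrow> 'g) \<Rightarrow> ('g \<Rightarrow> 'g) \<Rightarrow> bool"
  where
  "extrinsic_symmetric_triple \<gg> br B D \<theta> \<longleftrightarrow>
     pre_triple \<gg> br B D \<theta> \<and> nondegenerate_on \<gg> B"

definition weak_extrinsic_symmetric_triple ::
    "'g::real_vector set \<Rightarrow> ('g \<Rightarrow> 'g \<Rightarrow> 'g) \<Rightarrow> ('g \<Rightarrow> 'g \<Rightarrow> real) \<Rightarrow> ('g \<Rightarrow> 'g) \<Rightarrow> ('g \<Rightarrow> 'g) \<Rightarrow> bool"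
  where
  "weak_extrinsic_symmetric_triple \<gg> br B D \<theta> \<longleftrightarrow>
     pre_triple \<gg> br B D \<theta> \<and>
     nondegenerate_on
       {x + y | x y. x \<in> plus_space \<gg> \<theta> \<and> y \<in> minus_space \<gg> \<theta> \<inter> D_minus \<gg> D} B"

definition phi :: "('g::real_vector \<Rightarrow> 'g \<Rightarrow> 'g) \<Rightarrow> ('g \<Rightarrow> 'g) \<Rightarrow> 'g \<Rightarrow> ('g \<Rightarrow> 'g) \<times> 'g" where
  "phi br D X = (br X, - D X)"

definition G_plus ::
    "'g::real_normed_vector set \<Rightarrow> ('g \<Rightarrow> 'g \<Rightarrow> 'g) \<Rightarrow> ('g \<Rightarrow> 'g) \<Rightarrow> ('g \<Rightarrow> 'g) \<Rightarrow> ('g \<Rightarrow> 'g) set" where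
  "G_plus \<gg> br D \<theta> =
     generate (BijGroup (minus_space \<gg> \<theta>))
       {restrict (affine_exp (phi br D X)) (minus_space \<gg> \<theta>) | X. X \<in> plus_space \<gg> \<theta>}"

definition M_of_triple ::
    "'g::real_normed_vector set \<Rightarrow> ('g \<Rightarrow> 'g \<Rightarrow> 'g) \<Rightarrow> ('g \<Rightarrow> 'g) \<Rightarrow> ('g \<Rightarrow> 'g) \<Rightarrow> 'g set" where
  "M_of_triple \<gg> br D \<theta> = (\<lambda>h. h 0) ` G_plus \<gg> br D \<theta>"


section \<open>The triple of an extrinsic symmetric space through the origin\<close>

definition k_alg :: "('a::euclidean_space \<Rightarrow> 'a \<Rightarrow> real) \<Rightarrow> 'a set \<Rightarrow> 'a aff set" where
  "k_alg b M = velocities {A. aff_app A \<in> transvection_group b M} aff_id"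

text \<open>The differential at the identity of \<open>k \<mapsto> s\<^sub>0 k s\<^sub>0\<close>. As the reflection \<open>s\<^sub>0\<close> fixes \<open>0\<close>, this
  is given by the same formula as the conjugation itself.\<close>

definition k_inv :: "('a::euclidean_space \<Rightarrow> 'a \<Rightarrow> real) \<Rightarrow> 'a set \<Rightarrow> 'a aff \<Rightarrow> 'a aff" where
  "k_inv b M A = aff_comp (reflection b M 0) (aff_comp A (reflection b M 0))"

definition k_plus :: "('a::euclidean_space \<Rightarrow> 'a \<Rightarrow> real) \<Rightarrow> 'a set \<Rightarrow> 'a aff set" where
  "k_plus b M = plus_space (k_alg b M) (k_inv b M)"

definition k_minus :: "('a::euclidean_space \<Rightarrow> 'a \<Rightarrow> real) \<Rightarrow> 'a set \<Rightarrow> 'a aff set" where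
  "k_minus b M = minus_space (k_alg b M) (k_inv b M)"

definition T_map :: "('a::euclidean_space \<Rightarrow> 'a \<Rightarrow> real) \<Rightarrow> 'a set \<Rightarrow> 'a \<Rightarrow> 'a aff" where
  "T_map b M = inv_into (k_minus b M) (\<lambda>X. aff_app X 0)"

definition is_k_form ::
    "('a::euclidean_space \<Rightarrow> 'a \<Rightarrow> real) \<Rightarrow> 'a set \<Rightarrow> ('a aff \<Rightarrow> 'a aff \<Rightarrow> real) \<Rightarrow> bool" where
  "is_k_form b M B \<longleftrightarrow>
     sym_bilinear_on (k_alg b M) B \<and> nondegenerate_on (k_alg b M) B \<and>
     ad_invariant (k_alg b M) aff_bracket B \<and>
     (\<forall>X\<in>k_alg b M. \<forall>Y\<in>k_alg b M. B (k_inv b M X) (k_inv b M Y) = B X Y) \<and>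
     (\<forall>u\<in>tangent_space M 0. \<forall>v\<in>tangent_space M 0. B (T_map b M u) (T_map b M v) = b u v)"

text \<open>The last condition says that \<open>T_map\<close> is an isometry. \<open>is_k_form\<close> determines the form on \<open>k_alg\<close>; the values of the chosen function outside
  \<open>k_alg\<close> are never used.\<close>

definition k_form ::
    "('a::euclidean_space \<Rightarrow> 'a \<Rightarrow> real) \<Rightarrow> 'a set \<Rightarrow> 'a aff \<Rightarrow> 'a aff \<Rightarrow> real" where
  "k_form b M = (SOME B. is_k_form b M B)"

text \<open>The direct sum of \<open>k_alg\<close> and \<open>V\<close>, as pairs \<open>(A, v)\<close>.\<close>

definition g_alg :: "('a::euclidean_space \<Rightarrow> 'a \<Rightarrow> real) \<Rightarrow> 'a set \<Rightarrow> ('a aff \<times> 'a) set" where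
  "g_alg b M = k_alg b M \<times> UNIV"

definition g_form ::
    "('a::euclidean_space \<Rightarrow> 'a \<Rightarrow> real) \<Rightarrow> 'a set \<Rightarrow> 'a aff \<times> 'a \<Rightarrow> 'a aff \<times> 'a \<Rightarrow> real" where
  "g_form b M X Y = k_form b M (fst X) (fst Y) + b (snd X) (snd Y)"

definition VV_bracket ::
    "('a::euclidean_space \<Rightarrow> 'a \<Rightarrow> real) \<Rightarrow> 'a set \<Rightarrow> 'a \<Rightarrow> 'a \<Rightarrow> 'a aff" where
  "VV_bracket b M x y =
     (THE C. C \<in> k_alg b M \<and>
        (\<forall>A\<in>k_alg b M. k_form b M A C = b (blinfun_apply (fst A) x) y))"

definition g_bracket ::
    "('a::euclidean_space \<Rightarrow> 'a \<Rightarrow> real) \<Rightarrow> 'a set \<Rightarrow> 'a aff \<times> 'a \<Rightarrow> 'a aff \<times> 'a \<Rightarrow> 'a aff \<times> 'a" where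
  "g_bracket b M X Y =
     (aff_bracket (fst X) (fst Y) + VV_bracket b M (snd X) (snd Y),
      blinfun_apply (fst (fst X)) (snd Y) - blinfun_apply (fst (fst Y)) (snd X))"

definition g_theta :: "'a::euclidean_space aff \<times> 'a \<Rightarrow> 'a aff \<times> 'a" where
  "g_theta X = (fst X, - snd X)"

text \<open>The projections of \<open>k_alg\<close> onto \<open>k_minus\<close> and of \<open>V\<close> onto the tangent space at \<open>0\<close> along the
  other eigenspace. The reflection at \<open>0\<close> is linear, with eigenvalue \<open>-1\<close> on the tangent space and
  \<open>1\<close> on the normal space.\<close>

definition k_proj_minus :: "('a::euclidean_space \<Rightarrow> 'a \<Rightarrow> real) \<Rightarrow> 'a set \<Rightarrow> 'a aff \<Rightarrow> 'a aff" where
  "k_proj_minus b M A = (1/2) *\<^sub>R (A - k_inv b M A)"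

definition V_proj_minus :: "('a::euclidean_space \<Rightarrow> 'a \<Rightarrow> real) \<Rightarrow> 'a set \<Rightarrow> 'a \<Rightarrow> 'a" where
  "V_proj_minus b M v = (1/2) *\<^sub>R (v - aff_app (reflection b M 0) v)"

definition g_D ::
    "('a::euclidean_space \<Rightarrow> 'a \<Rightarrow> real) \<Rightarrow> 'a set \<Rightarrow> 'a aff \<times> 'a \<Rightarrow> 'a aff \<times> 'a" where
  "g_D b M X = (T_map b M (V_proj_minus b M (snd X)), - aff_app (k_proj_minus b M (fst X)) 0)"

end

theory Submission
  imports Defs
begin

text \<open>Write \<open>s x\<close> for the reflections and \<open>k\<close> for the Lie algebra of the
  transvection group, and let \<open>m\<close> and \<open>kplus\<close> be the eigenspaces of the
  conjugation by \<open>s 0\<close> on \<open>k\<close> for the eigenvalues \<open>-1\<close> and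
  \<open>1\<close>. Analysis has to show that \<open>m\<close> is as large as the tangent space at
  \<open>0\<close>, that \<open>k = m + [m, m]\<close>, and that \<open>exp k\<close> preserves
  \<open>M\<close> and acts transitively on it. Everything else is linear algebra.

  The algebra \<open>k\<close> is the set of velocities at the identity of \<open>C\<^sup>1\<close>
  curves in an abstract subgroup of the affine group. It contains enough because the reflection depends
  differentiably on its base point (\<open>reflection_curve\<close>): for a curve \<open>c\<close> in
  \<open>M\<close> through \<open>x\<close>, half of the velocity of \<open>s (c t) \<circ> s x\<close>
  is an element of \<open>k\<close> that is anti-invariant under \<open>s x\<close> and has the value
  \<open>c' 0\<close> at \<open>x\<close> (\<open>kminus_exists\<close>), and there is only one such
  element (\<open>kminus_determined\<close>). It is tangent to \<open>M\<close>, so that its flow stays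
  in \<open>M\<close> for a short time (\<open>local_flow\<close>, by Gronwall's lemma in a slice
  chart). Naturality of the reflections then gives \<open>exp (2 t A) = s (exp (t A) x) \<circ> s
  x\<close>, so that the flow consists of transvections (\<open>aexp_kminus_Kg\<close>). These flows
  sweep out a neighbourhood of \<open>x\<close> in \<open>M\<close> (\<open>exp_neighbourhood\<close>).
  As \<open>M\<close> is connected, the group generated by \<open>exp m\<close> is transitive on
  \<open>M\<close>, and it is the whole transvection group (\<open>orbit\<close>,
  \<open>Kg_eq\<close>).

  Conversely, \<open>k\<close> is not too large: if \<open>h\<close> is a Lie subalgebra, then every
  \<open>C\<^sup>1\<close> curve through the identity in the group generated by \<open>exp h\<close>
  has its velocity in \<open>h\<close> (\<open>velocities_exp_group\<close>). Near the identity the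
  translates of \<open>exp h\<close> are the leaves of a foliation; the group meets only countably many
  of them, and a continuous function with countably many values on an interval is constant. For
  \<open>h = m + [m, m]\<close> this is \<open>k_decomposition\<close>. The same charts factorize small
  elements of \<open>exp k\<close> into \<open>exp m\<close> and \<open>exp kplus\<close>, which both
  preserve \<open>M\<close> (\<open>aexp_k_M\<close>).

  Fullness is used in the form that a subspace stable under the affine maps in \<open>m\<close> is
  everything (\<open>full_subspace\<close>). Hence \<open>kplus\<close> acts faithfully on the tangent
  space at \<open>0\<close>, and \<open>V\<close> is spanned by this tangent space together with its
  images under \<open>m\<close> (\<open>normal_spanned\<close>). On \<open>kplus = [m, m]\<close> the
  invariant form must be \<open>\<langle>C, [X, Y]\<rangle> = b (C X(0)) (Y(0))\<close>; this is
  consistent and symmetric by the pair symmetry of the curvature tensor and non-degenerate by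
  faithfulness (\<open>k_form_exists\<close>). That \<open>D\<close> is a derivation is checked on
  tangent and normal vectors separately. What remains is the Jacobi identity for three vectors in
  \<open>V\<close>. If one of them is tangent, say \<open>u\<close>, it comes out when \<open>D\<close>
  is applied to \<open>[A, [v, w]] = [A v, w] + [v, A w]\<close> with \<open>A = T\<^sub>u\<close>
  (\<open>jac_tangent\<close>). The cyclic sum is equivariant under \<open>k\<close>, so it also
  vanishes when one vector is an image of a tangent vector under \<open>m\<close>, and therefore always
  (\<open>jac_zero\<close>).

  Finally, the affine map \<open>exp (\<phi> A)\<close> of the triple is \<open>exp A\<close> itself
  (\<open>affine_exp_phi\<close>), so that the orbit of \<open>0\<close> is \<open>M\<close> by
  invariance and transitivity.\<close>

section \<open>The exponential of a Banach algebra\<close>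

text \<open>The bound \<open>exp (norm A)\<close> is uniform along the segment from \<open>0\<close> to
  \<open>A\<close>, which is what the integral formulas below need.\<close>

lemma norm_exp_segment:
  fixes A :: "'b::{real_normed_algebra_1,banach}"
  assumes "0 \<le> s" "s \<le> 1"
  shows "norm (exp (s *\<^sub>R A)) \<le> exp (norm A)"
proof -
  have "norm (s *\<^sub>R A) \<le> norm A" using assms by (simp add: mult_left_le_one_le)
  then show ?thesis using norm_exp[of "s *\<^sub>R A"] by (meson exp_le_cancel_iff order_trans)
qed

lemma exp_scaleR_continuous [continuous_intros]:
  fixes A :: "'b::{real_normed_algebra_1,banach}"
  assumes "continuous_on S f"
  shows "continuous_on S (\<lambda>s::'t::topological_space. exp (f s *\<^sub>R A))"
proof -
  have "continuous_on UNIV (\<lambda>t. exp (t *\<^sub>R A))"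
    by (rule continuous_on_vector_derivative, rule exp_scaleR_has_vector_derivative_left[THEN has_vector_derivative_at_within])
  then show ?thesis using assms continuous_on_compose2[of UNIV "\<lambda>t. exp (t *\<^sub>R A)" S f] by auto
qed

text \<open>Duhamel's formula: differentiate \<open>exp (s A) exp ((1 - s) B)\<close> between \<open>s =
  0\<close> and \<open>s = 1\<close>.\<close>

lemma exp_diff_integral:
  fixes A B :: "'b::{real_normed_algebra_1,banach}"
  shows "((\<lambda>s. exp (s *\<^sub>R A) * (A - B) * exp ((1 - s) *\<^sub>R B)) has_integral (exp A - exp B)) {0..1}"
proof -
  let ?g = "\<lambda>s. exp (s *\<^sub>R A) * exp ((1 - s) *\<^sub>R B)"
  have "(?g has_vector_derivative exp (s *\<^sub>R A) * (A - B) * exp ((1 - s) *\<^sub>R B)) (at s within {0..1})" for s :: real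
  proof -
    have 1: "((\<lambda>s. exp (s *\<^sub>R A)) has_vector_derivative exp (s *\<^sub>R A) * A) (at s within {0..1})"
      by (rule exp_scaleR_has_vector_derivative_right)
    have "((\<lambda>s. 1 - s) has_vector_derivative -1) (at s within {0..1})"
      by (auto intro!: derivative_eq_intros)
    then have "(((\<lambda>s. exp (s *\<^sub>R B)) \<circ> (\<lambda>s. 1 - s)) has_vector_derivative
        (-1) *\<^sub>R (B * exp ((1 - s) *\<^sub>R B))) (at s within {0..1})"
      by (rule vector_diff_chain_within)
         (rule exp_scaleR_has_vector_derivative_left[THEN has_vector_derivative_at_within])
    then have 2: "((\<lambda>s. exp ((1 - s) *\<^sub>R B)) has_vector_derivative - (B * exp ((1 - s) *\<^sub>R B))) (at s within {0..1})"
      by (simp add: o_def)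
    show ?thesis
      using has_vector_derivative_mult[OF 1 2] by (simp add: algebra_simps)
  qed
  then have "((\<lambda>s. exp (s *\<^sub>R A) * (A - B) * exp ((1 - s) *\<^sub>R B)) has_integral (?g 1 - ?g 0)) {0..1}"
    by (intro fundamental_theorem_of_calculus) auto
  then show ?thesis by simp
qed

lemma norm_mult3_le:
  fixes a b c :: "'b::real_normed_algebra"
  assumes "norm a \<le> x" "norm b \<le> y" "norm c \<le> z"
  shows "norm (a * b * c) \<le> x * y * z"
proof -
  have "norm (a * b * c) \<le> norm a * norm b * norm c"
    by (meson mult_right_mono norm_ge_zero norm_mult_ineq order_trans)
  also have "\<dots> \<le> x * y * z"
    using assms norm_ge_zero
    by (intro mult_mono mult_nonneg_nonneg) (auto intro: order_trans[OF norm_ge_zero])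
  finally show ?thesis .
qed

lemma norm_exp_diff:
  fixes A B :: "'b::{real_normed_algebra_1,banach}"
  shows "norm (exp A - exp B) \<le> norm (A - B) * exp (norm A + norm B)"
proof -
  have "norm (exp A - exp B) \<le> (exp (norm A) * norm (A - B) * exp (norm B)) * measure lborel (cbox 0 (1::real))"
  proof (rule has_integral_bound)
    show "((\<lambda>s. exp (s *\<^sub>R A) * (A - B) * exp ((1 - s) *\<^sub>R B)) has_integral (exp A - exp B)) (cbox 0 1)"
      using exp_diff_integral[of A B] by simp
    fix s :: real assume "s \<in> cbox 0 1"
    then show "norm (exp (s *\<^sub>R A) * (A - B) * exp ((1 - s) *\<^sub>R B)) \<le> exp (norm A) * norm (A - B) * exp (norm B)"
      by (intro norm_mult3_le norm_exp_segment) auto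
  qed auto
  then show ?thesis by (simp add: exp_add mult_ac)
qed

lemma norm_exp_scaleR_diff:
  fixes A B :: "'b::{real_normed_algebra_1,banach}"
  assumes "0 \<le> s" "s \<le> 1"
  shows "norm (exp (s *\<^sub>R A) - exp (s *\<^sub>R B)) \<le> norm (A - B) * exp (norm A + norm B)"
proof -
  have "norm (exp (s *\<^sub>R A) - exp (s *\<^sub>R B)) \<le> norm (s *\<^sub>R A - s *\<^sub>R B) * exp (norm (s *\<^sub>R A) + norm (s *\<^sub>R B))"
    by (rule norm_exp_diff)
  also have "norm (s *\<^sub>R A - s *\<^sub>R B) \<le> norm (A - B)"
    using assms by (simp add: scaleR_diff_right[symmetric] mult_left_le_one_le)
  also have "exp (norm (s *\<^sub>R A) + norm (s *\<^sub>R B)) \<le> exp (norm A + norm B)"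
    using assms by (simp add: mult_left_le_one_le add_mono)
  finally show ?thesis by (simp add: mult_left_mono mult_right_mono)
qed

text \<open>The derivative of \<open>exp\<close> at \<open>Z\<close> in the direction \<open>W\<close>
  (see \<open>exp_has_derivative\<close>), in Duhamel's integral form.\<close>

definition dexp :: "'b::{real_normed_algebra_1,banach} \<Rightarrow> 'b \<Rightarrow> 'b" where
  "dexp Z W = integral {0..1} (\<lambda>s. exp (s *\<^sub>R Z) * W * exp ((1 - s) *\<^sub>R Z))"

lemma dexp_integrable:
  fixes Z W :: "'b::{real_normed_algebra_1,banach}"
  shows "(\<lambda>s. exp (s *\<^sub>R A) * W * exp ((1 - s) *\<^sub>R Z)) integrable_on {0..1}"
  by (intro integrable_continuous_interval continuous_intros)

lemma dexp_zero [simp]: "dexp 0 W = (W::'b::{real_normed_algebra_1,banach})"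
  by (simp add: dexp_def)

lemma dexp_add: "dexp Z (V + W) = dexp Z V + dexp (Z::'b::{real_normed_algebra_1,banach}) W"
  unfolding dexp_def
  by (subst integral_add[symmetric]) (auto intro!: dexp_integrable simp: distrib_left distrib_right)

lemma dexp_scaleR: "dexp Z (r *\<^sub>R W) = r *\<^sub>R dexp (Z::'b::{real_normed_algebra_1,banach}) W"
  unfolding dexp_def
  by (subst integral_cmul[symmetric]) (auto intro!: dexp_integrable)

lemma norm_dexp_diff:
  fixes Z Z' W :: "'b::{real_normed_algebra_1,banach}"
  shows "norm (dexp Z W - dexp Z' W) \<le> 2 * norm (Z - Z') * exp (2 * norm Z + 2 * norm Z') * norm W"
proof -
  let ?L = "norm (Z - Z') * exp (norm Z + norm Z')"
  have "norm (integral {0..1} (\<lambda>s. exp (s *\<^sub>R Z) * W * exp ((1 - s) *\<^sub>R Z) - exp (s *\<^sub>R Z') * W * exp ((1 - s) *\<^sub>R Z')))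
     \<le> (?L * norm W * exp (norm Z) + exp (norm Z') * norm W * ?L) * (1 - 0)"
  proof (rule integral_bound)
    fix s :: real assume s: "s \<in> {0..1}"
    have "exp (s *\<^sub>R Z) * W * exp ((1 - s) *\<^sub>R Z) - exp (s *\<^sub>R Z') * W * exp ((1 - s) *\<^sub>R Z')
      = (exp (s *\<^sub>R Z) - exp (s *\<^sub>R Z')) * W * exp ((1 - s) *\<^sub>R Z)
        + exp (s *\<^sub>R Z') * W * (exp ((1 - s) *\<^sub>R Z) - exp ((1 - s) *\<^sub>R Z'))"
      by (simp add: algebra_simps)
    also have "norm \<dots> \<le> ?L * norm W * exp (norm Z) + exp (norm Z') * norm W * ?L"
      using s by (intro norm_triangle_mono norm_mult3_le norm_exp_segment norm_exp_scaleR_diff) auto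
    finally show "norm (exp (s *\<^sub>R Z) * W * exp ((1 - s) *\<^sub>R Z) - exp (s *\<^sub>R Z') * W * exp ((1 - s) *\<^sub>R Z'))
       \<le> ?L * norm W * exp (norm Z) + exp (norm Z') * norm W * ?L" .
  next
    show "continuous_on {0..1} (\<lambda>s. exp (s *\<^sub>R Z) * W * exp ((1 - s) *\<^sub>R Z) - exp (s *\<^sub>R Z') * W * exp ((1 - s) *\<^sub>R Z'))"
      by (intro continuous_intros)
  qed simp
  then have "norm (dexp Z W - dexp Z' W) \<le> ?L * norm W * exp (norm Z) + exp (norm Z') * norm W * ?L"
    unfolding dexp_def by (subst integral_diff[symmetric]) (auto intro!: dexp_integrable)
  also have "\<dots> = ?L * norm W * (exp (norm Z) + exp (norm Z'))" by (simp add: algebra_simps)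
  also have "\<dots> \<le> ?L * norm W * (2 * exp (norm Z + norm Z'))"
  proof (rule mult_left_mono)
    have "exp (norm Z) \<le> exp (norm Z + norm Z')" "exp (norm Z') \<le> exp (norm Z + norm Z')" by auto
    then show "exp (norm Z) + exp (norm Z') \<le> 2 * exp (norm Z + norm Z')" by linarith
  qed auto
  also have "\<dots> = 2 * norm (Z - Z') * exp (2 * norm Z + 2 * norm Z') * norm W"
  proof -
    have "exp (2 * norm Z + 2 * norm Z') = exp (norm Z + norm Z') * exp (norm Z + norm Z')"
      by (simp add: exp_add[symmetric])
    then show ?thesis by (simp only: mult_ac)
  qed
  finally show ?thesis .
qed

lemma norm_dexp: "norm (dexp Z W) \<le> (1 + 2 * norm Z * exp (2 * norm Z)) * norm (W::'b::{real_normed_algebra_1,banach})"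
proof -
  have "norm (dexp Z W) \<le> norm (dexp Z W - dexp 0 W) + norm W"
    using norm_triangle_sub[of "dexp Z W" W] by simp
  then show ?thesis using norm_dexp_diff[of Z W 0] by (simp add: algebra_simps)
qed

lemma bounded_linear_dexp: "bounded_linear (dexp (Z::'b::{real_normed_algebra_1,banach}))"
  using dexp_add dexp_scaleR norm_dexp
  by (intro bounded_linear_intro[where K="1 + 2 * norm Z * exp (2 * norm Z)"]) (auto simp: mult.commute)

text \<open>Continuity in the operator norm, as required by the inverse function theorem.\<close>

lemma continuous_on_dexp: "continuous_on UNIV (\<lambda>Z::'b::{real_normed_algebra_1,banach}. Blinfun (dexp Z))"
proof (clarsimp simp: continuous_on_eq_continuous_at continuous_at)
  fix Z :: 'b
  have "((\<lambda>Z'. Blinfun (dexp Z') - Blinfun (dexp Z)) \<longlongrightarrow> 0) (at Z)"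
  proof (rule Lim_null_comparison)
    show "\<forall>\<^sub>F Z' in at Z. norm (Blinfun (dexp Z') - Blinfun (dexp Z)) \<le> 2 * norm (Z' - Z) * exp (2 * norm Z' + 2 * norm Z)"
      by (intro always_eventually allI norm_blinfun_bound)
         (auto simp: blinfun.diff_left bounded_linear_Blinfun_apply bounded_linear_dexp norm_dexp_diff)
    have "((\<lambda>Z'. 2 * norm (Z' - Z) * exp (2 * norm Z' + 2 * norm Z)) \<longlongrightarrow> 2 * norm (Z - Z) * exp (2 * norm Z + 2 * norm Z)) (at Z)"
      by (intro tendsto_intros)
    then show "((\<lambda>Z'. 2 * norm (Z' - Z) * exp (2 * norm Z' + 2 * norm Z)) \<longlongrightarrow> 0) (at Z)" by simp
  qed
  then show "((\<lambda>Z. Blinfun (dexp Z)) \<longlongrightarrow> Blinfun (dexp Z)) (at Z)" by (simp add: LIM_zero_iff)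
qed

text \<open>Duhamel's formula gives \<open>exp Y - exp Z\<close> as an integral that differs from
  \<open>dexp Z (Y - Z)\<close> only in its first factor \<open>exp (s Y)\<close> instead of \<open>exp
  (s Z)\<close>; the difference is of second order in \<open>Y - Z\<close>.\<close>

theorem exp_has_derivative:
  fixes Z :: "'b::{real_normed_algebra_1,banach}"
  shows "(exp has_derivative dexp Z) (at Z)"
proof (rule has_derivativeI)
  show "bounded_linear (dexp Z)" by (rule bounded_linear_dexp)
  let ?R = "\<lambda>Y. exp Y - exp Z - dexp Z (Y - Z)"
  have R: "norm (?R Y) \<le> norm (Y - Z) * norm (Y - Z) * (exp (norm Y + norm Z) * exp (norm Z))" for Y
  proof -
    have 1: "exp Y - exp Z = integral {0..1} (\<lambda>s. exp (s *\<^sub>R Y) * (Y - Z) * exp ((1 - s) *\<^sub>R Z))"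
      using integral_unique[OF exp_diff_integral[of Y Z]] by simp
    have "?R Y = integral {0..1} (\<lambda>s. (exp (s *\<^sub>R Y) - exp (s *\<^sub>R Z)) * (Y - Z) * exp ((1 - s) *\<^sub>R Z))"
      unfolding 1 dexp_def
      by (subst integral_diff[symmetric]) (auto intro!: dexp_integrable simp: left_diff_distrib)
    also have "norm \<dots> \<le> (norm (Y - Z) * exp (norm Y + norm Z)) * norm (Y - Z) * exp (norm Z) * (1 - 0)"
    proof (rule integral_bound)
      show "continuous_on {0..1} (\<lambda>s. (exp (s *\<^sub>R Y) - exp (s *\<^sub>R Z)) * (Y - Z) * exp ((1 - s) *\<^sub>R Z))"
        by (intro continuous_intros)
    qed (auto intro!: norm_mult3_le norm_exp_segment norm_exp_scaleR_diff)
    finally show ?thesis by (simp add: mult_ac)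
  qed
  show "((\<lambda>Y. (exp Y - exp Z - dexp Z (Y - Z)) /\<^sub>R norm (Y - Z)) \<longlongrightarrow> 0) (at Z)"
  proof (rule Lim_null_comparison)
    show "\<forall>\<^sub>F Y in at Z. norm (?R Y /\<^sub>R norm (Y - Z)) \<le> norm (Y - Z) * (exp (norm Y + norm Z) * exp (norm Z))"
    proof (intro always_eventually allI)
      fix Y
      show "norm (?R Y /\<^sub>R norm (Y - Z)) \<le> norm (Y - Z) * (exp (norm Y + norm Z) * exp (norm Z))"
      proof (cases "Y = Z")
        case False
        then have "norm (Y - Z) > 0" by simp
        have "norm (?R Y /\<^sub>R norm (Y - Z)) = norm (?R Y) / norm (Y - Z)"
          by (simp add: divide_inverse mult.commute)
        also have "\<dots> \<le> (norm (Y - Z) * norm (Y - Z) * (exp (norm Y + norm Z) * exp (norm Z))) / norm (Y - Z)"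
          by (intro divide_right_mono R) simp
        also have "\<dots> = norm (Y - Z) * (exp (norm Y + norm Z) * exp (norm Z))"
          using \<open>norm (Y - Z) > 0\<close> by simp
        finally show ?thesis .
      qed auto
    qed
    have "((\<lambda>Y. norm (Y - Z) * (exp (norm Y + norm Z) * exp (norm Z))) \<longlongrightarrow>
       norm (Z - Z) * (exp (norm Z + norm Z) * exp (norm Z))) (at Z)"
      by (intro tendsto_intros)
    then show "((\<lambda>Y. norm (Y - Z) * (exp (norm Y + norm Z) * exp (norm Z))) \<longlongrightarrow> 0) (at Z)" by simp
  qed
qed

lemma exp_has_vector_derivative:
  fixes f :: "real \<Rightarrow> 'b::{real_normed_algebra_1,banach}"
  assumes "(f has_vector_derivative f') (at t)"
  shows "((\<lambda>t. exp (f t)) has_vector_derivative dexp (f t) f') (at t)"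
proof -
  have "((\<lambda>t. exp (f t)) has_derivative (\<lambda>h. dexp (f t) (h *\<^sub>R f'))) (at t)"
    using has_derivative_compose[OF assms[unfolded has_vector_derivative_def] exp_has_derivative] by simp
  then show ?thesis by (simp add: has_vector_derivative_def dexp_scaleR)
qed

lemma continuous_on_exp_algebra:
  fixes f :: "'t::topological_space \<Rightarrow> 'b::{real_normed_algebra_1,banach}"
  assumes "continuous_on S f"
  shows "continuous_on S (\<lambda>t. exp (f t))"
proof -
  have "continuous_on UNIV (exp :: 'b \<Rightarrow> 'b)"
    by (auto intro!: continuous_at_imp_continuous_on has_derivative_continuous[OF exp_has_derivative])
  then show ?thesis using assms continuous_on_compose2[of UNIV exp S f] by auto
qed

lemma exp_minus_cancel [simp]:
  fixes X :: "'b::{real_normed_algebra_1,banach}"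
  shows "exp X * exp (- X) = 1" "exp (- X) * exp X = 1"
        "exp X * (exp (- X) * Y) = Y" "exp (- X) * (exp X * Y) = Y"
  using exp_minus_inverse[of X] exp_minus_inverse[of "- X"] by (simp_all add: mult.assoc[symmetric])

text \<open>The logarithmic derivative of the exponential as an average of the adjoint action. In this
  form it visibly stays in a Lie algebra that contains \<open>Z\<close> and \<open>W\<close>.\<close>

lemma dexp_exp_minus:
  fixes Z :: "'b::{real_normed_algebra_1,banach}"
  shows "((\<lambda>s. exp (s *\<^sub>R Z) * W * exp (- (s *\<^sub>R Z))) has_integral dexp Z W * exp (- Z)) {0..1}"
proof -
  have "((\<lambda>s. exp (s *\<^sub>R Z) * W * exp ((1 - s) *\<^sub>R Z)) has_integral dexp Z W) {0..1}"
    unfolding dexp_def by (rule integrable_integral[OF dexp_integrable])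
  from has_integral_mult_left[OF this, of "exp (- Z)"]
  have "((\<lambda>s. exp (s *\<^sub>R Z) * W * exp ((1 - s) *\<^sub>R Z) * exp (- Z)) has_integral dexp Z W * exp (- Z)) {0..1}" .
  moreover have "exp ((1 - s) *\<^sub>R Z) * exp (- Z) = exp (- (s *\<^sub>R Z))" for s
    by (subst exp_add_commuting[symmetric]) (auto simp: algebra_simps)
  ultimately show ?thesis by (simp add: mult.assoc)
qed

section \<open>Curves of invertible elements\<close>

lemma has_vector_derivative_iff_tendsto:
  "(f has_vector_derivative D) (at t) \<longleftrightarrow> ((\<lambda>s. (f s - f t) /\<^sub>R (s - t)) \<longlongrightarrow> D) (at t)"
proof -
  have "norm (f s - f t - (s - t) *\<^sub>R D) / norm (s - t) = norm ((f s - f t) /\<^sub>R (s - t) - D)" if "s \<noteq> t" for s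
  proof -
    have "(f s - f t) /\<^sub>R (s - t) - D = (f s - f t - (s - t) *\<^sub>R D) /\<^sub>R (s - t)"
      using that by (simp add: scaleR_diff_right)
    then show ?thesis by (simp add: divide_inverse mult.commute)
  qed
  then have "((\<lambda>s. norm (f s - f t - (s - t) *\<^sub>R D) / norm (s - t)) \<longlongrightarrow> 0) (at t)
     \<longleftrightarrow> ((\<lambda>s. norm ((f s - f t) /\<^sub>R (s - t) - D)) \<longlongrightarrow> 0) (at t)"
    by (intro tendsto_cong) (auto simp: eventually_at_filter)
  then show ?thesis
    unfolding has_vector_derivative_def has_derivative_iff_norm
    by (simp add: tendsto_norm_zero_iff LIM_zero_iff bounded_linear_scaleR_left)
qed

text \<open>From \<open>I s - I t = - I s (G s - G t) I t\<close>: for \<open>s\<close> near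
  \<open>t\<close> this identity bounds \<open>norm (I s)\<close> by \<open>2 norm (I t)\<close>, then it
  shows that \<open>I\<close> is continuous at \<open>t\<close>, and finally it gives the difference
  quotient.\<close>

lemma inverse_curve_has_vector_derivative:
  fixes G I :: "real \<Rightarrow> 'b::real_normed_algebra_1"
  assumes S: "open S" "t \<in> S"
    and inv: "\<And>s. s \<in> S \<Longrightarrow> I s * G s = 1" "\<And>s. s \<in> S \<Longrightarrow> G s * I s = 1"
    and G: "(G has_vector_derivative G') (at t)"
  shows "(I has_vector_derivative - (I t * G' * I t)) (at t)"
proof -
  have id: "I s - I t = - (I s * (G s - G t) * I t)" if "s \<in> S" for s
    using inv[OF that] inv[OF S(2)] by (simp add: algebra_simps mult.assoc)
  have GC: "(G \<longlongrightarrow> G t) (at t)"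
    using has_vector_derivative_continuous[OF G] by (simp add: continuous_at)
  have evS: "\<forall>\<^sub>F s in at t. s \<in> S" using S by (simp add: eventually_at_topological) blast
  have "((\<lambda>s. norm (G s - G t) * norm (I t)) \<longlongrightarrow> norm (G t - G t) * norm (I t)) (at t)"
    by (intro tendsto_intros GC)
  then have ev: "\<forall>\<^sub>F s in at t. norm (G s - G t) * norm (I t) < 1/2"
    by (intro order_tendstoD(2)) auto
  have bnd: "\<forall>\<^sub>F s in at t. norm (I s) \<le> 2 * norm (I t)"
    using evS ev
  proof eventually_elim
    fix s assume s: "s \<in> S" "norm (G s - G t) * norm (I t) < 1/2"
    have "norm (I s) \<le> norm (I t) + norm (I s - I t)" by (simp add: norm_triangle_sub)
    also have "norm (I s - I t) \<le> norm (I s) * norm (G s - G t) * norm (I t)"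
      unfolding id[OF s(1)] norm_minus_cancel by (rule norm_mult3_le) auto
    also have "\<dots> \<le> norm (I s) * (1/2)"
      using s(2) by (simp only: mult.assoc) (intro mult_left_mono, auto)
    finally show "norm (I s) \<le> 2 * norm (I t)" by simp
  qed
  have "((\<lambda>s. I s - I t) \<longlongrightarrow> 0) (at t)"
  proof (rule Lim_null_comparison)
    show "\<forall>\<^sub>F s in at t. norm (I s - I t) \<le> 2 * norm (I t) * norm (G s - G t) * norm (I t)"
      using evS bnd
      by eventually_elim (auto simp: id intro!: norm_mult3_le)
    have "((\<lambda>s. 2 * norm (I t) * norm (G s - G t) * norm (I t)) \<longlongrightarrow> 2 * norm (I t) * norm (G t - G t) * norm (I t)) (at t)"
      by (intro tendsto_intros GC)
    then show "((\<lambda>s. 2 * norm (I t) * norm (G s - G t) * norm (I t)) \<longlongrightarrow> 0) (at t)" by simp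
  qed
  then have IC: "(I \<longlongrightarrow> I t) (at t)" by (simp add: LIM_zero_iff)
  have "((\<lambda>s. (G s - G t) /\<^sub>R (s - t)) \<longlongrightarrow> G') (at t)"
    using G by (simp add: has_vector_derivative_iff_tendsto)
  then have "((\<lambda>s. - (I s * ((G s - G t) /\<^sub>R (s - t)) * I t)) \<longlongrightarrow> - (I t * G' * I t)) (at t)"
    by (intro tendsto_intros IC)
  then have "((\<lambda>s. (I s - I t) /\<^sub>R (s - t)) \<longlongrightarrow> - (I t * G' * I t)) (at t)"
    by (rule Lim_transform_eventually) (use evS in \<open>eventually_elim, simp add: id\<close>)
  then show ?thesis by (simp add: has_vector_derivative_iff_tendsto)
qed

lemma inverse_curve_C1:
  fixes G I :: "real \<Rightarrow> 'b::real_normed_algebra_1"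
  assumes S: "open S"
    and inv: "\<And>s. s \<in> S \<Longrightarrow> I s * G s = 1" "\<And>s. s \<in> S \<Longrightarrow> G s * I s = 1"
    and G: "G C1_differentiable_on S"
  shows "I C1_differentiable_on S"
proof -
  obtain D where D: "\<And>s. s \<in> S \<Longrightarrow> (G has_vector_derivative D s) (at s)" "continuous_on S D"
    using G unfolding C1_differentiable_on_def by blast
  have I: "\<And>s. s \<in> S \<Longrightarrow> (I has_vector_derivative - (I s * D s * I s)) (at s)"
    by (rule inverse_curve_has_vector_derivative[OF S _ inv D(1)])
  have C: "continuous_on S I"
  proof (rule continuous_on_vector_derivative)
    fix s assume "s \<in> S"
    show "(I has_vector_derivative - (I s * D s * I s)) (at s within S)"
      using I[OF \<open>s \<in> S\<close>] by (rule has_vector_derivative_at_within)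
  qed
  have "continuous_on S (\<lambda>s. - (I s * D s * I s))"
    by (rule continuous_on_minus[OF continuous_on_mult[OF continuous_on_mult[OF C D(2)] C]])
  with I show ?thesis unfolding C1_differentiable_on_def by (intro exI[of _ "\<lambda>s. - (I s * D s * I s)"] conjI ballI)
qed

section \<open>Gronwall's lemma\<close>

text \<open>The function \<open>exp (- 2 C t) \<parallel>u t\<parallel>\<^sup>2\<close> does not
  increase.\<close>

lemma gronwall_zero:
  fixes u :: "real \<Rightarrow> 'c::real_inner"
  assumes T: "0 \<le> T"
    and u: "\<And>t. 0 \<le> t \<Longrightarrow> t \<le> T \<Longrightarrow> (u has_vector_derivative u' t) (at t)"
    and bnd: "\<And>t. 0 \<le> t \<Longrightarrow> t \<le> T \<Longrightarrow> norm (u' t) \<le> C * norm (u t)"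
    and u0: "u 0 = 0"
  shows "u T = 0"
proof -
  let ?f = "\<lambda>t. exp (- 2 * C * t) * (u t \<bullet> u t)"
  have "?f T \<le> ?f 0"
  proof (rule DERIV_nonpos_imp_nonincreasing[OF T])
    fix t assume t: "0 \<le> t" "t \<le> T"
    have d: "(?f has_real_derivative exp (- 2 * C * t) * (2 * (u t \<bullet> u' t)) - 2 * C * exp (- 2 * C * t) * (u t \<bullet> u t)) (at t)"
    proof -
      have "((\<lambda>t. u t \<bullet> u t) has_derivative (\<lambda>h. u t \<bullet> (h *\<^sub>R u' t) + (h *\<^sub>R u' t) \<bullet> u t)) (at t)"
        using u[OF t] unfolding has_vector_derivative_def by (intro has_derivative_inner)
      then have 1: "((\<lambda>t. u t \<bullet> u t) has_real_derivative (2 * (u t \<bullet> u' t))) (at t)"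
        unfolding has_field_derivative_def
        by (rule has_derivative_eq_rhs) (auto simp: inner_commute fun_eq_iff)
      have 2: "((\<lambda>t. exp (- 2 * C * t)) has_real_derivative (- 2 * C) * exp (- 2 * C * t)) (at t)"
        by (auto intro!: derivative_eq_intros)
      show ?thesis using DERIV_mult[OF 2 1] by (simp add: algebra_simps)
    qed
    have "u t \<bullet> u' t \<le> norm (u t) * norm (u' t)" by (rule norm_cauchy_schwarz)
    also have "\<dots> \<le> norm (u t) * (C * norm (u t))" by (intro mult_left_mono bnd t) auto
    also have "\<dots> = C * (u t \<bullet> u t)" by (simp add: power2_norm_eq_inner[symmetric] power2_eq_square)
    finally have "exp (- 2 * C * t) * (2 * (u t \<bullet> u' t)) \<le> exp (- 2 * C * t) * (2 * (C * (u t \<bullet> u t)))"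
      by (intro mult_left_mono) auto
    then show "\<exists>y. (?f has_real_derivative y) (at t) \<and> y \<le> 0"
      by (intro exI[of _ "exp (- 2 * C * t) * (2 * (u t \<bullet> u' t)) - 2 * C * exp (- 2 * C * t) * (u t \<bullet> u t)"] conjI d)
         (simp add: mult_ac)
  qed
  then have "exp (- 2 * C * T) * (u T \<bullet> u T) \<le> 0" using u0 by simp
  then have "u T \<bullet> u T \<le> 0" by (simp add: mult_le_0_iff)
  then show ?thesis by (metis antisym inner_eq_zero_iff inner_ge_zero)
qed

section \<open>Subgroups generated by a Lie subalgebra\<close>

text \<open>A Banach algebra with linear coordinates \<open>J\<close> in a Euclidean space. The
  coordinates transport to \<open>'b\<close> the facts of finite-dimensional analysis: closedness of
  subspaces, boundedness of linear maps, and the inverse function theorem.\<close>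

locale fin_dim_algebra =
  fixes J :: "'b::{real_normed_algebra_1,banach} \<Rightarrow> 'c::euclidean_space" and J' :: "'c \<Rightarrow> 'b"
  assumes bl_J: "bounded_linear J" and bl_J': "bounded_linear J'"
    and J'_J [simp]: "J' (J x) = x" and J_J' [simp]: "J (J' y) = y"
begin

lemma J_inject: "J x = J y \<Longrightarrow> x = y"
  by (metis J'_J)

lemma linear_imp_bounded_linear:
  fixes f :: "'b \<Rightarrow> 'd::real_normed_vector"
  assumes "linear f"
  shows "bounded_linear f"
proof -
  have "linear (f \<circ> J')"
    by (rule linear_compose[OF bounded_linear.linear[OF bl_J'] assms])
  then have "bounded_linear (f \<circ> J')" by (simp add: linear_conv_bounded_linear)
  from bounded_linear_compose[OF this bl_J] show ?thesis by (simp add: o_def)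
qed

lemma projection_exists:
  assumes "subspace (h :: 'b set)"
  obtains P where "bounded_linear P" "\<And>x. P x \<in> h" "\<And>x. x \<in> h \<Longrightarrow> P x = x"
proof -
  have "\<exists>g. g ` UNIV \<subseteq> h \<and> linear g \<and> (\<forall>v\<in>h. g (id v) = v)"
    by (rule linear_exists_left_inverse_on[OF linear_id assms]) auto
  then show ?thesis using that linear_imp_bounded_linear by (auto simp: image_subset_iff)
qed

lemma closed_subspace_algebra:
  assumes "subspace (h :: 'b set)"
  shows "closed h"
proof -
  obtain P where P: "bounded_linear P" "\<And>x. P x \<in> h" "\<And>x. x \<in> h \<Longrightarrow> P x = x"
    using projection_exists[OF assms] by blast
  have "h = {x. P x = x}" using P(2,3) by (metis (mono_tags, lifting) Collect_cong Collect_mem_eq)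
  moreover have "closed {x. P x = x}"
    using P(1) by (intro closed_Collect_eq continuous_intros linear_continuous_on)
  ultimately show ?thesis by simp
qed

text \<open>The curve \<open>w t = exp (t X) Y exp (- t X)\<close> solves \<open>w' = [X, w]\<close>. As
  \<open>[X, h] \<subseteq> h\<close>, the component of \<open>w\<close> transversal to \<open>h\<close>
  is bounded by Gronwall's lemma in terms of its initial value, which is \<open>0\<close>.\<close>

lemma Ad_exp_closed:
  assumes h: "subspace h" and X: "\<And>Y. Y \<in> h \<Longrightarrow> X * Y - Y * X \<in> h" and Y: "Y \<in> h"
  shows "exp X * Y * exp (- X) \<in> (h :: 'b set)"
proof -
  obtain P where P: "bounded_linear P" "\<And>x. P x \<in> h" "\<And>x. x \<in> h \<Longrightarrow> P x = x"
    using projection_exists[OF h] by blast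
  interpret P: bounded_linear P by fact
  interpret J: bounded_linear J by (rule bl_J)
  interpret J': bounded_linear J' by (rule bl_J')
  define Q where "Q x = x - P x" for x
  have Q: "bounded_linear Q" unfolding Q_def by (intro bounded_linear_sub bounded_linear_ident P(1))
  interpret Q: bounded_linear Q by fact
  have Q0: "Q x = 0" if "x \<in> h" for x using P(3)[OF that] by (simp add: Q_def)
  define L where "L y = J (Q (X * J' y - J' y * X))" for y
  have "linear L" unfolding L_def
    by (rule linearI) (simp_all add: J.add J.scaleR J'.add J'.scaleR Q.add Q.scaleR Q.diff J.diff algebra_simps)
  then have "bounded_linear L" by (simp add: linear_conv_bounded_linear)
  then obtain C where C: "\<And>y. norm (L y) \<le> norm y * C" using bounded_linear.bounded by blast
  define w where "w t = exp (t *\<^sub>R X) * Y * exp (t *\<^sub>R (- X))" for t :: real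
  have w': "(w has_vector_derivative X * w t - w t * X) (at t)" for t
  proof -
    have "((\<lambda>t. exp (t *\<^sub>R X) * Y) has_vector_derivative X * exp (t *\<^sub>R X) * Y) (at t)"
      by (intro has_vector_derivative_mult_left exp_scaleR_has_vector_derivative_left)
    from has_vector_derivative_mult[OF this exp_scaleR_has_vector_derivative_right[of "- X" t UNIV]]
    show ?thesis unfolding w_def by (simp add: mult.assoc)
  qed
  have "J (Q (w 1)) = 0"
  proof (rule gronwall_zero[where u="\<lambda>t. J (Q (w t))" and u'="\<lambda>t. J (Q (X * w t - w t * X))" and C=C])
    fix t :: real
    show "((\<lambda>t. J (Q (w t))) has_vector_derivative J (Q (X * w t - w t * X))) (at t)"
      by (intro J.has_vector_derivative Q.has_vector_derivative w')
    have "Q (X * w t - w t * X) = Q (X * Q (w t) - Q (w t) * X) + Q (X * P (w t) - P (w t) * X)"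
      unfolding Q.add[symmetric] by (simp add: Q_def algebra_simps)
    also have "Q (X * P (w t) - P (w t) * X) = 0" by (intro Q0 X P(2))
    finally have "J (Q (X * w t - w t * X)) = L (J (Q (w t)))" by (simp add: L_def)
    then show "norm (J (Q (X * w t - w t * X))) \<le> C * norm (J (Q (w t)))"
      using C[of "J (Q (w t))"] by (simp add: mult.commute)
  qed (auto simp: w_def Q0 Y)
  then have "Q (w 1) = 0" by (metis J'_J J'.zero)
  then have "w 1 = P (w 1)" by (simp add: Q_def)
  then have "w 1 \<in> h" by (metis P(2))
  then show ?thesis by (simp add: w_def)
qed

text \<open>An average of the elements \<open>exp (s X) Y exp (- s X)\<close>, all of which lie in
  \<open>h\<close>.\<close>

lemma dexp_log_closed:
  assumes h: "subspace h" and X: "\<And>Y. Y \<in> h \<Longrightarrow> X * Y - Y * X \<in> h" and Y: "Y \<in> h"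
  shows "dexp X Y * exp (- X) \<in> (h :: 'b set)"
proof -
  obtain P where P: "bounded_linear P" "\<And>x. P x \<in> h" "\<And>x. x \<in> h \<Longrightarrow> P x = x"
    using projection_exists[OF h] by blast
  have Q: "bounded_linear (\<lambda>x. x - P x)" by (intro bounded_linear_sub bounded_linear_ident P(1))
  have in_h: "exp (s *\<^sub>R X) * Y * exp (- (s *\<^sub>R X)) \<in> h" for s
  proof (rule Ad_exp_closed[OF h _ Y])
    fix Z assume "Z \<in> h"
    then have "s *\<^sub>R (X * Z - Z * X) \<in> h" by (intro subspace_scale h X)
    then show "s *\<^sub>R X * Z - Z * (s *\<^sub>R X) \<in> h" by (simp add: algebra_simps)
  qed
  from has_integral_linear[OF dexp_exp_minus[of X Y] Q]
  have "((\<lambda>s. 0) has_integral (dexp X Y * exp (- X) - P (dexp X Y * exp (- X)))) {0..1::real}"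
    by (simp add: o_def P(3)[OF in_h])
  then have "dexp X Y * exp (- X) - P (dexp X Y * exp (- X)) = 0"
    using has_integral_unique has_integral_0 by blast
  then have "dexp X Y * exp (- X) = P (dexp X Y * exp (- X))" by simp
  then show ?thesis by (metis P(2))
qed

end

text \<open>Here \<open>h\<close> is a Lie subalgebra, \<open>P\<close> a projection onto it, and
  \<open>P1\<close> is a linear map that preserves \<open>h\<close>, such as the projection to a summand.
  The map \<open>\<Phi>\<close> below is a chart at \<open>1\<close> in which the third factor measures
  the distance from \<open>exp h\<close>: its argument \<open>q Z\<close> is constant along curves
  tangent to the right-invariant distribution defined by \<open>h\<close>. The first two factors split an
  element near \<open>1\<close> in \<open>exp h\<close> according to \<open>P1\<close>.\<close>

locale frobenius_chart = fin_dim_algebra J J' for J :: "'b::{real_normed_algebra_1,banach} \<Rightarrow> 'c::euclidean_space" and J' +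
  fixes h :: "'b set" and P P1 :: "'b \<Rightarrow> 'b"
  assumes h: "subspace h" and bracket: "\<And>X Y. X \<in> h \<Longrightarrow> Y \<in> h \<Longrightarrow> X * Y - Y * X \<in> h"
    and bl_P: "bounded_linear P" and P_in: "\<And>x. P x \<in> h" and P_id: "\<And>x. x \<in> h \<Longrightarrow> P x = x"
    and bl_P1: "bounded_linear P1" and P1_in: "\<And>x. x \<in> h \<Longrightarrow> P1 x \<in> h"
begin

definition q where "q Z = Z - P Z"
definition pa where "pa Z = P1 (P Z)"
definition pb where "pb Z = P Z - P1 (P Z)"

definition \<Phi> where "\<Phi> Z = exp (pa Z) * exp (pb Z) * exp (q Z)"

lemma bl_q: "bounded_linear q" unfolding q_def by (intro bounded_linear_sub bounded_linear_ident bl_P)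
lemma bl_pa: "bounded_linear pa" unfolding pa_def by (rule bounded_linear_compose[OF bl_P1 bl_P])
lemma bl_pb: "bounded_linear pb" unfolding pb_def
  by (intro bounded_linear_sub bl_P bounded_linear_compose[OF bl_P1 bl_P])

lemma pa_in: "pa Z \<in> h" by (simp add: pa_def P_in P1_in)
lemma pb_in: "pb Z \<in> h" by (simp add: pb_def P_in P1_in h subspace_diff)
lemma q_zero_iff: "q Z = 0 \<longleftrightarrow> Z \<in> h" by (auto simp: q_def P_id) (metis P_in)
lemma q_q: "q (q Z) = q Z"
  using linear_diff[OF bounded_linear.linear[OF bl_P], of Z "P Z"] by (simp add: q_def P_id P_in)

lemma zero_simps [simp]: "q 0 = 0" "pa 0 = 0" "pb 0 = 0"
  using bl_q bl_pa bl_pb by (simp_all add: bounded_linear.linear linear_0)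

lemma \<Phi>_0 [simp]: "\<Phi> 0 = 1" by (simp add: \<Phi>_def)

lemma Ad_closed: "X \<in> h \<Longrightarrow> Y \<in> h \<Longrightarrow> exp X * Y * exp (- X) \<in> h"
  by (rule Ad_exp_closed[OF h]) (auto intro: bracket)

lemma log_closed: "X \<in> h \<Longrightarrow> Y \<in> h \<Longrightarrow> dexp X Y * exp (- X) \<in> h"
  by (rule dexp_log_closed[OF h]) (auto intro: bracket)

definition d\<Phi> where
  "d\<Phi> Z W = dexp (pa Z) (pa W) * (exp (pb Z) * exp (q Z)) + exp (pa Z) * dexp (pb Z) (pb W) * exp (q Z)
     + exp (pa Z) * exp (pb Z) * dexp (q Z) (q W)"

lemma \<Phi>_has_derivative: "(\<Phi> has_derivative d\<Phi> Z) (at Z)"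
proof -
  have e: "((\<lambda>Z. exp (f Z)) has_derivative (\<lambda>W. dexp (f Z) (f W))) (at Z)" if "bounded_linear f" for f :: "'b \<Rightarrow> 'b"
    using has_derivative_compose[OF bounded_linear_imp_has_derivative[OF that] exp_has_derivative] .
  have "((\<lambda>Z. exp (pa Z) * exp (pb Z) * exp (q Z)) has_derivative
     (\<lambda>W. exp (pa Z) * exp (pb Z) * dexp (q Z) (q W) + (exp (pa Z) * dexp (pb Z) (pb W) + dexp (pa Z) (pa W) * exp (pb Z)) * exp (q Z))) (at Z)"
    by (intro has_derivative_mult e bl_q bl_pa bl_pb)
  then show ?thesis
    unfolding \<Phi>_def[abs_def] by (rule has_derivative_eq_rhs) (simp add: fun_eq_iff d\<Phi>_def algebra_simps)
qed

text \<open>The derivative of \<open>\<Phi>\<close> as a bounded linear map, for the sake of its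
  continuity in the operator norm.\<close>

definition d\<Phi>L where
  "d\<Phi>L Z = (blinfun_mult_left (exp (pb Z) * exp (q Z)) o\<^sub>L (Blinfun (dexp (pa Z)) o\<^sub>L Blinfun pa))
     + (blinfun_mult_right (exp (pa Z)) o\<^sub>L (blinfun_mult_left (exp (q Z)) o\<^sub>L (Blinfun (dexp (pb Z)) o\<^sub>L Blinfun pb)))
     + (blinfun_mult_right (exp (pa Z) * exp (pb Z)) o\<^sub>L (Blinfun (dexp (q Z)) o\<^sub>L Blinfun q))"

lemma d\<Phi>L_apply [simp]: "blinfun_apply (d\<Phi>L Z) = d\<Phi> Z"
  by (auto simp: d\<Phi>L_def d\<Phi>_def fun_eq_iff blinfun.add_left bounded_linear_Blinfun_apply bl_q bl_pa bl_pb bounded_linear_dexp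
      blinfun_mult_right.rep_eq mult.assoc)

lemma continuous_d\<Phi>L: "continuous_on UNIV d\<Phi>L"
proof -
  have c: "continuous_on UNIV f" if "bounded_linear f" for f :: "'b \<Rightarrow> 'b"
    using that by (rule linear_continuous_on)
  have d: "continuous_on UNIV (\<lambda>Z. Blinfun (dexp (f Z)))" if "bounded_linear f" for f :: "'b \<Rightarrow> 'b"
    using continuous_on_compose2[OF continuous_on_dexp c[OF that]] by simp
  show ?thesis
    unfolding d\<Phi>L_def[abs_def]
    by (intro continuous_on_add bounded_bilinear.continuous_on[OF bounded_bilinear_blinfun_compose]
        bounded_linear.continuous_on[OF bounded_linear_blinfun_mult_left]
        bounded_linear.continuous_on[OF bounded_linear_blinfun_mult_right]
        continuous_on_mult continuous_on_exp_algebra c d bl_q bl_pa bl_pb continuous_on_const)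
qed

text \<open>For small \<open>Q\<close> the element \<open>dexp Q \<kappa> exp (- Q)\<close> is close to
  \<open>\<kappa>\<close> relative to \<open>norm \<kappa>\<close>. If \<open>\<kappa>\<close> is
  transversal to \<open>h\<close>, it can therefore only lie in \<open>h\<close> if \<open>\<kappa> =
  0\<close>.\<close>

lemma transversal_injective:
  obtains \<delta> where "0 < \<delta>"
    "\<And>Q \<kappa>. norm Q < \<delta> \<Longrightarrow> q \<kappa> = \<kappa> \<Longrightarrow> dexp Q \<kappa> * exp (- Q) \<in> h \<Longrightarrow> \<kappa> = 0"
proof -
  interpret q: bounded_linear q by (rule bl_q)
  obtain K where K: "0 < K" "\<And>x. norm (q x) \<le> norm x * K" using q.pos_bounded by blast
  \<comment> \<open>For \<open>norm Q \<le> 1\<close> the difference of \<open>dexp Q \<kappa> exp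
    (- Q)\<close> and \<open>\<kappa>\<close> is at most \<open>3 exp 3 norm Q norm
    \<kappa>\<close>, and \<open>K\<close> bounds the norm of \<open>q\<close>.\<close>
  define \<delta> where "\<delta> = min 1 (1 / (3 * exp 3 * K))"
  show ?thesis
  proof (rule that[of \<delta>])
    show "0 < \<delta>" using K by (simp add: \<delta>_def)
    fix Q \<kappa> assume Q: "norm Q < \<delta>" and \<kappa>: "q \<kappa> = \<kappa>" and in_h: "dexp Q \<kappa> * exp (- Q) \<in> h"
    have Q1: "norm Q \<le> 1" "norm Q * (3 * exp 3 * K) < 1"
      using Q K by (auto simp: \<delta>_def field_simps)
    have e: "exp (norm Q) \<le> exp 1" "exp (2 * norm Q) \<le> exp 2" "exp 1 \<le> exp (3::real)" using Q1 by auto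
    have "dexp Q \<kappa> * exp (- Q) - \<kappa> = (dexp Q \<kappa> - dexp 0 \<kappa>) * exp (- Q) + \<kappa> * (exp (- Q) - exp 0)"
      by (simp add: algebra_simps)
    also have "norm \<dots> \<le> (2 * norm Q * exp 2 * norm \<kappa>) * exp 1 + norm \<kappa> * (norm Q * exp 1)"
    proof (intro norm_triangle_mono order_trans[OF norm_mult_ineq] mult_mono)
      have "norm (dexp Q \<kappa> - dexp 0 \<kappa>) \<le> 2 * norm Q * exp (2 * norm Q) * norm \<kappa>"
        using norm_dexp_diff[of Q \<kappa> 0] by simp
      also have "\<dots> \<le> 2 * norm Q * exp 2 * norm \<kappa>" by (intro mult_right_mono mult_left_mono e) auto
      finally show "norm (dexp Q \<kappa> - dexp 0 \<kappa>) \<le> 2 * norm Q * exp 2 * norm \<kappa>" .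
      show "norm (exp (- Q)) \<le> exp 1" using order_trans[OF norm_exp[of "- Q"]] e(1) by simp
      have "norm (exp (- Q) - exp 0) \<le> norm Q * exp (norm Q)" using norm_exp_diff[of "- Q" 0] by simp
      also have "\<dots> \<le> norm Q * exp 1" by (intro mult_left_mono e) auto
      finally show "norm (exp (- Q) - exp 0) \<le> norm Q * exp 1" .
    qed auto
    also have "\<dots> = norm \<kappa> * norm Q * (2 * (exp 2 * exp 1) + exp 1)" by (simp add: algebra_simps)
    also have "exp 2 * exp 1 = exp (3::real)" by (simp add: exp_add[symmetric])
    also have "norm \<kappa> * norm Q * (2 * exp 3 + exp 1) \<le> norm \<kappa> * norm Q * (3 * exp 3)"
      using e by (intro mult_left_mono) auto
    finally have n: "norm (dexp Q \<kappa> * exp (- Q) - \<kappa>) \<le> norm \<kappa> * (norm Q * (3 * exp 3))" by simp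
    have "q (dexp Q \<kappa> * exp (- Q) - \<kappa>) = - \<kappa>"
      using in_h \<kappa> by (simp add: q.diff q_zero_iff)
    then have "norm \<kappa> \<le> norm (dexp Q \<kappa> * exp (- Q) - \<kappa>) * K" using K(2)[of "dexp Q \<kappa> * exp (- Q) - \<kappa>"] by simp
    also have "\<dots> \<le> (norm \<kappa> * (norm Q * (3 * exp 3))) * K" using n K(1) by (intro mult_right_mono) auto
    also have "\<dots> = norm \<kappa> * (norm Q * (3 * exp 3 * K))" by simp
    finally have *: "norm \<kappa> \<le> norm \<kappa> * (norm Q * (3 * exp 3 * K))" .
    show "\<kappa> = 0"
    proof (rule ccontr)
      assume "\<kappa> \<noteq> 0"
      then have "norm \<kappa> * (norm Q * (3 * exp 3 * K)) < norm \<kappa> * 1" using Q1(2) by (intro mult_strict_left_mono) auto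
      with * show False by simp
    qed
  qed
qed

text \<open>The derivative of \<open>\<Phi>\<close> at \<open>0\<close> is the identity, so the inverse
  function theorem, applied in the coordinates \<open>J\<close>, gives a local inverse
  \<open>\<Gamma>\<close>.\<close>

lemma chart_exists:
  fixes \<delta> :: real
  assumes \<delta>: "0 < \<delta>"
  obtains V \<Gamma> where "open V" "1 \<in> V" "\<Gamma> 1 = 0" "\<And>g. g \<in> V \<Longrightarrow> \<Phi> (\<Gamma> g) = g"
    "\<And>g. g \<in> V \<Longrightarrow> norm (q (\<Gamma> g)) < \<delta>" "\<And>g. g \<in> V \<Longrightarrow> \<exists>\<Gamma>'. (\<Gamma> has_derivative \<Gamma>') (at g)"
proof -
  define f where "f y = J (\<Phi> (J' y))" for y
  define f' where "f' y = Blinfun J o\<^sub>L (d\<Phi>L (J' y) o\<^sub>L Blinfun J')" for y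
  have f'_apply: "blinfun_apply (f' y) = (\<lambda>w. J (d\<Phi> (J' y) (J' w)))" for y
    by (simp add: f'_def fun_eq_iff bounded_linear_Blinfun_apply bl_J bl_J')
  have der: "(f has_derivative blinfun_apply (f' y)) (at y)" for y
    unfolding f'_apply f_def
    by (rule bounded_linear.has_derivative[OF bl_J])
       (rule has_derivative_compose[OF bounded_linear_imp_has_derivative[OF bl_J'] \<Phi>_has_derivative])
  have cont: "continuous_on UNIV f'"
    unfolding f'_def[abs_def]
    by (intro bounded_bilinear.continuous_on[OF bounded_bilinear_blinfun_compose] continuous_on_const
        continuous_on_compose2[OF continuous_d\<Phi>L] linear_continuous_on bl_J') auto
  have J'0: "J' 0 = 0" using bl_J' by (simp add: bounded_linear.linear linear_0)
  \<comment> \<open>At \<open>0\<close> the three factors contribute \<open>pa\<close>,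
    \<open>pb\<close> and \<open>q\<close>, which add up to the identity.\<close>
  have id: "id_blinfun o\<^sub>L f' 0 = id_blinfun"
    by (rule blinfun_eqI) (simp add: f'_apply J'0 d\<Phi>_def, simp add: pa_def pb_def q_def)
  obtain U' V0 g g' where IFT: "open U'" "0 \<in> U'" "open V0" "f 0 \<in> V0" "homeomorphism U' V0 f g"
     "\<And>y. y \<in> V0 \<Longrightarrow> (g has_derivative (g' y)) (at y)"
    using inverse_function_theorem[OF open_UNIV der cont UNIV_I id] by metis
  define \<Gamma> where "\<Gamma> x = J' (g (J x))" for x
  define V1 where "V1 = J -` V0"
  have oV1: "open V1" unfolding V1_def using continuous_open_vimage[OF IFT(3)] linear_continuous_on[OF bl_J]
    by (metis open_UNIV continuous_on_open_vimage Int_UNIV_right IFT(3))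
  have f0: "f 0 = J 1" by (simp add: f_def J'0)
  have \<Gamma>1: "\<Gamma> 1 = 0"
    using IFT(2,5) f0 by (simp add: \<Gamma>_def homeomorphism_def) (metis J'0)
  have \<Gamma>d: "\<exists>\<Gamma>'. (\<Gamma> has_derivative \<Gamma>') (at x)" if "x \<in> V1" for x
  proof -
    have "((\<lambda>x. J' (g (J x))) has_derivative (\<lambda>w. J' (g' (J x) (J w)))) (at x)"
      using that IFT(6)[of "J x"]
      by (intro bounded_linear.has_derivative[OF bl_J'] has_derivative_compose[OF bounded_linear_imp_has_derivative[OF bl_J]]) (auto simp: V1_def)
    then show ?thesis unfolding \<Gamma>_def[abs_def] by blast
  qed
  define V where "V = V1 \<inter> (\<lambda>x. norm (q (\<Gamma> x))) -` {..<\<delta>}"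
  have cont_\<Gamma>: "continuous_on V1 \<Gamma>"
    using \<Gamma>d has_derivative_continuous by (intro continuous_at_imp_continuous_on) blast
  have "continuous_on V1 (\<lambda>x. norm (q (\<Gamma> x)))"
    by (intro continuous_on_norm bounded_linear.continuous_on[OF bl_q] cont_\<Gamma>)
  then have oV: "open V" unfolding V_def by (rule continuous_open_preimage[OF _ oV1]) simp
  show ?thesis
  proof (rule that[OF oV])
    show "1 \<in> V" using \<delta> \<Gamma>1 f0 IFT(4) by (simp add: V_def V1_def)
    show "\<Gamma> 1 = 0" by (rule \<Gamma>1)
    fix x assume x: "x \<in> V"
    then have "f (g (J x)) = J x" using IFT(5) by (simp add: V_def V1_def homeomorphism_def)
    then show "\<Phi> (\<Gamma> x) = x" unfolding f_def \<Gamma>_def by (rule J_inject)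
    show "norm (q (\<Gamma> x)) < \<delta>" using x by (simp add: V_def)
    show "\<exists>\<Gamma>'. (\<Gamma> has_derivative \<Gamma>') (at x)" using x \<Gamma>d by (simp add: V_def)
  qed
qed

text \<open>The local Frobenius theorem. Along a curve \<open>g\<close> with \<open>g' = W g\<close> and
  \<open>W\<close> in \<open>h\<close>, write \<open>g = \<Phi> z\<close> and compare logarithmic
  derivatives: those of the first two factors of \<open>\<Phi> z\<close> lie in \<open>h\<close>, hence
  so does that of \<open>exp (q z)\<close>, up to conjugation by exponentials of elements of
  \<open>h\<close>. By \<open>transversal_injective\<close>, \<open>q z\<close> does not move.\<close>

lemma foliation_chart:
  obtains V \<Gamma> where "open V" "1 \<in> V" "\<Gamma> 1 = 0" "\<And>g. g \<in> V \<Longrightarrow> \<Phi> (\<Gamma> g) = g"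
    "\<And>g. g \<in> V \<Longrightarrow> \<exists>\<Gamma>'. (\<Gamma> has_derivative \<Gamma>') (at g)"
    "\<And>g W. (\<And>t::real. 0 \<le> t \<Longrightarrow> t \<le> 1 \<Longrightarrow> g t \<in> V \<and> W t \<in> h \<and> (g has_vector_derivative W t * g t) (at t))
        \<Longrightarrow> q (\<Gamma> (g 1)) = q (\<Gamma> (g 0))"
proof -
  obtain \<delta> where \<delta>: "0 < \<delta>"
    "\<And>Q \<kappa>. norm Q < \<delta> \<Longrightarrow> q \<kappa> = \<kappa> \<Longrightarrow> dexp Q \<kappa> * exp (- Q) \<in> h \<Longrightarrow> \<kappa> = 0"
    using transversal_injective by blast
  obtain V \<Gamma> where V: "open V" "1 \<in> V" "\<Gamma> 1 = 0" "\<And>g. g \<in> V \<Longrightarrow> \<Phi> (\<Gamma> g) = g"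
    "\<And>g. g \<in> V \<Longrightarrow> norm (q (\<Gamma> g)) < \<delta>" "\<And>g. g \<in> V \<Longrightarrow> \<exists>\<Gamma>'. (\<Gamma> has_derivative \<Gamma>') (at g)"
    using chart_exists[OF \<delta>(1)] by blast
  interpret q: bounded_linear q by (rule bl_q)
  show ?thesis
  proof (rule that[OF V(1-4,6)])
    fix g W
    assume g: "\<And>t::real. 0 \<le> t \<Longrightarrow> t \<le> 1 \<Longrightarrow> g t \<in> V \<and> W t \<in> h \<and> (g has_vector_derivative W t * g t) (at t)"
    have der: "((\<lambda>t. q (\<Gamma> (g t))) has_vector_derivative 0) (at t)" if t: "0 \<le> t" "t \<le> 1" for t
    proof -
      have gV: "g t \<in> V" and Wh: "W t \<in> h" and g': "(g has_vector_derivative W t * g t) (at t)" using g[OF t] by auto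
      obtain \<Gamma>' where \<Gamma>': "(\<Gamma> has_derivative \<Gamma>') (at (g t))" using V(6)[OF gV] by blast
      define z where "z = \<Gamma> (g t)"
      define \<zeta> where "\<zeta> = \<Gamma>' (W t * g t)"
      have z': "((\<lambda>t. \<Gamma> (g t)) has_vector_derivative \<zeta>) (at t)"
        using vector_derivative_diff_chain_within[OF g' has_derivative_at_withinI[OF \<Gamma>']]
        by (simp add: o_def \<zeta>_def)
      have "((\<lambda>t. \<Phi> (\<Gamma> (g t))) has_vector_derivative d\<Phi> z \<zeta>) (at t)"
        using vector_derivative_diff_chain_within[OF z' has_derivative_at_withinI[OF \<Phi>_has_derivative]]
        by (simp add: o_def z_def)
      moreover have "((\<lambda>t. \<Phi> (\<Gamma> (g t))) has_vector_derivative W t * g t) (at t)"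
      proof (rule has_vector_derivative_transform_within_open[OF g'])
        show "open (interior (g -` V))" by simp
        have "isCont g t" using g' by (rule has_vector_derivative_continuous)
        then have "\<forall>\<^sub>F s in nhds t. g s \<in> V"
          using V(1) gV by (simp add: continuous_at_open eventually_nhds)
        then show "t \<in> interior (g -` V)" by (auto simp: eventually_nhds interior_def)
        fix s assume "s \<in> interior (g -` V)"
        then show "g s = \<Phi> (\<Gamma> (g s))" using interior_subset V(4) by fastforce
      qed
      ultimately have eq: "d\<Phi> z \<zeta> = W t * g t" by (rule vector_derivative_unique_at)
      \<comment> \<open>The right logarithmic derivatives of the three factors. Up to conjugation by
        the preceding factors they add up to \<open>W t\<close>.\<close>
      define A1 where "A1 = dexp (pa z) (pa \<zeta>) * exp (- pa z)"
      define A2 where "A2 = dexp (pb z) (pb \<zeta>) * exp (- pb z)"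
      define A3 where "A3 = dexp (q z) (q \<zeta>) * exp (- q z)"
      have "\<Phi> z = g t" using V(4)[OF gV] by (simp add: z_def)
      then have gt: "g t = exp (pa z) * exp (pb z) * exp (q z)" by (simp add: \<Phi>_def)
      have d1: "dexp (pa z) (pa \<zeta>) = A1 * exp (pa z)" "dexp (pb z) (pb \<zeta>) = A2 * exp (pb z)"
         "dexp (q z) (q \<zeta>) = A3 * exp (q z)"
        by (simp_all add: A1_def A2_def A3_def mult.assoc)
      have "W t = (W t * g t) * (exp (- q z) * exp (- pb z) * exp (- pa z))"
        by (simp add: gt mult.assoc)
      also have "\<dots> = A1 + exp (pa z) * A2 * exp (- pa z) + exp (pa z) * (exp (pb z) * A3 * exp (- pb z)) * exp (- pa z)"
        unfolding eq[symmetric] d\<Phi>_def d1 by (simp add: distrib_right mult.assoc)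
      finally have "exp (pa z) * (exp (pb z) * A3 * exp (- pb z)) * exp (- pa z) = W t - A1 - exp (pa z) * A2 * exp (- pa z)"
        by simp
      also have "\<dots> \<in> h"
        unfolding A1_def A2_def by (intro subspace_diff h Wh Ad_closed log_closed pa_in pb_in)
      finally have 1: "exp (pa z) * (exp (pb z) * A3 * exp (- pb z)) * exp (- pa z) \<in> h" .
      from Ad_closed[OF subspace_neg[OF h pa_in] 1, of z] have 2: "exp (pb z) * A3 * exp (- pb z) \<in> h"
        by (simp add: mult.assoc)
      from Ad_closed[OF subspace_neg[OF h pb_in] 2, of z] have "A3 \<in> h" by (simp add: mult.assoc)
      then have "q \<zeta> = 0"
        using \<delta>(2)[of "q z" "q \<zeta>"] V(5)[OF gV] q_q by (simp add: A3_def z_def)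
      then show ?thesis using q.has_vector_derivative[OF z'] by simp
    qed
    have "\<exists>c. \<forall>t\<in>{0..1}. q (\<Gamma> (g t)) = c"
      by (rule has_vector_derivative_zero_constant[OF convex_real_interval(5)])
         (auto intro: has_vector_derivative_at_within der)
    then show "q (\<Gamma> (g 1)) = q (\<Gamma> (g 0))" by auto
  qed
qed

text \<open>The curve \<open>exp (t A)\<close> starts at \<open>1\<close>, so it stays where \<open>q
  \<circ> \<Gamma>\<close> vanishes. There \<open>\<Phi>\<close> has only its first two factors.\<close>

lemma exp_factorization:
  obtains \<epsilon> where "0 < \<epsilon>"
    "\<And>A. A \<in> h \<Longrightarrow> norm A < \<epsilon> \<Longrightarrow> \<exists>Z\<in>h. exp A = exp (P1 Z) * exp (Z - P1 Z)"
proof -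
  obtain V \<Gamma> where V: "open V" "1 \<in> V" "\<Gamma> 1 = 0" "\<And>g. g \<in> V \<Longrightarrow> \<Phi> (\<Gamma> g) = g"
    "\<And>g W. (\<And>t::real. 0 \<le> t \<Longrightarrow> t \<le> 1 \<Longrightarrow> g t \<in> V \<and> W t \<in> h \<and> (g has_vector_derivative W t * g t) (at t))
        \<Longrightarrow> q (\<Gamma> (g 1)) = q (\<Gamma> (g 0))"
    using foliation_chart by metis
  have "open (exp -` V)"
    using continuous_on_exp_algebra[OF continuous_on_id, of UNIV] V(1) continuous_on_open_vimage[of UNIV exp] by auto
  moreover have "0 \<in> exp -` V" using V(2) by simp
  ultimately obtain \<epsilon> where \<epsilon>: "0 < \<epsilon>" "ball 0 \<epsilon> \<subseteq> exp -` V" using open_contains_ball by blast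
  show ?thesis
  proof (rule that[OF \<epsilon>(1)])
    fix A assume A: "A \<in> h" "norm A < \<epsilon>"
    have "q (\<Gamma> (exp (1 *\<^sub>R A))) = q (\<Gamma> (exp (0 *\<^sub>R A)))"
    proof (rule V(5)[where W="\<lambda>_. A"])
      fix t :: real assume t: "0 \<le> t" "t \<le> 1"
      have "norm (t *\<^sub>R A) \<le> norm A" using t by (simp add: mult_left_le_one_le)
      then have "t *\<^sub>R A \<in> ball 0 \<epsilon>" using A(2) by simp
      then have "exp (t *\<^sub>R A) \<in> V" using \<epsilon>(2) by blast
      then show "exp (t *\<^sub>R A) \<in> V \<and> A \<in> h \<and> ((\<lambda>t. exp (t *\<^sub>R A)) has_vector_derivative A * exp (t *\<^sub>R A)) (at t)"
        using A(1) exp_scaleR_has_vector_derivative_left by blast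
    qed
    then have q0: "q (\<Gamma> (exp A)) = 0" using V(3) by simp
    then have \<Gamma>h: "\<Gamma> (exp A) \<in> h" by (simp add: q_zero_iff)
    have "exp A \<in> V" using \<epsilon>(2) A(2) by auto
    then have "exp A = \<Phi> (\<Gamma> (exp A))" using V(4) by simp
    also have "\<dots> = exp (P1 (\<Gamma> (exp A))) * exp (\<Gamma> (exp A) - P1 (\<Gamma> (exp A)))"
      using q0 by (simp add: \<Phi>_def pa_def pb_def P_id[OF \<Gamma>h])
    finally show "\<exists>Z\<in>h. exp A = exp (P1 Z) * exp (Z - P1 Z)" using \<Gamma>h by blast
  qed
qed

end

text \<open>By Lindelof's theorem, countably many of the neighbourhoods cover \<open>S\<close>.\<close>

lemma countable_local_choice:
  fixes S :: "'p::second_countable_topology set"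
  assumes "\<And>p. p \<in> S \<Longrightarrow> \<exists>U c. open U \<and> p \<in> U \<and> (\<forall>p'\<in>U \<inter> S. R p' c)"
  obtains C where "countable C" "\<And>p. p \<in> S \<Longrightarrow> \<exists>c\<in>C. R p c"
proof -
  let ?\<U> = "{U. open U \<and> (\<exists>c. \<forall>p'\<in>U \<inter> S. R p' c)}"
  obtain \<V> where \<V>: "\<V> \<subseteq> ?\<U>" "countable \<V>" "\<Union>\<V> = \<Union>?\<U>"
    by (rule Lindelof[of ?\<U>]) blast+
  have "\<forall>U\<in>\<V>. \<exists>c. \<forall>p'\<in>U \<inter> S. R p' c" using \<V>(1) by blast
  then obtain c where c: "\<forall>U\<in>\<V>. \<forall>p'\<in>U \<inter> S. R p' (c U)" by metis
  show ?thesis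
  proof (rule that[of "c ` \<V>"])
    show "countable (c ` \<V>)" using \<V>(2) by (rule countable_image)
    fix p assume p: "p \<in> S"
    then have "p \<in> \<Union>\<V>" unfolding \<V>(3) using assms[OF p] by blast
    then show "\<exists>c\<in>c ` \<V>. R p c" using c p by blast
  qed
qed

inductive_set exp_group :: "'b::{real_normed_algebra_1,banach} set \<Rightarrow> 'b set" for h where
  exp_group_one: "1 \<in> exp_group h"
| exp_group_mult: "X \<in> h \<Longrightarrow> g \<in> exp_group h \<Longrightarrow> exp X * g \<in> exp_group h"

context fin_dim_algebra
begin

text \<open>The function \<open>F\<close> is a transversal coordinate near \<open>1\<close> for the
  foliation by the translates of \<open>exp h\<close>: it is constant along curves tangent to the leaves,
  and where it vanishes one is in \<open>exp h\<close>, with velocities in \<open>h\<close>.\<close>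

definition plaque_chart :: "'b set \<Rightarrow> 'b set \<Rightarrow> ('b \<Rightarrow> 'b) \<Rightarrow> bool" where
  "plaque_chart h V F \<longleftrightarrow> open V \<and> 1 \<in> V \<and> F 1 = 0 \<and> (\<forall>g\<in>V. F g = 0 \<longrightarrow> (\<exists>Z\<in>h. g = exp Z)) \<and> (\<forall>g\<in>V. isCont F g) \<and>
     (\<forall>g W. (\<forall>t::real. 0 \<le> t \<longrightarrow> t \<le> 1 \<longrightarrow> g t \<in> V \<and> W t \<in> h \<and> (g has_vector_derivative W t * g t) (at t))
        \<longrightarrow> F (g 1) = F (g 0)) \<and>
     (\<forall>c v e. (c has_vector_derivative v) (at 0) \<longrightarrow> c 0 = 1 \<longrightarrow> 0 < e \<longrightarrow> (\<forall>t. \<bar>t\<bar> < e \<longrightarrow> c t \<in> V \<and> F (c t) = 0)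
        \<longrightarrow> v \<in> h)"

lemma plaque_chartD:
  assumes "plaque_chart h V F"
  shows "open V" "1 \<in> V" "F 1 = 0" "\<And>g. g \<in> V \<Longrightarrow> F g = 0 \<Longrightarrow> \<exists>Z\<in>h. g = exp Z" "\<And>g. g \<in> V \<Longrightarrow> isCont F g"
    "\<And>g W. (\<And>t::real. 0 \<le> t \<Longrightarrow> t \<le> 1 \<Longrightarrow> g t \<in> V \<and> W t \<in> h \<and> (g has_vector_derivative W t * g t) (at t))
        \<Longrightarrow> F (g 1) = F (g 0)"
    "\<And>c v e. (c has_vector_derivative v) (at 0) \<Longrightarrow> c 0 = 1 \<Longrightarrow> 0 < e \<Longrightarrow> (\<And>t. \<bar>t\<bar> < e \<Longrightarrow> c t \<in> V \<and> F (c t) = 0)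
        \<Longrightarrow> v \<in> h"
  using assms unfolding plaque_chart_def by (elim conjE, blast)+

lemma plaque_chart_exists:
  fixes h :: "'b set"
  assumes h: "subspace h" and bracket: "\<And>X Y. X \<in> h \<Longrightarrow> Y \<in> h \<Longrightarrow> X * Y - Y * X \<in> h"
  obtains V F where "plaque_chart h V F"
proof -
  obtain P where P: "bounded_linear P" "\<And>x. P x \<in> h" "\<And>x. x \<in> h \<Longrightarrow> P x = x"
    using projection_exists[OF h] by blast
  interpret frobenius_chart J J' h P "\<lambda>x. x"
    by (rule frobenius_chart.intro[OF fin_dim_algebra_axioms frobenius_chart_axioms.intro])
       (assumption | rule h P(1) P(2) bounded_linear_ident bracket P(3))+
  interpret q: bounded_linear q by (rule bl_q)
  obtain V \<Gamma> where V: "open V" "1 \<in> V" "\<Gamma> 1 = 0" "\<And>g. g \<in> V \<Longrightarrow> \<Phi> (\<Gamma> g) = g"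
    "\<And>g. g \<in> V \<Longrightarrow> \<exists>\<Gamma>'. (\<Gamma> has_derivative \<Gamma>') (at g)"
    "\<And>g W. (\<And>t::real. 0 \<le> t \<Longrightarrow> t \<le> 1 \<Longrightarrow> g t \<in> V \<and> W t \<in> h \<and> (g has_vector_derivative W t * g t) (at t))
        \<Longrightarrow> q (\<Gamma> (g 1)) = q (\<Gamma> (g 0))"
    using foliation_chart by metis
  show ?thesis
  proof (rule that[of V "\<lambda>g. q (\<Gamma> g)"], unfold plaque_chart_def, intro conjI allI ballI impI)
    show "open V" "1 \<in> V" by (rule V)+
    show "q (\<Gamma> 1) = 0" using V(3) by simp
  next
    fix g assume g: "g \<in> V"
    show "\<exists>Z\<in>h. g = exp Z" if "q (\<Gamma> g) = 0"
    proof (rule bexI)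
      show "\<Gamma> g \<in> h" using that by (simp add: q_zero_iff)
      then show "g = exp (\<Gamma> g)" using V(4)[OF g] that by (simp add: \<Phi>_def pa_def pb_def P_id)
    qed
    have "isCont \<Gamma> g" using V(5)[OF g] has_derivative_continuous by blast
    then show "isCont (\<lambda>g. q (\<Gamma> g)) g" by (rule q.isCont)
  next
    fix g W
    assume "\<forall>t::real. 0 \<le> t \<longrightarrow> t \<le> 1 \<longrightarrow> g t \<in> V \<and> W t \<in> h \<and> (g has_vector_derivative W t * g t) (at t)"
    then show "q (\<Gamma> (g 1)) = q (\<Gamma> (g 0))" by (intro V(6)) blast
  next
    fix c v e assume c: "(c has_vector_derivative v) (at (0::real))" "c 0 = 1" "0 < e"
      and F: "\<forall>t. \<bar>t\<bar> < e \<longrightarrow> c t \<in> V \<and> q (\<Gamma> (c t)) = 0"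
    obtain \<Gamma>' where "(\<Gamma> has_derivative \<Gamma>') (at (c 0))" using V(5)[OF V(2)] c(2) by auto
    with vector_derivative_diff_chain_within[OF c(1) has_derivative_at_withinI[OF this]]
    have z': "((\<lambda>t. \<Gamma> (c t)) has_vector_derivative \<Gamma>' v) (at 0)" by (simp add: o_def)
    have "((\<lambda>t. q (\<Gamma> (c t))) has_vector_derivative 0) (at 0)"
      by (rule has_vector_derivative_transform_within_open[of "\<lambda>_. 0" _ _ "{-e<..<e}"]) (use F c(3) in auto)
    with q.has_vector_derivative[OF z'] have q0: "q (\<Gamma>' v) = 0" by (rule vector_derivative_unique_at)
    have "(\<Phi> has_derivative d\<Phi> 0) (at (\<Gamma> (c 0)))" using \<Phi>_has_derivative[of 0] c(2) V(3) by simp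
    with vector_derivative_diff_chain_within[OF z' has_derivative_at_withinI[OF this]]
    have "((\<lambda>t. \<Phi> (\<Gamma> (c t))) has_vector_derivative d\<Phi> 0 (\<Gamma>' v)) (at 0)" by (simp add: o_def)
    moreover have "((\<lambda>t. \<Phi> (\<Gamma> (c t))) has_vector_derivative v) (at 0)"
      by (rule has_vector_derivative_transform_within_open[OF c(1), of "{-e<..<e}"]) (use F c(3) V(4) in auto)
    ultimately have "d\<Phi> 0 (\<Gamma>' v) = v" by (rule vector_derivative_unique_at)
    moreover have "d\<Phi> 0 (\<Gamma>' v) = \<Gamma>' v"
      by (simp add: d\<Phi>_def) (simp add: pa_def pb_def q_def)
    ultimately have "v = \<Gamma>' v" by simp
    then show "v \<in> h" using q0 by (simp add: q_zero_iff)
  qed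
qed

text \<open>What will be used of the countable topology of the immersed subgroup generated by \<open>exp
  h\<close>.\<close>

definition thin :: "'b set \<Rightarrow> 'b set \<Rightarrow> bool" where
  "thin h S \<longleftrightarrow> (\<exists>C. countable C \<and> (\<forall>s\<in>S. \<exists>Z\<in>h. \<exists>c\<in>C. s = exp Z * c))"

text \<open>A segment in \<open>h\<close> is mapped by \<open>exp\<close> to a curve tangent to the
  leaves.\<close>

lemma exp_segment_log_derivative:
  fixes h :: "'b set"
  assumes h: "subspace h" and bracket: "\<And>X Y. X \<in> h \<Longrightarrow> Y \<in> h \<Longrightarrow> X * Y - Y * X \<in> h" and X: "X \<in> h" "X' \<in> h"
  shows "\<exists>W\<in>h. ((\<lambda>t. exp (X + t *\<^sub>R (X' - X))) has_vector_derivative W * exp (X + t *\<^sub>R (X' - X))) (at t)"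
proof -
  let ?x = "X + t *\<^sub>R (X' - X)"
  have "?x \<in> h" using X by (intro subspace_add subspace_scale subspace_diff h)
  then have "dexp ?x (X' - X) * exp (- ?x) \<in> h"
    by (intro dexp_log_closed[OF h]) (assumption | rule subspace_diff[OF h] X bracket)+
  moreover have "((\<lambda>t. exp (X + t *\<^sub>R (X' - X))) has_vector_derivative dexp ?x (X' - X)) (at t)"
    by (rule exp_has_vector_derivative) (auto intro!: derivative_eq_intros)
  moreover have "dexp ?x (X' - X) = dexp ?x (X' - X) * exp (- ?x) * exp ?x" by (simp only: mult.assoc exp_minus_cancel mult_1_right)
  ultimately show ?thesis by (intro bexI[of _ "dexp ?x (X' - X) * exp (- ?x)"]) simp_all
qed

text \<open>For \<open>(X, Y)\<close> near \<open>(X0, Y0)\<close> the product \<open>exp X exp Y\<close>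
  lies in \<open>exp h\<close> times \<open>exp X0 exp Y0\<close>: move from one pair to the other along
  a segment and use that \<open>F\<close> is constant along the resulting curve. The pairs form a second
  countable space, so countably many base points suffice.\<close>

lemma thin_exp_exp:
  fixes h :: "'b set"
  assumes h: "subspace h" and bracket: "\<And>X Y. X \<in> h \<Longrightarrow> Y \<in> h \<Longrightarrow> X * Y - Y * X \<in> h"
  shows "thin h {exp X * exp Y | X Y. X \<in> h \<and> Y \<in> h}"
proof -
  obtain V F where "plaque_chart h V F"
    using plaque_chart_exists[OF h bracket] by blast
  note V = plaque_chartD(1-5)[OF this] and const = plaque_chartD(6)[OF this] and vel = plaque_chartD(7)[OF this]
  let ?S = "{(u, v). J' u \<in> h \<and> J' v \<in> h}"
  let ?R = "\<lambda>(u, v) c. \<exists>Z\<in>h. exp (J' u) * exp (J' v) = exp Z * c"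
  obtain C where C: "countable C" "\<And>p. p \<in> ?S \<Longrightarrow> \<exists>c\<in>C. ?R p c"
  proof (rule countable_local_choice[of ?S ?R])
    fix p assume "p \<in> ?S"
    then obtain u0 v0 where p: "p = (u0, v0)" "J' u0 \<in> h" "J' v0 \<in> h" by auto
    \<comment> \<open>The product relative to its value at the base point, so that \<open>m p =
      1\<close> and \<open>F\<close> is available near it.\<close>
    define m where "m p = exp (J' (fst p)) * exp (J' (snd p)) * (exp (- J' v0) * exp (- J' u0))" for p
    have cont_m: "continuous_on UNIV m" unfolding m_def
      by (intro continuous_on_mult continuous_on_exp_algebra bounded_linear.continuous_on[OF bl_J'] continuous_on_fst
          continuous_on_snd continuous_on_id continuous_on_const)
    have m0: "m p = 1" by (simp add: m_def p(1) mult.assoc)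
    have "open (m -` V)" using cont_m V(1) continuous_on_open_vimage[of UNIV m] by auto
    then obtain e where e: "0 < e" "ball p e \<subseteq> m -` V"
      using m0 V(2) open_contains_ball by (metis vimageI2)
    show "\<exists>U c. open U \<and> p \<in> U \<and> (\<forall>p'\<in>U \<inter> ?S. ?R p' c)"
    proof (intro exI[of _ "ball p e"] exI[of _ "exp (J' u0) * exp (J' v0)"] conjI ballI)
      fix p' assume "p' \<in> ball p e \<inter> ?S"
      then obtain u v where p': "p' = (u, v)" "J' u \<in> h" "J' v \<in> h" "p' \<in> ball p e" by auto
      define X where "X t = J' u0 + t *\<^sub>R (J' u - J' u0)" for t
      define Y where "Y t = J' v0 + t *\<^sub>R (J' v - J' v0)" for t
      define g where "g t = exp (X t) * exp (Y t) * (exp (- J' v0) * exp (- J' u0))" for t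
      have "\<forall>t. \<exists>W\<in>h. (g has_vector_derivative W * g t) (at t)"
      proof
        fix t
        obtain A where A: "A \<in> h" "((\<lambda>t. exp (X t)) has_vector_derivative A * exp (X t)) (at t)"
          using exp_segment_log_derivative[OF h bracket p(2) p'(2), of t] unfolding X_def by blast
        obtain B where B: "B \<in> h" "((\<lambda>t. exp (Y t)) has_vector_derivative B * exp (Y t)) (at t)"
          using exp_segment_log_derivative[OF h bracket p(3) p'(3), of t] unfolding Y_def by blast
        have Xh: "X t \<in> h" unfolding X_def using p(2) p'(2) by (intro subspace_add subspace_scale subspace_diff h)
        have "(g has_vector_derivative (exp (X t) * (B * exp (Y t)) + A * exp (X t) * exp (Y t)) * (exp (- J' v0) * exp (- J' u0))) (at t)"
          unfolding g_def by (intro has_vector_derivative_mult_left has_vector_derivative_mult A B)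
        moreover have "(exp (X t) * (B * exp (Y t)) + A * exp (X t) * exp (Y t)) * (exp (- J' v0) * exp (- J' u0))
            = (exp (X t) * B * exp (- X t) + A) * g t"
          by (simp add: g_def distrib_right mult.assoc)
        moreover have "exp (X t) * B * exp (- X t) + A \<in> h"
          using A(1) B(1) Xh by (intro subspace_add h Ad_exp_closed bracket)
        ultimately show "\<exists>W\<in>h. (g has_vector_derivative W * g t) (at t)" by (intro bexI) auto
      qed
      then obtain W where W: "\<And>t. W t \<in> h" "\<And>t. (g has_vector_derivative W t * g t) (at t)" by metis
      have gm: "g t = m (p + t *\<^sub>R (p' - p))" for t
        using bl_J' by (simp add: g_def m_def X_def Y_def p p' bounded_linear.linear linear_add linear_scale linear_diff)
      have gV: "g t \<in> V" if "0 \<le> t" "t \<le> 1" for t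
      proof -
        have "p + t *\<^sub>R (p' - p) = (1 - t) *\<^sub>R p + t *\<^sub>R p'" by (simp add: algebra_simps)
        also have "\<dots> \<in> ball p e" using that e(1) p'(4) by (intro convexD[OF convex_ball]) auto
        finally show ?thesis using e(2) gm by auto
      qed
      have g0: "g 0 = 1" using gm[of 0] m0 by simp
      have "F (g 1) = F (g 0)" by (rule const[where W=W]) (use gV W in auto)
      then have "F (g 1) = 0" using g0 V(3) by simp
      then obtain Z where Z: "Z \<in> h" "g 1 = exp Z" using V(4) gV[of 1] by auto
      have "exp (J' u) * exp (J' v) = g 1 * (exp (J' u0) * exp (J' v0))"
        by (simp add: g_def X_def Y_def mult.assoc)
      then show "?R p' (exp (J' u0) * exp (J' v0))" using Z p'(1) by auto
    qed (use e(1) in auto)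
  qed blast
  show ?thesis unfolding thin_def
  proof (intro exI[of _ C] conjI ballI C(1))
    fix s assume "s \<in> {exp X * exp Y | X Y. X \<in> h \<and> Y \<in> h}"
    then obtain X Y where "s = exp X * exp Y" "X \<in> h" "Y \<in> h" by blast
    then show "\<exists>Z\<in>h. \<exists>c\<in>C. s = exp Z * c" using C(2)[of "(J X, J Y)"] by auto
  qed
qed

text \<open>By \<open>thin_exp_exp\<close> a word of length \<open>n + 1\<close> in exponentials is
  \<open>exp Z\<close> times a product of \<open>n + 1\<close> of the countably many translations found
  there.\<close>

lemma thin_exp_group:
  fixes h :: "'b set"
  assumes h: "subspace h" and bracket: "\<And>X Y. X \<in> h \<Longrightarrow> Y \<in> h \<Longrightarrow> X * Y - Y * X \<in> h"
  shows "thin h (exp_group h)"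
proof -
  obtain C0 where C0: "countable C0" "\<And>X Y. X \<in> h \<Longrightarrow> Y \<in> h \<Longrightarrow> \<exists>Z\<in>h. \<exists>c\<in>C0. exp X * exp Y = exp Z * c"
    using thin_exp_exp[OF h bracket] unfolding thin_def by blast
  define C where "C = rec_nat {1} (\<lambda>_ S. (\<lambda>(a, b). a * b) ` (C0 \<times> S))"
  have C: "C 0 = {1}" "C (Suc n) = (\<lambda>(a, b). a * b) ` (C0 \<times> C n)" for n by (simp_all add: C_def)
  have "countable (C n)" for n by (induction n) (auto simp: C C0(1))
  moreover have "\<exists>n. \<exists>Z\<in>h. \<exists>c\<in>C n. g = exp Z * c" if "g \<in> exp_group h" for g
    using that
  proof induction
    case exp_group_one
    show ?case using subspace_0[OF h] C(1) by (intro exI[of _ 0] bexI[of _ 0] bexI[of _ 1]) auto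
  next
    case (exp_group_mult X g)
    then obtain n Z c where g: "Z \<in> h" "c \<in> C n" "g = exp Z * c" by blast
    obtain Z' c' where "Z' \<in> h" "c' \<in> C0" "exp X * exp Z = exp Z' * c'" using C0(2)[OF exp_group_mult(1) g(1)] by blast
    then have "c' * c \<in> C (Suc n)" "exp X * g = exp Z' * (c' * c)" using g by (auto simp: C mult.assoc[symmetric])
    then show ?case using \<open>Z' \<in> h\<close> by blast
  qed
  ultimately show ?thesis unfolding thin_def by (intro exI[of _ "\<Union>n. C n"]) (auto, blast)
qed

text \<open>Along the curve, \<open>F\<close> is continuous and, since the group is covered by countably
  many translates of \<open>exp h\<close>, takes only countably many values. Hence it vanishes near
  \<open>1\<close>, and the velocity is in \<open>h\<close>.\<close>

theorem velocities_exp_group: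
  fixes h :: "'b set"
  assumes h: "subspace h" and bracket: "\<And>X Y. X \<in> h \<Longrightarrow> Y \<in> h \<Longrightarrow> X * Y - Y * X \<in> h"
  shows "velocities (exp_group h) 1 \<subseteq> h"
proof
  fix v assume "v \<in> velocities (exp_group h) 1"
  then obtain e c where c: "0 < e" "c C1_differentiable_on {-e<..<e}" "c ` {-e<..<e} \<subseteq> exp_group h" "c 0 = 1"
    "(c has_vector_derivative v) (at 0)" unfolding velocities_def by blast
  obtain C where C: "countable C" "\<And>g. g \<in> exp_group h \<Longrightarrow> \<exists>Z\<in>h. \<exists>c\<in>C. g = exp Z * c"
    using thin_exp_group[OF h bracket] unfolding thin_def by blast
  obtain V F where "plaque_chart h V F"
    using plaque_chart_exists[OF h bracket] by blast
  note V = plaque_chartD(1-5)[OF this] and const = plaque_chartD(6)[OF this] and vel = plaque_chartD(7)[OF this]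
  \<comment> \<open>On a single translate \<open>exp Z c\<close> the value of \<open>F\<close> is
    locally constant in \<open>Z\<close>, hence takes countably many values.\<close>
  have count: "countable (F ` (exp_group h \<inter> V))"
  proof -
    have "\<exists>D. countable D \<and> (\<forall>Z\<in>h. exp Z * c \<in> V \<longrightarrow> F (exp Z * c) \<in> D)" for c
    proof -
      let ?S = "{u. J' u \<in> h \<and> exp (J' u) * c \<in> V}"
      obtain D where D: "countable D" "\<And>u. u \<in> ?S \<Longrightarrow> \<exists>d\<in>D. F (exp (J' u) * c) = d"
      proof (rule countable_local_choice[of ?S "\<lambda>u d. F (exp (J' u) * c) = d"])
        fix u assume u: "u \<in> ?S"
        have "continuous_on UNIV (\<lambda>u. exp (J' u) * c)"
          by (intro continuous_on_mult continuous_on_exp_algebra linear_continuous_on bl_J' continuous_on_const)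
        then have "open ((\<lambda>u. exp (J' u) * c) -` V)" using V(1) continuous_on_open_vimage[of UNIV "\<lambda>u. exp (J' u) * c"] by auto
        then obtain e where e: "0 < e" "ball u e \<subseteq> (\<lambda>u. exp (J' u) * c) -` V"
          using u open_contains_ball by (metis (no_types, lifting) mem_Collect_eq vimageI2)
        have "F (exp (J' u') * c) = F (exp (J' u) * c)" if u': "u' \<in> ball u e" "u' \<in> ?S" for u'
        proof -
          have "\<forall>t. \<exists>W\<in>h. ((\<lambda>t. exp (J' u + t *\<^sub>R (J' u' - J' u))) has_vector_derivative W * exp (J' u + t *\<^sub>R (J' u' - J' u))) (at t)"
            using exp_segment_log_derivative[OF h bracket, of "J' u" "J' u'"] u u' by auto
          then obtain W where W: "\<And>t. W t \<in> h"
            "\<And>t. ((\<lambda>t. exp (J' u + t *\<^sub>R (J' u' - J' u))) has_vector_derivative W t * exp (J' u + t *\<^sub>R (J' u' - J' u))) (at t)"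
            by metis
          have "F (exp (J' u + 1 *\<^sub>R (J' u' - J' u)) * c) = F (exp (J' u + 0 *\<^sub>R (J' u' - J' u)) * c)"
          proof (rule const[where W=W])
            fix t :: real assume t: "0 \<le> t" "t \<le> 1"
            have "(1 - t) *\<^sub>R u + t *\<^sub>R u' \<in> ball u e" using t e(1) u'(1) by (intro convexD[OF convex_ball]) auto
            moreover have "J' ((1 - t) *\<^sub>R u + t *\<^sub>R u') = J' u + t *\<^sub>R (J' u' - J' u)"
              unfolding linear_add[OF bounded_linear.linear[OF bl_J']] linear_scale[OF bounded_linear.linear[OF bl_J']]
              by (simp add: algebra_simps)
            ultimately have "exp (J' u + t *\<^sub>R (J' u' - J' u)) * c \<in> V" using e(2) by (metis vimageD subsetD)
            then show "exp (J' u + t *\<^sub>R (J' u' - J' u)) * c \<in> V \<and> W t \<in> h \<and>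
              ((\<lambda>t. exp (J' u + t *\<^sub>R (J' u' - J' u)) * c) has_vector_derivative W t * (exp (J' u + t *\<^sub>R (J' u' - J' u)) * c)) (at t)"
              using has_vector_derivative_mult_left[OF W(2)[of t], of c] W(1) by (simp add: mult.assoc)
          qed
          then show ?thesis by simp
        qed
        then show "\<exists>U d. open U \<and> u \<in> U \<and> (\<forall>p'\<in>U \<inter> ?S. F (exp (J' p') * c) = d)"
          using e(1) by (intro exI[of _ "ball u e"] exI[of _ "F (exp (J' u) * c)"]) auto
      qed blast
      have "F (exp Z * c) \<in> D" if "Z \<in> h" "exp Z * c \<in> V" for Z using D(2)[of "J Z"] that by simp
      then show ?thesis using D(1) by blast
    qed
    then obtain D where D: "\<And>c. countable (D c)" "\<And>c Z. Z \<in> h \<Longrightarrow> exp Z * c \<in> V \<Longrightarrow> F (exp Z * c) \<in> D c" by metis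
    have "F ` (exp_group h \<inter> V) \<subseteq> (\<Union>c\<in>C. D c)" using C(2) D(2) by blast
    then show ?thesis using C(1) D(1) by (meson countable_UN countable_subset)
  qed
  have cc: "isCont c t" if "\<bar>t\<bar> < e" for t
  proof -
    have "t \<in> {-e<..<e}" using that by auto
    then obtain D where "(c has_vector_derivative D) (at t)"
      using c(2) unfolding C1_differentiable_on_def by blast
    then show ?thesis by (rule has_vector_derivative_continuous)
  qed
  have "isCont c 0" using cc c(1) by simp
  then have "\<forall>\<^sub>F t in nhds 0. c t \<in> V"
    using V(1,2) c(4) by (simp add: continuous_at_open eventually_nhds)
  then obtain d where d: "0 < d" "\<And>t. dist t 0 < d \<Longrightarrow> c t \<in> V" unfolding eventually_nhds_metric by blast
  define r where "r = min d e"
  have r: "0 < r" using d(1) c(1) by (simp add: r_def)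
  \<comment> \<open>A connected set with two points is uncountable.\<close>
  have F0: "F (c t) = 0" if t: "\<bar>t\<bar> < r" for t
  proof (rule ccontr)
    assume ne: "F (c t) \<noteq> 0"
    let ?I = "{-r<..<r}"
    have "continuous_on ?I (\<lambda>t. F (c t))"
    proof (intro continuous_at_imp_continuous_on ballI)
      fix s assume "s \<in> ?I"
      then have "\<bar>s\<bar> < e" "dist s 0 < d" by (auto simp: r_def)
      then show "isCont (\<lambda>t. F (c t)) s" using cc V(5) d(2) isCont_o2[of s c F] by blast
    qed
    then have "connected ((\<lambda>t. F (c t)) ` ?I)" by (rule connected_continuous_image) simp
    moreover have "t \<in> ?I" "0 \<in> ?I" using t r by auto
    then have "F (c t) \<in> (\<lambda>t. F (c t)) ` ?I" "F (c 0) \<in> (\<lambda>t. F (c t)) ` ?I"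
      using imageI[of _ ?I "\<lambda>t. F (c t)"] by metis+
    moreover have "F (c t) \<noteq> F (c 0)" using ne c(4) V(3) by simp
    ultimately have "uncountable ((\<lambda>t. F (c t)) ` ?I)" by (rule connected_uncountable)
    moreover have "(\<lambda>t. F (c t)) ` ?I \<subseteq> F ` (exp_group h \<inter> V)"
    proof (clarsimp)
      fix s assume "- r < s" "s < r"
      then have "s \<in> {-e<..<e}" "dist s 0 < d" by (auto simp: r_def)
      then show "F (c s) \<in> F ` (exp_group h \<inter> V)" using c(3) d(2) by blast
    qed
    ultimately show False using count countable_subset by blast
  qed
  show "v \<in> h"
  proof (rule vel[OF c(5,4) r])
    fix t assume "\<bar>t\<bar> < r"
    then show "c t \<in> V \<and> F (c t) = 0" using F0 d(2)[of t] by (auto simp: r_def)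
  qed
qed

end

section \<open>The Banach algebra of endomorphisms\<close>

text \<open>A copy of the space of bounded linear endomorphisms, made an algebra under composition, so
  that \<open>exp\<close> and the results above apply to it.\<close>

typedef (overloaded) 'e endo = "UNIV :: ('e::euclidean_space \<Rightarrow>\<^sub>L 'e) set"
  morphisms endo_map Endo by simp

setup_lifting type_definition_endo

instantiation endo :: (euclidean_space) real_normed_algebra_1
begin

lift_definition plus_endo :: "'a endo \<Rightarrow> 'a endo \<Rightarrow> 'a endo" is "(+)" .
lift_definition minus_endo :: "'a endo \<Rightarrow> 'a endo \<Rightarrow> 'a endo" is "(-)" .
lift_definition uminus_endo :: "'a endo \<Rightarrow> 'a endo" is "uminus" .
lift_definition zero_endo :: "'a endo" is "0" .
lift_definition one_endo :: "'a endo" is "id_blinfun" .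
lift_definition times_endo :: "'a endo \<Rightarrow> 'a endo \<Rightarrow> 'a endo" is "(o\<^sub>L)" .
lift_definition scaleR_endo :: "real \<Rightarrow> 'a endo \<Rightarrow> 'a endo" is "(*\<^sub>R)" .
lift_definition norm_endo :: "'a endo \<Rightarrow> real" is "norm" .
definition dist_endo :: "'a endo \<Rightarrow> 'a endo \<Rightarrow> real" where "dist_endo a b = norm (a - b)"
definition sgn_endo :: "'a endo \<Rightarrow> 'a endo" where "sgn_endo x = inverse (norm x) *\<^sub>R x"
definition uniformity_endo :: "('a endo \<times> 'a endo) filter" where
  "uniformity_endo = (INF e\<in>{0 <..}. principal {(x, y). dist x y < e})"
definition open_endo :: "'a endo set \<Rightarrow> bool" where
  "open_endo S = (\<forall>x\<in>S. \<forall>\<^sub>F (x', y) in uniformity. x' = x \<longrightarrow> y \<in> S)"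

instance
proof
  fix a b c :: "'a endo" and r s :: real
  show "dist a b = norm (a - b)" by (simp add: dist_endo_def)
  show "sgn a = inverse (norm a) *\<^sub>R a" by (simp add: sgn_endo_def)
  show "norm (1::'a endo) = 1" by transfer simp
  show "(0::'a endo) \<noteq> 1"
  proof
    assume "0 = (1::'a endo)"
    then have "norm (0::'a \<Rightarrow>\<^sub>L 'a) = norm (id_blinfun::'a \<Rightarrow>\<^sub>L 'a)" by transfer simp
    then show False by simp
  qed
  show "norm (a * b) \<le> norm a * norm b" by transfer (rule norm_blinfun_compose)
  show "a + b + c = a + (b + c)" by transfer (simp add: add.assoc)
  show "a + b = b + a" by transfer (simp add: add.commute)
  show "0 + a = a" "- a + a = 0" "a - b = a + - b" by (transfer, simp)+
  show "r *\<^sub>R (a + b) = r *\<^sub>R a + r *\<^sub>R b" by transfer (simp add: scaleR_add_right)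
  show "(r + s) *\<^sub>R a = r *\<^sub>R a + s *\<^sub>R a" by transfer (simp add: scaleR_add_left)
  show "r *\<^sub>R s *\<^sub>R a = (r * s) *\<^sub>R a" "1 *\<^sub>R a = a" by (transfer, simp)+
  show "a * b * c = a * (b * c)" by transfer (simp add: blinfun_eqI)
  show "(a + b) * c = a * c + b * c" "a * (b + c) = a * b + a * c" "1 * a = a" "a * 1 = a"
    by (transfer, rule blinfun_eqI, simp add: blinfun.bilinear_simps)+
  show "r *\<^sub>R a * b = r *\<^sub>R (a * b)" "a * r *\<^sub>R b = r *\<^sub>R (a * b)"
    by (transfer, rule blinfun_eqI, simp add: blinfun.bilinear_simps)+
  show "(uniformity :: ('a endo \<times> 'a endo) filter) = (INF e\<in>{0 <..}. principal {(x, y). dist x y < e})"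
    by (rule uniformity_endo_def)
  show "open U = (\<forall>x\<in>U. \<forall>\<^sub>F (x', y) in uniformity. x' = x \<longrightarrow> y \<in> U)" for U :: "'a endo set"
    by (rule open_endo_def)
  show "(norm a = 0) = (a = 0)" by transfer simp
  show "norm (a + b) \<le> norm a + norm b" by transfer (rule norm_triangle_ineq)
  show "norm (r *\<^sub>R a) = \<bar>r\<bar> * norm a" by transfer simp
qed

end

definition emap :: "'e::euclidean_space endo \<Rightarrow> 'e \<Rightarrow> 'e" where "emap X = blinfun_apply (endo_map X)"

lemma emap_simps [simp]:
  "emap (X + Y) p = emap X p + emap Y p" "emap (X - Y) p = emap X p - emap Y p" "emap (- X) p = - emap X p"
  "emap 0 p = 0" "emap 1 p = p" "emap (X * Y) p = emap X (emap Y p)" "emap (r *\<^sub>R X) p = r *\<^sub>R emap X p"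
  unfolding emap_def by (transfer, simp add: blinfun.bilinear_simps)+

lemma endo_eqI: "(\<And>p. emap X p = emap Y p) \<Longrightarrow> X = Y"
  unfolding emap_def by (simp add: blinfun_eqI endo_map_inject[symmetric])

lemma norm_emap: "norm (emap X p) \<le> norm X * norm p"
  unfolding emap_def by transfer (rule norm_blinfun)

lemma bounded_linear_endo_map: "bounded_linear endo_map"
  by (rule bounded_linear_intro[where K=1]) (transfer, simp)+

lemma bounded_linear_Endo: "bounded_linear Endo"
  by (rule bounded_linear_intro[where K=1])
     (simp_all add: plus_endo.abs_eq eq_onp_same_args scaleR_endo.abs_eq norm_endo.abs_eq)

lemma bounded_bilinear_emap: "bounded_bilinear emap"
  unfolding emap_def[abs_def]
  using bounded_bilinear.comp[OF bounded_bilinear_blinfun_apply bounded_linear_endo_map bounded_linear_ident] by simp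

lemma emap_Endo: "bounded_linear f \<Longrightarrow> emap (Endo (Blinfun f)) = f"
  by (simp add: emap_def Endo_inverse bounded_linear_Blinfun_apply)

lemma bounded_linear_emap: "bounded_linear (emap X)"
  unfolding emap_def by (rule blinfun.bounded_linear_right)

instance endo :: (euclidean_space) banach
proof
  fix X :: "nat \<Rightarrow> 'a endo" assume X: "Cauchy X"
  have "Cauchy (\<lambda>n. endo_map (X n))"
    using bounded_linear.Cauchy[OF bounded_linear_endo_map X] .
  then obtain l where "(\<lambda>n. endo_map (X n)) \<longlonglongrightarrow> l" using Cauchy_convergent convergentD by blast
  then have "(\<lambda>n. Endo (endo_map (X n))) \<longlonglongrightarrow> Endo l" by (rule bounded_linear.tendsto[OF bounded_linear_Endo])
  then show "convergent X" by (auto simp: endo_map_inverse convergent_def)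
qed

text \<open>The standard basis as a finite type. It indexes the columns of an endomorphism, which are the
  coordinates required by \<open>fin_dim_algebra\<close>.\<close>

typedef (overloaded) 'e basis_index = "Basis :: 'e::euclidean_space set"
  by (simp add: nonempty_Basis ex_in_conv)

instance basis_index :: (euclidean_space) finite
proof
  have "UNIV = Abs_basis_index ` (Basis :: 'a set)"
    by (metis Abs_basis_index_cases UNIV_eq_I image_eqI)
  then show "finite (UNIV :: 'a basis_index set)" by (metis finite_Basis finite_imageI)
qed

lemma sum_basis_index: "(\<Sum>i\<in>(UNIV::'e::euclidean_space basis_index set). f (Rep_basis_index i)) = (\<Sum>b\<in>Basis. f b)"
proof (rule sum.reindex_bij_betw)
  show "bij_betw Rep_basis_index UNIV (Basis :: 'e set)"
    unfolding bij_betw_def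
    using type_definition.Rep_range[OF type_definition_basis_index] by (auto intro: injI simp: Rep_basis_index_inject)
qed

definition endo_coords :: "'e::euclidean_space endo \<Rightarrow> 'e ^ 'e basis_index" where
  "endo_coords X = (\<chi> i. emap X (Rep_basis_index i))"

definition endo_of_coords :: "'e::euclidean_space ^ 'e basis_index \<Rightarrow> 'e endo" where
  "endo_of_coords x = Endo (Blinfun (\<lambda>v. \<Sum>i\<in>UNIV. (v \<bullet> Rep_basis_index i) *\<^sub>R x $ i))"

lemma emap_endo_of_coords: "emap (endo_of_coords x) v = (\<Sum>i\<in>UNIV. (v \<bullet> Rep_basis_index i) *\<^sub>R x $ i)"
  unfolding endo_of_coords_def
  by (subst emap_Endo) (auto intro!: bounded_linear_sum bounded_linear_scaleR_const bounded_linear_inner_left)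

interpretation endo: fin_dim_algebra "endo_coords :: 'e::euclidean_space endo \<Rightarrow> _" endo_of_coords
proof (rule fin_dim_algebra.intro)
  show "bounded_linear (endo_coords :: 'e endo \<Rightarrow> _)"
  proof (rule bounded_linear_intro[where K="real CARD('e basis_index)"])
    fix X Y :: "'e endo" and r :: real
    show "endo_coords (X + Y) = endo_coords X + endo_coords Y" by (simp add: endo_coords_def vec_eq_iff)
    show "endo_coords (r *\<^sub>R X) = r *\<^sub>R endo_coords X" by (simp add: endo_coords_def vec_eq_iff)
    have "norm (endo_coords X) \<le> (\<Sum>i\<in>UNIV. norm (endo_coords X $ i))"
      unfolding norm_vec_def by (rule L2_set_le_sum) simp
    also have "\<dots> \<le> (\<Sum>i\<in>(UNIV::'e basis_index set). norm X)"
    proof (rule sum_mono)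
      fix i :: "'e basis_index"
      have "Rep_basis_index i \<in> Basis" by (rule Rep_basis_index)
      then show "norm (endo_coords X $ i) \<le> norm X"
        using norm_emap[of X "Rep_basis_index i"] by (simp add: endo_coords_def)
    qed
    finally show "norm (endo_coords X) \<le> norm X * real CARD('e basis_index)" by (simp add: mult.commute)
  qed
  have "linear (endo_of_coords :: _ \<Rightarrow> 'e endo)"
    by (rule linearI; rule endo_eqI; simp add: emap_endo_of_coords scaleR_add_right sum.distrib scaleR_sum_right mult.commute)
  then show "bounded_linear (endo_of_coords :: _ \<Rightarrow> 'e endo)" by (simp add: linear_conv_bounded_linear)
  fix X :: "'e endo"
  show "endo_of_coords (endo_coords X) = X"
  proof (rule endo_eqI)
    fix p
    have "emap (endo_of_coords (endo_coords X)) p = (\<Sum>b\<in>Basis. (p \<bullet> b) *\<^sub>R emap X b)"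
      by (simp add: emap_endo_of_coords endo_coords_def sum_basis_index[symmetric])
    also have "\<dots> = emap X (\<Sum>b\<in>Basis. (p \<bullet> b) *\<^sub>R b)"
      using bounded_linear_emap[of X] by (simp add: bounded_linear.linear linear_sum linear_scale)
    finally show "emap (endo_of_coords (endo_coords X)) p = emap X p" by (simp add: euclidean_representation)
  qed
  fix y :: "'e ^ 'e basis_index"
  have "(Rep_basis_index i \<bullet> Rep_basis_index j) *\<^sub>R y $ j = (if j = i then y $ i else 0)" for i j
    using inner_Basis[OF Rep_basis_index Rep_basis_index, of i j] by (auto simp: Rep_basis_index_inject)
  then show "endo_coords (endo_of_coords y) = y"
    by (simp add: endo_coords_def emap_endo_of_coords vec_eq_iff)
qed

section \<open>Velocities of a group\<close>

lemma C1_bounded_linear: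
  assumes "bounded_linear f" "c C1_differentiable_on S"
  shows "(\<lambda>t. f (c t)) C1_differentiable_on S"
proof -
  obtain D where D: "\<And>s. s \<in> S \<Longrightarrow> (c has_vector_derivative D s) (at s)" "continuous_on S D"
    using assms(2) unfolding C1_differentiable_on_def by blast
  then show ?thesis unfolding C1_differentiable_on_def
    using bounded_linear.has_vector_derivative[OF assms(1)] bounded_linear.continuous_on[OF assms(1) D(2)]
    by (intro exI[of _ "\<lambda>s. f (D s)"]) auto
qed

lemma C1_bounded_bilinear:
  assumes "bounded_bilinear f" "c C1_differentiable_on S" "d C1_differentiable_on S"
  shows "(\<lambda>t. f (c t) (d t)) C1_differentiable_on S"
proof -
  obtain D where D: "\<And>s. s \<in> S \<Longrightarrow> (c has_vector_derivative D s) (at s)" "continuous_on S D"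
    using assms(2) unfolding C1_differentiable_on_def by blast
  obtain E where E: "\<And>s. s \<in> S \<Longrightarrow> (d has_vector_derivative E s) (at s)" "continuous_on S E"
    using assms(3) unfolding C1_differentiable_on_def by blast
  have c: "continuous_on S c" "continuous_on S d" using assms(2,3) by (auto intro: C1_differentiable_imp_continuous_on)
  have "continuous_on S (\<lambda>s. f (c s) (E s) + f (D s) (d s))"
    by (intro continuous_on_add bounded_bilinear.continuous_on[OF assms(1)] c D E)
  then show ?thesis unfolding C1_differentiable_on_def
    using bounded_bilinear.has_vector_derivative[OF assms(1) D(1) E(1)]
    by (intro exI[of _ "\<lambda>s. f (c s) (E s) + f (D s) (d s)"]) auto
qed

lemma velocitiesI:
  assumes "0 < e" "c C1_differentiable_on {-e<..<e}" "\<forall>t. \<bar>t\<bar> < e \<longrightarrow> c t \<in> S" "c 0 = p" "(c has_vector_derivative v) (at 0)"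
  shows "v \<in> velocities S p"
proof -
  have "c ` {-e<..<e} \<subseteq> S" using assms(3) by auto
  then show ?thesis using assms unfolding velocities_def by blast
qed

lemma velocitiesE:
  assumes "v \<in> velocities S p"
  obtains e c where "0 < e" "c C1_differentiable_on {-e<..<e}" "\<forall>t. \<bar>t\<bar> < e \<longrightarrow> c t \<in> S" "c 0 = p" "(c has_vector_derivative v) (at 0)"
proof -
  obtain e c where c: "0 < e" "c C1_differentiable_on {-e<..<e}" "c ` {-e<..<e} \<subseteq> S" "c 0 = p" "(c has_vector_derivative v) (at 0)"
    using assms unfolding velocities_def by blast
  have "c t \<in> S" if "\<bar>t\<bar> < e" for t
  proof -
    have "t \<in> {-e<..<e}" using that by auto
    then show ?thesis using c(3) by blast
  qed
  then show ?thesis by (intro that[OF c(1,2) _ c(4,5)]) blast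
qed

lemma velocities_affine_image:
  assumes f: "bounded_linear f" and g: "\<And>x. x \<in> S \<Longrightarrow> f x + a \<in> S'" and v: "v \<in> velocities S p"
  shows "f v \<in> velocities S' (f p + a)"
proof -
  obtain e c where c: "0 < e" "c C1_differentiable_on {-e<..<e}" "\<forall>t. \<bar>t\<bar> < e \<longrightarrow> c t \<in> S" "c 0 = p" "(c has_vector_derivative v) (at 0)"
    by (rule velocitiesE[OF v]) (rule that)
  show ?thesis
  proof (rule velocitiesI[of e "\<lambda>t. f (c t) + a"])
    show "(\<lambda>t. f (c t) + a) C1_differentiable_on {- e<..<e}"
      by (rule C1_differentiable_on_add[OF C1_bounded_linear[OF f c(2)] C1_differentiable_on_const])
    have "((\<lambda>t. f (c t) + a) has_vector_derivative f v + 0) (at 0)"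
      by (rule has_vector_derivative_add[OF bounded_linear.has_vector_derivative[OF f c(5)] has_vector_derivative_const])
    then show "((\<lambda>t. f (c t) + a) has_vector_derivative f v) (at 0)" by simp
  qed (use c g in auto)
qed

text \<open>Run through the curve at \<open>r\<close> times the speed.\<close>

lemma velocities_scale:
  assumes "v \<in> velocities S p"
  shows "r *\<^sub>R v \<in> velocities S p"
proof -
  obtain e c where c: "0 < e" "c C1_differentiable_on {-e<..<e}" "\<forall>t. \<bar>t\<bar> < e \<longrightarrow> c t \<in> S" "c 0 = p" "(c has_vector_derivative v) (at 0)"
    by (rule velocitiesE[OF assms]) (rule that)
  \<comment> \<open>The summand \<open>1\<close> covers \<open>r = 0\<close>.\<close>
  define d where "d = e / (\<bar>r\<bar> + 1)"
  have d: "0 < d" using c(1) by (simp add: d_def)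
  have rt: "\<bar>r * t\<bar> < e" if "\<bar>t\<bar> < d" for t
  proof -
    have "\<bar>r * t\<bar> \<le> (\<bar>r\<bar> + 1) * \<bar>t\<bar>" by (simp add: abs_mult distrib_right)
    also have "\<dots> < (\<bar>r\<bar> + 1) * d" using that by (intro mult_strict_left_mono) auto
    finally show ?thesis by (simp add: d_def)
  qed
  obtain D where D: "\<And>s. s \<in> {-e<..<e} \<Longrightarrow> (c has_vector_derivative D s) (at s)" "continuous_on {-e<..<e} D"
    using c(2) unfolding C1_differentiable_on_def by blast
  have der: "((\<lambda>t. c (r * t)) has_vector_derivative r *\<^sub>R w) (at t)" if "(c has_vector_derivative w) (at (r * t))" for t w
  proof -
    have "((\<lambda>t. r * t) has_vector_derivative r) (at t)" by (auto intro!: derivative_eq_intros)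
    from vector_diff_chain_at[OF this that] show ?thesis by (simp add: o_def)
  qed
  show ?thesis
  proof (rule velocitiesI[OF d, of "\<lambda>t. c (r * t)"])
    have "continuous_on {-d<..<d} (\<lambda>t. D (r * t))"
    proof (rule continuous_on_compose2[OF D(2)])
      show "(\<lambda>t. r * t) ` {-d<..<d} \<subseteq> {-e<..<e}"
      proof (rule image_subsetI)
        fix t assume "t \<in> {-d<..<d}"
        then show "r * t \<in> {-e<..<e}" using rt[of t] unfolding greaterThanLessThan_iff abs_less_iff by linarith
      qed
    qed (intro continuous_intros)
    then have "continuous_on {-d<..<d} (\<lambda>t. r *\<^sub>R D (r * t))" by (intro continuous_intros)
    moreover have "((\<lambda>t. c (r * t)) has_vector_derivative r *\<^sub>R D (r * t)) (at t)" if "t \<in> {-d<..<d}" for t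
      using rt[of t] that by (intro der D) (auto simp: abs_less_iff)
    ultimately show "(\<lambda>t. c (r * t)) C1_differentiable_on {- d<..<d}"
      unfolding C1_differentiable_on_def by (intro exI[of _ "\<lambda>t. r *\<^sub>R D (r * t)"] conjI ballI)
    show "((\<lambda>t. c (r * t)) has_vector_derivative r *\<^sub>R v) (at 0)" using der[of v 0] c(5) by simp
  qed (use c rt in auto)
qed

text \<open>A subgroup of the units without a Lie group structure. The set of velocities takes the place
  of its Lie algebra.\<close>

locale matrix_group = fin_dim_algebra J J' for J :: "'b::{real_normed_algebra_1,banach} \<Rightarrow> 'c::euclidean_space" and J' +
  fixes S :: "'b set"
  assumes one: "1 \<in> S" and mult: "\<And>x y. x \<in> S \<Longrightarrow> y \<in> S \<Longrightarrow> x * y \<in> S"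
    and inverses: "\<And>x. x \<in> S \<Longrightarrow> \<exists>y\<in>S. x * y = 1 \<and> y * x = 1"
begin

text \<open>The product of two curves through \<open>1\<close> has the sum of their velocities as its
  velocity.\<close>

lemma subspace_velocities: "subspace (velocities S 1)"
  unfolding subspace_def
proof (intro conjI ballI allI)
  show "0 \<in> velocities S 1" by (rule velocitiesI[of 1 "\<lambda>_. 1"]) (auto simp: one)
  fix v w assume vw: "v \<in> velocities S 1" "w \<in> velocities S 1"
  obtain e c where c: "0 < e" "c C1_differentiable_on {-e<..<e}" "\<forall>t. \<bar>t\<bar> < e \<longrightarrow> c t \<in> S" "c 0 = 1" "(c has_vector_derivative v) (at 0)"
    by (rule velocitiesE[OF vw(1)]) (rule that)
  obtain e' c' where c': "0 < e'" "c' C1_differentiable_on {-e'<..<e'}" "\<forall>t. \<bar>t\<bar> < e' \<longrightarrow> c' t \<in> S" "c' 0 = 1" "(c' has_vector_derivative w) (at 0)"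
    by (rule velocitiesE[OF vw(2)]) (rule that)
  show "v + w \<in> velocities S 1"
  proof (rule velocitiesI[of "min e e'" "\<lambda>t. c t * c' t"])
    show "(\<lambda>t. c t * c' t) C1_differentiable_on {- min e e'<..<min e e'}"
      by (rule C1_differentiable_on_mult; rule C1_differentiable_on_subset[OF c(2)] C1_differentiable_on_subset[OF c'(2)]; auto)
    show "((\<lambda>t. c t * c' t) has_vector_derivative v + w) (at 0)"
      using has_vector_derivative_mult[OF c(5) c'(5)] by (simp add: c c' add.commute)
  qed (use c c' mult in auto)
qed (rule velocities_scale)

lemma velocities_conj:
  assumes "\<And>x. x \<in> S \<Longrightarrow> g * x * g' \<in> S" "g * g' = 1" "v \<in> velocities S 1"
  shows "g * v * g' \<in> velocities S 1"
proof -
  have "bounded_linear (\<lambda>x. g * x * g')"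
    by (intro bounded_linear_const_mult bounded_linear_mult_const bounded_linear_ident)
  from velocities_affine_image[OF this _ assms(3), of 0 S] assms show ?thesis by simp
qed

text \<open>The bracket is the derivative at \<open>0\<close> of \<open>c t w (c
  t)\<^sup>-\<^sup>1\<close>, where \<open>c\<close> has the velocity \<open>v\<close>. The difference
  quotients are velocities by \<open>velocities_conj\<close>, and the subspace of velocities is
  closed.\<close>

lemma velocities_bracket:
  assumes v: "v \<in> velocities S 1" and w: "w \<in> velocities S 1"
  shows "v * w - w * v \<in> velocities S 1"
proof -
  obtain e c where c: "0 < e" "c C1_differentiable_on {-e<..<e}" "\<forall>t. \<bar>t\<bar> < e \<longrightarrow> c t \<in> S" "c 0 = 1" "(c has_vector_derivative v) (at 0)"
    by (rule velocitiesE[OF v]) (rule that)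
  define I where "I t = (SOME y. y \<in> S \<and> c t * y = 1 \<and> y * c t = 1)" for t
  have I: "I t \<in> S \<and> c t * I t = 1 \<and> I t * c t = 1" if "\<bar>t\<bar> < e" for t
    unfolding I_def by (rule someI_ex) (use inverses[OF c(3)[rule_format, OF that]] in blast)
  have I': "(I has_vector_derivative - (I 0 * v * I 0)) (at 0)"
    by (rule inverse_curve_has_vector_derivative[of "{-e<..<e}"]) (use c I in auto)
  have I0: "I 0 = 1" using I[of 0] c by auto
  have "((\<lambda>t. c t * w * I t) has_vector_derivative c 0 * w * - (I 0 * v * I 0) + v * w * I 0) (at 0)"
    by (rule has_vector_derivative_mult[OF has_vector_derivative_mult_left[OF c(5)] I'])
  then have "((\<lambda>t. c t * w * I t) has_vector_derivative v * w - w * v) (at 0)" by (simp add: I0 c)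
  then have lim: "((\<lambda>t. (c t * w * I t - c 0 * w * I 0) /\<^sub>R (t - 0)) \<longlongrightarrow> v * w - w * v) (at 0)"
    by (simp only: has_vector_derivative_iff_tendsto)
  have "\<forall>\<^sub>F t in at 0. \<bar>t\<bar> < e" using c(1) by (auto simp: eventually_at intro!: exI[of _ e])
  then have "\<forall>\<^sub>F t in at 0. (c t * w * I t - c 0 * w * I 0) /\<^sub>R (t - 0) \<in> velocities S 1"
  proof eventually_elim
    fix t assume t: "\<bar>t\<bar> < e"
    have "c t * w * I t \<in> velocities S 1"
      using c(3) I t mult by (intro velocities_conj w) auto
    then show "(c t * w * I t - c 0 * w * I 0) /\<^sub>R (t - 0) \<in> velocities S 1"
      using w by (simp add: c I0 subspace_velocities subspace_diff subspace_scale)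
  qed
  from Lim_in_closed_set[OF closed_subspace_algebra[OF subspace_velocities] this _ lim] show ?thesis by simp
qed

end

section \<open>Affine maps in homogeneous coordinates\<close>

abbreviation lin :: "'a::real_normed_vector aff \<Rightarrow> 'a \<Rightarrow> 'a" where
  "lin A \<equiv> blinfun_apply (fst A)"

lemma norm_endo_le:
  assumes "0 \<le> b" "\<And>p. norm (emap X p) \<le> b * norm p"
  shows "norm X \<le> b"
  using assms unfolding emap_def by transfer (rule norm_blinfun_bound)

lemma aff_eqI:
  assumes "\<And>y. aff_app A y = aff_app B y"
  shows "A = B"
proof -
  have "snd A = snd B" using assms[of 0] by (simp add: aff_app_def blinfun.zero_right)
  moreover have "fst A = fst B" using assms calculation by (intro blinfun_eqI) (simp add: aff_app_def)
  ultimately show ?thesis by (simp add: prod_eq_iff)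
qed

lemma aff_app_comp [simp]: "aff_app (aff_comp A B) y = aff_app A (aff_app B y)"
  by (simp add: aff_app_def aff_comp_def blinfun.add_right)

lemma aff_app_id [simp]: "aff_app aff_id y = y"
  by (simp add: aff_app_def aff_id_def)

lemma fst_aff_comp [simp]: "fst (aff_comp A B) = fst A o\<^sub>L fst B" by (simp add: aff_comp_def)
lemma fst_aff_id [simp]: "fst aff_id = id_blinfun" by (simp add: aff_id_def)

lemma aff_app_add: "aff_app A (y + v) = aff_app A y + lin A v"
  by (simp add: aff_app_def blinfun.add_right)

lemma aff_app_diff: "aff_app A y - aff_app A z = lin A (y - z)"
  by (simp add: aff_app_def blinfun.diff_right)

lemma aff_app_plus [simp]: "aff_app (A + B) y = aff_app A y + aff_app B y"
  and aff_app_minus [simp]: "aff_app (A - B) y = aff_app A y - aff_app B y"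
  and aff_app_scaleR [simp]: "aff_app (r *\<^sub>R A) y = r *\<^sub>R aff_app A y"
  and aff_app_uminus [simp]: "aff_app (- A) y = - aff_app A y"
  and aff_app_zero [simp]: "aff_app 0 y = 0"
  by (simp_all add: aff_app_def blinfun.bilinear_simps algebra_simps)

lemma aff_comp_assoc: "aff_comp (aff_comp A B) C = aff_comp A (aff_comp B C)"
  by (rule aff_eqI) simp

lemma aff_comp_id [simp]: "aff_comp A aff_id = A" "aff_comp aff_id A = A"
  by (rule aff_eqI, simp)+

lemma bounded_linear_aff_app: "bounded_linear (\<lambda>A. aff_app A y)"
  unfolding aff_app_def
  by (intro bounded_linear_add bounded_linear_compose[OF blinfun.bounded_linear_left bounded_linear_fst] bounded_linear_snd)

text \<open>The adjoint action of \<open>k\<close> on infinitesimal affine maps, where \<open>k'\<close>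
  is the inverse of \<open>k\<close>.\<close>

definition aff_conj :: "'a::real_normed_vector aff \<Rightarrow> 'a aff \<Rightarrow> 'a aff \<Rightarrow> 'a aff" where
  "aff_conj k k' A = (fst k o\<^sub>L (fst A o\<^sub>L fst k'), lin k (aff_app A (snd k')))"

lemma aff_app_conj: "aff_app (aff_conj k k' A) y = lin k (aff_app A (aff_app k' y))"
  by (simp add: aff_conj_def aff_app_def blinfun.add_right add.assoc)

lemma fst_aff_conj [simp]: "fst (aff_conj k k' A) = fst k o\<^sub>L (fst A o\<^sub>L fst k')"
  by (simp add: aff_conj_def)

lemma aff_app_bracket: "aff_app (aff_bracket A B) y = lin A (aff_app B y) - lin B (aff_app A y)"
  by (simp add: aff_app_def aff_bracket_def blinfun.bilinear_simps)

lemma aff_conj_linear: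
  "aff_conj k k' (A + B) = aff_conj k k' A + aff_conj k k' B"
  "aff_conj k k' (A - B) = aff_conj k k' A - aff_conj k k' B"
  "aff_conj k k' (r *\<^sub>R A) = r *\<^sub>R aff_conj k k' A"
  "aff_conj k k' (- A) = - aff_conj k k' A"
  by (rule aff_eqI, simp add: aff_app_conj blinfun.bilinear_simps)+

lemma aff_conj_conj:
  "aff_conj k k' (aff_conj l l' A) = aff_conj (aff_comp k l) (aff_comp l' k') A"
  by (rule aff_eqI) (simp add: aff_app_conj)

lemma aff_conj_id [simp]: "aff_conj aff_id aff_id A = A"
  by (rule aff_eqI) (simp add: aff_app_conj)

lemma aff_conj_bracket:
  assumes "aff_comp k' k = aff_id"
  shows "aff_conj k k' (aff_bracket A B) = aff_bracket (aff_conj k k' A) (aff_conj k k' B)"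
proof (rule aff_eqI)
  have "blinfun_apply (fst k' o\<^sub>L fst k) v = v" for v
    using arg_cong[OF assms, of fst] by simp
  then show "aff_app (aff_conj k k' (aff_bracket A B)) y = aff_app (aff_bracket (aff_conj k k' A) (aff_conj k k' B)) y" for y
    by (simp add: aff_app_conj aff_app_bracket blinfun.bilinear_simps)
qed

text \<open>An affine map acts on the points \<open>(x, 1)\<close>. An infinitesimal one becomes a matrix
  with last row \<open>(0, 0)\<close>, and an affine transformation one with last row \<open>(0,
  1)\<close> (\<open>grp_mat\<close>). In both cases the affine map is recovered by
  \<open>un_mat\<close>.\<close>

definition lie_mat :: "'a::euclidean_space aff \<Rightarrow> ('a \<times> real) endo" where
  "lie_mat A = Endo (Blinfun (\<lambda>p. (lin A (fst p) + snd p *\<^sub>R snd A, 0)))"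

definition unit_mat :: "('a::euclidean_space \<times> real) endo" where
  "unit_mat = Endo (Blinfun (\<lambda>p. (0, snd p)))"

definition grp_mat :: "'a::euclidean_space aff \<Rightarrow> ('a \<times> real) endo" where
  "grp_mat A = lie_mat A + unit_mat"

definition un_mat :: "('a::euclidean_space \<times> real) endo \<Rightarrow> 'a aff" where
  "un_mat X = (fst_blinfun o\<^sub>L (endo_map X o\<^sub>L Blinfun (\<lambda>z. (z, 0))), fst (emap X (0, 1)))"

lemma emap_lie_mat [simp]: "emap (lie_mat A) p = (lin A (fst p) + snd p *\<^sub>R snd A, 0)"
  unfolding lie_mat_def
  by (subst emap_Endo) (intro bounded_linear_Pair bounded_linear_add bounded_linear_zero
      bounded_linear_compose[OF blinfun.bounded_linear_right bounded_linear_fst]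
      bounded_linear_compose[OF bounded_linear_scaleR_left bounded_linear_snd], rule refl)

lemma emap_unit_mat [simp]: "emap unit_mat p = (0, snd p)"
  unfolding unit_mat_def
  by (subst emap_Endo) (intro bounded_linear_Pair bounded_linear_zero bounded_linear_snd, rule refl)

lemma emap_grp_mat [simp]: "emap (grp_mat A) p = (lin A (fst p) + snd p *\<^sub>R snd A, snd p)"
  by (simp add: grp_mat_def)

lemma un_mat_apply: "lin (un_mat X) z = fst (emap X (z, 0))" "snd (un_mat X) = fst (emap X (0, 1))"
proof -
  have "bounded_linear (\<lambda>z::'a. (z, 0::real))" by (intro bounded_linear_Pair bounded_linear_ident bounded_linear_zero)
  then show "lin (un_mat X) z = fst (emap X (z, 0))"
    by (simp add: un_mat_def emap_def bounded_linear_Blinfun_apply)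
qed (simp add: un_mat_def)

lemma un_mat_lie_mat [simp]: "un_mat (lie_mat A) = A"
  by (simp add: prod_eq_iff un_mat_apply blinfun_eqI)

lemma un_mat_grp_mat [simp]: "un_mat (grp_mat A) = A"
  by (simp add: prod_eq_iff un_mat_apply blinfun_eqI)

lemma bounded_linear_lie_mat: "bounded_linear lie_mat"
proof (rule bounded_linear_intro[where K=2])
  fix A B :: "'a aff" and r :: real
  show "lie_mat (A + B) = lie_mat A + lie_mat B" "lie_mat (r *\<^sub>R A) = r *\<^sub>R lie_mat A"
    by (rule endo_eqI, simp add: blinfun.bilinear_simps algebra_simps)+
  show "norm (lie_mat A) \<le> norm A * 2"
  proof (rule norm_endo_le)
    fix p :: "'a \<times> real"
    have "norm (emap (lie_mat A) p) \<le> norm (lin A (fst p)) + norm (snd p *\<^sub>R snd A)"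
      using norm_triangle_ineq[of "lin A (fst p)" "snd p *\<^sub>R snd A"] by simp
    also have "\<dots> \<le> norm A * norm p + norm p * norm A"
    proof (rule add_mono)
      have "norm (lin A (fst p)) \<le> norm (fst A) * norm (fst p)" by (rule norm_blinfun)
      also have "\<dots> \<le> norm A * norm p" using norm_fst_le[of "fst A" "snd A"] norm_fst_le[of "fst p" "snd p"] by (intro mult_mono) auto
      finally show "norm (lin A (fst p)) \<le> norm A * norm p" .
      have "norm (snd p *\<^sub>R snd A) = norm (snd p) * norm (snd A)" by simp
      also have "\<dots> \<le> norm p * norm A" using norm_snd_le[of "snd A" "fst A"] norm_snd_le[of "snd p" "fst p"] by (intro mult_mono) auto
      finally show "norm (snd p *\<^sub>R snd A) \<le> norm p * norm A" .
    qed
    finally show "norm (emap (lie_mat A) p) \<le> norm A * 2 * norm p" by (simp add: mult_ac)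
  qed simp
qed

lemma bounded_linear_un_mat: "bounded_linear un_mat"
  unfolding un_mat_def
  by (intro bounded_linear_Pair
      bounded_linear_compose[OF bounded_bilinear.bounded_linear_right[OF bounded_bilinear_blinfun_compose]]
      bounded_linear_compose[OF bounded_bilinear.bounded_linear_left[OF bounded_bilinear_blinfun_compose] bounded_linear_endo_map]
      bounded_linear_compose[OF bounded_linear_fst bounded_bilinear.bounded_linear_left[OF bounded_bilinear_emap]])

lemma lie_mat_un_mat:
  assumes "\<And>p. snd (emap X p) = 0"
  shows "lie_mat (un_mat X) = X"
proof (rule endo_eqI)
  fix p
  have "emap X p = emap X ((fst p, 0) + snd p *\<^sub>R (0, 1))" by simp
  also have "\<dots> = emap X (fst p, 0) + snd p *\<^sub>R emap X (0, 1)"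
    by (simp only: linear_add[OF bounded_linear.linear[OF bounded_linear_emap]]
         linear_scale[OF bounded_linear.linear[OF bounded_linear_emap]])
  finally show "emap (lie_mat (un_mat X)) p = emap X p"
    using assms[of p] by (simp add: prod_eq_iff un_mat_apply)
qed

lemma grp_mat_un_mat:
  assumes "\<And>p. snd (emap X p) = snd p"
  shows "grp_mat (un_mat X) = X"
proof -
  have "un_mat X = un_mat (X - unit_mat)"
    by (simp add: prod_eq_iff un_mat_apply blinfun_eqI)
  moreover have "lie_mat (un_mat (X - unit_mat)) = X - unit_mat"
    by (rule lie_mat_un_mat) (simp add: assms)
  ultimately show ?thesis by (simp add: grp_mat_def)
qed

lemma grp_mat_comp: "grp_mat (aff_comp A B) = grp_mat A * grp_mat B"
  by (rule endo_eqI) (simp add: aff_comp_def blinfun.bilinear_simps algebra_simps)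

lemma grp_mat_id [simp]: "grp_mat aff_id = 1"
  by (rule endo_eqI) (simp add: aff_id_def)

lemma grp_mat_inject: "grp_mat A = grp_mat B \<Longrightarrow> A = B"
  by (metis un_mat_grp_mat)

lemma lie_mat_bracket: "lie_mat (aff_bracket A B) = lie_mat A * lie_mat B - lie_mat B * lie_mat A"
  by (rule endo_eqI) (simp add: aff_bracket_def blinfun.bilinear_simps algebra_simps)

lemma lie_mat_conj: "lie_mat (aff_conj k k' A) = grp_mat k * lie_mat A * grp_mat k'"
  by (rule endo_eqI) (simp add: aff_conj_def aff_app_def blinfun.bilinear_simps algebra_simps)

lemma lie_mat_inject: "lie_mat A = lie_mat B \<Longrightarrow> A = B"
  by (metis un_mat_lie_mat)

text \<open>Affine maps form a finite-dimensional space: \<open>lie_mat\<close> embeds it into the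
  Euclidean space of coordinates.\<close>

lemma aff_subspace_basis:
  fixes k :: "'a::euclidean_space aff set"
  assumes "subspace k"
  obtains Bs where "finite Bs" "independent Bs" "Bs \<subseteq> k" "span Bs = k"
proof -
  obtain Bs where Bs: "Bs \<subseteq> k" "independent Bs" "k \<subseteq> span Bs" using maximal_independent_subset by metis
  have lin: "linear (\<lambda>A::'a aff. endo_coords (lie_mat A))"
    using bounded_linear_compose[OF endo.bl_J bounded_linear_lie_mat] by (rule bounded_linear.linear)
  have inj: "inj (\<lambda>A::'a aff. endo_coords (lie_mat A))"
    by (rule injI) (metis endo.J_inject lie_mat_inject)
  then have "independent ((\<lambda>A. endo_coords (lie_mat A)) ` Bs)"
    by (intro linear_independent_injective_image[OF lin Bs(2)]) (auto intro: inj_on_subset)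
  then have "finite ((\<lambda>A. endo_coords (lie_mat A)) ` Bs)" by (rule independent_imp_finite)
  then have "finite Bs" by (rule finite_imageD) (use inj in \<open>auto intro: inj_on_subset\<close>)
  moreover have "span Bs = k" using Bs assms by (metis span_minimal subset_antisym)
  ultimately show ?thesis using that Bs by blast
qed

section \<open>The exponential of an infinitesimal affine map\<close>

definition aexp :: "'a::euclidean_space aff \<Rightarrow> 'a aff" where "aexp A = un_mat (exp (lie_mat A))"

lemmas linear_lie_mat = bounded_linear.linear[OF bounded_linear_lie_mat]
lemmas lie_mat_scaleR = linear_scale[OF linear_lie_mat]
  and lie_mat_add = linear_add[OF linear_lie_mat]
  and lie_mat_diff = linear_diff[OF linear_lie_mat]
  and lie_mat_minus = linear_neg[OF linear_lie_mat]
  and lie_mat_zero [simp] = linear_0[OF linear_lie_mat]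

lemma emap_exp_has_vector_derivative:
  "((\<lambda>t. emap (exp (t *\<^sub>R X)) p) has_vector_derivative emap (X * exp (t *\<^sub>R X)) p) (at t)"
  using bounded_linear.has_vector_derivative[OF bounded_bilinear.bounded_linear_left[OF bounded_bilinear_emap]
      exp_scaleR_has_vector_derivative_left[of X t]] .

text \<open>The last coordinate of a solution of \<open>p' = lie_mat A p\<close> is constant, because the
  last row vanishes.\<close>

lemma snd_emap_exp_lie_mat: "snd (emap (exp (lie_mat A)) p) = snd p"
proof -
  have "((\<lambda>t. snd (emap (exp (t *\<^sub>R lie_mat A)) p)) has_vector_derivative snd (emap (lie_mat A * exp (t *\<^sub>R lie_mat A)) p)) (at t)" for t
    by (rule bounded_linear.has_vector_derivative[OF bounded_linear_snd emap_exp_has_vector_derivative])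
  moreover have "snd (emap (lie_mat A * exp (t *\<^sub>R lie_mat A)) p) = 0" for t by simp
  ultimately have "((\<lambda>t. snd (emap (exp (t *\<^sub>R lie_mat A)) p)) has_vector_derivative 0) (at t within UNIV)" for t
    by metis
  then have "\<exists>c. \<forall>t\<in>UNIV. snd (emap (exp (t *\<^sub>R lie_mat A)) p) = c"
    by (rule has_vector_derivative_zero_constant[OF convex_UNIV]) blast
  then obtain c where "\<And>t. snd (emap (exp (t *\<^sub>R lie_mat A)) p) = c" by auto
  from this[of 1] this[of 0] show ?thesis by simp
qed

lemma grp_mat_aexp: "grp_mat (aexp A) = exp (lie_mat A)"
  unfolding aexp_def by (rule grp_mat_un_mat) (rule snd_emap_exp_lie_mat)

lemma aexp_zero [simp]: "aexp 0 = aff_id"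
  by (rule grp_mat_inject) (simp add: grp_mat_aexp)

lemma aexp_add: "aff_comp (aexp (s *\<^sub>R A)) (aexp (t *\<^sub>R A)) = aexp ((s + t) *\<^sub>R A)"
proof (rule grp_mat_inject)
  have "exp (s *\<^sub>R lie_mat A + t *\<^sub>R lie_mat A) = exp (s *\<^sub>R lie_mat A) * exp (t *\<^sub>R lie_mat A)"
    by (rule exp_add_commuting) simp
  then show "grp_mat (aff_comp (aexp (s *\<^sub>R A)) (aexp (t *\<^sub>R A))) = grp_mat (aexp ((s + t) *\<^sub>R A))"
    by (simp add: grp_mat_comp grp_mat_aexp lie_mat_scaleR lie_mat_add scaleR_add_left)
qed

lemma aexp_minus [simp]: "aff_comp (aexp A) (aexp (- A)) = aff_id" "aff_comp (aexp (- A)) (aexp A) = aff_id"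
  using aexp_add[of 1 A "-1"] aexp_add[of "-1" A 1] by simp_all

text \<open>Conjugation passes through the exponential series.\<close>

lemma aexp_conj:
  assumes "aff_comp k k' = aff_id" "aff_comp k' k = aff_id"
  shows "aexp (aff_conj k k' A) = aff_comp k (aff_comp (aexp A) k')"
proof (rule grp_mat_inject)
  let ?g = "grp_mat k" and ?g' = "grp_mat k'"
  have gg: "?g * ?g' = 1" "?g' * ?g = 1" using assms by (simp_all add: grp_mat_comp[symmetric])
  have pow: "(?g * X * ?g') ^ n = ?g * X ^ n * ?g'" for X n
  proof (induction n)
    case (Suc n)
    have "?g' * (?g * Y) = Y" for Y using gg(2) by (simp add: mult.assoc[symmetric])
    moreover have "(?g * X * ?g') ^ Suc n = (?g * X * ?g') * (?g * X ^ n * ?g')" by (simp only: power_Suc Suc)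
    ultimately show ?case by (simp add: mult.assoc)
  qed (simp add: gg)
  have bl: "bounded_linear (\<lambda>x. ?g * x * ?g')"
    by (intro bounded_linear_const_mult bounded_linear_mult_const bounded_linear_ident)
  have "(\<lambda>n. ?g * (lie_mat A ^ n /\<^sub>R fact n) * ?g') sums (?g * exp (lie_mat A) * ?g')"
    by (rule bounded_linear.sums[OF bl exp_converges])
  then have "(\<lambda>n. (?g * lie_mat A * ?g') ^ n /\<^sub>R fact n) sums (?g * exp (lie_mat A) * ?g')"
    by (simp add: pow)
  then have "exp (?g * lie_mat A * ?g') = ?g * exp (lie_mat A) * ?g'"
    using exp_converges sums_unique2 by blast
  then show "grp_mat (aexp (aff_conj k k' A)) = grp_mat (aff_comp k (aff_comp (aexp A) k'))"
    by (simp add: grp_mat_aexp lie_mat_conj grp_mat_comp mult.assoc)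
qed

lemma aff_app_eq_emap: "aff_app A y = fst (emap (grp_mat A) (y, 1))"
  by (simp add: aff_app_def)

lemma aexp_app_has_vector_derivative:
  "((\<lambda>t. aff_app (aexp (t *\<^sub>R A)) y) has_vector_derivative aff_app A (aff_app (aexp (t *\<^sub>R A)) y)) (at t)"
proof -
  have "((\<lambda>t. fst (emap (exp (t *\<^sub>R lie_mat A)) (y, 1))) has_vector_derivative fst (emap (lie_mat A * exp (t *\<^sub>R lie_mat A)) (y, 1))) (at t)"
    by (rule bounded_linear.has_vector_derivative[OF bounded_linear_fst emap_exp_has_vector_derivative])
  then show ?thesis
    by (simp add: grp_mat_aexp[symmetric] lie_mat_scaleR[symmetric] aff_app_def)
qed

lemma aexp_linear_has_vector_derivative:
  "((\<lambda>t. lin (aexp (t *\<^sub>R A)) v) has_vector_derivative lin A (lin (aexp (t *\<^sub>R A)) v)) (at t)"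
proof -
  have "((\<lambda>t. fst (emap (exp (t *\<^sub>R lie_mat A)) (v, 0))) has_vector_derivative fst (emap (lie_mat A * exp (t *\<^sub>R lie_mat A)) (v, 0))) (at t)"
    by (rule bounded_linear.has_vector_derivative[OF bounded_linear_fst emap_exp_has_vector_derivative])
  then show ?thesis
    by (simp add: grp_mat_aexp[symmetric] lie_mat_scaleR[symmetric])
qed

lemma continuous_on_aexp_app: "continuous_on S (\<lambda>A. aff_app (aexp A) y)"
  unfolding aff_app_eq_emap grp_mat_aexp
  by (rule continuous_on_fst[OF bounded_linear.continuous_on[OF bounded_bilinear.bounded_linear_left[OF bounded_bilinear_emap]
      continuous_on_exp_algebra[OF linear_continuous_on[OF bounded_linear_lie_mat]]]])

lemma aexp_app_has_derivative: "((\<lambda>A. aff_app (aexp A) y) has_derivative (\<lambda>B. aff_app B y)) (at 0)"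
proof -
  have "((\<lambda>A. exp (lie_mat A)) has_derivative (\<lambda>B. dexp (lie_mat 0) (lie_mat B))) (at 0)"
    by (rule has_derivative_compose[OF bounded_linear_imp_has_derivative[OF bounded_linear_lie_mat] exp_has_derivative])
  then have "((\<lambda>A. fst (emap (exp (lie_mat A)) (y, 1))) has_derivative (\<lambda>B. fst (emap (dexp (lie_mat 0) (lie_mat B)) (y, 1)))) (at 0)"
    by (rule has_derivative_fst[OF bounded_linear.has_derivative[OF bounded_bilinear.bounded_linear_left[OF bounded_bilinear_emap]]])
  then show ?thesis by (simp add: grp_mat_aexp[symmetric]) (simp add: aff_app_def)
qed

section \<open>Groups of affine maps\<close>

text \<open>The counterpart of \<open>matrix_group\<close> for affine maps; homogeneous coordinates carry
  one to the other.\<close>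

locale affine_group =
  fixes G :: "'a::euclidean_space aff set"
  assumes id: "aff_id \<in> G" and comp: "\<And>A B. A \<in> G \<Longrightarrow> B \<in> G \<Longrightarrow> aff_comp A B \<in> G"
    and inverses: "\<And>A. A \<in> G \<Longrightarrow> \<exists>B\<in>G. aff_comp A B = aff_id \<and> aff_comp B A = aff_id"
begin

lemma matrix_group: "matrix_group endo_coords endo_of_coords (grp_mat ` G)"
proof (intro matrix_group.intro matrix_group_axioms.intro endo.fin_dim_algebra_axioms)
  show "1 \<in> grp_mat ` G" using id grp_mat_id by (metis imageI)
  show "x * y \<in> grp_mat ` G" if "x \<in> grp_mat ` G" "y \<in> grp_mat ` G" for x y
    using that comp grp_mat_comp by (metis (no_types, lifting) imageE imageI)
  show "\<exists>y\<in>grp_mat ` G. x * y = 1 \<and> y * x = 1" if x: "x \<in> grp_mat ` G" for x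
  proof -
    obtain A where A: "A \<in> G" "x = grp_mat A" using x by blast
    then obtain B where "B \<in> G" "aff_comp A B = aff_id" "aff_comp B A = aff_id" using inverses by blast
    then show ?thesis using A(2) by (intro bexI[of _ "grp_mat B"]) (auto simp: grp_mat_comp[symmetric])
  qed
qed

lemma velocities_iff: "A \<in> velocities G aff_id \<longleftrightarrow> lie_mat A \<in> velocities (grp_mat ` G) 1"
proof
  assume "A \<in> velocities G aff_id"
  from velocities_affine_image[OF bounded_linear_lie_mat _ this, of unit_mat "grp_mat ` G"]
  show "lie_mat A \<in> velocities (grp_mat ` G) 1" by (simp add: grp_mat_def[symmetric])
next
  assume A: "lie_mat A \<in> velocities (grp_mat ` G) 1"
  have "un_mat x + 0 \<in> G" if "x \<in> grp_mat ` G" for x using that by auto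
  from velocities_affine_image[OF bounded_linear_un_mat this A]
  have "A \<in> velocities G (un_mat 1)" by simp
  moreover have "un_mat 1 = (aff_id :: 'a aff)" by (metis grp_mat_id un_mat_grp_mat)
  ultimately show "A \<in> velocities G aff_id" by simp
qed

lemma subspace_velocities: "subspace (velocities G aff_id)"
proof -
  note L = matrix_group.subspace_velocities[OF matrix_group]
  show ?thesis
    unfolding subspace_def
    by (intro conjI ballI allI)
       (simp_all add: velocities_iff lie_mat_add lie_mat_scaleR subspace_0[OF L] subspace_add[OF L] subspace_scale[OF L])
qed

lemma velocities_bracket:
  "A \<in> velocities G aff_id \<Longrightarrow> B \<in> velocities G aff_id \<Longrightarrow> aff_bracket A B \<in> velocities G aff_id"
  unfolding velocities_iff lie_mat_bracket by (rule matrix_group.velocities_bracket[OF matrix_group])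

lemma velocities_conj:
  assumes "\<And>A. A \<in> G \<Longrightarrow> aff_comp k (aff_comp A k') \<in> G" "aff_comp k k' = aff_id" "A \<in> velocities G aff_id"
  shows "aff_conj k k' A \<in> velocities G aff_id"
  unfolding velocities_iff lie_mat_conj
proof (rule matrix_group.velocities_conj[OF matrix_group])
  show "grp_mat k * grp_mat k' = 1" using assms(2) by (simp add: grp_mat_comp[symmetric])
  show "lie_mat A \<in> velocities (grp_mat ` G) 1" using assms(3) by (simp add: velocities_iff)
  fix x assume "x \<in> grp_mat ` G"
  then obtain B where B: "B \<in> G" "x = grp_mat B" by blast
  then have "grp_mat k * x * grp_mat k' = grp_mat (aff_comp k (aff_comp B k'))" by (simp add: grp_mat_comp mult.assoc)
  then show "grp_mat k * x * grp_mat k' \<in> grp_mat ` G" using assms(1)[OF B(1)] by simp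
qed

end

inductive_set aexp_group :: "'a::euclidean_space aff set \<Rightarrow> 'a aff set" for m where
  aexp_group_id: "aff_id \<in> aexp_group m"
| aexp_group_mult: "X \<in> m \<Longrightarrow> A \<in> aexp_group m \<Longrightarrow> aff_comp (aexp X) A \<in> aexp_group m"

lemma aexp_group_generator: "X \<in> m \<Longrightarrow> aexp X \<in> aexp_group m"
  using aexp_group_mult[OF _ aexp_group_id, of X m] by simp

lemma aexp_group_comp: "A \<in> aexp_group m \<Longrightarrow> B \<in> aexp_group m \<Longrightarrow> aff_comp A B \<in> aexp_group m"
  by (induction rule: aexp_group.induct) (auto simp: aff_comp_assoc intro: aexp_group_mult)

lemma aexp_group_inverse:
  assumes "A \<in> aexp_group m" "\<And>X. X \<in> m \<Longrightarrow> - X \<in> m"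
  shows "\<exists>B\<in>aexp_group m. aff_comp A B = aff_id \<and> aff_comp B A = aff_id"
  using assms(1)
proof induction
  case aexp_group_id
  then show ?case by (intro bexI[of _ aff_id]) (auto intro: aexp_group.aexp_group_id)
next
  case (aexp_group_mult X A)
  then obtain B where B: "B \<in> aexp_group m" "aff_comp A B = aff_id" "aff_comp B A = aff_id" by blast
  have "aff_comp (aff_comp (aexp X) A) (aff_comp B (aexp (- X))) = aff_comp (aexp X) (aff_comp (aff_comp A B) (aexp (- X)))"
    "aff_comp (aff_comp B (aexp (- X))) (aff_comp (aexp X) A) = aff_comp B (aff_comp (aff_comp (aexp (- X)) (aexp X)) A)"
    by (simp_all only: aff_comp_assoc)
  then show ?case
    using B aexp_group_comp[OF B(1) aexp_group_generator[OF assms(2)[OF aexp_group_mult(1)]]]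
    by (intro bexI[of _ "aff_comp B (aexp (- X))"]) auto
qed

lemma
  fixes h :: "'a::euclidean_space aff set"
  assumes h: "subspace h" and bracket: "\<And>A B. A \<in> h \<Longrightarrow> B \<in> h \<Longrightarrow> aff_bracket A B \<in> h"
  shows subspace_lie_mat: "subspace (lie_mat ` h)"
    and lie_mat_image_bracket: "\<And>X Y. X \<in> lie_mat ` h \<Longrightarrow> Y \<in> lie_mat ` h \<Longrightarrow> X * Y - Y * X \<in> lie_mat ` h"
proof -
  show "subspace (lie_mat ` h)"
    by (rule linear_subspace_image[OF bounded_linear.linear[OF bounded_linear_lie_mat] h])
  show "X * Y - Y * X \<in> lie_mat ` h" if "X \<in> lie_mat ` h" "Y \<in> lie_mat ` h" for X Y
    using that bracket lie_mat_bracket by (metis (no_types, lifting) imageE imageI)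
qed

text \<open>This is \<open>velocities_exp_group\<close> in homogeneous coordinates.\<close>

theorem velocities_aexp_group:
  fixes h :: "'a::euclidean_space aff set"
  assumes h: "subspace h" and bracket: "\<And>A B. A \<in> h \<Longrightarrow> B \<in> h \<Longrightarrow> aff_bracket A B \<in> h" and m: "m \<subseteq> h"
    and A: "A \<in> velocities (aexp_group m) aff_id"
  shows "A \<in> h"
proof -
  have "grp_mat B \<in> exp_group (lie_mat ` h)" if "B \<in> aexp_group m" for B
    using that
  proof induction
    case (aexp_group_mult X B)
    then show ?case using m by (auto simp: grp_mat_comp grp_mat_aexp intro!: exp_group_mult)
  qed (simp add: exp_group_one)
  then have "lie_mat A \<in> velocities (exp_group (lie_mat ` h)) (lie_mat aff_id + unit_mat)"
    by (intro velocities_affine_image[OF bounded_linear_lie_mat _ A]) (simp add: grp_mat_def)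
  then have "lie_mat A \<in> velocities (exp_group (lie_mat ` h)) 1" by (simp add: grp_mat_def[symmetric])
  then have "lie_mat A \<in> lie_mat ` h"
    using endo.velocities_exp_group[OF subspace_lie_mat[OF h bracket] lie_mat_image_bracket[OF h bracket]] by blast
  then show ?thesis using lie_mat_inject by blast
qed

text \<open>This is \<open>exp_factorization\<close> in homogeneous coordinates, for a splitting of
  \<open>h\<close> by a linear map \<open>p\<close>. It only concerns elements near \<open>0\<close>,
  whence the division by \<open>n\<close>.\<close>

theorem aexp_factorization:
  fixes h :: "'a::euclidean_space aff set"
  assumes h: "subspace h" and bracket: "\<And>A B. A \<in> h \<Longrightarrow> B \<in> h \<Longrightarrow> aff_bracket A B \<in> h"
    and p: "bounded_linear p" "\<And>A. A \<in> h \<Longrightarrow> p A \<in> h" and A: "A \<in> h"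
  obtains n :: nat and Z where "0 < n" "Z \<in> h" "aexp ((1 / real n) *\<^sub>R A) = aff_comp (aexp (p Z)) (aexp (Z - p Z))"
proof -
  note h' = subspace_lie_mat[OF h bracket] lie_mat_image_bracket[OF h bracket]
  obtain P where P: "bounded_linear P" "\<And>x. P x \<in> lie_mat ` h" "\<And>x. x \<in> lie_mat ` h \<Longrightarrow> P x = x"
    using endo.projection_exists[OF h'(1)] by blast
  let ?P1 = "\<lambda>X. lie_mat (p (un_mat X))"
  interpret frobenius_chart endo_coords endo_of_coords "lie_mat ` h" P ?P1
  proof (rule frobenius_chart.intro[OF endo.fin_dim_algebra_axioms frobenius_chart_axioms.intro])
    show "bounded_linear ?P1"
      by (rule bounded_linear_compose[OF bounded_linear_lie_mat bounded_linear_compose[OF p(1) bounded_linear_un_mat]])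
    show "?P1 x \<in> lie_mat ` h" if "x \<in> lie_mat ` h" for x using that p(2) by auto
  qed (use h' P in auto)
  obtain \<epsilon> where \<epsilon>: "0 < \<epsilon>" "\<And>X. X \<in> lie_mat ` h \<Longrightarrow> norm X < \<epsilon> \<Longrightarrow> \<exists>Z\<in>lie_mat ` h. exp X = exp (?P1 Z) * exp (Z - ?P1 Z)"
    using exp_factorization by blast
  obtain n :: nat where n: "norm (lie_mat A) / \<epsilon> < real n" using reals_Archimedean2 by blast
  have n0: "0 < n"
    using n \<epsilon>(1) by (metis divide_nonneg_pos gr0I norm_ge_zero not_less of_nat_0)
  have "norm (lie_mat ((1 / real n) *\<^sub>R A)) < \<epsilon>"
    using n n0 \<epsilon>(1) by (simp add: lie_mat_scaleR field_simps)
  moreover have "lie_mat ((1 / real n) *\<^sub>R A) \<in> lie_mat ` h" using A assms(1) by (intro imageI subspace_scale)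
  ultimately obtain Z where Z: "Z \<in> h" "exp (lie_mat ((1 / real n) *\<^sub>R A)) = exp (lie_mat (p Z)) * exp (lie_mat Z - lie_mat (p Z))"
    using \<epsilon>(2) by fastforce
  then have "grp_mat (aexp ((1 / real n) *\<^sub>R A)) = grp_mat (aff_comp (aexp (p Z)) (aexp (Z - p Z)))"
    by (simp add: grp_mat_aexp grp_mat_comp lie_mat_diff)
  then show ?thesis using that[OF n0 Z(1)] grp_mat_inject by blast
qed

section \<open>Slice charts\<close>

lemma C1_sum:
  assumes "finite I" "\<And>i. i \<in> I \<Longrightarrow> (\<lambda>t. f i t) C1_differentiable_on S"
  shows "(\<lambda>t. \<Sum>i\<in>I. f i t) C1_differentiable_on S"
  using assms by (induction I) (simp_all add: C1_differentiable_on_add)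

lemma C1_Pair:
  assumes "f C1_differentiable_on S" "g C1_differentiable_on S"
  shows "(\<lambda>t. (f t, g t)) C1_differentiable_on S"
proof -
  have "bounded_linear (\<lambda>x. (x, 0))" "bounded_linear (\<lambda>y. (0, y))"
    by (intro bounded_linear_Pair bounded_linear_ident bounded_linear_zero)+
  then have "(\<lambda>t. (f t, 0) + (0, g t)) C1_differentiable_on S"
    by (intro C1_differentiable_on_add C1_bounded_linear[OF _ assms(1)] C1_bounded_linear[OF _ assms(2)])
  then show ?thesis by simp
qed

text \<open>The rank one map \<open>y \<mapsto> (y \<bullet> i) w\<close>. Sums of these reduce
  statements about maps in the operator norm to statements about their values on a basis.\<close>

definition blinfun_component :: "'a::euclidean_space \<Rightarrow> 'b::real_normed_vector \<Rightarrow> 'a \<Rightarrow>\<^sub>L 'b" where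
  "blinfun_component i w = blinfun_scaleR_left w o\<^sub>L blinfun_inner_left i"

lemma blinfun_component_apply [simp]: "blinfun_apply (blinfun_component i w) y = (y \<bullet> i) *\<^sub>R w"
  by (simp add: blinfun_component_def blinfun_inner_left.rep_eq)

lemma bounded_linear_blinfun_component: "bounded_linear (blinfun_component i)"
  unfolding blinfun_component_def
  by (rule bounded_linear_compose[OF bounded_bilinear.bounded_linear_left[OF bounded_bilinear_blinfun_compose] bounded_linear_blinfun_scaleR_left])

lemma blinfun_eq_sum_component: "F = (\<Sum>i\<in>Basis. blinfun_component i (blinfun_apply F i))"
proof (rule blinfun_eqI)
  fix y
  have "blinfun_apply F y = blinfun_apply F (\<Sum>i\<in>Basis. (y \<bullet> i) *\<^sub>R i)" by (simp only: euclidean_representation)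
  also have "\<dots> = blinfun_apply (\<Sum>i\<in>Basis. blinfun_component i (blinfun_apply F i)) y"
    by (simp only: blinfun.bilinear_simps blinfun_component_apply)
  finally show "blinfun_apply F y = blinfun_apply (\<Sum>i\<in>Basis. blinfun_component i (blinfun_apply F i)) y" .
qed

lemma C1_blinfunI:
  fixes F :: "real \<Rightarrow> 'a::euclidean_space \<Rightarrow>\<^sub>L 'b::real_normed_vector"
  assumes "\<And>i. i \<in> Basis \<Longrightarrow> (\<lambda>t. blinfun_apply (F t) i) C1_differentiable_on S"
  shows "F C1_differentiable_on S"
proof -
  have "(\<lambda>t. \<Sum>i\<in>Basis. blinfun_component i (blinfun_apply (F t) i)) C1_differentiable_on S"
    by (rule C1_sum[OF finite_Basis]) (rule C1_bounded_linear[OF bounded_linear_blinfun_component assms])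
  then show ?thesis by (simp only: blinfun_eq_sum_component[symmetric])
qed

definition C1_derivative :: "'a::real_normed_vector set \<Rightarrow> ('a \<Rightarrow> 'b::real_normed_vector) \<Rightarrow> ('a \<Rightarrow> 'a \<Rightarrow>\<^sub>L 'b) \<Rightarrow> bool" where
  "C1_derivative S f f' \<longleftrightarrow> (\<forall>x\<in>S. (f has_derivative blinfun_apply (f' x)) (at x)) \<and> continuous_on S f'"

text \<open>The directional derivatives along a basis determine the derivative and its
  continuity.\<close>

lemma Ck_on_1_C1:
  fixes f :: "'a::euclidean_space \<Rightarrow> 'b::real_normed_vector"
  assumes "Ck_on (Suc 0) f S"
  shows "C1_derivative S f (\<lambda>x. \<Sum>i\<in>Basis. blinfun_component i (frechet_derivative f (at x) i))"
proof -
  have d: "\<forall>x\<in>S. f differentiable (at x)" and c: "\<And>v. continuous_on S (\<lambda>x. frechet_derivative f (at x) v)"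
    using assms by simp_all
  have "(f has_derivative blinfun_apply (\<Sum>i\<in>Basis. blinfun_component i (frechet_derivative f (at x) i))) (at x)" if "x \<in> S" for x
  proof -
    have D: "(f has_derivative frechet_derivative f (at x)) (at x)" using d that frechet_derivative_works by blast
    then have bl: "bounded_linear (frechet_derivative f (at x))" by (rule has_derivative_bounded_linear)
    have "blinfun_apply (\<Sum>i\<in>Basis. blinfun_component i (frechet_derivative f (at x) i)) = frechet_derivative f (at x)"
      using arg_cong[OF blinfun_eq_sum_component[of "Blinfun (frechet_derivative f (at x))"], of blinfun_apply]
      unfolding bounded_linear_Blinfun_apply[OF bl] by (rule sym)
    with D show ?thesis by simp
  qed
  moreover have "continuous_on S (\<lambda>x. \<Sum>i\<in>Basis. blinfun_component i (frechet_derivative f (at x) i))"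
    by (rule continuous_on_sum) (rule bounded_linear.continuous_on[OF bounded_linear_blinfun_component c])
  ultimately show ?thesis by (simp add: C1_derivative_def)
qed

lemma smooth_on_C2:
  fixes f :: "'a::euclidean_space \<Rightarrow> 'b::real_normed_vector"
  assumes "smooth_on S f"
  obtains f' f'' where "C1_derivative S f f'" "C1_derivative S f' f''"
proof -
  let ?f' = "\<lambda>x. \<Sum>i\<in>Basis. blinfun_component i (frechet_derivative f (at x) i)"
  have 1: "C1_derivative S f ?f'" by (rule Ck_on_1_C1) (use assms in \<open>simp only: smooth_on_def\<close>)
  have "Ck_on (Suc (Suc 0)) f S" using assms by (simp only: smooth_on_def)
  then have Ck: "Ck_on (Suc 0) (\<lambda>x. frechet_derivative f (at x) v) S" for v by simp
  have "\<exists>D. \<forall>v. C1_derivative S (\<lambda>x. frechet_derivative f (at x) v) (D v)"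
    by (intro exI allI) (rule Ck_on_1_C1[OF Ck])
  then obtain D where D: "\<And>v. C1_derivative S (\<lambda>x. frechet_derivative f (at x) v) (D v)" by blast
  define f'' where "f'' x = (\<Sum>i\<in>Basis. Blinfun (blinfun_component i) o\<^sub>L D i x)" for x
  have "(?f' has_derivative blinfun_apply (f'' x)) (at x)" if "x \<in> S" for x
  proof -
    have "(?f' has_derivative (\<lambda>h. \<Sum>i\<in>Basis. blinfun_component i (blinfun_apply (D i x) h))) (at x)"
      by (intro has_derivative_sum bounded_linear.has_derivative[OF bounded_linear_blinfun_component])
         (use D that in \<open>auto simp: C1_derivative_def\<close>)
    moreover have "(\<lambda>h. \<Sum>i\<in>Basis. blinfun_component i (blinfun_apply (D i x) h)) = blinfun_apply (f'' x)"
      by (simp add: f''_def fun_eq_iff blinfun.sum_left bounded_linear_Blinfun_apply bounded_linear_blinfun_component)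
    ultimately show ?thesis by simp
  qed
  moreover have "continuous_on S f''"
    unfolding f''_def
    by (intro continuous_on_sum bounded_bilinear.continuous_on[OF bounded_bilinear_blinfun_compose] continuous_on_const)
       (use D in \<open>auto simp: C1_derivative_def\<close>)
  ultimately have "C1_derivative S ?f' f''" by (simp add: C1_derivative_def)
  with 1 show ?thesis by (rule that)
qed

text \<open>A slice chart with two derivatives in each direction. The second one is needed because the
  tangent spaces \<open>g' w ` E\<close> have to depend differentiably on the point.\<close>

locale slice_chart =
  fixes M U W E :: "'a::euclidean_space set" and f g :: "'a \<Rightarrow> 'a"
    and f' g' :: "'a \<Rightarrow> 'a \<Rightarrow>\<^sub>L 'a" and f'' g'' :: "'a \<Rightarrow> 'a \<Rightarrow>\<^sub>L ('a \<Rightarrow>\<^sub>L 'a)"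
  assumes opens: "open U" "open W" and fW: "\<And>y. y \<in> U \<Longrightarrow> f y \<in> W" and gU: "\<And>w. w \<in> W \<Longrightarrow> g w \<in> U"
    and gf: "\<And>y. y \<in> U \<Longrightarrow> g (f y) = y" and fg: "\<And>w. w \<in> W \<Longrightarrow> f (g w) = w"
    and E: "subspace E" and M_iff: "\<And>y. y \<in> U \<Longrightarrow> y \<in> M \<longleftrightarrow> f y \<in> E"
    and Cf: "C1_derivative U f f'" "C1_derivative U f' f''" and Cg: "C1_derivative W g g'" "C1_derivative W g' g''"

lemma submanifold_chart:
  fixes M :: "'a::euclidean_space set"
  assumes "submanifold M" "x \<in> M"
  obtains U W E f g f' g' f'' g'' where "slice_chart M U W E f g f' g' f'' g''" "x \<in> U"
proof -
  obtain U W :: "'a set" and f g E where c: "open U" "open W" "x \<in> U" "homeomorphism U W f g" "smooth_on U f" "smooth_on W g"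
    "subspace E" "f ` (M \<inter> U) = E \<inter> W"
    using assms unfolding submanifold_def by blast
  obtain f' f'' where f: "C1_derivative U f f'" "C1_derivative U f' f''" by (rule smooth_on_C2[OF c(5)]) (rule that)
  obtain g' g'' where g: "C1_derivative W g g'" "C1_derivative W g' g''" by (rule smooth_on_C2[OF c(6)]) (rule that)
  have h: "\<And>y. y \<in> U \<Longrightarrow> f y \<in> W" "\<And>w. w \<in> W \<Longrightarrow> g w \<in> U" "\<And>y. y \<in> U \<Longrightarrow> g (f y) = y" "\<And>w. w \<in> W \<Longrightarrow> f (g w) = w"
    using c(4) by (auto simp: homeomorphism_def)
  have "y \<in> M \<longleftrightarrow> f y \<in> E" if y: "y \<in> U" for y
  proof
    assume "y \<in> M"
    then have "f y \<in> f ` (M \<inter> U)" using y by blast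
    then show "f y \<in> E" using c(8) by blast
  next
    assume "f y \<in> E"
    then have "f y \<in> f ` (M \<inter> U)" using c(8) h(1)[OF y] by blast
    then obtain z where "z \<in> M" "z \<in> U" "f y = f z" by blast
    then show "y \<in> M" using h(3) y by metis
  qed
  with c f g h have "slice_chart M U W E f g f' g' f'' g''" by (intro slice_chart.intro)
  then show ?thesis using that c(3) by blast
qed

lemma C1_derivativeD:
  assumes "C1_derivative S f f'" "x \<in> S"
  shows "(f has_derivative blinfun_apply (f' x)) (at x)"
  using assms by (simp add: C1_derivative_def)

context slice_chart
begin

lemma df_dg: "w \<in> W \<Longrightarrow> blinfun_apply (f' (g w)) (blinfun_apply (g' w) v) = v"
proof -
  assume w: "w \<in> W"
  have "((\<lambda>w. f (g w)) has_derivative (\<lambda>v. blinfun_apply (f' (g w)) (blinfun_apply (g' w) v))) (at w)"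
    by (rule has_derivative_compose[OF C1_derivativeD[OF Cg(1) w] C1_derivativeD[OF Cf(1) gU[OF w]]])
  moreover have "((\<lambda>w. f (g w)) has_derivative (\<lambda>v. v)) (at w)"
    by (rule has_derivative_transform_within_open[OF has_derivative_ident opens(2) w]) (simp add: fg)
  ultimately have "(\<lambda>v. blinfun_apply (f' (g w)) (blinfun_apply (g' w) v)) = (\<lambda>v. v)"
    by (rule has_derivative_unique)
  then show ?thesis by metis
qed

lemma dg_df: "y \<in> U \<Longrightarrow> blinfun_apply (g' (f y)) (blinfun_apply (f' y) v) = v"
proof -
  assume y: "y \<in> U"
  have "((\<lambda>w. g (f w)) has_derivative (\<lambda>v. blinfun_apply (g' (f y)) (blinfun_apply (f' y) v))) (at y)"
    by (rule has_derivative_compose[OF C1_derivativeD[OF Cf(1) y] C1_derivativeD[OF Cg(1) fW[OF y]]])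
  moreover have "((\<lambda>w. g (f w)) has_derivative (\<lambda>v. v)) (at y)"
    by (rule has_derivative_transform_within_open[OF has_derivative_ident opens(1) y]) (simp add: gf)
  ultimately have "(\<lambda>v. blinfun_apply (g' (f y)) (blinfun_apply (f' y) v)) = (\<lambda>v. v)"
    by (rule has_derivative_unique)
  then show ?thesis by metis
qed

text \<open>Pull a line in the slice \<open>E\<close> back to \<open>M\<close>; the frame
  \<open>g'\<close> of the tangent spaces is differentiable along it.\<close>

lemma chart_line:
  assumes y: "y \<in> U" "y \<in> M" and \<xi>: "\<xi> \<in> E"
  obtains e where "0 < e" "\<And>t. \<bar>t\<bar> < e \<Longrightarrow> f y + t *\<^sub>R \<xi> \<in> W" "\<And>t. \<bar>t\<bar> < e \<Longrightarrow> g (f y + t *\<^sub>R \<xi>) \<in> M \<inter> U"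
    "(\<lambda>t. g (f y + t *\<^sub>R \<xi>)) C1_differentiable_on {-e<..<e}"
    "((\<lambda>t. g (f y + t *\<^sub>R \<xi>)) has_vector_derivative blinfun_apply (g' (f y)) \<xi>) (at 0)"
    "(\<lambda>t. g' (f y + t *\<^sub>R \<xi>)) C1_differentiable_on {-e<..<e}"
proof -
  have "continuous_on UNIV (\<lambda>t::real. f y + t *\<^sub>R \<xi>)" by (intro continuous_intros)
  then have "open ((\<lambda>t::real. f y + t *\<^sub>R \<xi>) -` W)" using opens(2) continuous_on_open_vimage[of UNIV] by auto
  moreover have "0 \<in> (\<lambda>t::real. f y + t *\<^sub>R \<xi>) -` W" using fW[OF y(1)] by simp
  ultimately obtain e where e: "0 < e" "ball 0 e \<subseteq> (\<lambda>t::real. f y + t *\<^sub>R \<xi>) -` W" using open_contains_ball by blast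
  have inW: "f y + t *\<^sub>R \<xi> \<in> W" if "\<bar>t\<bar> < e" for t using e(2) that by (auto simp: subset_iff dist_real_def)
  have inE: "f y + t *\<^sub>R \<xi> \<in> E" for t using M_iff[OF y(1)] y(2) \<xi> by (intro subspace_add subspace_scale E) auto
  have line: "((\<lambda>t. f y + t *\<^sub>R \<xi>) has_vector_derivative \<xi>) (at t)" for t
    by (auto intro!: derivative_eq_intros)
  have C1: "(\<lambda>t. h (f y + t *\<^sub>R \<xi>)) C1_differentiable_on {-e<..<e}"
    if h: "C1_derivative W h h'" for h :: "'a \<Rightarrow> 'z::real_normed_vector" and h'
  proof -
    have "((\<lambda>t. h (f y + t *\<^sub>R \<xi>)) has_vector_derivative blinfun_apply (h' (f y + t *\<^sub>R \<xi>)) \<xi>) (at t)" if "\<bar>t\<bar> < e" for t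
      using vector_derivative_diff_chain_within[OF line has_derivative_at_withinI[OF C1_derivativeD[OF h inW[OF that]]]]
      by (simp add: o_def)
    moreover have "continuous_on {-e<..<e} (\<lambda>t. blinfun_apply (h' (f y + t *\<^sub>R \<xi>)) \<xi>)"
    proof (rule bounded_linear.continuous_on[OF blinfun.bounded_linear_left])
      have "continuous_on W h'" using h by (simp add: C1_derivative_def)
      then show "continuous_on {-e<..<e} (\<lambda>t. h' (f y + t *\<^sub>R \<xi>))"
        by (rule continuous_on_compose2) (auto intro!: continuous_intros inW)
    qed
    ultimately show ?thesis
      unfolding C1_differentiable_on_def by (intro exI[of _ "\<lambda>t. blinfun_apply (h' (f y + t *\<^sub>R \<xi>)) \<xi>"]) auto
  qed
  show ?thesis
  proof (rule that[OF e(1) inW _ C1[OF Cg(1)] _ C1[OF Cg(2)]])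
    fix t assume t: "\<bar>t\<bar> < e"
    show "g (f y + t *\<^sub>R \<xi>) \<in> M \<inter> U" using M_iff[OF gU[OF inW[OF t]]] gU[OF inW[OF t]] inE fg[OF inW[OF t]] by simp
  next
    show "((\<lambda>t. g (f y + t *\<^sub>R \<xi>)) has_vector_derivative blinfun_apply (g' (f y)) \<xi>) (at 0)"
      using vector_derivative_diff_chain_within[OF line[of 0] has_derivative_at_withinI[OF C1_derivativeD[OF Cg(1)]]] fW[OF y(1)]
      by (simp add: o_def)
  qed
qed

text \<open>The velocity of \<open>f \<circ> c\<close> is a limit of difference quotients in the closed
  subspace \<open>E\<close>; conversely, \<open>chart_line\<close> provides a curve with the given
  velocity.\<close>

lemma tangent_iff:
  assumes y: "y \<in> U" "y \<in> M"
  shows "v \<in> tangent_space M y \<longleftrightarrow> blinfun_apply (f' y) v \<in> E"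
proof
  assume "v \<in> tangent_space M y"
  then have v: "v \<in> velocities M y" by (simp add: tangent_space_def)
  obtain e c where c: "0 < e" "c C1_differentiable_on {-e<..<e}" "\<forall>t. \<bar>t\<bar> < e \<longrightarrow> c t \<in> M" "c 0 = y" "(c has_vector_derivative v) (at 0)"
    by (rule velocitiesE[OF v]) (rule that)
  have d: "((\<lambda>t. f (c t)) has_vector_derivative blinfun_apply (f' y) v) (at 0)"
    using vector_derivative_diff_chain_within[OF c(5) has_derivative_at_withinI[OF C1_derivativeD[OF Cf(1)]]] c(4) y(1)
    by (simp add: o_def)
  have lim: "((\<lambda>t. (f (c t) - f (c 0)) /\<^sub>R (t - 0)) \<longlongrightarrow> blinfun_apply (f' y) v) (at 0)"
    using d by (simp only: has_vector_derivative_iff_tendsto)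
  have "(c \<longlongrightarrow> c 0) (at 0)" using has_vector_derivative_continuous[OF c(5)] by (simp add: continuous_at)
  then have "\<forall>\<^sub>F t in at 0. c t \<in> U" using opens(1) y(1) c(4) by (auto elim: topological_tendstoD)
  moreover have "\<forall>\<^sub>F t in at 0. \<bar>t\<bar> < e" using c(1) by (auto simp: eventually_at intro!: exI[of _ e])
  ultimately have "\<forall>\<^sub>F t in at 0. (f (c t) - f (c 0)) /\<^sub>R (t - 0) \<in> E"
  proof eventually_elim
    fix t assume "c t \<in> U" "\<bar>t\<bar> < e"
    then have "f (c t) \<in> E" using c(3) M_iff by blast
    moreover have "f (c 0) \<in> E" using c(4) M_iff y by simp
    ultimately show "(f (c t) - f (c 0)) /\<^sub>R (t - 0) \<in> E" by (intro subspace_scale subspace_diff E)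
  qed
  then show "blinfun_apply (f' y) v \<in> E"
    using Lim_in_closed_set[OF closed_subspace[OF E] _ _ lim] by simp
next
  assume "blinfun_apply (f' y) v \<in> E"
  then obtain e where e: "0 < e" "\<And>t. \<bar>t\<bar> < e \<Longrightarrow> g (f y + t *\<^sub>R blinfun_apply (f' y) v) \<in> M \<inter> U"
    "(\<lambda>t. g (f y + t *\<^sub>R blinfun_apply (f' y) v)) C1_differentiable_on {-e<..<e}"
    "((\<lambda>t. g (f y + t *\<^sub>R blinfun_apply (f' y) v)) has_vector_derivative blinfun_apply (g' (f y)) (blinfun_apply (f' y) v)) (at 0)"
    using chart_line[OF y] by metis
  have "v \<in> velocities M y"
    by (rule velocitiesI[OF e(1,3)]) (use e(2,4) gf[OF y(1)] dg_df[OF y(1)] in auto)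
  then show "v \<in> tangent_space M y" by (simp add: tangent_space_def)
qed

lemma tangent_eq: "w \<in> W \<Longrightarrow> w \<in> E \<Longrightarrow> tangent_space M (g w) = blinfun_apply (g' w) ` E"
proof -
  assume w: "w \<in> W" "w \<in> E"
  have gM: "g w \<in> U" "g w \<in> M" using M_iff[OF gU[OF w(1)]] gU[OF w(1)] fg[OF w(1)] w(2) by auto
  show ?thesis
  proof (intro equalityI subsetI)
    fix v assume "v \<in> tangent_space M (g w)"
    then have "blinfun_apply (f' (g w)) v \<in> E" by (simp add: tangent_iff[OF gM])
    moreover have "v = blinfun_apply (g' w) (blinfun_apply (f' (g w)) v)" using dg_df[OF gM(1), of v] fg[OF w(1)] by simp
    ultimately show "v \<in> blinfun_apply (g' w) ` E" by (rule rev_image_eqI)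
  next
    fix v assume "v \<in> blinfun_apply (g' w) ` E"
    then show "v \<in> tangent_space M (g w)" using df_dg[OF w(1)] by (auto simp: tangent_iff[OF gM])
  qed
qed

end

lemma subspace_tangent_space:
  assumes "submanifold M" "x \<in> M"
  shows "subspace (tangent_space M x)"
proof -
  obtain U W E f g f' g' f'' g'' where "slice_chart M U W E f g f' g' f'' g''" and x: "x \<in> U"
    by (rule submanifold_chart[OF assms])
  then interpret slice_chart M U W E f g f' g' f'' g'' by simp
  show ?thesis
    unfolding subspace_def
    using tangent_iff[OF x assms(2)] E
    by (auto simp: blinfun.bilinear_simps subspace_0 subspace_add subspace_scale)
qed

text \<open>The hypothesis is local, so that the lemma applies to flows that are only known to preserve
  \<open>M\<close> near a point.\<close>

lemma tangent_space_affine_map: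
  assumes N: "open N" "y \<in> N" and A: "\<And>z. z \<in> M \<inter> N \<Longrightarrow> aff_app A z \<in> M" and v: "v \<in> tangent_space M y"
  shows "lin A v \<in> tangent_space M (aff_app A y)"
proof -
  from v have v': "v \<in> velocities M y" by (simp add: tangent_space_def)
  obtain e c where c: "0 < e" "c C1_differentiable_on {-e<..<e}" "\<forall>t. \<bar>t\<bar> < e \<longrightarrow> c t \<in> M" "c 0 = y" "(c has_vector_derivative v) (at 0)"
    by (rule velocitiesE[OF v']) (rule that)
  have "(c \<longlongrightarrow> c 0) (at 0)" using has_vector_derivative_continuous[OF c(5)] by (simp add: continuous_at)
  then have "\<forall>\<^sub>F t in at 0. c t \<in> N" using N c(4) by (auto elim: topological_tendstoD)
  then obtain d where d: "0 < d" "\<And>t. t \<noteq> 0 \<Longrightarrow> dist t 0 < d \<Longrightarrow> c t \<in> N" by (auto simp: eventually_at)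
  define r where "r = min d e"
  have "v \<in> velocities (M \<inter> N) y"
  proof (rule velocitiesI[of r c])
    show "0 < r" using c(1) d(1) by (simp add: r_def)
    show "c C1_differentiable_on {-r<..<r}" by (rule C1_differentiable_on_subset[OF c(2)]) (auto simp: r_def)
    show "\<forall>t. \<bar>t\<bar> < r \<longrightarrow> c t \<in> M \<inter> N"
    proof (intro allI impI)
      fix t assume t: "\<bar>t\<bar> < r"
      show "c t \<in> M \<inter> N" using t c(3,4) d(2)[of t] N(2) by (cases "t = 0") (auto simp: r_def)
    qed
  qed (use c in auto)
  from velocities_affine_image[OF blinfun.bounded_linear_right _ this, of "fst A" "snd A" M]
  show ?thesis using A by (simp add: tangent_space_def aff_app_def)
qed

section \<open>Linear algebra of forms on subspaces\<close>

lemma linear_on_setD: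
  assumes "linear_on_set U f"
  shows "\<And>x y. x \<in> U \<Longrightarrow> y \<in> U \<Longrightarrow> f (x + y) = f x + f y" "\<And>r x. x \<in> U \<Longrightarrow> f (r *\<^sub>R x) = r *\<^sub>R f x"
  using assms by (auto simp: linear_on_set_def)

lemma linear_on_set_0: "linear_on_set U f \<Longrightarrow> subspace U \<Longrightarrow> f 0 = 0"
  using linear_on_setD(2)[of U f 0 0] subspace_0 by fastforce

lemma linear_on_set_eqI:
  assumes f: "linear_on_set (span Bs) f" and g: "linear_on_set (span Bs) g"
    and eq: "\<And>i. i \<in> Bs \<Longrightarrow> f i = g i" and x: "x \<in> span Bs"
  shows "f x = g x"
proof -
  let ?H = "{x \<in> span Bs. f x = g x}"
  have "subspace ?H"
    unfolding subspace_def
    using linear_on_set_0[OF f subspace_span] linear_on_set_0[OF g subspace_span] linear_on_setD[OF f] linear_on_setD[OF g]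
    by (simp add: span_zero span_add span_scale)
  moreover have "Bs \<subseteq> ?H" using eq span_base by auto
  ultimately show ?thesis using x span_minimal by blast
qed

lemma bilinear_on_setD:
  assumes "bilinear_on_set U B"
  shows "x \<in> U \<Longrightarrow> linear_on_set U (B x)" "y \<in> U \<Longrightarrow> linear_on_set U (\<lambda>x. B x y)"
  using assms by (auto simp: bilinear_on_set_def)

text \<open>Representation of linear forms. The map \<open>\<psi>\<close> sends \<open>x\<close> to the
  vector whose coordinates are the products of \<open>x\<close> with the basis \<open>Bs\<close>. It is
  injective on \<open>U\<close> by non-degeneracy, hence maps \<open>U\<close> onto \<open>U\<close>, and
  a preimage of \<open>\<Sum>i\<in>Bs. \<phi> i *\<^sub>R i\<close> represents
  \<open>\<phi>\<close>.\<close>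

lemma nondegenerate_representation:
  fixes B :: "'v::real_vector \<Rightarrow> 'v \<Rightarrow> real"
  assumes fin: "finite Bs" and ind: "independent Bs" and U: "span Bs = U"
    and B: "sym_bilinear_on U B" and nd: "nondegenerate_on U B" and \<phi>: "linear_on_set U \<phi>"
  obtains u where "u \<in> U" "\<And>v. v \<in> U \<Longrightarrow> B v u = \<phi> v"
proof -
  have sub: "subspace U" using U subspace_span by blast
  have bil: "bilinear_on_set U B" and sym: "\<And>x y. x \<in> U \<Longrightarrow> y \<in> U \<Longrightarrow> B x y = B y x"
    using B by (auto simp: sym_bilinear_on_def)
  have BU: "i \<in> U" if "i \<in> Bs" for i using that U span_base by blast
  obtain P where P: "range P \<subseteq> U" "linear P" "\<And>v. v \<in> U \<Longrightarrow> P v = v"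
    using linear_exists_left_inverse_on[OF linear_id sub] by auto
  have PU: "P x \<in> U" for x using P(1) by blast
  define \<psi> where "\<psi> x = (\<Sum>i\<in>Bs. B i (P x) *\<^sub>R i)" for x
  have lin: "linear \<psi>"
  proof (rule linearI)
    fix x y r
    have "B i (P (x + y)) = B i (P x) + B i (P y)" "B i (P (r *\<^sub>R x)) = r * B i (P x)" if "i \<in> Bs" for i
      using linear_on_setD[OF bilinear_on_setD(1)[OF bil BU[OF that]]] PU
      by (simp_all add: linear_add[OF P(2)] linear_scale[OF P(2)])
    then show "\<psi> (x + y) = \<psi> x + \<psi> y" "\<psi> (r *\<^sub>R x) = r *\<^sub>R \<psi> x"
      by (simp_all add: \<psi>_def scaleR_add_left sum.distrib scaleR_sum_right)
  qed
  have coeff: "B v u = \<phi>' v" if "\<And>i. i \<in> Bs \<Longrightarrow> B i u = \<phi>' i" "u \<in> U" "v \<in> U" "linear_on_set U \<phi>'" for u v \<phi>'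
    using linear_on_set_eqI[of Bs "\<lambda>v. B v u" \<phi>' v] bilinear_on_setD(2)[OF bil that(2)] that U by simp
  have \<psi>0: "x = 0" if "x \<in> U" "\<psi> x = 0" for x
  proof -
    have "B i x = 0" if "i \<in> Bs" for i
      using independentD[OF ind fin order_refl, of "\<lambda>i. B i (P x)"] that \<open>\<psi> x = 0\<close> P(3)[OF \<open>x \<in> U\<close>]
      by (simp add: \<psi>_def)
    then have "B v x = 0" if "v \<in> U" for v
      using coeff[of x "\<lambda>_. 0" v] \<open>x \<in> U\<close> that by (simp add: linear_on_set_def)
    then show "x = 0" using nd \<open>x \<in> U\<close> sym unfolding nondegenerate_on_def by metis
  qed
  have inj: "inj_on \<psi> (span Bs)"
    unfolding U using linear_inj_on_iff_eq_0[OF lin sub] \<psi>0 by blast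
  have ind': "independent (\<psi> ` Bs)" by (rule linear_independent_injective_image[OF lin ind inj])
  have card: "card (\<psi> ` Bs) = card Bs" by (rule card_image) (use inj inj_on_subset span_superset in blast)
  have \<psi>U: "\<psi> x \<in> span Bs" for x unfolding \<psi>_def by (intro span_sum span_scale span_base)
  have "v \<in> span (\<psi> ` Bs)" if v: "v \<in> span Bs" for v
  proof (rule ccontr)
    assume "v \<notin> span (\<psi> ` Bs)"
    then have i: "independent (insert v (\<psi> ` Bs))" "v \<notin> \<psi> ` Bs"
      using independent_insertI[OF _ ind'] span_base[of v "\<psi> ` Bs"] by blast+
    have "insert v (\<psi> ` Bs) \<subseteq> span Bs" using v \<psi>U by auto
    then have "card (insert v (\<psi> ` Bs)) \<le> card Bs" using independent_span_bound[OF fin i(1)] by blast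
    then show False using card fin i(2) by simp
  qed
  moreover have "(\<Sum>i\<in>Bs. \<phi> i *\<^sub>R i) \<in> span Bs" by (intro span_sum span_scale span_base)
  ultimately have "(\<Sum>i\<in>Bs. \<phi> i *\<^sub>R i) \<in> \<psi> ` span Bs" using linear_span_image[OF lin] by blast
  then obtain u where u: "u \<in> U" "\<psi> u = (\<Sum>i\<in>Bs. \<phi> i *\<^sub>R i)" using U by auto
  have "(\<Sum>i\<in>Bs. (B i u - \<phi> i) *\<^sub>R i) = 0" using u P(3)[OF u(1)] by (simp add: \<psi>_def scaleR_diff_left sum_subtractf)
  then have "B i u = \<phi> i" if "i \<in> Bs" for i
    using independentD[OF ind fin order_refl, of "\<lambda>i. B i u - \<phi> i"] that by simp
  then show ?thesis using that[OF u(1)] coeff[OF _ u(1) _ \<phi>] by blast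
qed

section \<open>Reflections\<close>

lemma C1_cong:
  assumes "open S" "\<And>t. t \<in> S \<Longrightarrow> f t = g t" "g C1_differentiable_on S"
  shows "f C1_differentiable_on S"
proof -
  obtain D where D: "\<And>s. s \<in> S \<Longrightarrow> (g has_vector_derivative D s) (at s)" "continuous_on S D"
    using assms(3) unfolding C1_differentiable_on_def by blast
  have "(f has_vector_derivative D s) (at s)" if "s \<in> S" for s
    by (rule has_vector_derivative_transform_within_open[OF D(1)[OF that] assms(1) that]) (simp add: assms(2))
  then show ?thesis unfolding C1_differentiable_on_def using D(2) by (intro exI[of _ D] conjI ballI)
qed

locale extrinsic_space =
  fixes b :: "'a::euclidean_space \<Rightarrow> 'a \<Rightarrow> real" and M :: "'a set"
  assumes inner_product_b: "inner_product b" and symmetric_M: "extrinsic_symmetric b M"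
begin

abbreviation T where "T \<equiv> tangent_space M"
abbreviation s where "s \<equiv> reflection b M"

lemma sub_M: "submanifold M" and nd_T: "x \<in> M \<Longrightarrow> nondegenerate_on (T x) b"
  using symmetric_M by (auto simp: extrinsic_symmetric_def nondegenerate_submanifold_def)

lemma refl_image: "x \<in> M \<Longrightarrow> aff_app (s x) ` M = M"
  using symmetric_M by (simp add: extrinsic_symmetric_def)

lemma b_sym: "b x y = b y x"
  using inner_product_b by (simp add: inner_product_def sym_bilinear_on_def)

lemma bilinear_b: "bilinear b"
  using inner_product_b by (auto simp: inner_product_def sym_bilinear_on_def bilinear_on_set_def linear_on_set_def bilinear_def intro!: linearI)

lemma bounded_bilinear_b: "bounded_bilinear b"
  using bilinear_b by (simp add: bilinear_conv_bounded_bilinear)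

lemmas b_simps = bounded_bilinear.add_left[OF bounded_bilinear_b] bounded_bilinear.add_right[OF bounded_bilinear_b] bounded_bilinear.diff_left[OF bounded_bilinear_b]
  bounded_bilinear.diff_right[OF bounded_bilinear_b] bounded_bilinear.scaleR_left[OF bounded_bilinear_b] bounded_bilinear.scaleR_right[OF bounded_bilinear_b]
  bounded_bilinear.zero_left[OF bounded_bilinear_b] bounded_bilinear.zero_right[OF bounded_bilinear_b] bounded_bilinear.minus_left[OF bounded_bilinear_b]
  bounded_bilinear.minus_right[OF bounded_bilinear_b]

lemma sub_T: "x \<in> M \<Longrightarrow> subspace (T x)"
  by (rule subspace_tangent_space[OF sub_M])

lemma orthogonal_zero:
  assumes x: "x \<in> M" and u: "u \<in> T x" "\<And>t. t \<in> T x \<Longrightarrow> b t u = 0"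
  shows "u = 0"
  using nd_T[OF x] u b_sym unfolding nondegenerate_on_def by metis

text \<open>Represent the linear form \<open>\<lambda>t. b t v\<close> on the non-degenerate tangent
  space. The form \<open>b\<close> itself may be degenerate.\<close>

lemma tangent_projection_exists:
  assumes x: "x \<in> M"
  shows "\<exists>!u. u \<in> T x \<and> (\<forall>t\<in>T x. b t (v - u) = 0)"
proof -
  obtain Bs where Bs: "Bs \<subseteq> T x" "independent Bs" "T x \<subseteq> span Bs" using basis_exists[of "T x"] by metis
  have sp: "span Bs = T x" using Bs sub_T[OF x] span_minimal by blast
  have lin: "linear_on_set (T x) (b w)" "linear_on_set (T x) (\<lambda>t. b t w)" for w
    by (simp_all add: linear_on_set_def b_simps)
  have sb: "sym_bilinear_on (T x) b"
    using lin b_sym by (simp add: sym_bilinear_on_def bilinear_on_set_def)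
  obtain u where u: "u \<in> T x" "\<And>t. t \<in> T x \<Longrightarrow> b t u = b t v"
    by (rule nondegenerate_representation[OF independent_imp_finite[OF Bs(2)] Bs(2) sp sb nd_T[OF x] lin(2)[of v]]) (rule that)
  show ?thesis
  proof (rule ex1I[of _ u])
    show "u \<in> T x \<and> (\<forall>t\<in>T x. b t (v - u) = 0)" using u by (simp add: b_simps)
    fix u' assume u': "u' \<in> T x \<and> (\<forall>t\<in>T x. b t (v - u') = 0)"
    have "u' - u = 0"
      using u' u by (intro orthogonal_zero[OF x] subspace_diff sub_T x) (auto simp: b_simps)
    then show "u' = u" by simp
  qed
qed

text \<open>The projection onto the tangent space at \<open>x\<close> along the normal space.\<close>

definition P where "P x v = (THE u. u \<in> T x \<and> (\<forall>t\<in>T x. b t (v - u) = 0))"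

lemma P_in: "x \<in> M \<Longrightarrow> P x v \<in> T x" and P_orth: "x \<in> M \<Longrightarrow> t \<in> T x \<Longrightarrow> b t (v - P x v) = 0"
  using theI'[OF tangent_projection_exists, of x v] unfolding P_def by auto

lemma P_unique: "x \<in> M \<Longrightarrow> u \<in> T x \<Longrightarrow> (\<And>t. t \<in> T x \<Longrightarrow> b t (v - u) = 0) \<Longrightarrow> P x v = u"
  unfolding P_def by (rule the1_equality[OF tangent_projection_exists]) auto

lemma P_tangent: "x \<in> M \<Longrightarrow> v \<in> T x \<Longrightarrow> P x v = v"
  by (rule P_unique) (auto simp: b_simps)

lemma P_normal_iff: "x \<in> M \<Longrightarrow> P x v = 0 \<longleftrightarrow> v \<in> normal_space b M x"
  using P_orth[of x _ v] P_unique[of x 0 v] subspace_0[OF sub_T, of x] by (auto simp: normal_space_def)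

lemma P_add: "x \<in> M \<Longrightarrow> P x (v + w) = P x v + P x w"
proof (rule P_unique)
  assume x: "x \<in> M"
  then show "P x v + P x w \<in> T x" using sub_T P_in by (intro subspace_add)
  fix t assume "t \<in> T x"
  then show "b t (v + w - (P x v + P x w)) = 0"
    using P_orth[OF x, of t v] P_orth[OF x, of t w] by (simp add: b_simps)
qed

lemma P_scale: "x \<in> M \<Longrightarrow> P x (r *\<^sub>R v) = r *\<^sub>R P x v"
proof (rule P_unique)
  assume x: "x \<in> M"
  then show "r *\<^sub>R P x v \<in> T x" using sub_T P_in by (intro subspace_scale)
  fix t assume "t \<in> T x"
  then show "b t (r *\<^sub>R v - r *\<^sub>R P x v) = 0"
    using P_orth[OF x, of t v] by (simp add: b_simps)
qed

lemma linear_P: "x \<in> M \<Longrightarrow> linear (P x)"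
  by (rule linearI) (simp_all add: P_add P_scale)

lemma bl_refl: "x \<in> M \<Longrightarrow> bounded_linear (\<lambda>v. v - 2 *\<^sub>R P x v)"
  using linear_P[of x] by (intro bounded_linear_sub bounded_linear_ident bounded_linear_compose[OF bounded_linear_scaleR_right])
    (simp add: linear_conv_bounded_linear)

text \<open>Both conditions together determine an affine map through the decomposition of \<open>y -
  x\<close> into its tangent and normal parts, so the definite description in \<open>reflection\<close>
  is justified.\<close>

lemma reflection_eqI:
  assumes x: "x \<in> M" and tan: "\<And>v. v \<in> T x \<Longrightarrow> lin S v = - v"
    and nor: "\<And>v. v \<in> normal_space b M x \<Longrightarrow> aff_app S (x + v) = x + v"
  shows "s x = S" and "lin S v = v - 2 *\<^sub>R P x v" and "aff_app S y = y - 2 *\<^sub>R P x (y - x)"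
proof -
  have app: "aff_app S y = y - 2 *\<^sub>R P x (y - x)"
    if tan: "\<And>v. v \<in> T x \<Longrightarrow> lin S v = - v"
    and nor: "\<And>v. v \<in> normal_space b M x \<Longrightarrow> aff_app S (x + v) = x + v" for S y
  proof -
    have n: "y - x - P x (y - x) \<in> normal_space b M x"
      using P_orth[OF x] by (simp add: normal_space_def)
    have "aff_app S y = aff_app S (x + (y - x - P x (y - x))) + lin S (P x (y - x))"
      using aff_app_add[of S "x + (y - x - P x (y - x))" "P x (y - x)"] by simp
    also have "\<dots> = (x + (y - x - P x (y - x))) - P x (y - x)"
      by (simp only: nor[OF n] tan[OF P_in[OF x]]) simp
    finally show ?thesis by (simp add: algebra_simps scaleR_2)
  qed
  show "s x = S"
    unfolding reflection_def
  proof (rule the_equality)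
    fix S' assume "(\<forall>v\<in>T x. lin S' v = - v) \<and> (\<forall>v\<in>normal_space b M x. aff_app S' (x + v) = x + v)"
    then show "S' = S" using app[of S] app[of S'] tan nor by (intro aff_eqI) simp
  qed (use tan nor in auto)
  show A: "aff_app S y = y - 2 *\<^sub>R P x (y - x)" for y by (rule app[OF tan nor])
  have "lin S v = aff_app S (x + v) - aff_app S x" by (simp add: aff_app_diff)
  then show "lin S v = v - 2 *\<^sub>R P x v" using linear_0[OF linear_P[OF x]] by (simp add: A)
qed

lemma
  assumes x: "x \<in> M"
  shows aff_app_refl: "aff_app (s x) y = y - 2 *\<^sub>R P x (y - x)"
    and fst_refl: "lin (s x) v = v - 2 *\<^sub>R P x v"
proof -
  define S where "S = (Blinfun (\<lambda>v. v - 2 *\<^sub>R P x v), 2 *\<^sub>R P x x)"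
  have S: "lin S v = v - 2 *\<^sub>R P x v" "snd S = 2 *\<^sub>R P x x" for v
    by (simp_all add: S_def bounded_linear_Blinfun_apply bl_refl[OF x])
  have 1: "lin S v = - v" if "v \<in> T x" for v
    using P_tangent[OF x that] by (simp add: S scaleR_2)
  have 2: "aff_app S (x + v) = x + v" if "v \<in> normal_space b M x" for v
  proof -
    have "P x v = 0" using that P_normal_iff[OF x] by blast
    then show ?thesis by (simp add: aff_app_def S P_add[OF x])
  qed
  note E = reflection_eqI[OF x 1 2]
  show "aff_app (s x) y = y - 2 *\<^sub>R P x (y - x)" "lin (s x) v = v - 2 *\<^sub>R P x v"
    using E by simp_all
qed

lemma P_P [simp]: "x \<in> M \<Longrightarrow> P x (P x v) = P x v"
  by (simp add: P_tangent P_in)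

lemma refl_fix: "x \<in> M \<Longrightarrow> aff_app (s x) x = x"
  using linear_0[OF linear_P] by (simp add: aff_app_refl)

lemma refl_invol: "x \<in> M \<Longrightarrow> aff_comp (s x) (s x) = aff_id"
proof (rule aff_eqI)
  fix y assume x: "x \<in> M"
  have "P x (w - 2 *\<^sub>R P x w) = - P x w" for w
    by (simp add: linear_diff[OF linear_P[OF x]] P_scale[OF x] P_P[OF x]) (simp add: scaleR_2)
  from this[of "y - x"] have "P x (y - 2 *\<^sub>R P x (y - x) - x) = - P x (y - x)" by (simp add: algebra_simps)
  then show "aff_app (aff_comp (s x) (s x)) y = aff_app aff_id y" by (simp add: aff_app_refl[OF x])
qed

lemma b_P: "x \<in> M \<Longrightarrow> b (P x u) v = b (P x u) (P x v)"
  using P_orth[of x "P x u" v] P_in[of x u] by (simp add: b_simps)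

lemma refl_isometry: "x \<in> M \<Longrightarrow> b (lin (s x) u) (lin (s x) v) = b u v"
  using b_P[of x u v] b_P[of x v u] b_sym[of u "P x v"] b_sym[of "P x v" "P x u"]
  by (simp add: fst_refl b_simps)

lemma refl_tangent_iff: "x \<in> M \<Longrightarrow> lin (s x) v = - v \<longleftrightarrow> v \<in> T x"
proof
  assume x: "x \<in> M" and "lin (s x) v = - v"
  then have "2 *\<^sub>R v = 2 *\<^sub>R P x v" by (simp add: fst_refl scaleR_2 algebra_simps)
  then have "v = P x v" by simp
  then show "v \<in> T x" using P_in[OF x, of v] by simp
qed (simp add: fst_refl P_tangent scaleR_2)

text \<open>Naturality: \<open>k \<circ> s x \<circ> k\<^sup>-\<^sup>1\<close> satisfies the two
  conditions that characterize \<open>s (k x)\<close>. The hypotheses only concern \<open>x\<close> and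
  \<open>k x\<close>, because the lemma will be applied to flows that are known to preserve
  \<open>M\<close> near \<open>x\<close> only.\<close>

lemma reflection_conj:
  assumes x: "x \<in> M" "aff_app k x \<in> M" and inv: "aff_comp k k' = aff_id" "aff_comp k' k = aff_id"
    and iso: "\<And>u v. b (lin k u) (lin k v) = b u v"
    and tan: "\<And>u. u \<in> T x \<Longrightarrow> lin k u \<in> T (aff_app k x)"
      "\<And>u. u \<in> T (aff_app k x) \<Longrightarrow> lin k' u \<in> T x"
  shows "aff_comp k (aff_comp (s x) k') = s (aff_app k x)"
proof -
  have kk: "lin k (lin k' v) = v" "lin k' (lin k v) = v" for v
    using arg_cong[OF inv(1), of fst] arg_cong[OF inv(2), of fst] by (metis blinfun_apply_blinfun_compose blinfun_apply_id_blinfun fst_aff_comp fst_aff_id)+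
  have k'kx: "aff_app k' (aff_app k x) = x" using arg_cong[OF inv(2), of "\<lambda>A. aff_app A x"] by simp
  show ?thesis
  proof (rule reflection_eqI(1)[OF x(2), symmetric])
    fix v assume v: "v \<in> T (aff_app k x)"
    then have "lin (s x) (lin k' v) = - lin k' v"
      using tan(2) refl_tangent_iff[OF x(1)] by blast
    then show "lin (aff_comp k (aff_comp (s x) k')) v = - v"
      by (simp add: kk blinfun.minus_right)
  next
    fix n assume n: "n \<in> normal_space b M (aff_app k x)"
    have "lin k' n \<in> normal_space b M x"
      unfolding normal_space_def
    proof (clarify)
      fix u assume "u \<in> T x"
      then have "b (lin k u) n = 0" using n tan(1) by (simp add: normal_space_def)
      then show "b u (lin k' n) = 0" using iso[of u "lin k' n"] by (simp add: kk)
    qed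
    then have "P x (lin k' n) = 0" by (simp add: P_normal_iff[OF x(1)])
    then show "aff_app (aff_comp k (aff_comp (s x) k')) (aff_app k x + n) = aff_app k x + n"
    proof -
      have "aff_app (s x) (x + lin k' n) = x + lin k' n"
        using \<open>P x (lin k' n) = 0\<close> by (simp add: aff_app_refl[OF x(1)])
      then have "aff_app k (aff_app (s x) (aff_app k' (aff_app k x + n))) = aff_app k (x + lin k' n)"
        by (simp only: aff_app_add[of k'] k'kx)
      then show ?thesis by (simp only: aff_app_comp aff_app_add[of k] kk)
    qed
  qed
qed

text \<open>The reflection depends differentiably on its base point. Along a curve in a slice chart, the
  derivative of the chart gives a frame of the tangent spaces. In this frame the projection
  \<open>P\<close> is the vector of products with the frame, multiplied by the inverse of the Gram
  matrix, and inversion of matrices preserves \<open>C\<^sup>1\<close> curves.\<close>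

lemma reflection_curve:
  assumes x: "x \<in> M" and u: "u \<in> T x"
  obtains e \<gamma> where "0 < e" "\<gamma> 0 = x" "(\<gamma> has_vector_derivative u) (at 0)" "\<And>t. \<bar>t\<bar> < e \<Longrightarrow> \<gamma> t \<in> M"
    "(\<lambda>t. s (\<gamma> t)) C1_differentiable_on {-e<..<e}"
proof -
  obtain U W E f g f' g' f'' g'' where "slice_chart M U W E f g f' g' f'' g''" and xU: "x \<in> U"
    by (rule submanifold_chart[OF sub_M x])
  then interpret slice_chart M U W E f g f' g' f'' g'' by simp
  define \<xi> where "\<xi> = blinfun_apply (f' x) u"
  have \<xi>E: "\<xi> \<in> E" using u tangent_iff[OF xU x] by (simp add: \<xi>_def)
  obtain e where e: "0 < e" "\<And>t. \<bar>t\<bar> < e \<Longrightarrow> f x + t *\<^sub>R \<xi> \<in> W" "\<And>t. \<bar>t\<bar> < e \<Longrightarrow> g (f x + t *\<^sub>R \<xi>) \<in> M \<inter> U"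
    "(\<lambda>t. g (f x + t *\<^sub>R \<xi>)) C1_differentiable_on {-e<..<e}"
    "((\<lambda>t. g (f x + t *\<^sub>R \<xi>)) has_vector_derivative blinfun_apply (g' (f x)) \<xi>) (at 0)"
    "(\<lambda>t. g' (f x + t *\<^sub>R \<xi>)) C1_differentiable_on {-e<..<e}"
    using chart_line[OF xU x \<xi>E] by metis
  define \<gamma> where "\<gamma> t = g (f x + t *\<^sub>R \<xi>)" for t
  define ee where "ee t = g' (f x + t *\<^sub>R \<xi>)" for t
  have \<gamma>M: "\<gamma> t \<in> M" "\<gamma> t \<in> U" if "\<bar>t\<bar> < e" for t using e(3)[OF that] by (auto simp: \<gamma>_def)
  have inE: "f x + t *\<^sub>R \<xi> \<in> E" for t using M_iff[OF xU] x \<xi>E by (intro subspace_add subspace_scale E) auto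
  have T\<gamma>: "T (\<gamma> t) = blinfun_apply (ee t) ` E" if "\<bar>t\<bar> < e" for t
    unfolding \<gamma>_def ee_def by (rule tangent_eq[OF e(2)[OF that] inE])
  have ee_inj: "v = 0" if "\<bar>t\<bar> < e" "blinfun_apply (ee t) v = 0" for t v
    using df_dg[OF e(2)[OF that(1)], of v] that(2) by (simp add: ee_def blinfun.zero_right)
  have C1e: "ee C1_differentiable_on {-e<..<e}" using e(6) by (simp add: ee_def[abs_def])
  have C1ev: "(\<lambda>t. blinfun_apply (ee t) v) C1_differentiable_on {-e<..<e}" for v
    by (rule C1_bounded_linear[OF blinfun.bounded_linear_left C1e])
  obtain B where B: "B \<subseteq> E" "pairwise orthogonal B" "\<And>x. x \<in> B \<Longrightarrow> norm x = 1" "independent B" "span B = E"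
    by (rule orthonormal_basis_subspace[OF E]) (rule that)
  have finB: "finite B" using B(4) by (rule independent_imp_finite)
  have inner_B: "(\<Sum>j\<in>B. a j *\<^sub>R j) \<bullet> i = a i" if "i \<in> B" for a :: "'a \<Rightarrow> real" and i
  proof -
    have "(\<Sum>j\<in>B. a j *\<^sub>R j) \<bullet> i = (\<Sum>j\<in>B. if j = i then a i else 0)"
      unfolding inner_sum_left
    proof (rule sum.cong[OF refl])
      fix j assume "j \<in> B"
      then show "(a j *\<^sub>R j) \<bullet> i = (if j = i then a i else 0)"
        using B(2,3) that by (auto simp: pairwise_def orthogonal_def dot_square_norm)
    qed
    then show ?thesis using finB that by simp
  qed
  define \<pi> where "\<pi> v = (\<Sum>j\<in>B. (v \<bullet> j) *\<^sub>R j)" for v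
  have sumE: "(\<Sum>j\<in>B. a j *\<^sub>R j) \<in> E" for a using B(1) by (intro subspace_sum E subspace_scale) auto
  have \<pi>sum: "\<pi> (\<Sum>j\<in>B. a j *\<^sub>R j) = (\<Sum>j\<in>B. a j *\<^sub>R j)" for a
    unfolding \<pi>_def by (rule sum.cong[OF refl]) (simp add: inner_B)
  have lin\<pi>: "linear \<pi>"
    unfolding \<pi>_def by (rule linearI) (simp_all add: inner_add_left scaleR_add_left sum.distrib scaleR_sum_right)
  have \<pi>E: "\<pi> v \<in> E" for v unfolding \<pi>_def by (rule sumE)
  have eqE: "blinfun_apply L v = h v" if "\<And>j. j \<in> B \<Longrightarrow> blinfun_apply L j = h j" "v \<in> E" "linear h" for L :: "'a \<Rightarrow>\<^sub>L real" and v h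
    using linear_eq_on[OF bounded_linear.linear[OF blinfun.bounded_linear_right] that(3), of v B L] that(1,2) B(5) by blast
  \<comment> \<open>\<open>cc t v\<close> lists the products of \<open>v\<close> with the frame
    \<open>ee t\<close>, and \<open>G t\<close> below is the Gram matrix of the frame, extended by
    the identity on the orthogonal complement of \<open>E\<close> in order to be invertible on the
    whole space.\<close>
  define cc where "cc t = Blinfun (\<lambda>v. \<Sum>j\<in>B. b v (blinfun_apply (ee t) j) *\<^sub>R j)" for t
  have cc: "blinfun_apply (cc t) v = (\<Sum>j\<in>B. b v (blinfun_apply (ee t) j) *\<^sub>R j)" for t v
  proof -
    have "linear (\<lambda>v. \<Sum>j\<in>B. b v (blinfun_apply (ee t) j) *\<^sub>R j)"
      by (rule linearI) (simp_all add: b_simps scaleR_add_left sum.distrib scaleR_sum_right)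
    then show ?thesis by (simp add: cc_def linear_conv_bounded_linear bounded_linear_Blinfun_apply)
  qed
  define G where "G t = Blinfun (\<lambda>\<eta>. (\<Sum>j\<in>B. b (blinfun_apply (ee t) (\<pi> \<eta>)) (blinfun_apply (ee t) j) *\<^sub>R j) + (\<eta> - \<pi> \<eta>))" for t
  have G: "blinfun_apply (G t) \<eta> = (\<Sum>j\<in>B. b (blinfun_apply (ee t) (\<pi> \<eta>)) (blinfun_apply (ee t) j) *\<^sub>R j) + (\<eta> - \<pi> \<eta>)" for t \<eta>
  proof -
    have "linear (\<lambda>\<eta>. (\<Sum>j\<in>B. b (blinfun_apply (ee t) (\<pi> \<eta>)) (blinfun_apply (ee t) j) *\<^sub>R j) + (\<eta> - \<pi> \<eta>))"
      by (rule linearI) (simp_all add: linear_add[OF lin\<pi>] linear_scale[OF lin\<pi>] blinfun.bilinear_simps b_simps scaleR_add_left sum.distrib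
          scaleR_sum_right algebra_simps)
    then show ?thesis by (simp add: G_def linear_conv_bounded_linear bounded_linear_Blinfun_apply)
  qed
  have bterm: "(\<lambda>t. b (F t) (H t) *\<^sub>R j) C1_differentiable_on {-e<..<e}"
    if "F C1_differentiable_on {-e<..<e}" "H C1_differentiable_on {-e<..<e}" for F H and j :: 'a
    by (rule C1_bounded_linear[OF bounded_linear_scaleR_left C1_bounded_bilinear[OF bounded_bilinear_b that]])
  have C1cc: "cc C1_differentiable_on {-e<..<e}"
    by (rule C1_blinfunI, unfold cc, rule C1_sum[OF finB], rule bterm[OF C1_differentiable_on_const C1ev])
  have C1G: "G C1_differentiable_on {-e<..<e}"
    by (rule C1_blinfunI, unfold G, rule C1_differentiable_on_add[OF C1_sum[OF finB] C1_differentiable_on_const], rule bterm[OF C1ev C1ev])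
  have orth: "b (blinfun_apply (ee t) \<zeta>) w = 0" if "\<And>j. j \<in> B \<Longrightarrow> b (blinfun_apply (ee t) j) w = 0" "\<zeta> \<in> E" for t \<zeta> w
  proof -
    have l: "linear (\<lambda>\<zeta>. b (blinfun_apply (ee t) \<zeta>) w)" by (rule linearI) (simp_all add: blinfun.bilinear_simps b_simps)
    have "linear (\<lambda>_::'a. 0::real)" by (rule linearI) simp_all
    then show ?thesis using linear_eq_on[OF l, of "\<lambda>_. 0" \<zeta> B] that B(5) by simp
  qed
  have G0: "\<eta> = 0" if t: "\<bar>t\<bar> < e" and 0: "blinfun_apply (G t) \<eta> = 0" for t \<eta>
  proof -
    have "\<pi> (blinfun_apply (G t) \<eta>) = (\<Sum>j\<in>B. b (blinfun_apply (ee t) (\<pi> \<eta>)) (blinfun_apply (ee t) j) *\<^sub>R j)"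
      unfolding G linear_add[OF lin\<pi>] linear_diff[OF lin\<pi>] \<pi>sum using \<pi>sum[of "\<lambda>j. \<eta> \<bullet> j"] by (simp add: \<pi>_def)
    then have s0: "(\<Sum>j\<in>B. b (blinfun_apply (ee t) (\<pi> \<eta>)) (blinfun_apply (ee t) j) *\<^sub>R j) = 0"
      using 0 linear_0[OF lin\<pi>] by simp
    then have "b (blinfun_apply (ee t) j) (blinfun_apply (ee t) (\<pi> \<eta>)) = 0" if "j \<in> B" for j
      using inner_B[OF that, of "\<lambda>j. b (blinfun_apply (ee t) (\<pi> \<eta>)) (blinfun_apply (ee t) j)"] b_sym by simp
    then have "blinfun_apply (ee t) (\<pi> \<eta>) = 0"
      using orth \<pi>E by (intro orthogonal_zero[OF \<gamma>M(1)[OF t]]) (auto simp: T\<gamma>[OF t])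
    then have "\<pi> \<eta> = 0" using ee_inj[OF t] by blast
    then show "\<eta> = 0" using 0 s0 by (simp add: G)
  qed
  have "\<exists>I. \<bar>t\<bar> < e \<longrightarrow> I * Endo (G t) = 1 \<and> Endo (G t) * I = 1" for t
  proof (cases "\<bar>t\<bar> < e")
    case True
    have l: "linear (blinfun_apply (G t))" by (rule bounded_linear.linear[OF blinfun.bounded_linear_right])
    have "inj (blinfun_apply (G t))" using G0[OF True] linear_injective_0[OF l] by blast
    then obtain h where h: "linear h" "\<And>x. h (blinfun_apply (G t) x) = x" "\<And>x. blinfun_apply (G t) (h x) = x"
      using linear_injective_isomorphism[OF l] by metis
    have blh: "bounded_linear h" using h(1) by (simp add: linear_conv_bounded_linear)
    have "emap (Endo (G t)) = blinfun_apply (G t)" by (simp add: emap_def Endo_inverse)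
    then have "Endo (Blinfun h) * Endo (G t) = 1 \<and> Endo (G t) * Endo (Blinfun h) = 1"
      using h by (auto intro!: endo_eqI simp: emap_Endo[OF blh])
    then show ?thesis by blast
  qed auto
  then obtain I where I: "\<And>t. \<bar>t\<bar> < e \<Longrightarrow> I t * Endo (G t) = 1 \<and> Endo (G t) * I t = 1" by metis
  have C1I: "I C1_differentiable_on {-e<..<e}"
    by (rule inverse_curve_C1[OF open_greaterThanLessThan _ _ C1_bounded_linear[OF bounded_linear_Endo C1G]])
       (use I in \<open>auto simp: abs_less_iff\<close>)
  \<comment> \<open>The projection onto the tangent space, in terms of the frame.\<close>
  define PB where "PB t = ee t o\<^sub>L (endo_map (I t) o\<^sub>L cc t)" for t
  have C1PB: "PB C1_differentiable_on {-e<..<e}"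
    unfolding PB_def
    by (rule C1_bounded_bilinear[OF bounded_bilinear_blinfun_compose C1e
          C1_bounded_bilinear[OF bounded_bilinear_blinfun_compose C1_bounded_linear[OF bounded_linear_endo_map C1I] C1cc]])
  have PB: "blinfun_apply (PB t) v = P (\<gamma> t) v" if t: "\<bar>t\<bar> < e" for t v
  proof -
    define \<eta> where "\<eta> = emap (I t) (blinfun_apply (cc t) v)"
    have "emap (Endo (G t) * I t) (blinfun_apply (cc t) v) = blinfun_apply (cc t) v" using I[OF t] by simp
    then have G\<eta>: "blinfun_apply (G t) \<eta> = blinfun_apply (cc t) v" by (simp add: \<eta>_def) (simp add: emap_def Endo_inverse)
    have "\<pi> (blinfun_apply (G t) \<eta>) = blinfun_apply (G t) \<eta>" unfolding G\<eta> cc by (rule \<pi>sum)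
    moreover have "\<pi> (blinfun_apply (G t) \<eta>) = (\<Sum>j\<in>B. b (blinfun_apply (ee t) (\<pi> \<eta>)) (blinfun_apply (ee t) j) *\<^sub>R j)"
      unfolding G linear_add[OF lin\<pi>] linear_diff[OF lin\<pi>] \<pi>sum using \<pi>sum[of "\<lambda>j. \<eta> \<bullet> j"] by (simp add: \<pi>_def)
    ultimately have \<pi>\<eta>: "\<pi> \<eta> = \<eta>" by (simp add: G)
    have bj: "b (blinfun_apply (ee t) j) (v - blinfun_apply (ee t) \<eta>) = 0" if "j \<in> B" for j
    proof -
      have "(\<Sum>j\<in>B. b (blinfun_apply (ee t) \<eta>) (blinfun_apply (ee t) j) *\<^sub>R j) = (\<Sum>j\<in>B. b v (blinfun_apply (ee t) j) *\<^sub>R j)"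
        using G\<eta> by (simp add: G cc \<pi>\<eta>)
      from arg_cong[OF this, of "\<lambda>w. w \<bullet> j"] have "b (blinfun_apply (ee t) \<eta>) (blinfun_apply (ee t) j) = b v (blinfun_apply (ee t) j)"
        by (simp only: inner_B[OF that])
      then show ?thesis using b_sym[of "blinfun_apply (ee t) j"] by (simp add: b_simps)
    qed
    have "P (\<gamma> t) v = blinfun_apply (ee t) \<eta>"
    proof (rule P_unique[OF \<gamma>M(1)[OF t]])
      show "blinfun_apply (ee t) \<eta> \<in> T (\<gamma> t)" using \<pi>E[of \<eta>] by (simp add: T\<gamma>[OF t] \<pi>\<eta>)
      fix w assume "w \<in> T (\<gamma> t)"
      then show "b w (v - blinfun_apply (ee t) \<eta>) = 0" using orth[OF bj] by (auto simp: T\<gamma>[OF t])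
    qed
    then show ?thesis by (simp add: PB_def \<eta>_def emap_def)
  qed
  have "(\<lambda>t. s (\<gamma> t)) C1_differentiable_on {-e<..<e}"
  proof (rule C1_cong[OF open_greaterThanLessThan, where g="\<lambda>t. (id_blinfun - 2 *\<^sub>R PB t, 2 *\<^sub>R blinfun_apply (PB t) (\<gamma> t))"])
    fix t assume "t \<in> {-e<..<e}"
    then have t: "\<bar>t\<bar> < e" by (simp add: abs_less_iff)
    show "s (\<gamma> t) = (id_blinfun - 2 *\<^sub>R PB t, 2 *\<^sub>R blinfun_apply (PB t) (\<gamma> t))"
      by (rule aff_eqI)
         (simp only: aff_app_refl[OF \<gamma>M(1)[OF t]], simp add: aff_app_def PB[OF t] blinfun.bilinear_simps
            linear_diff[OF linear_P[OF \<gamma>M(1)[OF t]]] scaleR_diff_right)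
  next
    have C1\<gamma>: "\<gamma> C1_differentiable_on {-e<..<e}" using e(4) by (simp add: \<gamma>_def[abs_def])
    show "(\<lambda>t. (id_blinfun - 2 *\<^sub>R PB t, 2 *\<^sub>R blinfun_apply (PB t) (\<gamma> t))) C1_differentiable_on {-e<..<e}"
      by (rule C1_Pair[OF C1_differentiable_on_diff[OF C1_differentiable_on_const C1_bounded_linear[OF bounded_linear_scaleR_right C1PB]]
            C1_bounded_linear[OF bounded_linear_scaleR_right C1_bounded_bilinear[OF bounded_bilinear_blinfun_apply C1PB C1\<gamma>]]])
  qed
  moreover have "\<gamma> 0 = x" using gf[OF xU] by (simp add: \<gamma>_def)
  moreover have "(\<gamma> has_vector_derivative u) (at 0)"
    using e(5) dg_df[OF xU, of u] by (simp add: \<gamma>_def[abs_def] \<xi>_def)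
  ultimately show ?thesis using that[OF e(1)] \<gamma>M(1) by blast
qed

end

section \<open>The transvection group and its Lie algebra\<close>

lemma aff_bij:
  assumes "aff_comp A B = aff_id" "aff_comp B A = aff_id"
  shows "aff_app A \<in> Bij UNIV" "inv_into UNIV (aff_app A) = aff_app B"
proof -
  have AB: "aff_app A (aff_app B y) = y" "aff_app B (aff_app A y) = y" for y
    using arg_cong[OF assms(1), of "\<lambda>A. aff_app A y"] arg_cong[OF assms(2), of "\<lambda>A. aff_app A y"] by simp_all
  then have "bij (aff_app A)" by (intro o_bij[of "aff_app B"]) (auto simp: fun_eq_iff)
  then show "aff_app A \<in> Bij UNIV" by (simp add: Bij_def extensional_def)
  show "inv_into UNIV (aff_app A) = aff_app B" by (rule inv_equality) (simp_all add: AB)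
qed

lemma aff_app_inject: "aff_app A = aff_app B \<longleftrightarrow> A = B"
  by (metis aff_eqI)

lemma aff_app_has_vector_derivative:
  assumes S: "(S has_vector_derivative S') (at t)" and z: "(z has_vector_derivative z') (at t)"
  shows "((\<lambda>t. aff_app (S t) (z t)) has_vector_derivative aff_app S' (z t) + lin (S t) z') (at t)"
proof -
  have "((\<lambda>t. lin (S t) (z t) + snd (S t)) has_vector_derivative
      (lin (S t) z' + lin S' (z t)) + snd S') (at t)"
    by (rule has_vector_derivative_add[OF bounded_bilinear.has_vector_derivative[OF bounded_bilinear_blinfun_apply
          bounded_linear.has_vector_derivative[OF bounded_linear_fst S] z] bounded_linear.has_vector_derivative[OF bounded_linear_snd S]])
  then show ?thesis by (simp add: aff_app_def add.commute add.left_commute)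
qed

lemma bounded_linear_aff_comp_left: "bounded_linear (\<lambda>A. aff_comp A B)"
  unfolding aff_comp_def
  by (intro bounded_linear_Pair bounded_linear_add bounded_linear_snd
      bounded_linear_compose[OF bounded_bilinear.bounded_linear_left[OF bounded_bilinear_blinfun_compose] bounded_linear_fst]
      bounded_linear_compose[OF blinfun.bounded_linear_left bounded_linear_fst])

context extrinsic_space
begin

text \<open>The transvection group in terms of pairs of linear part and translation (see
  \<open>transvection_group_iff\<close>). The products \<open>s x \<circ> s y\<close> are closed under
  inversion, so that they generate the group as a monoid.\<close>

inductive_set Kg :: "'a aff set" where
  Kg_id: "aff_id \<in> Kg"
| Kg_mult: "x \<in> M \<Longrightarrow> y \<in> M \<Longrightarrow> A \<in> Kg \<Longrightarrow> aff_comp (aff_comp (s x) (s y)) A \<in> Kg"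

lemma Kg_transvection: "x \<in> M \<Longrightarrow> y \<in> M \<Longrightarrow> aff_comp (s x) (s y) \<in> Kg"
  using Kg_mult[OF _ _ Kg_id] by simp

lemma Kg_comp: "A \<in> Kg \<Longrightarrow> B \<in> Kg \<Longrightarrow> aff_comp A B \<in> Kg"
  by (induction rule: Kg.induct) (auto simp: aff_comp_assoc intro: Kg_mult[unfolded aff_comp_assoc])

lemma refl_refl_app: "x \<in> M \<Longrightarrow> aff_app (s x) (aff_app (s x) y) = y"
  using arg_cong[OF refl_invol, of x "\<lambda>A. aff_app A y"] by simp

lemma refl_invol': "x \<in> M \<Longrightarrow> aff_comp (s x) (aff_comp (s x) A) = A"
  using refl_invol[of x] by (simp add: aff_comp_assoc[symmetric])

lemma transvection_inverse:
  "x \<in> M \<Longrightarrow> y \<in> M \<Longrightarrow> aff_comp (aff_comp (s x) (s y)) (aff_comp (s y) (s x)) = aff_id"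
  by (simp add: aff_comp_assoc refl_invol' refl_invol)

lemma Kg_inverse: "A \<in> Kg \<Longrightarrow> \<exists>B\<in>Kg. aff_comp A B = aff_id \<and> aff_comp B A = aff_id"
proof (induction rule: Kg.induct)
  case Kg_id
  then show ?case by (intro bexI[of _ aff_id]) (auto intro: Kg.Kg_id)
next
  case (Kg_mult x y A)
  then obtain B where B: "B \<in> Kg" "aff_comp A B = aff_id" "aff_comp B A = aff_id" by blast
  have AB: "aff_comp A (aff_comp B C) = C" for C using B(2) by (simp add: aff_comp_assoc[symmetric])
  show ?case
  proof (intro bexI[of _ "aff_comp B (aff_comp (s y) (s x))"] conjI)
    show "aff_comp (aff_comp (aff_comp (s x) (s y)) A) (aff_comp B (aff_comp (s y) (s x))) = aff_id"
      using Kg_mult(1,2) by (simp add: aff_comp_assoc AB refl_invol' refl_invol)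
    show "aff_comp (aff_comp B (aff_comp (s y) (s x))) (aff_comp (aff_comp (s x) (s y)) A) = aff_id"
      using Kg_mult(1,2) by (simp add: aff_comp_assoc refl_invol' B)
    show "aff_comp B (aff_comp (s y) (s x)) \<in> Kg" using Kg_mult(1,2) B(1) by (intro Kg_comp Kg_transvection)
  qed
qed

sublocale K: affine_group Kg
  by unfold_locales (rule Kg_id, erule (1) Kg_comp, erule Kg_inverse)

lemma refl_M: "x \<in> M \<Longrightarrow> y \<in> M \<Longrightarrow> aff_app (s x) y \<in> M"
  using refl_image by blast

lemma Kg_M: "A \<in> Kg \<Longrightarrow> y \<in> M \<Longrightarrow> aff_app A y \<in> M"
  by (induction arbitrary: y rule: Kg.induct) (auto simp: refl_M)

lemma Kg_isometry: "A \<in> Kg \<Longrightarrow> b (lin A u) (lin A v) = b u v"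
  by (induction arbitrary: u v rule: Kg.induct) (auto simp: refl_isometry)

lemma Kg_refl_conj: "A \<in> Kg \<Longrightarrow> x \<in> M \<Longrightarrow> aff_comp (s x) (aff_comp A (s x)) \<in> Kg"
proof (induction rule: Kg.induct)
  case (Kg_mult y z A)
  have "aff_comp (aff_comp (aff_comp (s x) (s y)) (aff_comp (s z) (s x))) (aff_comp (s x) (aff_comp A (s x))) \<in> Kg"
    by (rule Kg_comp[OF Kg_comp[OF Kg_transvection Kg_transvection]]) (use Kg_mult in auto)
  then show ?case using Kg_mult(5) by (simp add: aff_comp_assoc refl_invol')
qed (simp add: refl_invol Kg.Kg_id)

lemma transvection_group_iff: "aff_app A \<in> transvection_group b M \<longleftrightarrow> A \<in> Kg"
proof
  let ?H = "{aff_app (s x) \<circ> aff_app (s y) | x y. x \<in> M \<and> y \<in> M}"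
  have bij: "aff_app B \<in> Bij UNIV" if "B \<in> Kg" for B using Kg_inverse[OF that] aff_bij(1) by blast
  have one: "\<one>\<^bsub>BijGroup UNIV\<^esub> = aff_app (aff_id :: 'a aff)" by (simp add: BijGroup_def fun_eq_iff)
  have mult: "aff_app B \<otimes>\<^bsub>BijGroup UNIV\<^esub> aff_app C = aff_app (aff_comp B C)" if "B \<in> Kg" "C \<in> Kg" for B C
    using bij[OF that(1)] bij[OF that(2)] by (simp add: BijGroup_def compose_def fun_eq_iff)
  have gen: "\<exists>B\<in>Kg. h = aff_app B" if "h \<in> generate (BijGroup UNIV) ?H" for h
    using that
  proof (induction rule: generate.induct)
    case one
    then show ?case using \<open>\<one>\<^bsub>BijGroup UNIV\<^esub> = aff_app aff_id\<close> Kg_id by blast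
  next
    case (incl h)
    then obtain x y where xy: "x \<in> M" "y \<in> M" "h = aff_app (s x) \<circ> aff_app (s y)" by blast
    then show ?case by (intro bexI[OF _ Kg_transvection[OF xy(1,2)]]) auto
  next
    case (inv h)
    then obtain x y where xy: "x \<in> M" "y \<in> M" "h = aff_app (s x) \<circ> aff_app (s y)" by blast
    have h: "h = aff_app (aff_comp (s x) (s y))" using xy(3) by auto
    note B = aff_bij[OF transvection_inverse[OF xy(1,2)] transvection_inverse[OF xy(2,1)]]
    have "inv\<^bsub>BijGroup UNIV\<^esub> h = aff_app (aff_comp (s y) (s x))"
      using B unfolding h by (subst inv_BijGroup) auto
    then show ?case using Kg_transvection[OF xy(2,1)] by blast
  next
    case (eng h1 h2)
    then obtain B C where BC: "B \<in> Kg" "C \<in> Kg" "h1 = aff_app B" "h2 = aff_app C" by blast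
    show ?case unfolding BC(3,4) mult[OF BC(1,2)] using Kg_comp[OF BC(1,2)] by blast
  qed
  show "A \<in> Kg" if A: "aff_app A \<in> transvection_group b M"
  proof -
    obtain B where "B \<in> Kg" "aff_app A = aff_app B" using gen[OF A[unfolded transvection_group_def]] by blast
    then show ?thesis by (simp add: aff_app_inject)
  qed
  show "aff_app A \<in> transvection_group b M" if "A \<in> Kg"
    using that unfolding transvection_group_def
  proof induction
    case Kg_id
    show ?case unfolding one[symmetric] by (rule generate.one)
  next
    case (Kg_mult x y A)
    have "aff_app (aff_comp (s x) (s y)) \<in> generate (BijGroup UNIV) ?H"
    proof (rule generate.incl)
      show "aff_app (aff_comp (s x) (s y)) \<in> ?H"
        using Kg_mult(1,2) by (intro CollectI exI[of _ x] exI[of _ y]) (auto simp: fun_eq_iff)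
    qed
    from generate.eng[OF this Kg_mult(4)]
    show ?case by (simp only: mult[OF Kg_transvection[OF Kg_mult(1,2)] Kg_mult(3)])
  qed
qed

abbreviation k where "k \<equiv> k_alg b M"

lemma k_eq: "k = velocities Kg aff_id"
  by (simp add: k_alg_def transvection_group_iff)

lemma sub_k: "subspace k" unfolding k_eq by (rule K.subspace_velocities)

lemma k_bracket: "A \<in> k \<Longrightarrow> B \<in> k \<Longrightarrow> aff_bracket A B \<in> k"
  unfolding k_eq by (rule K.velocities_bracket)

lemma k_conj:
  assumes "A \<in> Kg" "B \<in> Kg" "aff_comp A B = aff_id" "X \<in> k"
  shows "aff_conj A B X \<in> k"
  using assms unfolding k_eq by (intro K.velocities_conj Kg_comp)

lemma k_refl_conj: "x \<in> M \<Longrightarrow> X \<in> k \<Longrightarrow> aff_conj (s x) (s x) X \<in> k"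
  unfolding k_eq by (intro K.velocities_conj Kg_refl_conj refl_invol)

text \<open>Apply the curve in the group to the point \<open>y\<close>.\<close>

lemma k_tangent: "A \<in> k \<Longrightarrow> y \<in> M \<Longrightarrow> aff_app A y \<in> T y"
  using velocities_affine_image[OF bounded_linear_aff_app[of y], of Kg 0 M A aff_id] Kg_M
  unfolding k_eq tangent_space_def by simp

text \<open>Differentiate the invariance of \<open>b\<close> under the linear parts.\<close>

lemma k_skew:
  assumes "A \<in> k"
  shows "b (lin A u) v + b u (lin A v) = 0"
proof -
  from assms have A: "A \<in> velocities Kg aff_id" by (simp add: k_eq)
  obtain e c where c: "0 < e" "c C1_differentiable_on {-e<..<e}" "\<forall>t. \<bar>t\<bar> < e \<longrightarrow> c t \<in> Kg" "c 0 = aff_id" "(c has_vector_derivative A) (at 0)"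
    by (rule velocitiesE[OF A]) (rule that)
  have lin: "bounded_linear (\<lambda>A::'a aff. lin A w)" for w
    by (rule bounded_linear_compose[OF blinfun.bounded_linear_left bounded_linear_fst])
  have d: "((\<lambda>t. b (lin (c t) u) (lin (c t) v)) has_vector_derivative
     b (lin (c 0) u) (lin A v) + b (lin A u) (lin (c 0) v)) (at 0)"
    by (rule bounded_bilinear.has_vector_derivative[OF bounded_bilinear_b bounded_linear.has_vector_derivative[OF lin c(5)]
          bounded_linear.has_vector_derivative[OF lin c(5)]])
  have "((\<lambda>t. b (lin (c t) u) (lin (c t) v)) has_vector_derivative 0) (at 0)"
  proof (rule has_vector_derivative_transform_within_open[of "\<lambda>_. b u v" _ _ "{-e<..<e}"])
    fix t assume "t \<in> {-e<..<e}"
    then have "\<bar>t\<bar> < e" by (simp add: abs_less_iff)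
    then show "b u v = b (lin (c t) u) (lin (c t) v)"
      using c(3) Kg_isometry by simp
  qed (use c(1) in auto)
  from vector_derivative_unique_at[OF d this] show ?thesis by (simp add: c(4) add.commute)
qed

text \<open>The infinitesimal transvections at \<open>x\<close>.\<close>

definition kminus where "kminus x = {A \<in> k. aff_conj (s x) (s x) A = - A}"

lemma sub_kminus: "subspace (kminus x)"
  unfolding kminus_def subspace_def
proof (intro conjI ballI allI; (elim CollectE conjE)?)
  have "aff_conj (s x) (s x) 0 = - 0" using aff_conj_linear(3)[of "s x" "s x" 0 0] by simp
  then show "0 \<in> {A \<in> k. aff_conj (s x) (s x) A = - A}" using subspace_0[OF sub_k] by simp
qed (simp_all add: aff_conj_linear subspace_add[OF sub_k] subspace_scale[OF sub_k])

text \<open>If \<open>A\<close> vanishes at \<open>x\<close>, its linear part preserves the tangent space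
  \<open>T x\<close>, because \<open>A\<close> is a vector field tangent to \<open>M\<close>.
  Anti-invariance, on the other hand, means that the linear part interchanges tangent and normal space.
  So it vanishes on \<open>T x\<close>, and by skewness and non-degeneracy also on normal
  vectors.\<close>

lemma kminus_determined:
  assumes x: "x \<in> M" and A: "A \<in> kminus x" and 0: "aff_app A x = 0"
  shows "A = 0"
proof -
  have Ak: "A \<in> k" and conj: "aff_conj (s x) (s x) A = - A" using A by (auto simp: kminus_def)
  have anti: "lin (s x) (lin A (lin (s x) v)) = - lin A v" for v
    using arg_cong[OF conj, of "\<lambda>B. lin B v"] by (simp add: blinfun.minus_left)
  \<comment> \<open>The derivative of the tangent vector field \<open>A\<close> at its zero
    \<open>x\<close> along a curve in \<open>M\<close>: in the chart, \<open>f' (\<gamma> t) (A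
    (\<gamma> t))\<close> stays in \<open>E\<close>.\<close>
  have tan: "lin A u \<in> T x" if u: "u \<in> T x" for u
  proof -
    obtain U W E f g f' g' f'' g'' where "slice_chart M U W E f g f' g' f'' g''" and xU: "x \<in> U"
      by (rule submanifold_chart[OF sub_M x])
    then interpret slice_chart M U W E f g f' g' f'' g'' by simp
    define \<xi> where "\<xi> = blinfun_apply (f' x) u"
    have \<xi>E: "\<xi> \<in> E" using u tangent_iff[OF xU x] by (simp add: \<xi>_def)
    obtain e where e: "0 < e" "\<And>t. \<bar>t\<bar> < e \<Longrightarrow> g (f x + t *\<^sub>R \<xi>) \<in> M \<inter> U"
      "((\<lambda>t. g (f x + t *\<^sub>R \<xi>)) has_vector_derivative blinfun_apply (g' (f x)) \<xi>) (at 0)"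
      using chart_line[OF xU x \<xi>E] by metis
    define \<gamma> where "\<gamma> t = g (f x + t *\<^sub>R \<xi>)" for t
    have \<gamma>0: "\<gamma> 0 = x" using gf[OF xU] by (simp add: \<gamma>_def)
    have \<gamma>': "(\<gamma> has_vector_derivative u) (at 0)" using e(3) dg_df[OF xU, of u] by (simp add: \<gamma>_def[abs_def] \<xi>_def)
    have "(f' has_derivative blinfun_apply (f'' (\<gamma> 0))) (at (\<gamma> 0))" using C1_derivativeD[OF Cf(2)] xU \<gamma>0 by simp
    with vector_derivative_diff_chain_within[OF \<gamma>' has_derivative_at_withinI[OF this]]
    have "((\<lambda>t. f' (\<gamma> t)) has_vector_derivative blinfun_apply (f'' x) u) (at 0)" by (simp add: o_def \<gamma>0)
    moreover have "((\<lambda>t. aff_app A (\<gamma> t)) has_vector_derivative lin A u) (at 0)"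
      using aff_app_has_vector_derivative[OF has_vector_derivative_const \<gamma>', of A] by simp
    ultimately have "((\<lambda>t. blinfun_apply (f' (\<gamma> t)) (aff_app A (\<gamma> t))) has_vector_derivative
       blinfun_apply (f' (\<gamma> 0)) (lin A u) + blinfun_apply (blinfun_apply (f'' x) u) (aff_app A (\<gamma> 0))) (at 0)"
      by (rule bounded_bilinear.has_vector_derivative[OF bounded_bilinear_blinfun_apply])
    then have lim: "((\<lambda>t. (blinfun_apply (f' (\<gamma> t)) (aff_app A (\<gamma> t)) - blinfun_apply (f' (\<gamma> 0)) (aff_app A (\<gamma> 0))) /\<^sub>R (t - 0))
       \<longlongrightarrow> blinfun_apply (f' x) (lin A u)) (at 0)"
      by (simp add: has_vector_derivative_iff_tendsto \<gamma>0 0 blinfun.zero_right)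
    have inE: "blinfun_apply (f' (\<gamma> t)) (aff_app A (\<gamma> t)) \<in> E" if "\<bar>t\<bar> < e" for t
      using e(2)[OF that] k_tangent[OF Ak] tangent_iff by (auto simp: \<gamma>_def)
    have "\<forall>\<^sub>F t in at 0. \<bar>t\<bar> < e" using e(1) by (auto simp: eventually_at intro!: exI[of _ e])
    then have "\<forall>\<^sub>F t in at 0. (blinfun_apply (f' (\<gamma> t)) (aff_app A (\<gamma> t)) - blinfun_apply (f' (\<gamma> 0)) (aff_app A (\<gamma> 0))) /\<^sub>R (t - 0) \<in> E"
      by eventually_elim (intro subspace_scale subspace_diff E inE, use e(1) in auto)
    then have "blinfun_apply (f' x) (lin A u) \<in> E"
      using Lim_in_closed_set[OF closed_subspace[OF E] _ _ lim] by simp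
    then show ?thesis by (simp add: tangent_iff[OF xU x])
  qed
  \<comment> \<open>By anti-invariance \<open>lin A u\<close> is normal as well as tangent.\<close>
  have dT: "lin A u = 0" if u: "u \<in> T x" for u
  proof -
    have 1: "lin (s x) (lin A u) = - lin A u"
      using refl_tangent_iff[OF x] tan[OF u] by blast
    have "lin (s x) u = - u" using refl_tangent_iff[OF x] u by blast
    then have "lin (s x) (lin A u) = lin A u"
      using anti[of u] by (simp add: blinfun.minus_right)
    with 1 have "lin A u = - lin A u" by simp
    from arg_cong[OF this, of "\<lambda>z. lin A u + z"]
    have "2 *\<^sub>R lin A u = 0" unfolding scaleR_2 by (rule trans) simp
    then show ?thesis by simp
  qed
  have dN: "lin A n = 0" if n: "P x n = 0" for n
  proof (rule orthogonal_zero[OF x])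
    have "lin (s x) n = n" using n by (simp add: fst_refl[OF x])
    then show "lin A n \<in> T x" using anti[of n] refl_tangent_iff[OF x] by simp
    fix t assume "t \<in> T x"
    then show "b t (lin A n) = 0" using k_skew[OF Ak, of t n] dT by (simp add: b_simps)
  qed
  have "lin A v = 0" for v
  proof -
    have "P x (v - P x v) = 0" by (simp add: linear_diff[OF linear_P[OF x]] P_P[OF x])
    then have "lin A (v - P x v) = 0" by (rule dN)
    then show ?thesis using dT[OF P_in[OF x, of v]] by (simp add: blinfun.diff_right)
  qed
  then show ?thesis using 0 by (intro aff_eqI) (metis aff_app_diff aff_app_zero diff_0_right)
qed

text \<open>Half of the velocity of \<open>s (\<gamma> t) \<circ> s x\<close>, where
  \<open>\<gamma>\<close> is a curve in \<open>M\<close> with velocity \<open>u\<close>. Its value at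
  \<open>x\<close> is found by differentiating \<open>s (\<gamma> t) (\<gamma> t) = \<gamma> t\<close>,
  its anti-invariance by differentiating \<open>s (\<gamma> t) \<circ> s (\<gamma> t) =
  id\<close>.\<close>

lemma kminus_exists:
  assumes x: "x \<in> M" and u: "u \<in> T x"
  shows "\<exists>A\<in>kminus x. aff_app A x = u"
proof -
  obtain e \<gamma> where e: "0 < e" "\<gamma> 0 = x" "(\<gamma> has_vector_derivative u) (at 0)" "\<And>t. \<bar>t\<bar> < e \<Longrightarrow> \<gamma> t \<in> M"
    "(\<lambda>t. s (\<gamma> t)) C1_differentiable_on {-e<..<e}"
    using reflection_curve[OF x u] by metis
  obtain D where "\<forall>t\<in>{-e<..<e}. ((\<lambda>t. s (\<gamma> t)) has_vector_derivative D t) (at t)"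
    using e(5) unfolding C1_differentiable_on_def by blast
  then have "((\<lambda>t. s (\<gamma> t)) has_vector_derivative D 0) (at 0)" using e(1) by simp
  then obtain S' where S': "((\<lambda>t. s (\<gamma> t)) has_vector_derivative S') (at 0)" by blast
  have ev: "(h has_vector_derivative h') (at 0)"
    if "(h1 has_vector_derivative h') (at 0)" "\<And>t. \<bar>t\<bar> < e \<Longrightarrow> h1 t = h t" for h h1 :: "real \<Rightarrow> 'a" and h'
    by (rule has_vector_derivative_transform_within_open[OF that(1), of "{-e<..<e}"]) (use e(1) that(2) in \<open>auto simp: abs_less_iff\<close>)
  have val: "aff_app S' x = 2 *\<^sub>R u"
  proof -
    have "((\<lambda>t. aff_app (s (\<gamma> t)) (\<gamma> t)) has_vector_derivative aff_app S' (\<gamma> 0) + lin (s (\<gamma> 0)) u) (at 0)"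
      by (rule aff_app_has_vector_derivative[OF S' e(3)])
    moreover have "((\<lambda>t. aff_app (s (\<gamma> t)) (\<gamma> t)) has_vector_derivative u) (at 0)"
      by (rule ev[OF e(3)]) (simp add: refl_fix e(4))
    ultimately have "aff_app S' (\<gamma> 0) + lin (s (\<gamma> 0)) u = u" by (rule vector_derivative_unique_at)
    then have "aff_app S' x + lin (s x) u = u" by (simp add: e(2))
    moreover have "lin (s x) u = - u" using refl_tangent_iff[OF x] u by blast
    ultimately show ?thesis by (simp add: scaleR_2 algebra_simps)
  qed
  have anti: "aff_app S' (aff_app (s x) y) + lin (s x) (aff_app S' y) = 0" for y
  proof -
    have 1: "((\<lambda>t. aff_app (s (\<gamma> t)) y) has_vector_derivative aff_app S' y) (at 0)"
      by (rule bounded_linear.has_vector_derivative[OF bounded_linear_aff_app S'])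
    have "((\<lambda>t. aff_app (s (\<gamma> t)) (aff_app (s (\<gamma> t)) y)) has_vector_derivative
       aff_app S' (aff_app (s (\<gamma> 0)) y) + lin (s (\<gamma> 0)) (aff_app S' y)) (at 0)"
      by (rule aff_app_has_vector_derivative[OF S' 1])
    moreover have "((\<lambda>t. aff_app (s (\<gamma> t)) (aff_app (s (\<gamma> t)) y)) has_vector_derivative 0) (at 0)"
    proof (rule ev[OF has_vector_derivative_const[of y]])
      fix t assume "\<bar>t\<bar> < e"
      then show "y = aff_app (s (\<gamma> t)) (aff_app (s (\<gamma> t)) y)" by (simp add: refl_refl_app e(4))
    qed
    ultimately have "aff_app S' (aff_app (s (\<gamma> 0)) y) + lin (s (\<gamma> 0)) (aff_app S' y) = 0"
      by (rule vector_derivative_unique_at)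
    then show ?thesis by (simp add: e(2))
  qed
  define A where "A = aff_comp S' (s x)"
  have A: "aff_app A y = aff_app S' (aff_app (s x) y)" for y by (simp add: A_def)
  have "A \<in> velocities Kg (aff_comp (s (\<gamma> 0)) (s x))"
  proof (rule velocitiesI[OF e(1), of "\<lambda>t. aff_comp (s (\<gamma> t)) (s x)"])
    show "(\<lambda>t. aff_comp (s (\<gamma> t)) (s x)) C1_differentiable_on {-e<..<e}"
      by (rule C1_bounded_linear[OF bounded_linear_aff_comp_left e(5)])
    show "((\<lambda>t. aff_comp (s (\<gamma> t)) (s x)) has_vector_derivative A) (at 0)"
      unfolding A_def by (rule bounded_linear.has_vector_derivative[OF bounded_linear_aff_comp_left S'])
  qed (auto intro: Kg_transvection x e(4))
  then have Ak: "A \<in> k" by (simp add: k_eq e(2) refl_invol[OF x])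
  have "aff_conj (s x) (s x) A = - A"
  proof (rule aff_eqI)
    fix y
    have "aff_app (s x) (aff_app (s x) y) = y" by (rule refl_refl_app[OF x])
    then show "aff_app (aff_conj (s x) (s x) A) y = aff_app (- A) y"
      using anti[of y] by (simp add: aff_app_conj A eq_neg_iff_add_eq_0 add.commute)
  qed
  then have "A \<in> kminus x" using Ak by (simp add: kminus_def)
  then have "(1/2) *\<^sub>R A \<in> kminus x" by (rule subspace_scale[OF sub_kminus])
  moreover have "aff_app ((1/2) *\<^sub>R A) x = u" by (simp add: A refl_fix[OF x] val)
  ultimately show ?thesis by blast
qed

end

section \<open>Local Lipschitz bounds\<close>

definition locally_lipschitz :: "('a::real_normed_vector \<Rightarrow> 'b::real_normed_vector) \<Rightarrow> 'a \<Rightarrow> bool" where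
  "locally_lipschitz f x0 \<longleftrightarrow> (\<exists>r>0. \<exists>L>0. \<forall>p\<in>ball x0 r. \<forall>q\<in>ball x0 r. norm (f p - f q) \<le> L * norm (p - q))"

lemma C1_locally_lipschitz:
  assumes f: "C1_derivative S f f'" and S: "open S" "x0 \<in> S"
  shows "locally_lipschitz f x0"
proof -
  have "isCont f' x0" using f S by (simp add: C1_derivative_def continuous_on_eq_continuous_at)
  then have "((\<lambda>x. norm (f' x)) \<longlongrightarrow> norm (f' x0)) (nhds x0)"
    by (intro tendsto_norm) (simp add: isCont_def tendsto_at_iff_tendsto_nhds)
  then have "\<forall>\<^sub>F x in nhds x0. norm (f' x) < norm (f' x0) + 1" by (rule order_tendstoD) simp
  moreover have "\<forall>\<^sub>F x in nhds x0. x \<in> S" using S by (rule eventually_nhds_in_open)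
  ultimately have "\<forall>\<^sub>F x in nhds x0. norm (f' x) < norm (f' x0) + 1 \<and> x \<in> S" by (rule eventually_conj)
  then obtain r where r: "0 < r" "\<And>x. dist x x0 < r \<Longrightarrow> norm (f' x) < norm (f' x0) + 1 \<and> x \<in> S"
    unfolding eventually_nhds_metric by blast
  have "norm (f p - f q) \<le> (norm (f' x0) + 1) * norm (p - q)" if "p \<in> ball x0 r" "q \<in> ball x0 r" for p q
  proof (rule differentiable_bound[OF convex_ball _ _ that])
    fix x assume "x \<in> ball x0 r"
    then have x: "dist x x0 < r" by (simp add: dist_commute)
    show "(f has_derivative blinfun_apply (f' x)) (at x within ball x0 r)"
      using C1_derivativeD[OF f] r(2)[OF x] by (blast intro: has_derivative_at_withinI)
    show "onorm (blinfun_apply (f' x)) \<le> norm (f' x0) + 1"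
      using r(2)[OF x] by (simp add: norm_blinfun.rep_eq[symmetric])
  qed
  moreover have "0 < norm (f' x0) + 1" by (simp add: add_nonneg_pos)
  ultimately show ?thesis unfolding locally_lipschitz_def using r(1) by blast
qed

lemma locally_lipschitz_aff_app: "locally_lipschitz (aff_app A) x0"
proof -
  have "norm (aff_app A p - aff_app A q) \<le> (norm (fst A) + 1) * norm (p - q)" for p q
    unfolding aff_app_diff by (rule order_trans[OF norm_blinfun]) (simp add: distrib_right)
  moreover have "0 < norm (fst A) + 1" by (simp add: add_nonneg_pos)
  ultimately show ?thesis unfolding locally_lipschitz_def by (intro exI[of _ 1] exI[of _ "norm (fst A) + 1"]) auto
qed

lemma locally_lipschitz_compose:
  assumes g: "locally_lipschitz g w" and f: "locally_lipschitz f (g w)"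
  shows "locally_lipschitz (\<lambda>x. f (g x)) w"
proof -
  obtain r L where g': "0 < r" "0 < L" "\<And>p q. p \<in> ball w r \<Longrightarrow> q \<in> ball w r \<Longrightarrow> norm (g p - g q) \<le> L * norm (p - q)"
    using g unfolding locally_lipschitz_def by blast
  obtain r' L' where f': "0 < r'" "0 < L'" "\<And>p q. p \<in> ball (g w) r' \<Longrightarrow> q \<in> ball (g w) r' \<Longrightarrow> norm (f p - f q) \<le> L' * norm (p - q)"
    using f unfolding locally_lipschitz_def by blast
  define \<rho> where "\<rho> = min r (r' / L)"
  have in_ball: "p \<in> ball w r \<and> g p \<in> ball (g w) r'" if p: "p \<in> ball w \<rho>" for p
  proof
    show pr: "p \<in> ball w r" using p by (simp add: \<rho>_def)
    have "norm (g w - g p) \<le> L * norm (w - p)" using g'(1) pr by (intro g'(3)) auto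
    also have "\<dots> < L * (r' / L)" using p g'(2) by (intro mult_strict_left_mono) (auto simp: \<rho>_def dist_norm)
    finally show "g p \<in> ball (g w) r'" using g'(2) by (simp add: dist_norm)
  qed
  have "norm (f (g p) - f (g q)) \<le> (L' * L) * norm (p - q)" if "p \<in> ball w \<rho>" "q \<in> ball w \<rho>" for p q
  proof -
    have "norm (f (g p) - f (g q)) \<le> L' * norm (g p - g q)" using in_ball that by (intro f'(3)) auto
    also have "\<dots> \<le> L' * (L * norm (p - q))" using in_ball that f'(2) by (intro mult_left_mono g'(3)) auto
    finally show ?thesis by (simp add: mult.assoc)
  qed
  moreover have "0 < \<rho>" "0 < L' * L" using g'(1,2) f'(1,2) by (simp_all add: \<rho>_def)
  ultimately show ?thesis unfolding locally_lipschitz_def by blast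
qed

lemma locally_lipschitz_bilinear:
  assumes B: "bounded_bilinear B" and f: "locally_lipschitz f w" and g: "locally_lipschitz g w"
  shows "locally_lipschitz (\<lambda>x. B (f x) (g x)) w"
proof -
  obtain r L where f': "0 < r" "0 < L" "\<And>p q. p \<in> ball w r \<Longrightarrow> q \<in> ball w r \<Longrightarrow> norm (f p - f q) \<le> L * norm (p - q)"
    using f unfolding locally_lipschitz_def by blast
  obtain r' L' where g': "0 < r'" "0 < L'" "\<And>p q. p \<in> ball w r' \<Longrightarrow> q \<in> ball w r' \<Longrightarrow> norm (g p - g q) \<le> L' * norm (p - q)"
    using g unfolding locally_lipschitz_def by blast
  obtain K where K: "0 < K" "\<And>a b. norm (B a b) \<le> norm a * norm b * K" using bounded_bilinear.pos_bounded[OF B] by blast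
  define \<rho> where "\<rho> = min r r'"
  define F where "F = norm (f w) + L * \<rho>"
  define G where "G = norm (g w) + L' * \<rho>"
  have \<rho>: "0 < \<rho>" "ball w \<rho> \<subseteq> ball w r" "ball w \<rho> \<subseteq> ball w r'" "w \<in> ball w \<rho>" using f'(1) g'(1) by (auto simp: \<rho>_def)
  have Fb: "norm (f p) \<le> F" if "p \<in> ball w \<rho>" for p
  proof -
    have "norm (f p) \<le> norm (f w) + norm (f p - f w)" by (rule norm_triangle_sub)
    also have "norm (f p - f w) \<le> L * norm (p - w)" using that \<rho> by (intro f'(3)) blast+
    also have "L * norm (p - w) \<le> L * \<rho>" using that f'(2) by (intro mult_left_mono) (auto simp: dist_norm norm_minus_commute)
    finally show ?thesis by (simp add: F_def)
  qed
  have Gb: "norm (g p) \<le> G" if "p \<in> ball w \<rho>" for p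
  proof -
    have "norm (g p) \<le> norm (g w) + norm (g p - g w)" by (rule norm_triangle_sub)
    also have "norm (g p - g w) \<le> L' * norm (p - w)" using that \<rho> by (intro g'(3)) blast+
    also have "L' * norm (p - w) \<le> L' * \<rho>" using that g'(2) by (intro mult_left_mono) (auto simp: dist_norm norm_minus_commute)
    finally show ?thesis by (simp add: G_def)
  qed
  have FG: "0 < F" "0 < G" using \<rho>(1) f'(2) g'(2) by (simp_all add: F_def G_def add_nonneg_pos)
  have "norm (B (f p) (g p) - B (f q) (g q)) \<le> ((L * G + F * L') * K) * norm (p - q)"
    if pq: "p \<in> ball w \<rho>" "q \<in> ball w \<rho>" for p q
  proof -
    have "B (f p) (g p) - B (f q) (g q) = B (f p - f q) (g p) + B (f q) (g p - g q)"
      by (simp add: bounded_bilinear.diff_left[OF B] bounded_bilinear.diff_right[OF B])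
    also have "norm \<dots> \<le> norm (f p - f q) * norm (g p) * K + norm (f q) * norm (g p - g q) * K"
      by (intro norm_triangle_mono K)
    also have "\<dots> \<le> (L * norm (p - q)) * G * K + F * (L' * norm (p - q)) * K"
    proof (intro add_mono mult_right_mono mult_mono)
      show "norm (f p - f q) \<le> L * norm (p - q)" using pq \<rho> by (intro f'(3)) blast+
      show "norm (g p - g q) \<le> L' * norm (p - q)" using pq \<rho> by (intro g'(3)) blast+
    qed (use Fb Gb pq K(1) FG f'(2) in auto)
    finally show ?thesis by (simp add: algebra_simps)
  qed
  moreover have "0 < (L * G + F * L') * K" using FG f'(2) g'(2) K(1) by (simp add: add_pos_pos)
  ultimately show ?thesis unfolding locally_lipschitz_def using \<rho>(1) by blast
qed

section \<open>Flows of infinitesimal transvections\<close>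

lemma continuous_on_flow: "continuous_on UNIV (\<lambda>p. aff_app (aexp (fst p *\<^sub>R A)) (snd p))"
proof -
  have "continuous_on UNIV (\<lambda>p::real \<times> 'a. exp (fst p *\<^sub>R lie_mat A))"
    by (intro continuous_on_exp_algebra continuous_intros)
  moreover have "continuous_on UNIV (\<lambda>p::real \<times> 'a. (snd p, 1::real))" by (intro continuous_intros)
  ultimately have "continuous_on UNIV (\<lambda>p::real \<times> 'a. fst (emap (exp (fst p *\<^sub>R lie_mat A)) (snd p, 1)))"
    by (intro continuous_on_fst bounded_bilinear.continuous_on[OF bounded_bilinear_emap])
  then show ?thesis by (simp add: aff_app_eq_emap grp_mat_aexp lie_mat_scaleR)
qed

lemma euclidean_projection_exists:
  assumes "subspace (E :: 'a::euclidean_space set)"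
  obtains \<pi> where "bounded_linear \<pi>" "\<And>v. \<pi> v \<in> E" "\<And>v. v \<in> E \<Longrightarrow> \<pi> v = v"
proof -
  have "\<exists>g. g ` UNIV \<subseteq> E \<and> linear g \<and> (\<forall>v\<in>E. g (id v) = v)"
    by (rule linear_exists_left_inverse_on[OF linear_id assms]) auto
  then show ?thesis using that by (auto simp: image_subset_iff linear_conv_bounded_linear)
qed

text \<open>The component of the flow transversal to \<open>W\<close> satisfies a linear differential
  inequality and starts at \<open>0\<close>.\<close>

lemma aexp_invariant_subspace:
  assumes W: "subspace W" and X: "\<And>y. y \<in> W \<Longrightarrow> aff_app X y \<in> W" and y: "y \<in> W"
  shows "aff_app (aexp X) y \<in> W"
proof -
  obtain \<pi> where \<pi>: "bounded_linear \<pi>" "\<And>v. \<pi> v \<in> W" "\<And>v. v \<in> W \<Longrightarrow> \<pi> v = v"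
    using euclidean_projection_exists[OF W] by blast
  define Q where "Q v = v - \<pi> v" for v
  have blQ: "bounded_linear Q" unfolding Q_def by (intro bounded_linear_sub bounded_linear_ident \<pi>(1))
  interpret Q: bounded_linear Q by (rule blQ)
  have Q0: "Q v = 0" if "v \<in> W" for v using \<pi>(3)[OF that] by (simp add: Q_def)
  have "bounded_linear (\<lambda>v. Q (lin X v))" by (rule bounded_linear_compose[OF blQ blinfun.bounded_linear_right])
  then obtain C where C: "\<And>v. norm (Q (lin X v)) \<le> norm v * C" using bounded_linear.bounded by blast
  define w where "w t = aff_app (aexp (t *\<^sub>R X)) y" for t
  have "Q (w 1) = 0"
  proof (rule gronwall_zero[where u="\<lambda>t. Q (w t)" and u'="\<lambda>t. Q (aff_app X (w t))" and C=C])
    fix t :: real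
    show "((\<lambda>t. Q (w t)) has_vector_derivative Q (aff_app X (w t))) (at t)"
      unfolding w_def by (rule Q.has_vector_derivative[OF aexp_app_has_vector_derivative])
    have "aff_app X (w t) = aff_app X (\<pi> (w t)) + lin X (Q (w t))"
      unfolding aff_app_add[symmetric] by (simp add: Q_def)
    then have "Q (aff_app X (w t)) = Q (lin X (Q (w t)))" by (simp add: Q.add Q0[OF X[OF \<pi>(2)]])
    then show "norm (Q (aff_app X (w t))) \<le> C * norm (Q (w t))" using C[of "Q (w t)"] by (simp add: mult.commute)
  qed (auto simp: w_def Q0 y)
  then have "w 1 = \<pi> (w 1)" by (simp add: Q_def)
  then have "w 1 \<in> W" by (metis \<pi>(2))
  then show ?thesis by (simp add: w_def)
qed

text \<open>The map \<open>exp A\<close> is the \<open>n\<close>-th power of \<open>exp (A /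
  n)\<close>.\<close>

lemma aexp_iterate:
  assumes step: "\<And>y. y \<in> S \<Longrightarrow> aff_app (aexp ((1 / real n) *\<^sub>R A)) y \<in> S" and n: "0 < n" and y: "y \<in> S"
  shows "aff_app (aexp A) y \<in> S"
proof -
  have "aff_app (aexp ((real i / real n) *\<^sub>R A)) y \<in> S" for i
  proof (induction i)
    case (Suc i)
    have "aexp ((real (Suc i) / real n) *\<^sub>R A) = aff_comp (aexp ((1 / real n) *\<^sub>R A)) (aexp ((real i / real n) *\<^sub>R A))"
      unfolding aexp_add by (simp add: add_divide_distrib)
    then show ?case using step[OF Suc] by simp
  qed (simp add: y)
  from this[of n] show ?thesis using n by simp
qed

context extrinsic_space
begin

text \<open>In a slice chart the flow solves \<open>w' = X w\<close> for a locally Lipschitz vector field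
  \<open>X\<close> that is tangent to the slice \<open>E\<close> along \<open>E\<close>. Comparison of
  \<open>X w\<close> with \<open>X (\<pi> w)\<close> bounds the component of \<open>X w\<close>
  transversal to \<open>E\<close> by that of \<open>w\<close>, so that Gronwall's lemma keeps solutions
  in \<open>E\<close>. Time and radius are uniform near \<open>x\<close>.\<close>

lemma local_flow_forward:
  assumes A: "A \<in> k" and x: "x \<in> M"
  shows "\<exists>\<epsilon>>0. \<forall>y\<in>M \<inter> ball x \<epsilon>. \<forall>t. 0 \<le> t \<and> t < \<epsilon> \<longrightarrow> aff_app (aexp (t *\<^sub>R A)) y \<in> M"
proof -
  obtain U W E f g f' g' f'' g'' where "slice_chart M U W E f g f' g' f'' g''" and xU: "x \<in> U"
    by (rule submanifold_chart[OF sub_M x])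
  then interpret slice_chart M U W E f g f' g' f'' g'' by simp
  obtain \<pi> where \<pi>: "bounded_linear \<pi>" "\<And>v. \<pi> v \<in> E" "\<And>v. v \<in> E \<Longrightarrow> \<pi> v = v"
    using euclidean_projection_exists[OF E] by blast
  define Q where "Q v = v - \<pi> v" for v
  have blQ: "bounded_linear Q" unfolding Q_def by (intro bounded_linear_sub bounded_linear_ident \<pi>(1))
  interpret \<pi>: bounded_linear \<pi> by (rule \<pi>(1))
  interpret Q: bounded_linear Q by (rule blQ)
  have Q0: "Q v = 0" if "v \<in> E" for v using \<pi>(3)[OF that] by (simp add: Q_def)
  obtain K where K: "0 < K" "\<And>v. norm (\<pi> v) \<le> norm v * K" using \<pi>.pos_bounded by blast
  obtain KQ where KQ: "0 < KQ" "\<And>v. norm (Q v) \<le> norm v * KQ" using Q.pos_bounded by blast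
  define w0 where "w0 = f x"
  have w0: "w0 \<in> W" "w0 \<in> E" "g w0 = x" using fW[OF xU] M_iff[OF xU] x gf[OF xU] by (simp_all add: w0_def)
  \<comment> \<open>The vector field \<open>A\<close> in the chart.\<close>
  define X where "X w = blinfun_apply (f' (g w)) (aff_app A (g w))" for w
  have "locally_lipschitz X w0"
    unfolding X_def
    by (rule locally_lipschitz_bilinear[OF bounded_bilinear_blinfun_apply])
       (rule locally_lipschitz_compose[OF C1_locally_lipschitz[OF Cg(1) opens(2) w0(1)]], simp add: w0 C1_locally_lipschitz[OF Cf(2) opens(1) xU] locally_lipschitz_aff_app)+
  then obtain r0 L where r0: "0 < r0" "0 < L" "\<And>p q. p \<in> ball w0 r0 \<Longrightarrow> q \<in> ball w0 r0 \<Longrightarrow> norm (X p - X q) \<le> L * norm (p - q)"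
    unfolding locally_lipschitz_def by blast
  obtain r1 where r1: "0 < r1" "ball w0 r1 \<subseteq> W" using opens(2) w0(1) open_contains_ball by blast
  define r where "r = min r0 r1"
  \<comment> \<open>In the smaller ball the projection to \<open>E\<close> does not leave the ball
    of radius \<open>r\<close>, on which \<open>X\<close> is Lipschitz.\<close>
  define \<rho> where "\<rho> = min r (r / K)"
  have r: "0 < r" "ball w0 r \<subseteq> W" "0 < \<rho>" using r0(1) r1 K(1) by (auto simp: r_def \<rho>_def)
  have proj_ball: "\<pi> w \<in> ball w0 r" "w \<in> ball w0 r" if "w \<in> ball w0 \<rho>" for w
  proof -
    have "norm (\<pi> w - w0) = norm (\<pi> (w - w0))" using \<pi>(3)[OF w0(2)] by (simp add: \<pi>.diff)
    also have "\<dots> \<le> norm (w - w0) * K" by (rule K(2))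
    also have "\<dots> < (r / K) * K" using that K(1) by (intro mult_strict_right_mono) (auto simp: \<rho>_def dist_norm norm_minus_commute)
    finally show "\<pi> w \<in> ball w0 r" using K(1) by (simp add: dist_norm norm_minus_commute)
    show "w \<in> ball w0 r" using that by (simp add: \<rho>_def)
  qed
  have XE: "X w \<in> E" if "w \<in> ball w0 r" "w \<in> E" for w
  proof -
    have wW: "w \<in> W" using that(1) r(2) by blast
    have gw: "g w \<in> U" "g w \<in> M" using gU[OF wW] M_iff[OF gU[OF wW]] fg[OF wW] that(2) by auto
    then show ?thesis using tangent_iff[OF gw, of "aff_app A (g w)"] k_tangent[OF A gw(2)] by (simp add: X_def)
  qed
  have QX: "norm (Q (X w)) \<le> (L * KQ) * norm (Q w)" if w: "w \<in> ball w0 \<rho>" for w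
  proof -
    have "Q (X w) = Q (X w - X (\<pi> w))" using Q0[OF XE[OF proj_ball(1)[OF w] \<pi>(2)]] by (simp add: Q.diff)
    then have "norm (Q (X w)) \<le> norm (X w - X (\<pi> w)) * KQ" using KQ(2) by simp
    also have "\<dots> \<le> (L * norm (w - \<pi> w)) * KQ"
      using proj_ball[OF w] KQ(1) by (intro mult_right_mono r0(3)) (auto simp: r_def)
    finally show ?thesis by (simp add: Q_def mult_ac)
  qed
  define F where "F p = aff_app (aexp (fst p *\<^sub>R A)) (snd p)" for p
  have "open (U \<inter> f -` ball w0 \<rho>)"
    using C1_derivativeD[OF Cf(1)] by (intro continuous_open_preimage opens open_ball continuous_at_imp_continuous_on ballI has_derivative_continuous) blast
  then have "open (F -` (U \<inter> f -` ball w0 \<rho>))"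
    using continuous_on_flow[of A] continuous_on_open_vimage[of UNIV F] by (auto simp: F_def[abs_def])
  moreover have "(0, x) \<in> F -` (U \<inter> f -` ball w0 \<rho>)" using xU r(3) by (simp add: F_def w0_def)
  ultimately obtain \<delta> where \<delta>: "0 < \<delta>" "ball (0, x) \<delta> \<subseteq> F -` (U \<inter> f -` ball w0 \<rho>)" using open_contains_ball by metis
  have flow_in: "F (t, y) \<in> U" "f (F (t, y)) \<in> ball w0 \<rho>" if "y \<in> ball x (\<delta>/2)" "0 \<le> t" "t < \<delta>/2" for y t
  proof -
    have "dist (0, x) (t, y) \<le> dist 0 t + dist x y" unfolding dist_Pair_Pair by (rule sqrt_sum_squares_le_sum) auto
    also have "\<dots> < \<delta>" using that by simp
    finally have "(t, y) \<in> ball (0, x) \<delta>" by simp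
    then show "F (t, y) \<in> U" "f (F (t, y)) \<in> ball w0 \<rho>" using \<delta>(2) by auto
  qed
  show ?thesis
  proof (intro exI[of _ "\<delta>/2"] conjI ballI allI impI)
    show "0 < \<delta>/2" using \<delta>(1) by simp
    fix y t0 assume y: "y \<in> M \<inter> ball x (\<delta>/2)" and t0: "0 \<le> t0 \<and> t0 < \<delta>/2"
    define w where "w t = f (F (t, y))" for t
    have yU: "y \<in> U" using flow_in(1)[of y 0] y \<delta>(1) by (simp add: F_def)
    have "Q (w t0) = 0"
    proof (rule gronwall_zero[where u="\<lambda>t. Q (w t)" and u'="\<lambda>t. Q (X (w t))" and C="L * KQ"])
      show "0 \<le> t0" using t0 by simp
      show "Q (w 0) = 0" using Q0 M_iff[OF yU] y by (simp add: w_def F_def)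
      fix t assume t: "0 \<le> t" "t \<le> t0"
      have in': "F (t, y) \<in> U" "w t \<in> ball w0 \<rho>" using flow_in[of y t] y t t0 by (simp_all add: w_def)
      have "(f has_derivative blinfun_apply (f' (F (t, y)))) (at (aff_app (aexp (t *\<^sub>R A)) y))"
        using C1_derivativeD[OF Cf(1) in'(1)] by (simp add: F_def)
      with vector_derivative_diff_chain_within[OF aexp_app_has_vector_derivative has_derivative_at_withinI[OF this]]
      have "((\<lambda>t. f (F (t, y))) has_vector_derivative blinfun_apply (f' (F (t, y))) (aff_app A (F (t, y)))) (at t)"
        by (simp add: o_def F_def)
      then have "(w has_vector_derivative X (w t)) (at t)" using gf[OF in'(1)] by (simp add: w_def[abs_def] X_def)
      then show "((\<lambda>t. Q (w t)) has_vector_derivative Q (X (w t))) (at t)" by (rule Q.has_vector_derivative)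
      show "norm (Q (X (w t))) \<le> L * KQ * norm (Q (w t))" using QX[OF in'(2)] by simp
    qed
    then have "w t0 = \<pi> (w t0)" by (simp add: Q_def)
    then have "w t0 \<in> E" by (metis \<pi>(2))
    moreover have "F (t0, y) \<in> U" using flow_in(1)[of y t0] y t0 by simp
    ultimately show "aff_app (aexp (t0 *\<^sub>R A)) y \<in> M" using M_iff by (simp add: w_def F_def)
  qed
qed

lemma local_flow:
  assumes A: "A \<in> k" and x: "x \<in> M"
  obtains \<epsilon> where "0 < \<epsilon>" "\<And>y t. y \<in> M \<Longrightarrow> y \<in> ball x \<epsilon> \<Longrightarrow> \<bar>t\<bar> < \<epsilon> \<Longrightarrow> aff_app (aexp (t *\<^sub>R A)) y \<in> M"
proof -
  obtain \<epsilon>1 where 1: "0 < \<epsilon>1" "\<forall>y\<in>M \<inter> ball x \<epsilon>1. \<forall>t. 0 \<le> t \<and> t < \<epsilon>1 \<longrightarrow> aff_app (aexp (t *\<^sub>R A)) y \<in> M"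
    using local_flow_forward[OF A x] by blast
  obtain \<epsilon>2 where 2: "0 < \<epsilon>2" "\<forall>y\<in>M \<inter> ball x \<epsilon>2. \<forall>t. 0 \<le> t \<and> t < \<epsilon>2 \<longrightarrow> aff_app (aexp (t *\<^sub>R (- A))) y \<in> M"
    using local_flow_forward[OF subspace_neg[OF sub_k A] x] by blast
  show ?thesis
  proof (rule that[of "min \<epsilon>1 \<epsilon>2"])
    show "0 < min \<epsilon>1 \<epsilon>2" using 1(1) 2(1) by simp
    fix y and t :: real assume y: "y \<in> M" "y \<in> ball x (min \<epsilon>1 \<epsilon>2)" "\<bar>t\<bar> < min \<epsilon>1 \<epsilon>2"
    show "aff_app (aexp (t *\<^sub>R A)) y \<in> M"
    proof (cases "0 \<le> t")
      case True
      then show ?thesis using 1(2) y by auto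
    next
      case False
      then have "aff_app (aexp ((- t) *\<^sub>R (- A))) y \<in> M" using 2(2) y by (auto simp del: scaleR_minus_left scaleR_minus_right)
      then show ?thesis by simp
    qed
  qed
qed

lemma aexp_isometry:
  assumes "A \<in> k"
  shows "b (lin (aexp A) u) (lin (aexp A) v) = b u v"
proof -
  let ?f = "\<lambda>t. b (lin (aexp (t *\<^sub>R A)) u) (lin (aexp (t *\<^sub>R A)) v)"
  have "(?f has_vector_derivative 0) (at t within UNIV)" for t
    using bounded_bilinear.has_vector_derivative[OF bounded_bilinear_b aexp_linear_has_vector_derivative[of A u t] aexp_linear_has_vector_derivative[of A v t]]
      k_skew[OF assms] by (simp add: add.commute)
  then have "\<exists>c. \<forall>t\<in>UNIV. ?f t = c"
    by (rule has_vector_derivative_zero_constant[OF convex_UNIV]) blast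
  then obtain c where "\<And>t. ?f t = c" by auto
  from this[of 1] this[of 0] show ?thesis by simp
qed

text \<open>For small \<open>t\<close> the map \<open>h = exp (t A / 2)\<close> preserves
  \<open>M\<close> near \<open>x\<close>, so \<open>h \<circ> s x \<circ> h\<^sup>-\<^sup>1 = s (h
  x)\<close>. Anti-invariance means \<open>s x \<circ> h\<^sup>-\<^sup>1 \<circ> s x = h\<close>.
  Together, \<open>s (h x) \<circ> s x = h \<circ> h = exp (t A)\<close>. Powers of such maps reach
  \<open>exp A\<close>.\<close>

lemma aexp_kminus_Kg:
  assumes x: "x \<in> M" and A: "A \<in> kminus x"
  shows "aexp A \<in> Kg"
proof -
  have Ak: "A \<in> k" and conj: "aff_conj (s x) (s x) A = - A" using A by (auto simp: kminus_def)
  obtain \<epsilon> where \<epsilon>: "0 < \<epsilon>" "\<And>y t. y \<in> M \<Longrightarrow> y \<in> ball x \<epsilon> \<Longrightarrow> \<bar>t\<bar> < \<epsilon> \<Longrightarrow> aff_app (aexp (t *\<^sub>R A)) y \<in> M"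
    using local_flow[OF Ak x] by blast
  have "isCont (\<lambda>t. aff_app (aexp (t *\<^sub>R A)) x) 0"
    using aexp_app_has_vector_derivative by (rule has_vector_derivative_continuous)
  then have "((\<lambda>t. aff_app (aexp (t *\<^sub>R A)) x) \<longlongrightarrow> x) (at 0)" by (simp add: isCont_def)
  then have "\<forall>\<^sub>F t in at 0. aff_app (aexp (t *\<^sub>R A)) x \<in> ball x \<epsilon>" using \<epsilon>(1) by (intro topological_tendstoD) auto
  then obtain d where d: "0 < d" "\<And>t. t \<noteq> 0 \<Longrightarrow> \<bar>t\<bar> < d \<Longrightarrow> aff_app (aexp (t *\<^sub>R A)) x \<in> ball x \<epsilon>"
    by (auto simp: eventually_at dist_real_def)
  \<comment> \<open>The bound \<open>d\<close> keeps the moved point in the ball on which the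
    inverse flow preserves \<open>M\<close>.\<close>
  have small: "aexp (t *\<^sub>R A) \<in> Kg" if t: "\<bar>t\<bar> < min d \<epsilon>" for t
  proof -
    let ?k = "aexp ((t/2) *\<^sub>R A)" and ?k' = "aexp (- ((t/2) *\<^sub>R A))"
    have t2: "\<bar>t/2\<bar> < \<epsilon>" "\<bar>-(t/2)\<bar> < \<epsilon>" "\<bar>t/2\<bar> < d" using t by auto
    have k'_eq: "?k' = aexp ((-(t/2)) *\<^sub>R A)" by simp
    have kx: "aff_app ?k x \<in> M" using \<epsilon>(2)[OF x _ t2(1)] \<epsilon>(1) by simp
    have kxb: "aff_app ?k x \<in> ball x \<epsilon>"
      using d(2)[of "t/2"] t2(3) \<epsilon>(1) by (cases "t = 0") auto
    have hA: "(t/2) *\<^sub>R A \<in> k" using Ak by (rule subspace_scale[OF sub_k])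
    have k'kx: "aff_app ?k' (aff_app ?k x) = x"
      by (simp only: aff_app_comp[symmetric] aexp_minus aff_app_id)
    have "aff_comp ?k (aff_comp (s x) ?k') = s (aff_app ?k x)"
    proof (rule reflection_conj[OF x kx aexp_minus])
      show "b (lin ?k u) (lin ?k v) = b u v" for u v by (rule aexp_isometry[OF hA])
      show "lin ?k u \<in> T (aff_app ?k x)" if "u \<in> T x" for u
        by (rule tangent_space_affine_map[where N="ball x \<epsilon>", OF open_ball _ _ that]) (use \<epsilon> t2 in auto)
      show "lin ?k' u \<in> T x" if "u \<in> T (aff_app ?k x)" for u
      proof -
        have "lin ?k' u \<in> T (aff_app ?k' (aff_app ?k x))"
        proof (rule tangent_space_affine_map[OF open_ball kxb _ that])
          show "aff_app ?k' z \<in> M" if "z \<in> M \<inter> ball x \<epsilon>" for z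
            unfolding k'_eq using that by (intro \<epsilon>(2)[OF _ _ t2(2)]) auto
        qed
        then show ?thesis by (simp only: k'kx)
      qed
    qed
    moreover have "aff_comp (s x) (aff_comp ?k' (s x)) = ?k"
    proof -
      have "aff_conj (s x) (s x) (- ((t/2) *\<^sub>R A)) = (t/2) *\<^sub>R A" using conj by (simp add: aff_conj_linear)
      then show ?thesis using aexp_conj[OF refl_invol[OF x] refl_invol[OF x], of "- ((t/2) *\<^sub>R A)"] by simp
    qed
    ultimately have "aff_comp (s (aff_app ?k x)) (s x) = aff_comp ?k ?k"
      by (metis aff_comp_assoc)
    also have "\<dots> = aexp (t *\<^sub>R A)" by (simp add: aexp_add)
    finally show ?thesis using Kg_transvection[OF kx x] by metis
  qed
  obtain n :: nat where n: "1 / min d \<epsilon> < real n" using reals_Archimedean2 by blast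
  have "0 < 1 / min d \<epsilon>" using d(1) \<epsilon>(1) by simp
  then have n0: "0 < real n" using n by linarith
  have "\<bar>1 / real n\<bar> < min d \<epsilon>"
  proof -
    have "0 < min d \<epsilon>" using d(1) \<epsilon>(1) by simp
    then have "1 < real n * min d \<epsilon>" using n by (simp add: divide_less_eq)
    then have "1 / real n < min d \<epsilon>" using n0 by (subst pos_divide_less_eq) (simp_all only: mult.commute)
    then show ?thesis using n0 by simp
  qed
  then have step: "aexp ((1 / real n) *\<^sub>R A) \<in> Kg" by (rule small)
  have "aexp ((real i / real n) *\<^sub>R A) \<in> Kg" for i
  proof (induction i)
    case (Suc i)
    have "aexp ((real (Suc i) / real n) *\<^sub>R A) = aff_comp (aexp ((1 / real n) *\<^sub>R A)) (aexp ((real i / real n) *\<^sub>R A))"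
      unfolding aexp_add by (simp add: add_divide_distrib)
    then show ?case using Kg_comp[OF step Suc] by simp
  qed (simp add: Kg_id)
  from this[of n] show ?thesis using n0 by simp
qed

text \<open>The map \<open>e \<zeta> = exp (\<sigma> \<zeta>) x\<close>, where \<open>\<sigma>\<close>
  restricts to an isomorphism from \<open>E\<close> to \<open>kminus x\<close>, takes values in
  \<open>M\<close>, and its derivative at \<open>0\<close> identifies \<open>E\<close> with \<open>T
  x\<close>. A continuous map whose derivative at one point is invertible maps neighbourhoods of this
  point to neighbourhoods of its image.\<close>

lemma exp_neighbourhood:
  assumes x: "x \<in> M"
  obtains N where "open N" "x \<in> N" "\<And>y. y \<in> N \<Longrightarrow> y \<in> M \<Longrightarrow> \<exists>A\<in>kminus x. y = aff_app (aexp A) x"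
proof -
  obtain U W E f g f' g' f'' g'' where "slice_chart M U W E f g f' g' f'' g''" and xU: "x \<in> U"
    by (rule submanifold_chart[OF sub_M x])
  then interpret slice_chart M U W E f g f' g' f'' g'' by simp
  obtain \<pi> where \<pi>: "bounded_linear \<pi>" "\<And>v. \<pi> v \<in> E" "\<And>v. v \<in> E \<Longrightarrow> \<pi> v = v"
    using euclidean_projection_exists[OF E] by blast
  interpret \<pi>: bounded_linear \<pi> by (rule \<pi>(1))
  define v where "v \<zeta> = blinfun_apply (g' (f x)) (\<pi> \<zeta>)" for \<zeta>
  have vT: "v \<zeta> \<in> T x" for \<zeta>
    using tangent_iff[OF xU x] df_dg[OF fW[OF xU]] gf[OF xU] \<pi>(2) by (simp add: v_def)
  have "\<forall>\<zeta>. \<exists>A. A \<in> kminus x \<and> aff_app A x = v \<zeta>" using kminus_exists[OF x vT] by blast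
  then obtain \<sigma> where \<sigma>: "\<And>\<zeta>. \<sigma> \<zeta> \<in> kminus x" "\<And>\<zeta>. aff_app (\<sigma> \<zeta>) x = v \<zeta>" by metis
  have \<sigma>_unique: "A = \<sigma> \<zeta>" if "A \<in> kminus x" "aff_app A x = v \<zeta>" for A \<zeta>
    using kminus_determined[OF x, of "A - \<sigma> \<zeta>"] that \<sigma> by (simp add: subspace_diff[OF sub_kminus])
  have "linear \<sigma>"
  proof (rule linearI)
    show "\<sigma> (\<zeta> + \<eta>) = \<sigma> \<zeta> + \<sigma> \<eta>" for \<zeta> \<eta>
      by (rule \<sigma>_unique[symmetric]) (simp_all add: \<sigma> subspace_add[OF sub_kminus] v_def \<pi>.add blinfun.add_right)
    show "\<sigma> (r *\<^sub>R \<zeta>) = r *\<^sub>R \<sigma> \<zeta>" for r \<zeta>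
      by (rule \<sigma>_unique[symmetric]) (simp_all add: \<sigma> subspace_scale[OF sub_kminus] v_def \<pi>.scaleR blinfun.scaleR_right)
  qed
  then have bl\<sigma>: "bounded_linear \<sigma>" by (simp add: linear_conv_bounded_linear)
  have \<sigma>0: "\<sigma> 0 = 0" using \<open>linear \<sigma>\<close> by (rule linear_0)
  define e where "e \<zeta> = aff_app (aexp (\<sigma> \<zeta>)) x" for \<zeta>
  have eM: "e \<zeta> \<in> M" for \<zeta> unfolding e_def by (rule Kg_M[OF aexp_kminus_Kg[OF x \<sigma>(1)] x])
  have cont_e: "continuous_on UNIV e"
    unfolding e_def using continuous_on_compose2[OF continuous_on_aexp_app linear_continuous_on[OF bl\<sigma>]] by auto
  have der_e: "(e has_derivative v) (at 0)"
  proof -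
    have "((\<lambda>A. aff_app (aexp A) x) has_derivative (\<lambda>B. aff_app B x)) (at (\<sigma> 0))" by (simp add: \<sigma>0 aexp_app_has_derivative)
    from has_derivative_compose[OF bounded_linear_imp_has_derivative[OF bl\<sigma>] this]
    show ?thesis by (simp add: e_def[abs_def] \<sigma>(2))
  qed
  \<comment> \<open>The component transversal to \<open>E\<close> is added so that the derivative at
    \<open>0\<close> becomes the identity of the whole space.\<close>
  define h where "h \<zeta> = f (e \<zeta>) + (\<zeta> - \<pi> \<zeta>)" for \<zeta>
  define S where "S = e -` U"
  have "open S" unfolding S_def using cont_e opens(1) continuous_on_open_vimage[of UNIV e] by auto
  have e0: "e 0 = x" by (simp add: e_def \<sigma>0)
  have h0: "h 0 = f x" by (simp add: h_def e0 \<pi>.zero)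
  have cont_f: "continuous_on U f"
    using C1_derivativeD[OF Cf(1)] by (intro continuous_at_imp_continuous_on ballI has_derivative_continuous) blast
  have "continuous_on S h"
    unfolding h_def
    by (intro continuous_on_add continuous_on_diff continuous_on_id \<pi>.continuous_on
        continuous_on_compose2[OF cont_f continuous_on_subset[OF cont_e]]) (auto simp: S_def)
  have der_h: "(h has_derivative (\<lambda>\<zeta>. \<zeta>)) (at 0)"
  proof -
    have "(f has_derivative blinfun_apply (f' x)) (at (e 0))" using C1_derivativeD[OF Cf(1) xU] by (simp add: e0)
    from has_derivative_compose[OF der_e this]
    have 1: "((\<lambda>\<zeta>. f (e \<zeta>)) has_derivative (\<lambda>\<zeta>. \<pi> \<zeta>)) (at 0)"
      using df_dg[OF fW[OF xU]] gf[OF xU] by (simp add: v_def)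
    have "(h has_derivative (\<lambda>\<zeta>. \<pi> \<zeta> + (\<zeta> - \<pi> \<zeta>))) (at 0)"
      unfolding h_def
      by (rule has_derivative_add[OF 1 has_derivative_diff[OF has_derivative_ident bounded_linear_imp_has_derivative[OF \<pi>(1)]]])
    then show ?thesis by simp
  qed
  have "h 0 \<in> interior (h ` S)"
  proof (rule sussmann_open_mapping[OF \<open>open S\<close> \<open>continuous_on S h\<close> _ der_h])
    show "bounded_linear (\<lambda>\<zeta>::'a. \<zeta>)" by (rule bounded_linear_ident)
    show "(\<lambda>\<zeta>::'a. \<zeta>) \<circ> (\<lambda>\<zeta>. \<zeta>) = id" by (simp add: fun_eq_iff)
    show "0 \<in> S" "S \<subseteq> S" "0 \<in> interior S" using \<open>open S\<close> xU by (simp_all add: S_def e0 interior_open)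
  qed
  then obtain r where r: "0 < r" "ball (f x) r \<subseteq> h ` S" using h0 mem_interior by metis
  define N where "N = U \<inter> f -` ball (f x) r"
  show ?thesis
  proof (rule that)
    show "open N" unfolding N_def by (rule continuous_open_preimage[OF cont_f opens(1) open_ball])
    show "x \<in> N" using xU r(1) by (simp add: N_def)
    fix y assume y: "y \<in> N" "y \<in> M"
    then obtain \<zeta> where \<zeta>: "\<zeta> \<in> S" "f y = h \<zeta>" using r(2) by (auto simp: N_def)
    have yU: "y \<in> U" using y by (simp add: N_def)
    have eU: "e \<zeta> \<in> U" using \<zeta>(1) by (simp add: S_def)
    have "\<zeta> - \<pi> \<zeta> = f y - f (e \<zeta>)" using \<zeta>(2) by (simp add: h_def)
    also have "\<dots> \<in> E" using M_iff[OF yU] M_iff[OF eU] y(2) eM by (intro subspace_diff E) auto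
    finally have "\<pi> (\<zeta> - \<pi> \<zeta>) = \<zeta> - \<pi> \<zeta>" by (rule \<pi>(3))
    moreover have "\<pi> (\<zeta> - \<pi> \<zeta>) = 0" by (simp add: \<pi>.diff \<pi>(3) \<pi>(2))
    ultimately have "f y = f (e \<zeta>)" using \<zeta>(2) by (simp add: h_def)
    then have "y = e \<zeta>" using gf[OF yU] gf[OF eU] by metis
    then show "\<exists>A\<in>kminus x. y = aff_app (aexp A) x" using \<sigma>(1) by (auto simp: e_def)
  qed
qed

end

section \<open>The symmetric decomposition at the origin\<close>

lemma aff_bracket_linear:
  "aff_bracket (A + B) C = aff_bracket A C + aff_bracket B C"
  "aff_bracket C (A + B) = aff_bracket C A + aff_bracket C B"
  "aff_bracket (r *\<^sub>R A) C = r *\<^sub>R aff_bracket A C"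
  "aff_bracket C (r *\<^sub>R A) = r *\<^sub>R aff_bracket C A"
  "aff_bracket (- A) C = - aff_bracket A C"
  "aff_bracket C (- A) = - aff_bracket C A"
  "aff_bracket 0 C = 0" "aff_bracket C 0 = 0"
  by (rule aff_eqI, simp add: aff_app_bracket blinfun.bilinear_simps algebra_simps)+

lemma aff_bracket_self [simp]: "aff_bracket A A = 0"
  by (rule aff_eqI) (simp add: aff_app_bracket)

lemma aff_bracket_skew: "aff_bracket A B = - aff_bracket B A"
  by (rule aff_eqI) (simp add: aff_app_bracket)

lemma fst_aff_bracket: "lin (aff_bracket A B) v
    = lin A (lin B v) - lin B (lin A v)"
  by (simp add: aff_bracket_def blinfun.diff_left)

lemma aff_bracket_jacobi: "aff_bracket A (aff_bracket B C) = aff_bracket (aff_bracket A B) C + aff_bracket B (aff_bracket A C)"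
  by (rule aff_eqI) (simp add: aff_app_bracket fst_aff_bracket blinfun.diff_right)

lemma aff_conj_aexp_self: "aff_conj (aexp A) (aexp (- A)) A = A"
proof (rule lie_mat_inject)
  have "lie_mat (aff_conj (aexp A) (aexp (- A)) A) = exp (lie_mat A) * lie_mat A * exp (- lie_mat A)"
    by (simp add: lie_mat_conj grp_mat_aexp lie_mat_minus)
  also have "\<dots> = lie_mat A" by (simp add: exp_times_arg_commute mult.assoc)
  finally show "lie_mat (aff_conj (aexp A) (aexp (- A)) A) = lie_mat A" .
qed

text \<open>\<open>Ad_exp_closed\<close> in homogeneous coordinates.\<close>

lemma aff_conj_aexp_closed:
  assumes m: "subspace m" and Y: "\<And>X. X \<in> m \<Longrightarrow> aff_bracket Y X \<in> m" and X: "X \<in> m"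
  shows "aff_conj (aexp Y) (aexp (- Y)) X \<in> m"
proof -
  have "exp (lie_mat Y) * lie_mat X * exp (- lie_mat Y) \<in> lie_mat ` m"
  proof (rule endo.Ad_exp_closed)
    show "subspace (lie_mat ` m)" by (rule linear_subspace_image[OF linear_lie_mat m])
    show "lie_mat X \<in> lie_mat ` m" using X by blast
    show "lie_mat Y * Z - Z * lie_mat Y \<in> lie_mat ` m" if "Z \<in> lie_mat ` m" for Z
      using that Y lie_mat_bracket by (metis (no_types, lifting) imageE imageI)
  qed
  then have "lie_mat (aff_conj (aexp Y) (aexp (- Y)) X) \<in> lie_mat ` m"
    by (simp add: lie_mat_conj grp_mat_aexp lie_mat_minus)
  then show ?thesis using lie_mat_inject by blast
qed

lemma aff_conj_inverse:
  assumes "aff_comp k k' = aff_id" "aff_comp k' k = aff_id"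
  shows "aff_conj k k' (aff_conj k' k A) = A"
  by (simp add: aff_conj_conj assms)

context extrinsic_space
begin

lemma Kg_tangent: "A \<in> Kg \<Longrightarrow> x \<in> M \<Longrightarrow> u \<in> T x \<Longrightarrow> lin A u \<in> T (aff_app A x)"
  by (rule tangent_space_affine_map[where N=UNIV]) (auto intro: Kg_M)

text \<open>Transvections are isometries that preserve \<open>M\<close>, so
  \<open>reflection_conj\<close> applies to them.\<close>

lemma refl_Kg:
  assumes A: "A \<in> Kg" "B \<in> Kg" "aff_comp A B = aff_id" "aff_comp B A = aff_id" and x: "x \<in> M"
  shows "aff_comp A (aff_comp (s x) B) = s (aff_app A x)"
proof (rule reflection_conj[OF x Kg_M[OF A(1) x] A(3,4) Kg_isometry[OF A(1)]])
  show "lin A u \<in> T (aff_app A x)" if "u \<in> T x" for u using that A x by (intro Kg_tangent)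
  show "lin B u \<in> T x" if "u \<in> T (aff_app A x)" for u
  proof -
    have "aff_app B (aff_app A x) = x" by (simp only: aff_app_comp[symmetric] A(4) aff_app_id)
    then show ?thesis using Kg_tangent[OF A(2) Kg_M[OF A(1) x] that] by simp
  qed
qed

lemma kminus_conj:
  assumes A: "A \<in> Kg" "B \<in> Kg" "aff_comp A B = aff_id" "aff_comp B A = aff_id" and x: "x \<in> M" and X: "X \<in> kminus x"
  shows "aff_conj A B X \<in> kminus (aff_app A x)"
proof -
  have Xk: "X \<in> k" and conj: "aff_conj (s x) (s x) X = - X" using X by (auto simp: kminus_def)
  have BA: "aff_comp B (aff_comp A C) = C" for C by (simp add: aff_comp_assoc[symmetric] A(4))
  have "aff_conj (s (aff_app A x)) (s (aff_app A x)) (aff_conj A B X) = aff_conj A B (aff_conj (s x) (s x) X)"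
    unfolding refl_Kg[OF A x, symmetric] aff_conj_conj by (simp add: aff_comp_assoc BA A(4))
  then show ?thesis using k_conj[OF A(1,2,3) Xk] conj by (simp add: kminus_def aff_conj_linear)
qed

end

text \<open>The abbreviation \<open>m\<close> and the set \<open>kplus\<close> are the eigenspaces of the
  involution of \<open>k\<close>. The span \<open>l\<close> of the brackets of \<open>m\<close> will turn
  out to be \<open>kplus\<close> (see \<open>kplus_eq\<close>).\<close>

locale full_space = extrinsic_space +
  assumes full_M: "full M" and zero: "0 \<in> M"
begin

abbreviation m where "m \<equiv> kminus 0"
definition kplus where "kplus = {A \<in> k. aff_conj (s 0) (s 0) A = A}"
definition l where "l = span {aff_bracket X Y | X Y. X \<in> m \<and> Y \<in> m}"

lemma snd_s0: "snd (s 0) = 0"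
  using refl_fix[OF zero] by (simp add: aff_app_def blinfun.zero_right)

lemma k_inv_eq: "k_inv b M A = aff_conj (s 0) (s 0) A"
  by (simp add: k_inv_def aff_comp_def aff_conj_def aff_app_def snd_s0 blinfun.zero_right)

lemma k_minus_eq: "k_minus b M = m"
  by (simp add: k_minus_def minus_space_def kminus_def k_inv_eq)

lemma sub_kplus: "subspace kplus"
  unfolding kplus_def subspace_def
proof (intro conjI ballI allI; (elim CollectE conjE)?)
  have "aff_conj (s 0) (s 0) 0 = 0" using aff_conj_linear(3)[of "s 0" "s 0" 0 0] by simp
  then show "0 \<in> {A \<in> k. aff_conj (s 0) (s 0) A = A}" using subspace_0[OF sub_k] by simp
qed (simp_all add: aff_conj_linear subspace_add[OF sub_k] subspace_scale[OF sub_k])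

lemma m_k: "X \<in> m \<Longrightarrow> X \<in> k" by (simp add: kminus_def)
lemma kplus_k: "X \<in> kplus \<Longrightarrow> X \<in> k" by (simp add: kplus_def)

lemma brackets:
  "C \<in> kplus \<Longrightarrow> X \<in> m \<Longrightarrow> aff_bracket C X \<in> m"
  "X \<in> m \<Longrightarrow> C \<in> kplus \<Longrightarrow> aff_bracket X C \<in> m"
  "X \<in> m \<Longrightarrow> Y \<in> m \<Longrightarrow> aff_bracket X Y \<in> kplus"
  "C \<in> kplus \<Longrightarrow> C' \<in> kplus \<Longrightarrow> aff_bracket C C' \<in> kplus"
  using k_bracket aff_conj_bracket[OF refl_invol[OF zero]]
  by (simp_all add: kminus_def kplus_def aff_bracket_linear)

text \<open>The value at \<open>0\<close> is tangent, hence reversed by \<open>s 0\<close>, but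
  invariance of \<open>C\<close> means that it is fixed.\<close>

lemma value_kplus: "C \<in> kplus \<Longrightarrow> aff_app C 0 = 0"
proof -
  assume C: "C \<in> kplus"
  then have "aff_conj (s 0) (s 0) C = C" by (simp add: kplus_def)
  from arg_cong[OF this, of "\<lambda>A. aff_app A 0"]
  have "lin (s 0) (aff_app C 0) = aff_app C 0"
    by (simp add: aff_app_conj refl_fix[OF zero])
  moreover have tan: "aff_app C 0 \<in> T 0" using k_tangent[OF kplus_k[OF C] zero] .
  ultimately have "aff_app C 0 = - aff_app C 0" using refl_tangent_iff[OF zero] by metis
  then have "2 *\<^sub>R aff_app C 0 = 0" by (metis add.right_inverse scaleR_2)
  then show ?thesis by simp
qed

lemma app_kplus: "C \<in> kplus \<Longrightarrow> aff_app C y = lin C y"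
  using value_kplus[of C] by (simp add: aff_app_def blinfun.zero_right)

lemma m_eqI: "X \<in> m \<Longrightarrow> Y \<in> m \<Longrightarrow> aff_app X 0 = aff_app Y 0 \<Longrightarrow> X = Y"
  using kminus_determined[OF zero, of "X - Y"] by (simp add: subspace_diff[OF sub_kminus])

lemma exp_m_Kg: "A \<in> aexp_group m \<Longrightarrow> A \<in> Kg"
  by (induction rule: aexp_group.induct) (auto intro: Kg_id Kg_comp aexp_kminus_Kg[OF zero])

lemma exp_m_inverse:
  assumes "A \<in> aexp_group m"
  obtains B where "B \<in> aexp_group m" "aff_comp A B = aff_id" "aff_comp B A = aff_id"
  using aexp_group_inverse[OF assms] subspace_neg[OF sub_kminus] by blast

text \<open>Conjugation by \<open>h\<close> carries \<open>m\<close> to the infinitesimal transvections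
  at \<open>h 0\<close>.\<close>

lemma exp_kminus_orbit:
  assumes h: "h \<in> aexp_group m" and X: "X \<in> kminus (aff_app h 0)"
  shows "\<exists>h'\<in>aexp_group m. aff_app (aexp X) (aff_app h 0) = aff_app h' 0"
proof -
  obtain h' where h': "h' \<in> aexp_group m" "aff_comp h h' = aff_id" "aff_comp h' h = aff_id" using exp_m_inverse[OF h] .
  have "aff_conj h' h X \<in> kminus (aff_app h' (aff_app h 0))"
    by (rule kminus_conj[OF exp_m_Kg[OF h'(1)] exp_m_Kg[OF h] h'(3,2) Kg_M[OF exp_m_Kg[OF h] zero] X])
  then have "aff_conj h' h X \<in> m" by (simp only: aff_app_comp[symmetric] h'(3) aff_app_id)
  then have "aff_comp h (aexp (aff_conj h' h X)) \<in> aexp_group m" by (intro aexp_group_comp h aexp_group_generator)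
  moreover have "aff_comp h (aexp (aff_conj h' h X)) = aff_comp (aexp X) h"
    unfolding aexp_conj[OF h'(3,2)] by (simp add: aff_comp_assoc[symmetric] h'(2))
  ultimately show ?thesis by (metis aff_app_comp)
qed

text \<open>By \<open>exp_neighbourhood\<close> and \<open>exp_kminus_orbit\<close>, both the orbit and
  its complement in \<open>M\<close> are open in \<open>M\<close>, and \<open>M\<close> is
  connected.\<close>

lemma orbit:
  assumes "x \<in> M"
  obtains h where "h \<in> aexp_group m" "x = aff_app h 0"
proof -
  define O1 where "O1 = (\<lambda>h. aff_app h 0) ` aexp_group m"
  have O1M: "O1 \<subseteq> M" unfolding O1_def using Kg_M[OF exp_m_Kg zero] by blast
  have "\<forall>y\<in>M. \<exists>N. open N \<and> y \<in> N \<and> (\<forall>z\<in>N. z \<in> M \<longrightarrow> (\<exists>A\<in>kminus y. z = aff_app (aexp A) y))"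
    using exp_neighbourhood by metis
  then obtain N where N: "\<And>y. y \<in> M \<Longrightarrow> open (N y)" "\<And>y. y \<in> M \<Longrightarrow> y \<in> N y"
    "\<And>y z. y \<in> M \<Longrightarrow> z \<in> N y \<Longrightarrow> z \<in> M \<Longrightarrow> \<exists>A\<in>kminus y. z = aff_app (aexp A) y" by metis
  \<comment> \<open>The orbit is open in \<open>M\<close>.\<close>
  have 1: "z \<in> O1" if yz: "y \<in> O1" "z \<in> N y" "z \<in> M" for y z
  proof -
    have "y \<in> M" using yz(1) O1M by blast
    obtain h where h: "h \<in> aexp_group m" "y = aff_app h 0" using yz(1) unfolding O1_def by blast
    obtain A where "A \<in> kminus y" "z = aff_app (aexp A) y" using N(3)[OF \<open>y \<in> M\<close> yz(2,3)] by blast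
    then obtain i where "i \<in> aexp_group m" "z = aff_app i 0" using exp_kminus_orbit[OF h(1)] h(2) by metis
    then show ?thesis unfolding O1_def by blast
  qed
  \<comment> \<open>Its complement is open as well: if \<open>z = exp A y\<close>, then \<open>y =
    exp (- A) z\<close>, and \<open>A\<close> is an infinitesimal transvection at \<open>z\<close>
    too.\<close>
  have 2: "y \<in> O1" if y: "y \<in> M" "z \<in> N y" "z \<in> O1" for y z
  proof -
    have "z \<in> M" using y(3) O1M by blast
    then obtain A where A: "A \<in> kminus y" "z = aff_app (aexp A) y" using N(3)[OF y(1,2)] by blast
    obtain h where h: "h \<in> aexp_group m" "z = aff_app h 0" using y(3) unfolding O1_def by blast
    have K: "aexp A \<in> Kg" "aexp (- A) \<in> Kg"
      by (rule aexp_kminus_Kg[OF y(1) A(1)], rule aexp_kminus_Kg[OF y(1) subspace_neg[OF sub_kminus A(1)]])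
    have "A \<in> kminus z" using kminus_conj[OF K aexp_minus y(1) A(1)] by (simp add: aff_conj_aexp_self A(2))
    then have "- A \<in> kminus (aff_app h 0)" using subspace_neg[OF sub_kminus] h(2) by blast
    moreover have "aff_app (aexp (- A)) (aff_app h 0) = y"
      unfolding h(2)[symmetric] A(2) by (simp only: aff_app_comp[symmetric] aexp_minus aff_app_id)
    ultimately obtain i where "i \<in> aexp_group m" "y = aff_app i 0" using exp_kminus_orbit[OF h(1), of "- A"] by metis
    then show ?thesis unfolding O1_def by blast
  qed
  have conn: "connected M" using sub_M by (simp add: submanifold_def)
  have "M \<subseteq> O1"
  proof (rule ccontr)
    assume "\<not> M \<subseteq> O1"
    then obtain z where z: "z \<in> M" "z \<notin> O1" by blast
    let ?A = "\<Union>y\<in>O1. N y" and ?B = "\<Union>y\<in>M - O1. N y"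
    have "open ?A" "open ?B" using N(1) O1M by auto
    moreover have "M \<subseteq> ?A \<union> ?B" using N(2) by blast
    moreover have "?A \<inter> ?B \<inter> M = {}" using 1 2 by blast
    moreover have "0 \<in> O1" unfolding O1_def by (rule image_eqI[OF _ aexp_group_id]) simp
    then have "?A \<inter> M \<noteq> {}" using N(2)[OF zero] zero by blast
    moreover have "?B \<inter> M \<noteq> {}" using z N(2) by blast
    ultimately show False using conn unfolding connected_def by blast
  qed
  then obtain h where "h \<in> aexp_group m" "x = aff_app h 0" using assms unfolding O1_def by blast
  then show ?thesis by (rule that)
qed

text \<open>Conjugation by \<open>s 0\<close> inverts the generators.\<close>

lemma exp_m_refl0: "A \<in> aexp_group m \<Longrightarrow> aff_comp (s 0) (aff_comp A (s 0)) \<in> aexp_group m"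
proof (induction rule: aexp_group.induct)
  case aexp_group_id
  then show ?case by (simp add: refl_invol[OF zero] aexp_group.aexp_group_id)
next
  case (aexp_group_mult X A)
  have "aff_comp (s 0) (aff_comp (aexp X) (s 0)) = aexp (- X)"
    using aexp_conj[OF refl_invol[OF zero] refl_invol[OF zero], of X] aexp_group_mult(1) by (simp add: kminus_def)
  moreover have "aff_comp (s 0) (aff_comp (aff_comp (aexp X) A) (s 0))
     = aff_comp (aff_comp (s 0) (aff_comp (aexp X) (s 0))) (aff_comp (s 0) (aff_comp A (s 0)))"
    by (simp add: aff_comp_assoc refl_invol'[OF zero])
  ultimately show ?case
    using aexp_group.aexp_group_mult[OF subspace_neg[OF sub_kminus aexp_group_mult(1)] aexp_group_mult(3)] by simp
qed

text \<open>For \<open>x = h 0\<close> and \<open>y = i 0\<close> one has \<open>s x \<circ> s y = h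
  \<circ> (s 0 \<circ> h\<^sup>-\<^sup>1 \<circ> i \<circ> s 0) \<circ>
  i\<^sup>-\<^sup>1\<close>.\<close>

lemma Kg_eq: "Kg = aexp_group m"
proof
  show "aexp_group m \<subseteq> Kg" using exp_m_Kg by blast
  have "A \<in> aexp_group m" if "A \<in> Kg" for A
    using that
  proof induction
    case (Kg_mult x y A)
    obtain h where h: "h \<in> aexp_group m" "x = aff_app h 0" using orbit[OF Kg_mult(1)] .
    obtain h' where h': "h' \<in> aexp_group m" "aff_comp h h' = aff_id" "aff_comp h' h = aff_id" using exp_m_inverse[OF h(1)] .
    obtain i where i: "i \<in> aexp_group m" "y = aff_app i 0" using orbit[OF Kg_mult(2)] .
    obtain i' where i': "i' \<in> aexp_group m" "aff_comp i i' = aff_id" "aff_comp i' i = aff_id" using exp_m_inverse[OF i(1)] .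
    have "s x = aff_comp h (aff_comp (s 0) h')" "s y = aff_comp i (aff_comp (s 0) i')"
      using refl_Kg[OF exp_m_Kg[OF h(1)] exp_m_Kg[OF h'(1)] h'(2,3) zero]
        refl_Kg[OF exp_m_Kg[OF i(1)] exp_m_Kg[OF i'(1)] i'(2,3) zero] h(2) i(2) by simp_all
    then have "aff_comp (aff_comp (s x) (s y)) A
       = aff_comp (aff_comp h (aff_comp (aff_comp (s 0) (aff_comp (aff_comp h' i) (s 0))) i')) A"
      by (simp add: aff_comp_assoc)
    also have "\<dots> \<in> aexp_group m"
      by (intro aexp_group_comp exp_m_refl0 h h' i i' Kg_mult)
    finally show ?case .
  qed (rule aexp_group_id)
  then show "Kg \<subseteq> aexp_group m" by blast
qed

lemma l_kplus: "l \<subseteq> kplus"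
  unfolding l_def by (rule span_minimal[OF _ sub_kplus]) (auto intro: brackets)

lemma bracket_in_l: "X \<in> m \<Longrightarrow> Y \<in> m \<Longrightarrow> aff_bracket X Y \<in> l"
  unfolding l_def by (rule span_base) blast

lemma sub_l: "subspace l" by (simp add: l_def)

lemma kplus_l_bracket:
  assumes C: "C \<in> kplus" and D: "D \<in> l"
  shows "aff_bracket C D \<in> l"
proof -
  have "subspace {D. aff_bracket C D \<in> l}"
    unfolding subspace_def by (simp add: aff_bracket_linear subspace_0[OF sub_l] subspace_add[OF sub_l] subspace_scale[OF sub_l])
  moreover have "{aff_bracket X Y | X Y. X \<in> m \<and> Y \<in> m} \<subseteq> {D. aff_bracket C D \<in> l}"
  proof (rule subsetI)
    fix D assume "D \<in> {aff_bracket X Y | X Y. X \<in> m \<and> Y \<in> m}"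
    then obtain X Y where D: "D = aff_bracket X Y" and X: "X \<in> m" and Y: "Y \<in> m" by blast
    have "aff_bracket C D \<in> l"
      unfolding D aff_bracket_jacobi[of C]
      by (rule subspace_add[OF sub_l bracket_in_l[OF brackets(1)[OF C X] Y] bracket_in_l[OF X brackets(1)[OF C Y]]])
    then show "D \<in> {D. aff_bracket C D \<in> l}" by blast
  qed
  ultimately show ?thesis using D span_minimal unfolding l_def by blast
qed

text \<open>The sum \<open>m + l\<close> is a subalgebra that contains \<open>m\<close>, and
  \<open>Kg\<close> is generated by \<open>exp m\<close>.\<close>

theorem k_decomposition:
  assumes A: "A \<in> k"
  obtains X C where "X \<in> m" "C \<in> l" "A = X + C"
proof -
  let ?h = "{X + C | X C. X \<in> m \<and> C \<in> l}"
  have sub: "subspace ?h" by (rule subspace_sums[OF sub_kminus sub_l])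
  have br: "aff_bracket A B \<in> ?h" if AB: "A \<in> ?h" "B \<in> ?h" for A B
  proof -
    obtain X C Y D where e: "A = X + C" "B = Y + D" "X \<in> m" "C \<in> l" "Y \<in> m" "D \<in> l" using AB by blast
    have CD: "C \<in> kplus" "D \<in> kplus" using e l_kplus by auto
    have "aff_bracket A B = (aff_bracket X D + aff_bracket C Y) + (aff_bracket X Y + aff_bracket C D)"
      by (simp add: e aff_bracket_linear)
    moreover have "aff_bracket X D + aff_bracket C Y \<in> m"
      by (intro subspace_add[OF sub_kminus] brackets e CD)
    moreover have "aff_bracket X Y + aff_bracket C D \<in> l"
      by (intro subspace_add[OF sub_l] bracket_in_l kplus_l_bracket e CD)
    ultimately show ?thesis by blast
  qed
  have mh: "m \<subseteq> ?h"
  proof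
    fix X assume "X \<in> m"
    then show "X \<in> ?h" using subspace_0[OF sub_l] by (intro CollectI exI[of _ X] exI[of _ 0]) simp
  qed
  have "A \<in> ?h"
    using velocities_aexp_group[OF sub br mh, of A] A by (simp add: k_eq Kg_eq)
  then show ?thesis using that by blast
qed

lemma kplus_eq: "kplus = l"
proof
  show "l \<subseteq> kplus" by (rule l_kplus)
  show "kplus \<subseteq> l"
  proof
    fix A assume A: "A \<in> kplus"
    obtain X C where XC: "X \<in> m" "C \<in> l" "A = X + C" using k_decomposition[OF kplus_k[OF A]] .
    have "aff_conj (s 0) (s 0) X = - X" "aff_conj (s 0) (s 0) C = C" "aff_conj (s 0) (s 0) A = A"
      using XC l_kplus A by (auto simp: kminus_def kplus_def)
    then have "- X + C = X + C" using XC(3) by (simp add: aff_conj_linear)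
    then have "2 *\<^sub>R X = 0" by (metis add.right_inverse add_right_cancel scaleR_2)
    then show "A \<in> l" using XC by simp
  qed
qed

section \<open>Consequences of fullness\<close>

text \<open>The orbit of \<open>0\<close> under the group generated by \<open>exp m\<close> stays in
  \<open>W\<close>, but it is \<open>M\<close>.\<close>

lemma full_subspace:
  assumes W: "subspace W" and X: "\<And>X y. X \<in> m \<Longrightarrow> y \<in> W \<Longrightarrow> aff_app X y \<in> W"
  shows "W = UNIV"
proof -
  have "aff_app h 0 \<in> W" if "h \<in> aexp_group m" for h
    using that
  proof induction
    case (aexp_group_mult X A)
    then show ?case using aexp_invariant_subspace[OF W X] by simp
  qed (simp add: subspace_0[OF W])
  then have "M \<subseteq> W" using orbit by blast
  moreover have "affine W" by (rule subspace_imp_affine[OF W])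
  ultimately show ?thesis using full_M unfolding full_def by blast
qed

text \<open>For \<open>X\<close> in \<open>m\<close> the bracket \<open>[C, X]\<close> is again in
  \<open>m\<close>, with value \<open>C X(0) = 0\<close> at the origin, so it vanishes. Thus
  \<open>C\<close> commutes with \<open>m\<close>, its kernel is stable under \<open>m\<close>, and
  \<open>full_subspace\<close> applies.\<close>

lemma kplus_faithful:
  assumes C: "C \<in> kplus" and 0: "\<And>u. u \<in> T 0 \<Longrightarrow> lin C u = 0"
  shows "C = 0"
proof -
  let ?W = "{y. lin C y = 0}"
  have W: "subspace ?W" unfolding subspace_def by (simp add: blinfun.bilinear_simps)
  have "aff_app X y \<in> ?W" if X: "X \<in> m" and y: "y \<in> ?W" for X y
  proof -
    have "aff_app (aff_bracket C X) 0 = aff_app 0 0"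
      using 0[OF k_tangent[OF m_k[OF X] zero]] by (simp add: aff_app_bracket value_kplus[OF C] blinfun.zero_right)
    then have "aff_bracket C X = 0" by (intro m_eqI brackets C X subspace_0[OF sub_kminus])
    then have "lin C (aff_app X y) - lin X (aff_app C y) = 0"
      by (metis aff_app_bracket aff_app_zero)
    then show ?thesis using y by (simp add: app_kplus[OF C] blinfun.zero_right)
  qed
  then have "?W = UNIV" by (rule full_subspace[OF W])
  then have "lin C y = 0" for y by blast
  then show ?thesis by (intro aff_eqI) (simp add: app_kplus[OF C])
qed

lemma m_anti:
  assumes "X \<in> m"
  shows "lin (s 0) (lin X (lin (s 0) v)) = - lin X v"
proof -
  have "aff_conj (s 0) (s 0) X = - X" using assms by (simp add: kminus_def)
  from arg_cong[OF this, of "\<lambda>B. lin B v"] show ?thesis by (simp add: blinfun.minus_left)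
qed

lemma kplus_commute:
  assumes "C \<in> kplus"
  shows "lin (s 0) (lin C (lin (s 0) v)) = lin C v"
proof -
  have "aff_conj (s 0) (s 0) C = C" using assms by (simp add: kplus_def)
  from arg_cong[OF this, of "\<lambda>B. lin B v"] show ?thesis by simp
qed

lemma refl0_normal: "P 0 n = 0 \<longleftrightarrow> lin (s 0) n = n"
  by (simp add: fst_refl[OF zero])

lemma refl0_tangent: "v \<in> T 0 \<longleftrightarrow> lin (s 0) v = - v"
  using refl_tangent_iff[OF zero] by blast

lemma m_normal: "X \<in> m \<Longrightarrow> P 0 n = 0 \<Longrightarrow> lin X n \<in> T 0"
  using m_anti[of X n] by (simp add: refl0_normal refl0_tangent)

lemma m_tangent: "X \<in> m \<Longrightarrow> u \<in> T 0 \<Longrightarrow> P 0 (lin X u) = 0"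
  using m_anti[of X u] by (simp add: refl0_normal refl0_tangent blinfun.minus_right)

lemma kplus_tangent:
  assumes "C \<in> kplus" "u \<in> T 0"
  shows "lin C u \<in> T 0"
proof -
  have "- lin (s 0) (lin C u) = lin C u"
    using kplus_commute[OF assms(1), of u] assms(2) by (simp add: refl0_tangent blinfun.minus_right)
  then have "lin (s 0) (lin C u) = - lin C u"
    by (metis minus_minus)
  then show ?thesis by (simp add: refl0_tangent)
qed

lemma kplus_normal: "C \<in> kplus \<Longrightarrow> P 0 n = 0 \<Longrightarrow> P 0 (lin C n) = 0"
  using kplus_commute[of C n] by (simp add: refl0_normal)

text \<open>The subspace on the right is stable under \<open>m\<close>, as the linear parts of
  \<open>m\<close> map normal vectors to tangent vectors.\<close>

lemma normal_spanned: "UNIV = {u + n | u n. u \<in> T 0 \<and> n \<in> span {lin X y | X y. X \<in> m \<and> y \<in> T 0}}"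
  (is "_ = ?W")
proof -
  let ?N = "span {lin X y | X y. X \<in> m \<and> y \<in> T 0}"
  have W: "subspace ?W" by (rule subspace_sums[OF sub_T[OF zero] subspace_span])
  have normal: "P 0 n = 0" if "n \<in> ?N" for n
  proof -
    have "subspace {n. P 0 n = 0}"
      unfolding subspace_def by (simp add: linear_0[OF linear_P[OF zero]] P_add[OF zero] P_scale[OF zero])
    then show ?thesis using that span_minimal[of "{lin X y | X y. X \<in> m \<and> y \<in> T 0}" "{n. P 0 n = 0}"] m_tangent by blast
  qed
  have "aff_app X y \<in> ?W" if X: "X \<in> m" and y: "y \<in> ?W" for X y
  proof -
    obtain u n where un: "y = u + n" "u \<in> T 0" "n \<in> ?N" using y by blast
    have "aff_app X y = (aff_app X 0 + lin X n) + lin X u"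
      by (simp add: un aff_app_def blinfun.bilinear_simps)
    moreover have "aff_app X 0 + lin X n \<in> T 0"
      using k_tangent[OF m_k[OF X] zero] m_normal[OF X normal[OF un(3)]] by (rule subspace_add[OF sub_T[OF zero]])
    moreover have "lin X u \<in> ?N" using X un(2) by (intro span_base) blast
    ultimately show ?thesis by blast
  qed
  then show ?thesis using full_subspace[OF W] by blast
qed

text \<open>A point of \<open>M\<close> is \<open>h 0\<close> with \<open>h\<close> a product of
  exponentials of \<open>m\<close>. As \<open>exp Y\<close> normalizes \<open>m\<close>, it can be moved
  past \<open>h\<close>, and it fixes \<open>0\<close>.\<close>

lemma aexp_kplus_M:
  assumes Y: "Y \<in> kplus" and x: "x \<in> M"
  shows "aff_app (aexp Y) x \<in> M"
proof -
  obtain h where h: "h \<in> aexp_group m" "x = aff_app h 0" using orbit[OF x] .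
  have fix0: "aff_app (aexp Y) 0 = 0"
    using aexp_invariant_subspace[of "{0}" Y 0] value_kplus[OF Y] by (simp add: subspace_def)
  \<comment> \<open>Each generator \<open>exp X\<close> is replaced by the exponential of the
    conjugate of \<open>X\<close>.\<close>
  have "\<exists>h'\<in>aexp_group m. aff_comp (aexp Y) h = aff_comp h' (aexp Y)"
    using h(1)
  proof induction
    case (aexp_group_mult X A)
    then obtain A' where A': "A' \<in> aexp_group m" "aff_comp (aexp Y) A = aff_comp A' (aexp Y)" by blast
    have X': "aff_conj (aexp Y) (aexp (- Y)) X \<in> m"
      by (rule aff_conj_aexp_closed[OF sub_kminus brackets(1)[OF Y] aexp_group_mult(1)])
    have "aff_comp (aexp (aff_conj (aexp Y) (aexp (- Y)) X)) (aexp Y) = aff_comp (aexp Y) (aexp X)"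
      unfolding aexp_conj[OF aexp_minus] by (simp add: aff_comp_assoc)
    then have "aff_comp (aexp Y) (aff_comp (aexp X) A) = aff_comp (aff_comp (aexp (aff_conj (aexp Y) (aexp (- Y)) X)) A') (aexp Y)"
      by (metis aff_comp_assoc A'(2))
    then show ?case using aexp_group.aexp_group_mult[OF X' A'(1)] by blast
  next
    case aexp_group_id
    show ?case by (intro bexI[of _ aff_id]) (simp_all add: aexp_group.aexp_group_id)
  qed
  then obtain h' where h': "h' \<in> aexp_group m" "aff_comp (aexp Y) h = aff_comp h' (aexp Y)" by blast
  have "aff_app (aexp Y) x = aff_app (aff_comp h' (aexp Y)) 0" unfolding h(2) h'(2)[symmetric] by simp
  also have "\<dots> = aff_app h' 0" by (simp add: fix0)
  finally show ?thesis using Kg_M[OF exp_m_Kg[OF h'(1)] zero] by simp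
qed

definition minus_part where "minus_part A = (1/2) *\<^sub>R (A - aff_conj (s 0) (s 0) A)"

lemma minus_part_split:
  assumes A: "A \<in> k"
  shows "minus_part A \<in> m" "A - minus_part A \<in> kplus"
proof -
  have c: "aff_conj (s 0) (s 0) A \<in> k" by (rule k_refl_conj[OF zero A])
  have cc: "aff_conj (s 0) (s 0) (aff_conj (s 0) (s 0) A) = A"
    by (rule aff_conj_inverse[OF refl_invol[OF zero] refl_invol[OF zero]])
  show "minus_part A \<in> m"
    using A c by (simp add: minus_part_def kminus_def aff_conj_linear cc subspace_scale[OF sub_k] subspace_diff[OF sub_k] scaleR_minus_right[symmetric] del: scaleR_minus_right)
  have "A - minus_part A = (1/2) *\<^sub>R (A + aff_conj (s 0) (s 0) A)"
  proof -
    have "A - (1/2) *\<^sub>R A = (1/2) *\<^sub>R A" using scaleR_left_diff_distrib[of 1 "1/2" A] by simp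
    then show ?thesis by (simp add: minus_part_def scaleR_diff_right scaleR_add_right add_diff_eq[symmetric] diff_diff_eq2 diff_add_eq)
  qed
  then show "A - minus_part A \<in> kplus"
    using A c by (simp add: kplus_def aff_conj_linear cc subspace_scale[OF sub_k] subspace_add[OF sub_k] add.commute)
qed

lemma bounded_linear_aff_conj: "bounded_linear (aff_conj k1 k2)"
  unfolding aff_conj_def
  by (intro bounded_linear_Pair
      bounded_linear_compose[OF bounded_bilinear.bounded_linear_right[OF bounded_bilinear_blinfun_compose]]
      bounded_linear_compose[OF bounded_bilinear.bounded_linear_left[OF bounded_bilinear_blinfun_compose] bounded_linear_fst]
      bounded_linear_compose[OF blinfun.bounded_linear_right bounded_linear_aff_app])

text \<open>After division by some \<open>n\<close>, \<open>exp A\<close> is a product of an element of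
  \<open>exp m\<close>, which consists of transvections, and one of \<open>exp kplus\<close>.\<close>

theorem aexp_k_M:
  assumes A: "A \<in> k" and x: "x \<in> M"
  shows "aff_app (aexp A) x \<in> M"
proof -
  have bl: "bounded_linear minus_part"
    unfolding minus_part_def
    by (rule bounded_linear_compose[OF bounded_linear_scaleR_right bounded_linear_sub[OF bounded_linear_ident bounded_linear_aff_conj]])
  obtain n Z where n: "0 < n" "Z \<in> k" "aexp ((1 / real n) *\<^sub>R A) = aff_comp (aexp (minus_part Z)) (aexp (Z - minus_part Z))"
    using aexp_factorization[OF sub_k k_bracket bl m_k[OF minus_part_split(1)] A] by blast
  show ?thesis
  proof (rule aexp_iterate[OF _ n(1) x])
    fix y assume "y \<in> M"
    then have "aff_app (aexp (Z - minus_part Z)) y \<in> M" by (rule aexp_kplus_M[OF minus_part_split(2)[OF n(2)]])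
    then show "aff_app (aexp ((1 / real n) *\<^sub>R A)) y \<in> M"
      unfolding n(3) using Kg_M[OF aexp_kminus_Kg[OF zero minus_part_split(1)[OF n(2)]]] by simp
  qed
qed

section \<open>The invariant form on the transvection algebra\<close>

lemma minus_part_add: "minus_part (A + B) = minus_part A + minus_part B"
  and minus_part_scale: "minus_part (r *\<^sub>R A) = r *\<^sub>R minus_part A"
  by (simp_all add: minus_part_def aff_conj_linear algebra_simps)

lemma minus_part_m: "X \<in> m \<Longrightarrow> minus_part X = X"
  by (simp add: minus_part_def kminus_def scaleR_2[symmetric])

lemma minus_part_kplus: "C \<in> kplus \<Longrightarrow> minus_part C = 0"
  by (simp add: minus_part_def kplus_def)

lemma minus_part_sum: "X \<in> m \<Longrightarrow> C \<in> kplus \<Longrightarrow> minus_part (X + C) = X"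
  by (simp add: minus_part_add minus_part_m minus_part_kplus)

definition plus_part where "plus_part A = A - minus_part A"

lemma plus_part_add: "plus_part (A + B) = plus_part A + plus_part B" and plus_part_scale: "plus_part (r *\<^sub>R A) = r *\<^sub>R plus_part A"
  by (simp_all add: plus_part_def minus_part_add minus_part_scale scaleR_diff_right)

lemma plus_part_in: "A \<in> k \<Longrightarrow> plus_part A \<in> kplus" and minus_part_in: "A \<in> k \<Longrightarrow> minus_part A \<in> m"
  using minus_part_split by (simp_all add: plus_part_def)

lemma k_split: "A = minus_part A + plus_part A" by (simp add: plus_part_def)

lemma m_value_T: "X \<in> m \<Longrightarrow> aff_app X 0 \<in> T 0"
  using k_tangent[OF m_k zero] .

lemma bracket_value:
  "C \<in> kplus \<Longrightarrow> X \<in> m \<Longrightarrow> aff_app (aff_bracket C X) 0 = lin C (aff_app X 0)"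
  "C \<in> kplus \<Longrightarrow> X \<in> m \<Longrightarrow> aff_app (aff_bracket X C) 0 = - lin C (aff_app X 0)"
  by (simp_all add: aff_app_bracket value_kplus blinfun.zero_right)

text \<open>The bracket \<open>[X, Y]\<close> lies in \<open>kplus\<close> and therefore vanishes at
  \<open>0\<close>.\<close>

lemma torsion_free:
  assumes "X \<in> m" "Y \<in> m"
  shows "lin X (aff_app Y 0) = lin Y (aff_app X 0)"
  using value_kplus[OF brackets(3)[OF assms]] by (simp add: aff_app_bracket)

text \<open>The Jacobi identity of \<open>X\<close>, \<open>Y\<close>, \<open>Z\<close>, evaluated at
  \<open>0\<close>. With \<open>m\<close> identified with the tangent space this is the first Bianchi
  identity for the curvature tensor.\<close>

lemma bianchi:
  assumes "X \<in> m" "Y \<in> m" "Z \<in> m"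
  shows "lin (aff_bracket X Y) (aff_app Z 0) + lin (aff_bracket Y Z) (aff_app X 0)
    + lin (aff_bracket Z X) (aff_app Y 0) = 0"
proof -
  have "aff_bracket (aff_bracket X Y) Z + aff_bracket (aff_bracket Y Z) X + aff_bracket (aff_bracket Z X) Y = 0"
    using aff_bracket_jacobi[of X Y Z] aff_bracket_skew[of "aff_bracket Y Z" X] aff_bracket_skew[of "aff_bracket Z X" Y]
      aff_bracket_skew[of Z X] by (simp add: aff_bracket_linear)
  from arg_cong[OF this, of "\<lambda>A. aff_app A 0"] show ?thesis
    using assms by (simp add: bracket_value brackets)
qed

text \<open>As for any curvature tensor: the pair symmetry follows from four instances of the Bianchi
  identity and skewness in the first and in the last two arguments.\<close>

lemma curvature_pair_symmetry:
  assumes X: "X \<in> m" and Y: "Y \<in> m" and Z: "Z \<in> m" and W: "W \<in> m"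
  shows "b (lin (aff_bracket X Y) (aff_app Z 0)) (aff_app W 0)
       = b (lin (aff_bracket Z W) (aff_app X 0)) (aff_app Y 0)"
proof -
  define r where "r X Y Z W = b (lin (aff_bracket X Y) (aff_app Z 0)) (aff_app W 0)" for X Y Z W
  have sk1: "r X Y Z W = - r Y X Z W" for X Y Z W
    unfolding r_def aff_bracket_skew[of X Y] by (simp add: blinfun.minus_left b_simps)
  have sk2: "r X Y Z W = - r X Y W Z" if "X \<in> m" "Y \<in> m" for X Y Z W
    using k_skew[OF k_bracket[OF m_k[OF that(1)] m_k[OF that(2)]], of "aff_app Z 0" "aff_app W 0"] b_sym
    unfolding r_def by (metis eq_neg_iff_add_eq_0)
  have bi: "r X Y Z W + r Y Z X W + r Z X Y W = 0" if "X \<in> m" "Y \<in> m" "Z \<in> m" for X Y Z W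
    using arg_cong[OF bianchi[OF that], of "\<lambda>v. b v (aff_app W 0)"] unfolding r_def by (simp add: b_simps)
  have "r X Y Z W = r Z W X Y"
    using bi[OF X Y Z, of W] bi[OF Y Z W, of X] bi[OF Z W X, of Y] bi[OF W X Y, of Z]
      sk1[of X Y Z W] sk1[of Z X Y W] sk1[of Z W Y X] sk1[of W Y Z X] sk1[of W X Z Y] sk1[of X Z W Y] sk1[of W X Y Z] sk1[of X Y W Z] sk1[of Y W X Z]
      sk2[OF X Y, of Z W] sk2[OF Y Z, of X W] sk2[OF Z X, of Y W] sk2[OF Z W, of X Y] sk2[OF W Y, of Z X] sk2[OF W X, of Z Y] sk2[OF X Z, of W Y] sk2[OF Y W, of X Z]
      sk1[of Y W Z X] sk1[of X Z Y W] sk2[OF Y W, of Z X] sk2[OF X Z, of Y W] sk1[of Y Z W X] sk1[of X W Y Z] sk2[OF X W, of Y Z]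
    by linarith
  then show ?thesis by (simp add: r_def)
qed

lemma aff_independent_finite: "independent (Bs :: 'a aff set) \<Longrightarrow> finite Bs"
proof -
  assume i: "independent Bs"
  obtain U where U: "finite U" "span U = (UNIV :: 'a aff set)" using aff_subspace_basis[OF subspace_UNIV] by metis
  then show "finite Bs" using independent_span_bound[OF U(1) i] by auto
qed

text \<open>The third property forces the definition on brackets. A basis of \<open>l\<close> that
  consists of brackets gives a form with this property in the basis elements; pair symmetry extends it to
  all brackets and yields symmetry.\<close>

lemma invariant_pairing_exists:
  obtains \<beta> where "\<And>C. C \<in> l \<Longrightarrow> linear_on_set l (\<beta> C)" "\<And>C'. linear_on_set l (\<lambda>C. \<beta> C C')"
    "\<And>C X Y. C \<in> l \<Longrightarrow> X \<in> m \<Longrightarrow> Y \<in> m \<Longrightarrow> \<beta> C (aff_bracket X Y) = b (lin C (aff_app X 0)) (aff_app Y 0)"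
    "\<And>C C'. C \<in> l \<Longrightarrow> C' \<in> l \<Longrightarrow> \<beta> C C' = \<beta> C' C"
proof -
  let ?Br = "{aff_bracket X Y | X Y. X \<in> m \<and> Y \<in> m}"
  obtain Bs where Bs: "Bs \<subseteq> ?Br" "independent Bs" "?Br \<subseteq> span Bs" using maximal_independent_subset by blast
  have fin: "finite Bs" using Bs(2) by (rule aff_independent_finite)
  have sp: "span Bs = l"
    unfolding l_def by (rule equalityI[OF span_mono[OF Bs(1)] span_minimal[OF Bs(3) subspace_span]])
  have "\<forall>e\<in>Bs. \<exists>X Y. X \<in> m \<and> Y \<in> m \<and> e = aff_bracket X Y" using Bs(1) by blast
  then obtain X1 Y1 where XY: "\<And>e. e \<in> Bs \<Longrightarrow> X1 e \<in> m" "\<And>e. e \<in> Bs \<Longrightarrow> Y1 e \<in> m" "\<And>e. e \<in> Bs \<Longrightarrow> e = aff_bracket (X1 e) (Y1 e)"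
    by metis
  \<comment> \<open>Expand the second argument in a basis of brackets \<open>e = [X1 e, Y1
    e]\<close>.\<close>
  define \<beta> where "\<beta> C C' = (\<Sum>e\<in>Bs. representation Bs C' e * b (lin C (aff_app (X1 e) 0)) (aff_app (Y1 e) 0))" for C C' :: "'a aff"
  have lin2: "linear_on_set l (\<beta> C)" for C
    unfolding linear_on_set_def sp[symmetric]
  proof (intro conjI ballI allI)
    fix x y assume xy: "x \<in> span Bs" "y \<in> span Bs"
    show "\<beta> C (x + y) = \<beta> C x + \<beta> C y"
      unfolding \<beta>_def by (simp only: representation_add[OF Bs(2) xy(2,1)] representation_add[OF Bs(2) xy] distrib_right sum.distrib)
  next
    fix r x assume x: "x \<in> span Bs"
    show "\<beta> C (r *\<^sub>R x) = r *\<^sub>R \<beta> C x"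
      unfolding \<beta>_def representation_scale[OF Bs(2) x] real_scaleR_def sum_distrib_left mult.assoc ..
  qed
  have lin1: "linear_on_set l (\<lambda>C. \<beta> C C')" for C'
    unfolding linear_on_set_def \<beta>_def
    by (simp add: blinfun.bilinear_simps b_simps distrib_left sum.distrib sum_distrib_left mult.left_commute)
  have lin3: "linear_on_set l (\<lambda>C. b (lin C x) y)" for x y
    unfolding linear_on_set_def by (simp add: blinfun.bilinear_simps b_simps)
  have A: "\<beta> (aff_bracket Z W) C' = b (lin C' (aff_app Z 0)) (aff_app W 0)"
    if Z: "Z \<in> m" and W: "W \<in> m" and C': "C' \<in> l" for Z W C'
  proof -
    have "\<beta> (aff_bracket Z W) C' = (\<Sum>e\<in>Bs. representation Bs C' e * b (lin e (aff_app Z 0)) (aff_app W 0))"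
      unfolding \<beta>_def
    proof (rule sum.cong[OF refl])
      fix e assume e: "e \<in> Bs"
      show "representation Bs C' e * b (lin (aff_bracket Z W) (aff_app (X1 e) 0)) (aff_app (Y1 e) 0)
        = representation Bs C' e * b (lin e (aff_app Z 0)) (aff_app W 0)"
        using curvature_pair_symmetry[OF Z W XY(1)[OF e] XY(2)[OF e]] XY(3)[OF e] by metis
    qed
    also have "\<dots> = b (lin (\<Sum>e\<in>Bs. representation Bs C' e *\<^sub>R e) (aff_app Z 0)) (aff_app W 0)"
      by (simp add: fst_sum blinfun.sum_left blinfun.scaleR_left bounded_bilinear.sum_left[OF bounded_bilinear_b] b_simps)
    also have "(\<Sum>e\<in>Bs. representation Bs C' e *\<^sub>R e) = C'"
      using sum_representation_eq[OF Bs(2) _ fin order_refl, of C'] C' sp by blast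
    finally show ?thesis .
  qed
  have Bm: "\<beta> C (aff_bracket X Y) = b (lin C (aff_app X 0)) (aff_app Y 0)"
    if C: "C \<in> l" and X: "X \<in> m" and Y: "Y \<in> m" for C X Y
  proof (rule linear_on_set_eqI[of ?Br "\<lambda>C. \<beta> C (aff_bracket X Y)" "\<lambda>C. b (lin C (aff_app X 0)) (aff_app Y 0)" C,
        folded l_def, OF lin1 lin3 _ C])
    fix D assume "D \<in> ?Br"
    then obtain Z W where D: "Z \<in> m" "W \<in> m" "D = aff_bracket Z W" by blast
    show "\<beta> D (aff_bracket X Y) = b (lin D (aff_app X 0)) (aff_app Y 0)"
      using A[OF D(1,2) bracket_in_l[OF X Y]] curvature_pair_symmetry[OF X Y D(1,2)] by (simp add: D(3))
  qed
  have sym: "\<beta> C C' = \<beta> C' C" if C: "C \<in> l" and C': "C' \<in> l" for C C'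
  proof (rule linear_on_set_eqI[of ?Br "\<lambda>C. \<beta> C C'" "\<beta> C'" C, folded l_def, OF lin1 lin2 _ C])
    fix D assume "D \<in> ?Br"
    then obtain Z W where D: "Z \<in> m" "W \<in> m" "D = aff_bracket Z W" by blast
    show "\<beta> D C' = \<beta> C' D" using A[OF D(1,2) C'] Bm[OF C' D(1,2)] by (simp add: D(3))
  qed
  show ?thesis by (rule that[OF lin2 lin1 Bm sym])
qed

abbreviation \<tau> where "\<tau> \<equiv> T_map b M"

lemma \<tau>: assumes "u \<in> T 0" shows "\<tau> u \<in> m" "aff_app (\<tau> u) 0 = u"
proof -
  have "u \<in> (\<lambda>X. aff_app X 0) ` m" using kminus_exists[OF zero assms] by force
  then show "\<tau> u \<in> m" "aff_app (\<tau> u) 0 = u"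
    unfolding T_map_def k_minus_eq by (rule inv_into_into, rule f_inv_into_f)
qed

lemma \<tau>_value: "X \<in> m \<Longrightarrow> \<tau> (aff_app X 0) = X"
  using \<tau>[OF m_value_T] by (intro m_eqI) auto

lemma \<tau>_eqI: "X \<in> m \<Longrightarrow> aff_app X 0 = u \<Longrightarrow> \<tau> u = X"
  using \<tau>_value by blast

lemma \<tau>_linear: "u \<in> T 0 \<Longrightarrow> v \<in> T 0 \<Longrightarrow> \<tau> (u + v) = \<tau> u + \<tau> v"
  "u \<in> T 0 \<Longrightarrow> v \<in> T 0 \<Longrightarrow> \<tau> (u - v) = \<tau> u - \<tau> v" "u \<in> T 0 \<Longrightarrow> \<tau> (r *\<^sub>R u) = r *\<^sub>R \<tau> u" "u \<in> T 0 \<Longrightarrow> \<tau> (- u) = - \<tau> u" "\<tau> 0 = 0"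
  using \<tau> by (auto intro!: \<tau>_eqI simp: subspace_add[OF sub_kminus] subspace_scale[OF sub_kminus] subspace_diff[OF sub_kminus]
      subspace_neg[OF sub_kminus] subspace_0[OF sub_kminus])

text \<open>The orthogonal sum of the pairing on \<open>kplus = l\<close> and of the form on
  \<open>m\<close> carried over from the tangent space. An element of \<open>kplus\<close> orthogonal to
  all brackets acts trivially on the tangent space, so \<open>kplus_faithful\<close> gives
  non-degeneracy.\<close>

theorem k_form_exists: "\<exists>B. is_k_form b M B"
proof -
  obtain \<beta> where lin2: "\<And>C. C \<in> l \<Longrightarrow> linear_on_set l (\<beta> C)" and lin1: "\<And>C'. linear_on_set l (\<lambda>C. \<beta> C C')"
    and \<beta>: "\<And>C X Y. C \<in> l \<Longrightarrow> X \<in> m \<Longrightarrow> Y \<in> m \<Longrightarrow> \<beta> C (aff_bracket X Y) = b (lin C (aff_app X 0)) (aff_app Y 0)"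
    and \<beta>_sym: "\<And>C C'. C \<in> l \<Longrightarrow> C' \<in> l \<Longrightarrow> \<beta> C C' = \<beta> C' C"
    using invariant_pairing_exists by metis
  define B where "B A A' = \<beta> (plus_part A) (plus_part A') + b (aff_app (minus_part A) 0) (aff_app (minus_part A') 0)" for A A'
  have cpl: "plus_part A \<in> l" if "A \<in> k" for A using plus_part_in[OF that] kplus_eq by blast
  have \<beta>0: "\<beta> C 0 = 0" "\<beta> 0 C = 0" if "C \<in> l" for C
    using linear_on_set_0[OF lin2[OF that] sub_l] linear_on_set_0[OF lin1 sub_l] by auto
  have \<beta>ad: "\<beta> (aff_bracket C C') C'' + \<beta> C' (aff_bracket C C'') = 0" if C: "C \<in> l" "C' \<in> l" and C'': "C'' \<in> l" for C C' C''
  proof -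
    have Ck: "C \<in> kplus" "C' \<in> kplus" using C kplus_eq by auto
    have CC: "aff_bracket C C' \<in> l" by (rule kplus_l_bracket[OF Ck(1) C(2)])
    have l1: "linear_on_set l (\<lambda>C''. \<beta> (aff_bracket C C') C'' + \<beta> C' (aff_bracket C C''))"
      unfolding linear_on_set_def
    proof (intro conjI ballI allI)
      fix x y r assume xy: "x \<in> l" "y \<in> l"
      have Cx: "aff_bracket C x \<in> l" "aff_bracket C y \<in> l" using xy kplus_l_bracket[OF Ck(1)] by auto
      show "\<beta> (aff_bracket C C') (x + y) + \<beta> C' (aff_bracket C (x + y)) =
        \<beta> (aff_bracket C C') x + \<beta> C' (aff_bracket C x) + (\<beta> (aff_bracket C C') y + \<beta> C' (aff_bracket C y))"
        using linear_on_setD(1)[OF lin2[OF CC] xy] linear_on_setD(1)[OF lin2[OF C(2)] Cx] by (simp add: aff_bracket_linear)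
    next
      fix r x assume x: "x \<in> l"
      show "\<beta> (aff_bracket C C') (r *\<^sub>R x) + \<beta> C' (aff_bracket C (r *\<^sub>R x)) = r *\<^sub>R (\<beta> (aff_bracket C C') x + \<beta> C' (aff_bracket C x))"
        using linear_on_setD(2)[OF lin2[OF CC] x, of r] linear_on_setD(2)[OF lin2[OF C(2)] kplus_l_bracket[OF Ck(1) x], of r]
        by (simp add: aff_bracket_linear distrib_left)
    qed
    have l2: "linear_on_set l (\<lambda>_. 0::real)" by (simp add: linear_on_set_def)
    show ?thesis
    proof (rule linear_on_set_eqI[of "{aff_bracket X Y | X Y. X \<in> m \<and> Y \<in> m}", folded l_def, OF l1 l2 _ C''])
      fix D assume "D \<in> {aff_bracket X Y | X Y. X \<in> m \<and> Y \<in> m}"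
      then obtain Z W where D: "Z \<in> m" "W \<in> m" "D = aff_bracket Z W" by blast
      have CZ: "aff_bracket C Z \<in> m" "aff_bracket C W \<in> m" using brackets(1)[OF Ck(1)] D by auto
      have "\<beta> (aff_bracket C C') D = b (lin (aff_bracket C C') (aff_app Z 0)) (aff_app W 0)"
        unfolding D(3) by (rule \<beta>[OF CC D(1,2)])
      moreover have "\<beta> C' (aff_bracket C D) = \<beta> C' (aff_bracket (aff_bracket C Z) W) + \<beta> C' (aff_bracket Z (aff_bracket C W))"
        unfolding D(3) aff_bracket_jacobi[of C Z W]
        by (rule linear_on_setD(1)[OF lin2[OF C(2)]]) (intro bracket_in_l CZ D)+
      moreover have "\<dots> = b (lin C' (lin C (aff_app Z 0))) (aff_app W 0)
           + b (lin C' (aff_app Z 0)) (lin C (aff_app W 0))"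
        by (simp add: \<beta>[OF C(2) CZ(1) D(2)] \<beta>[OF C(2) D(1) CZ(2)] bracket_value(1)[OF Ck(1)] D)
      ultimately show "\<beta> (aff_bracket C C') D + \<beta> C' (aff_bracket C D) = 0"
        using k_skew[OF kplus_k[OF Ck(1)], of "lin C' (aff_app Z 0)" "aff_app W 0"]
        by (simp add: fst_aff_bracket b_simps)
    qed
  qed
  have "is_k_form b M B"
    unfolding is_k_form_def
  proof (intro conjI)
    show "sym_bilinear_on k B"
      unfolding sym_bilinear_on_def bilinear_on_set_def
    proof (intro conjI ballI)
      fix A A' assume A: "A \<in> k" "A' \<in> k"
      show "B A A' = B A' A" using \<beta>_sym[OF cpl[OF A(1)] cpl[OF A(2)]] b_sym by (simp add: B_def)
    next
      fix A assume A: "A \<in> k"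
      show "linear_on_set k (B A)"
        unfolding linear_on_set_def B_def
        using linear_on_setD[OF lin2[OF cpl[OF A]]] cpl by (simp add: plus_part_add plus_part_scale minus_part_add minus_part_scale b_simps distrib_left)
      show "linear_on_set k (\<lambda>A'. B A' A)"
        unfolding linear_on_set_def B_def
        using linear_on_setD[OF lin1[of "plus_part A"]] cpl by (simp add: plus_part_add plus_part_scale minus_part_add minus_part_scale b_simps distrib_left)
    qed
    show "nondegenerate_on k B"
      unfolding nondegenerate_on_def
    proof (intro ballI impI)
      fix A assume A: "A \<in> k" and z: "\<forall>A'\<in>k. B A A' = 0"
      have km: "minus_part A = 0"
      proof (rule m_eqI[OF minus_part_in[OF A] subspace_0[OF sub_kminus]])
        have "aff_app (minus_part A) 0 = 0"
        proof (rule orthogonal_zero[OF zero m_value_T[OF minus_part_in[OF A]]])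
          fix t assume t: "t \<in> T 0"
          have "B A (\<tau> t) = 0" using z m_k[OF \<tau>(1)[OF t]] by blast
          then show "b t (aff_app (minus_part A) 0) = 0"
            using \<beta>0(1)[OF cpl[OF A]] \<tau>[OF t] b_sym by (simp add: B_def minus_part_m plus_part_def)
        qed
        then show "aff_app (minus_part A) 0 = aff_app 0 0" by simp
      qed
      have C: "A \<in> kplus" using plus_part_in[OF A] km by (simp add: plus_part_def)
      then have Al: "A \<in> l" using kplus_eq by blast
      show "A = 0"
      proof (rule kplus_faithful[OF C])
        fix u assume u: "u \<in> T 0"
        show "lin A u = 0"
        proof (rule orthogonal_zero[OF zero kplus_tangent[OF C u]])
          fix t assume t: "t \<in> T 0"
          have br: "aff_bracket (\<tau> u) (\<tau> t) \<in> kplus" by (intro brackets \<tau> u t)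
          have "B A (aff_bracket (\<tau> u) (\<tau> t)) = 0" using z kplus_k[OF br] by blast
          then have "\<beta> A (aff_bracket (\<tau> u) (\<tau> t)) = 0"
            by (simp add: B_def km plus_part_def minus_part_kplus[OF br] b_simps)
          then show "b t (lin A u) = 0"
            using \<beta>[OF Al \<tau>(1)[OF u] \<tau>(1)[OF t]] \<tau>(2)[OF u] \<tau>(2)[OF t] b_sym by simp
        qed
      qed
    qed
    show "ad_invariant k aff_bracket B"
      unfolding ad_invariant_def
    proof (intro ballI)
      fix A1 A2 A3 assume A: "A1 \<in> k" "A2 \<in> k" "A3 \<in> k"
      have mm: "minus_part A1 \<in> m" "minus_part A2 \<in> m" "minus_part A3 \<in> m" using A by (auto intro: minus_part_in)
      have cc: "plus_part A1 \<in> kplus" "plus_part A2 \<in> kplus" "plus_part A3 \<in> kplus" using A by (auto intro: plus_part_in)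
      have cl: "plus_part A1 \<in> l" "plus_part A2 \<in> l" "plus_part A3 \<in> l" using A cpl by auto
      have split: "minus_part (aff_bracket A A') = aff_bracket (minus_part A) (plus_part A') + aff_bracket (plus_part A) (minus_part A')
           \<and> plus_part (aff_bracket A A') = aff_bracket (minus_part A) (minus_part A') + aff_bracket (plus_part A) (plus_part A')"
        if "A \<in> k" "A' \<in> k" for A A'
      proof -
        have mA: "minus_part A \<in> m" "minus_part A' \<in> m" "plus_part A \<in> kplus" "plus_part A' \<in> kplus" using that by (auto intro: minus_part_in plus_part_in)
        have e: "aff_bracket A A' = (aff_bracket (minus_part A) (plus_part A') + aff_bracket (plus_part A) (minus_part A'))
          + (aff_bracket (minus_part A) (minus_part A') + aff_bracket (plus_part A) (plus_part A'))"
          using arg_cong2[OF k_split[of A] k_split[of A'], of aff_bracket] by (simp add: aff_bracket_linear add_ac)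
        have km: "minus_part (aff_bracket A A') = aff_bracket (minus_part A) (plus_part A') + aff_bracket (plus_part A) (minus_part A')"
          unfolding e by (rule minus_part_sum) (intro subspace_add[OF sub_kminus] subspace_add[OF sub_kplus] brackets mA)+
        have "plus_part (aff_bracket A A') = aff_bracket (minus_part A) (minus_part A') + aff_bracket (plus_part A) (plus_part A')"
          unfolding plus_part_def[of "aff_bracket A A'"] km by (subst e) simp
        with km show ?thesis by blast
      qed
      have \<beta>1: "\<beta> (aff_bracket (minus_part A1) (minus_part A2) + aff_bracket (plus_part A1) (plus_part A2)) (plus_part A3)
         = b (lin (plus_part A3) (aff_app (minus_part A1) 0)) (aff_app (minus_part A2) 0) + \<beta> (aff_bracket (plus_part A1) (plus_part A2)) (plus_part A3)"
        using linear_on_setD(1)[OF lin1 bracket_in_l[OF mm(1,2)] kplus_l_bracket[OF cc(1) cl(2)], of "plus_part A3"]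
          \<beta>_sym[OF bracket_in_l[OF mm(1,2)] cl(3)] \<beta>[OF cl(3) mm(1,2)] by simp
      have \<beta>2: "\<beta> (plus_part A2) (aff_bracket (minus_part A1) (minus_part A3) + aff_bracket (plus_part A1) (plus_part A3))
         = b (lin (plus_part A2) (aff_app (minus_part A1) 0)) (aff_app (minus_part A3) 0) + \<beta> (plus_part A2) (aff_bracket (plus_part A1) (plus_part A3))"
        using linear_on_setD(1)[OF lin2[OF cl(2)] bracket_in_l[OF mm(1,3)] kplus_l_bracket[OF cc(1) cl(3)]] \<beta>[OF cl(2) mm(1,3)] by simp
      show "B (aff_bracket A1 A2) A3 + B A2 (aff_bracket A1 A3) = 0"
        unfolding B_def split[OF A(1,2), THEN conjunct1] split[OF A(1,2), THEN conjunct2]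
          split[OF A(1,3), THEN conjunct1] split[OF A(1,3), THEN conjunct2] \<beta>1 \<beta>2
        using \<beta>ad[OF cl] k_skew[OF kplus_k[OF cc(1)], of "aff_app (minus_part A2) 0" "aff_app (minus_part A3) 0"]
          b_sym[of "aff_app (minus_part A2) 0" "lin (plus_part A3) (aff_app (minus_part A1) 0)"]
        by (simp add: bracket_value[OF cc(1) mm(2)] bracket_value[OF cc(1) mm(3)] bracket_value[OF cc(2) mm(1)] bracket_value[OF cc(3) mm(1)] b_simps)
    qed
    show "\<forall>X\<in>k. \<forall>Y\<in>k. B (k_inv b M X) (k_inv b M Y) = B X Y"
    proof (intro ballI)
      have inv: "minus_part (k_inv b M A) = - minus_part A" "plus_part (k_inv b M A) = plus_part A" if "A \<in> k" for A
      proof -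
        have "aff_conj (s 0) (s 0) A = aff_conj (s 0) (s 0) (minus_part A) + aff_conj (s 0) (s 0) (plus_part A)"
          using arg_cong[OF k_split[of A], of "aff_conj (s 0) (s 0)"] by (simp add: aff_conj_linear)
        then have e: "k_inv b M A = - minus_part A + plus_part A"
          using minus_part_in[OF that] plus_part_in[OF that] by (simp add: k_inv_eq kminus_def kplus_def)
        show km: "minus_part (k_inv b M A) = - minus_part A"
          unfolding e by (rule minus_part_sum[OF subspace_neg[OF sub_kminus minus_part_in[OF that]] plus_part_in[OF that]])
        show "plus_part (k_inv b M A) = plus_part A" unfolding plus_part_def[of "k_inv b M A"] km by (subst e) simp
      qed
      fix X Y assume "X \<in> k" "Y \<in> k"
      then show "B (k_inv b M X) (k_inv b M Y) = B X Y" by (simp add: B_def inv b_simps)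
    qed
    show "\<forall>u\<in>T 0. \<forall>v\<in>T 0. B (\<tau> u) (\<tau> v) = b u v"
      using \<tau> \<beta>0(1)[OF subspace_0[OF sub_l]] by (simp add: B_def minus_part_m plus_part_def)
  qed
  then show ?thesis by blast
qed

abbreviation \<kappa> where "\<kappa> \<equiv> k_form b M"

lemma k_form: "is_k_form b M \<kappa>"
  unfolding k_form_def by (rule someI_ex[OF k_form_exists])

lemma \<kappa>_bilinear: "sym_bilinear_on k \<kappa>" and \<kappa>_nondegenerate: "nondegenerate_on k \<kappa>"
  and \<kappa>_ad: "ad_invariant k aff_bracket \<kappa>"
  and \<kappa>_inv: "X \<in> k \<Longrightarrow> Y \<in> k \<Longrightarrow> \<kappa> (aff_conj (s 0) (s 0) X) (aff_conj (s 0) (s 0) Y) = \<kappa> X Y"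
  and \<kappa>_\<tau>: "u \<in> T 0 \<Longrightarrow> v \<in> T 0 \<Longrightarrow> \<kappa> (\<tau> u) (\<tau> v) = b u v"
  using k_form unfolding is_k_form_def k_inv_eq by blast+

lemma \<kappa>_sym: "X \<in> k \<Longrightarrow> Y \<in> k \<Longrightarrow> \<kappa> X Y = \<kappa> Y X"
  using \<kappa>_bilinear by (simp add: sym_bilinear_on_def)

lemma \<kappa>_lin: "X \<in> k \<Longrightarrow> linear_on_set k (\<kappa> X)" "Y \<in> k \<Longrightarrow> linear_on_set k (\<lambda>X. \<kappa> X Y)"
  using \<kappa>_bilinear by (auto simp: sym_bilinear_on_def bilinear_on_set_def)

lemma \<kappa>_simps:
  "X \<in> k \<Longrightarrow> Y \<in> k \<Longrightarrow> Z \<in> k \<Longrightarrow> \<kappa> X (Y + Z) = \<kappa> X Y + \<kappa> X Z"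
  "X \<in> k \<Longrightarrow> Y \<in> k \<Longrightarrow> Z \<in> k \<Longrightarrow> \<kappa> (Y + Z) X = \<kappa> Y X + \<kappa> Z X"
  "X \<in> k \<Longrightarrow> Y \<in> k \<Longrightarrow> \<kappa> X (r *\<^sub>R Y) = r * \<kappa> X Y"
  "X \<in> k \<Longrightarrow> Y \<in> k \<Longrightarrow> \<kappa> (r *\<^sub>R Y) X = r * \<kappa> Y X"
  "X \<in> k \<Longrightarrow> Y \<in> k \<Longrightarrow> \<kappa> X (- Y) = - \<kappa> X Y"
  "X \<in> k \<Longrightarrow> Y \<in> k \<Longrightarrow> \<kappa> (- Y) X = - \<kappa> Y X"
  "X \<in> k \<Longrightarrow> \<kappa> X 0 = 0" "X \<in> k \<Longrightarrow> \<kappa> 0 X = 0"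
  using linear_on_setD[OF \<kappa>_lin(1), of X] linear_on_setD[OF \<kappa>_lin(2), of X]
    linear_on_setD(2)[OF \<kappa>_lin(1), of X Y "-1"] linear_on_setD(2)[OF \<kappa>_lin(2), of X Y "-1"]
    linear_on_set_0[OF \<kappa>_lin(1) sub_k, of X] linear_on_set_0[OF \<kappa>_lin(2) sub_k, of X]
  by simp_all

lemma \<kappa>_m: "X \<in> m \<Longrightarrow> Y \<in> m \<Longrightarrow> \<kappa> X Y = b (aff_app X 0) (aff_app Y 0)"
  using \<kappa>_\<tau>[OF m_value_T m_value_T, of X Y] by (simp add: \<tau>_value)

lemma \<kappa>_orth: "C \<in> kplus \<Longrightarrow> X \<in> m \<Longrightarrow> \<kappa> C X = 0" "C \<in> kplus \<Longrightarrow> X \<in> m \<Longrightarrow> \<kappa> X C = 0"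
proof -
  assume C: "C \<in> kplus" and X: "X \<in> m"
  have "\<kappa> C (- X) = \<kappa> C X" using \<kappa>_inv[OF kplus_k[OF C] m_k[OF X]] C X by (simp add: kplus_def kminus_def)
  then show "\<kappa> C X = 0" using \<kappa>_simps(5)[OF kplus_k[OF C] m_k[OF X]] by simp
  then show "\<kappa> X C = 0" using \<kappa>_sym[OF kplus_k[OF C] m_k[OF X]] by simp
qed

text \<open>Invariance fixes the pairing with brackets, so the chosen form has the properties of the
  constructed one.\<close>

lemma \<kappa>_bracket:
  assumes C: "C \<in> kplus" and X: "X \<in> m" and Y: "Y \<in> m"
  shows "\<kappa> C (aff_bracket X Y) = b (lin C (aff_app X 0)) (aff_app Y 0)"
proof -
  have "\<kappa> (aff_bracket X C) Y + \<kappa> C (aff_bracket X Y) = 0"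
    using \<kappa>_ad m_k[OF X] kplus_k[OF C] m_k[OF Y] unfolding ad_invariant_def by blast
  then show ?thesis using \<kappa>_m[OF brackets(2)[OF X C] Y] by (simp add: bracket_value(2)[OF C X] b_simps)
qed

lemma \<kappa>_eqI:
  assumes "C \<in> k" "C' \<in> k" "\<And>A. A \<in> k \<Longrightarrow> \<kappa> A C = \<kappa> A C'"
  shows "C = C'"
proof -
  have d: "C - C' \<in> k" using assms by (intro subspace_diff[OF sub_k])
  have "\<kappa> (C - C') A = 0" if A: "A \<in> k" for A
    using \<kappa>_simps(1)[OF A d assms(2)] assms(3)[OF A] \<kappa>_sym[OF A d] by simp
  then have "C - C' = 0" using \<kappa>_nondegenerate d unfolding nondegenerate_on_def by blast
  then show ?thesis by simp
qed

section \<open>The bracket of two vectors\<close>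

abbreviation VV where "VV \<equiv> VV_bracket b M"

text \<open>The form \<open>\<kappa>\<close> is non-degenerate, so the linear form that defines the
  bracket of two vectors is represented.\<close>

lemma VV_ex1: "\<exists>!C. C \<in> k \<and> (\<forall>A\<in>k. \<kappa> A C = b (lin A v) w)"
proof -
  obtain Bs where Bs: "finite Bs" "independent Bs" "Bs \<subseteq> k" "span Bs = k" using aff_subspace_basis[OF sub_k] by metis
  have lin: "linear_on_set k (\<lambda>A. b (lin A v) w)"
    unfolding linear_on_set_def by (simp add: blinfun.bilinear_simps b_simps)
  obtain C where C: "C \<in> k" "\<forall>A\<in>k. \<kappa> A C = b (lin A v) w"
    using nondegenerate_representation[OF Bs(1,2,4) \<kappa>_bilinear \<kappa>_nondegenerate lin] by metis
  show ?thesis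
  proof (rule ex1I[of _ C])
    fix C' assume "C' \<in> k \<and> (\<forall>A\<in>k. \<kappa> A C' = b (lin A v) w)"
    then show "C' = C" using C by (intro \<kappa>_eqI) auto
  qed (use C in blast)
qed

lemma VV_in: "VV v w \<in> k" and VV_char: "A \<in> k \<Longrightarrow> \<kappa> A (VV v w) = b (lin A v) w"
  using theI'[OF VV_ex1, of v w] unfolding VV_bracket_def by auto

lemma VV_eqI: "C \<in> k \<Longrightarrow> (\<And>A. A \<in> k \<Longrightarrow> \<kappa> A C = b (lin A v) w) \<Longrightarrow> VV v w = C"
  unfolding VV_bracket_def by (rule the1_equality[OF VV_ex1]) blast

lemma VV_add_left: "VV (v + v') w = VV v w + VV v' w"
  by (rule VV_eqI) (simp_all add: subspace_add[OF sub_k] VV_in \<kappa>_simps VV_char blinfun.bilinear_simps b_simps)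

lemma VV_scale_left: "VV (r *\<^sub>R v) w = r *\<^sub>R VV v w"
  by (rule VV_eqI) (simp_all add: subspace_scale[OF sub_k] VV_in \<kappa>_simps VV_char blinfun.bilinear_simps b_simps)

lemma VV_skew: "VV v w = - VV w v"
proof (rule VV_eqI)
  show "- VV w v \<in> k" by (rule subspace_neg[OF sub_k VV_in])
  fix A assume A: "A \<in> k"
  show "\<kappa> A (- VV w v) = b (lin A v) w"
    using k_skew[OF A, of w v] b_sym[of w "lin A v"] by (simp add: \<kappa>_simps(5)[OF A VV_in] VV_char[OF A])
qed

lemma VV_minus_left: "VV (- v) w = - VV v w"
  using VV_scale_left[of "-1" v w] by simp

lemma VV_linear:
  "VV (v + v') w = VV v w + VV v' w" "VV (r *\<^sub>R v) w = r *\<^sub>R VV v w" "VV (- v) w = - VV v w" "VV (v - v') w = VV v w - VV v' w"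
  "VV w (v + v') = VV w v + VV w v'" "VV w (r *\<^sub>R v) = r *\<^sub>R VV w v" "VV w (- v) = - VV w v" "VV w (v - v') = VV w v - VV w v'"
  "VV 0 w = 0" "VV w 0 = 0" "VV v v = 0"
proof -
  show L: "VV (v + v') w = VV v w + VV v' w" "VV (r *\<^sub>R v) w = r *\<^sub>R VV v w" "VV (- v) w = - VV v w" for v v' w r
    by (rule VV_add_left VV_scale_left VV_minus_left)+
  show L4: "VV (v - v') w = VV v w - VV v' w" for v v' w using L(1)[of v "- v'" w] L(3) by simp
  show "VV 0 w = 0" using L(2)[of 0 0 w] by simp
  show "VV w (v + v') = VV w v + VV w v'" using VV_skew[of w "v + v'"] VV_skew[of w v] VV_skew[of w v'] L(1) by simp
  show "VV w (r *\<^sub>R v) = r *\<^sub>R VV w v" using VV_skew[of w "r *\<^sub>R v"] VV_skew[of w v] L(2) by simp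
  show "VV w (- v) = - VV w v" using VV_skew[of w "- v"] VV_skew[of w v] L(3) by simp
  show "VV w (v - v') = VV w v - VV w v'" using VV_skew[of w "v - v'"] VV_skew[of w v] VV_skew[of w v'] L4 by simp
  show "VV w 0 = 0" using VV_skew[of w 0] L(2)[of 0 0 w] by simp
  have "2 *\<^sub>R VV v v = 0" using VV_skew[of v v] by (metis add.right_inverse scaleR_2)
  then show "VV v v = 0" by simp
qed

text \<open>The Jacobi identity for one element of \<open>k\<close> and two vectors is invariance of
  \<open>\<kappa>\<close> and skewness of \<open>A\<close>.\<close>

lemma k_VV:
  assumes A: "A \<in> k"
  shows "aff_bracket A (VV v w) = VV (lin A v) w + VV v (lin A w)"
proof (rule \<kappa>_eqI)
  show "aff_bracket A (VV v w) \<in> k" by (intro k_bracket A VV_in)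
  show "VV (lin A v) w + VV v (lin A w) \<in> k" by (intro subspace_add[OF sub_k] VV_in)
  fix D assume D: "D \<in> k"
  have "\<kappa> (aff_bracket A D) (VV v w) + \<kappa> D (aff_bracket A (VV v w)) = 0"
    using \<kappa>_ad A D VV_in unfolding ad_invariant_def by blast
  then show "\<kappa> D (aff_bracket A (VV v w)) = \<kappa> D (VV (lin A v) w + VV v (lin A w))"
    using k_skew[OF A, of "lin D v" w]
    by (simp add: \<kappa>_simps(1)[OF D VV_in VV_in] VV_char[OF D] VV_char[OF k_bracket[OF A D]] fst_aff_bracket b_simps)
qed

lemma b_normal: "P 0 n = 0 \<Longrightarrow> u \<in> T 0 \<Longrightarrow> b u n = 0" "P 0 n = 0 \<Longrightarrow> u \<in> T 0 \<Longrightarrow> b n u = 0"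
  using P_orth[OF zero, of u n] b_sym by auto

text \<open>The map \<open>T\<close> is compatible with the brackets of tangent vectors: paired with
  \<open>A\<close>, the right-hand side depends on the part of \<open>A\<close> in \<open>kplus\<close>
  only, by \<open>\<kappa>_bracket\<close>, and so does \<open>b (A p) q\<close>, as the part in
  \<open>m\<close> maps \<open>p\<close> to a normal vector.\<close>

lemma VV_tangent:
  assumes p: "p \<in> T 0" and q: "q \<in> T 0"
  shows "VV p q = aff_bracket (\<tau> p) (\<tau> q)"
proof (rule VV_eqI)
  have br: "aff_bracket (\<tau> p) (\<tau> q) \<in> kplus" by (intro brackets \<tau> p q)
  then show brk: "aff_bracket (\<tau> p) (\<tau> q) \<in> k" by (rule kplus_k)
  fix A assume A: "A \<in> k"
  have "\<kappa> A (aff_bracket (\<tau> p) (\<tau> q)) = \<kappa> (minus_part A) (aff_bracket (\<tau> p) (\<tau> q)) + \<kappa> (plus_part A) (aff_bracket (\<tau> p) (\<tau> q))"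
    using \<kappa>_simps(2)[OF brk m_k[OF minus_part_in[OF A]] kplus_k[OF plus_part_in[OF A]]] k_split[of A] by simp
  also have "\<dots> = b (lin (plus_part A) p) q"
    using \<kappa>_orth(2)[OF br minus_part_in[OF A]] \<kappa>_bracket[OF plus_part_in[OF A] \<tau>(1)[OF p] \<tau>(1)[OF q]] \<tau>(2) p q by simp
  also have "\<dots> = b (lin (minus_part A) p) q + b (lin (plus_part A) p) q"
    using b_normal(2)[OF m_tangent[OF minus_part_in[OF A] p] q] by simp
  also have "\<dots> = b (lin (minus_part A + plus_part A) p) q" by (simp add: blinfun.add_left b_simps)
  finally show "\<kappa> A (aff_bracket (\<tau> p) (\<tau> q)) = b (lin A p) q" by (simp only: k_split[symmetric])
qed

text \<open>Skewness moves \<open>T p\<close> to the other argument of \<open>b\<close>, and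
  \<open>torsion_free\<close> exchanges it with the part of \<open>A\<close> in \<open>m\<close>. As a
  function of \<open>p\<close>, \<open>T p n\<close> is the shape operator of the normal vector
  \<open>n\<close>, up to sign.\<close>

lemma VV_mixed:
  assumes p: "p \<in> T 0" and n: "P 0 n = 0"
  shows "VV p n = - \<tau> (lin (\<tau> p) n)"
proof (rule VV_eqI)
  have w: "lin (\<tau> p) n \<in> T 0" by (rule m_normal[OF \<tau>(1)[OF p] n])
  have tw: "\<tau> (lin (\<tau> p) n) \<in> k" by (rule m_k[OF \<tau>(1)[OF w]])
  then show "- \<tau> (lin (\<tau> p) n) \<in> k" by (rule subspace_neg[OF sub_k])
  fix A assume A: "A \<in> k"
  have "\<kappa> A (\<tau> (lin (\<tau> p) n)) = \<kappa> (minus_part A) (\<tau> (lin (\<tau> p) n)) + \<kappa> (plus_part A) (\<tau> (lin (\<tau> p) n))"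
    using \<kappa>_simps(2)[OF tw m_k[OF minus_part_in[OF A]] kplus_k[OF plus_part_in[OF A]]] k_split[of A] by simp
  also have "\<dots> = b (aff_app (minus_part A) 0) (lin (\<tau> p) n)"
    using \<kappa>_orth(1)[OF plus_part_in[OF A] \<tau>(1)[OF w]] \<kappa>_m[OF minus_part_in[OF A] \<tau>(1)[OF w]] \<tau>(2)[OF w] by simp
  also have "\<dots> = - b (lin (\<tau> p) (aff_app (minus_part A) 0)) n"
    using k_skew[OF m_k[OF \<tau>(1)[OF p]], of "aff_app (minus_part A) 0" n] by simp
  also have "lin (\<tau> p) (aff_app (minus_part A) 0) = lin (minus_part A) p"
    using torsion_free[OF \<tau>(1)[OF p] minus_part_in[OF A]] \<tau>(2)[OF p] by simp
  also have "b (lin (minus_part A) p) n = b (lin (minus_part A + plus_part A) p) n"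
    using b_normal(1)[OF n kplus_tangent[OF plus_part_in[OF A] p]] by (simp add: blinfun.add_left b_simps)
  finally show "\<kappa> A (- \<tau> (lin (\<tau> p) n)) = b (lin A p) n"
    by (simp add: \<kappa>_simps(5)[OF A tw] k_split[symmetric])
qed

text \<open>The component in \<open>m\<close> vanishes because it is orthogonal to \<open>m\<close>,
  which maps normal vectors to tangent ones.\<close>

lemma VV_normal:
  assumes n: "P 0 n = 0" "P 0 n' = 0"
  shows "VV n n' \<in> kplus"
proof -
  let ?C = "VV n n'"
  have "aff_app (minus_part ?C) 0 = 0"
  proof (rule orthogonal_zero[OF zero m_value_T[OF minus_part_in[OF VV_in]]])
    fix t assume t: "t \<in> T 0"
    have "\<kappa> (\<tau> t) ?C = b (lin (\<tau> t) n) n'" by (rule VV_char[OF m_k[OF \<tau>(1)[OF t]]])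
    also have "\<dots> = 0" by (rule b_normal(1)[OF n(2) m_normal[OF \<tau>(1)[OF t] n(1)]])
    finally have "\<kappa> (\<tau> t) (minus_part ?C + plus_part ?C) = 0" by (simp only: k_split[symmetric])
    then have "\<kappa> (\<tau> t) (minus_part ?C) = 0"
      using \<kappa>_simps(1)[OF m_k[OF \<tau>(1)[OF t]] m_k[OF minus_part_in[OF VV_in]] kplus_k[OF plus_part_in[OF VV_in]], of n n' n n']
        \<kappa>_orth(2)[OF plus_part_in[OF VV_in] \<tau>(1)[OF t], of n n'] by simp
    then show "b t (aff_app (minus_part ?C) 0) = 0" using \<kappa>_m[OF \<tau>(1)[OF t] minus_part_in[OF VV_in]] \<tau>(2)[OF t] by simp
  qed
  then have "minus_part ?C = 0" by (intro m_eqI minus_part_in VV_in subspace_0[OF sub_kminus]) simp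
  then show ?thesis using plus_part_in[OF VV_in, of n n'] by (simp add: plus_part_def)
qed

section \<open>The derivation and the Jacobi identity\<close>

lemma V_proj_eq: "V_proj_minus b M v = P 0 v"
  by (simp add: V_proj_minus_def aff_app_refl[OF zero])

lemma value_minus_part: "A \<in> k \<Longrightarrow> aff_app (minus_part A) 0 = aff_app A 0"
  using arg_cong[OF k_split[of A], of "\<lambda>A. aff_app A 0"] value_kplus[OF plus_part_in] by simp

lemma g_D_eq: "A \<in> k \<Longrightarrow> g_D b M (A, v) = (\<tau> (P 0 v), - aff_app A 0)"
  by (simp add: g_D_def V_proj_eq k_proj_minus_def k_inv_eq minus_part_def[symmetric] value_minus_part)

lemma P0_in: "P 0 v \<in> T 0" and P0_normal: "P 0 (v - P 0 v) = 0"
  by (rule P_in[OF zero]) (simp add: linear_diff[OF linear_P[OF zero]] P_P[OF zero])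

lemma bracket_kplus_\<tau>: "C \<in> kplus \<Longrightarrow> p \<in> T 0 \<Longrightarrow> aff_bracket C (\<tau> p) = \<tau> (lin C p)"
  by (rule \<tau>_eqI[symmetric]) (simp_all add: brackets(1) \<tau> bracket_value)

text \<open>The derivation property of \<open>D\<close> on \<open>[A, v]\<close>. It is linear in
  \<open>A\<close> and \<open>v\<close>: split \<open>A\<close> into its parts in \<open>m\<close> and
  \<open>kplus\<close> and \<open>v\<close> into tangent and normal part; the four cases follow from the
  preceding formulas for brackets.\<close>

lemma derivation_kV:
  assumes A: "A \<in> k"
  shows "\<tau> (P 0 (lin A v)) = aff_bracket A (\<tau> (P 0 v)) - VV (aff_app A 0) v"
proof -
  let ?X = "minus_part A" and ?C = "plus_part A" and ?p = "P 0 v" and ?n = "v - P 0 v"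
  note X = minus_part_in[OF A] and C = plus_part_in[OF A] and p = P0_in[of v] and n = P0_normal[of v]
  have Xp: "P 0 (lin ?X ?p) = 0" by (rule m_tangent[OF X p])
  have Xn: "lin ?X ?n \<in> T 0" by (rule m_normal[OF X n])
  have Cp: "lin ?C ?p \<in> T 0" by (rule kplus_tangent[OF C p])
  have Cn: "P 0 (lin ?C ?n) = 0" by (rule kplus_normal[OF C n])
  have A0: "aff_app A 0 = aff_app ?X 0" by (rule value_minus_part[OF A, symmetric])
  have "lin A v = lin ?X ?p + lin ?X ?n
      + (lin ?C ?p + lin ?C ?n)"
    by (simp add: plus_part_def blinfun.bilinear_simps)
  then have "P 0 (lin A v) = lin ?X ?n + lin ?C ?p"
    by (simp add: P_add[OF zero] Xp Cn P_tangent[OF zero Xn] P_tangent[OF zero Cp])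
  then have 1: "\<tau> (P 0 (lin A v)) = \<tau> (lin ?X ?n) + aff_bracket ?C (\<tau> ?p)"
    by (simp add: \<tau>_linear(1)[OF Xn Cp] bracket_kplus_\<tau>[OF C p])
  have "VV (aff_app A 0) v = VV (aff_app ?X 0) ?p + VV (aff_app ?X 0) ?n"
    unfolding A0 VV_linear(5)[symmetric] by simp
  also have "\<dots> = aff_bracket ?X (\<tau> ?p) - \<tau> (lin ?X ?n)"
    using VV_tangent[OF m_value_T[OF X] p] VV_mixed[OF m_value_T[OF X] n] by (simp add: \<tau>_value[OF X])
  finally have 2: "VV (aff_app A 0) v = aff_bracket ?X (\<tau> ?p) - \<tau> (lin ?X ?n)" .
  have 3: "aff_bracket A (\<tau> ?p) = aff_bracket ?X (\<tau> ?p) + aff_bracket ?C (\<tau> ?p)"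
    unfolding aff_bracket_linear(1)[symmetric] by (simp only: k_split[symmetric])
  show ?thesis unfolding 1 2 3 by simp
qed

text \<open>The derivation property of \<open>D\<close> on \<open>[v, w]\<close>, by the same splitting.
  On \<open>k\<close> the map \<open>D\<close> is the negative of the value at the origin
  (\<open>g_D_eq\<close>).\<close>

lemma derivation_VV:
  "- aff_app (VV v w) 0 = lin (\<tau> (P 0 v)) w - lin (\<tau> (P 0 w)) v"
proof -
  have mixed: "aff_app (VV p n) 0 = - lin (\<tau> p) n" if "p \<in> T 0" "P 0 n = 0" for p n
    using \<tau>(2)[OF m_normal[OF \<tau>(1)[OF that(1)] that(2)]] by (simp add: VV_mixed[OF that])
  let ?p = "P 0 v" and ?n = "v - P 0 v" and ?q = "P 0 w" and ?n' = "w - P 0 w"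
  note p = P0_in[of v] and n = P0_normal[of v] and q = P0_in[of w] and n' = P0_normal[of w]
  have "VV v w = VV (?p + ?n) (?q + ?n')" by simp
  also have "\<dots> = VV ?p ?q + VV ?p ?n' - VV ?q ?n + VV ?n ?n'"
    unfolding VV_linear(1) VV_linear(5) VV_skew[of ?n ?q] by simp
  finally have e: "VV v w = VV ?p ?q + VV ?p ?n' - VV ?q ?n + VV ?n ?n'" .
  have "aff_app (VV ?p ?q) 0 = 0"
    unfolding VV_tangent[OF p q] by (rule value_kplus[OF brackets(3)[OF \<tau>(1)[OF p] \<tau>(1)[OF q]]])
  then have "aff_app (VV v w) 0 = lin (\<tau> ?q) ?n - lin (\<tau> ?p) ?n'"
    unfolding e by (simp add: mixed[OF p n'] mixed[OF q n] value_kplus[OF VV_normal[OF n n']])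
  then show ?thesis
    using torsion_free[OF \<tau>(1)[OF p] \<tau>(1)[OF q]] by (simp add: \<tau>(2)[OF p] \<tau>(2)[OF q] blinfun.diff_right)
qed

text \<open>The cyclic sum in the Jacobi identity of three vectors; \<open>[u, [v, w]] = - [[v, w],
  u]\<close> is the negative of the first term.\<close>

definition jac where
  "jac u v w = lin (VV v w) u + lin (VV w u) v + lin (VV u v) w"

text \<open>Apply \<open>D\<close> to \<open>[X, [v, w]] = [X v, w] + [v, X w]\<close>, which holds for
  \<open>X = T\<^sub>u\<close> by \<open>k_VV\<close>. As \<open>D X = - u\<close>, the terms in which
  \<open>D\<close> hits \<open>X\<close> form the cyclic sum, and the others cancel.\<close>

lemma jac_tangent:
  assumes u: "u \<in> T 0"
  shows "jac u v w = 0"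
proof -
  let ?X = "\<tau> u"
  let ?D = "\<lambda>v. \<tau> (P 0 v)"
  have X: "?X \<in> k" by (rule m_k[OF \<tau>(1)[OF u]])
  have X0: "aff_app ?X 0 = u" by (rule \<tau>(2)[OF u])
  have d1: "?D (lin ?X v) = aff_bracket ?X (?D v) - VV u v" for v
    using derivation_kV[OF X, of v] by (simp only: X0)
  have "- aff_app (aff_bracket ?X (VV v w)) 0
      = - aff_app (VV (lin ?X v) w) 0 + - aff_app (VV v (lin ?X w)) 0"
    by (simp add: k_VV[OF X])
  also have "\<dots> = lin ?X (lin (?D v) w - lin (?D w) v)
      - lin (VV u v) w + lin (VV u w) v"
    unfolding derivation_VV d1 by (simp add: fst_aff_bracket blinfun.bilinear_simps)
  also have "\<dots> = - lin ?X (aff_app (VV v w) 0)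
      - lin (VV u v) w + lin (VV u w) v"
    unfolding derivation_VV[symmetric] by (simp add: blinfun.minus_right)
  finally show ?thesis
    by (simp add: jac_def aff_app_bracket X0 VV_skew[of w u] blinfun.minus_left algebra_simps)
qed

lemma jac_linear: "jac (u + u') v w = jac u v w + jac u' v w" "jac (r *\<^sub>R u) v w = r *\<^sub>R jac u v w"
  by (simp_all add: jac_def VV_linear blinfun.bilinear_simps algebra_simps)

text \<open>All three constituents are equivariant under \<open>k\<close> by \<open>k_VV\<close>.\<close>

lemma jac_equivariant:
  assumes A: "A \<in> k"
  shows "lin A (jac u v w) = jac (lin A u) v w
    + jac u (lin A v) w + jac u v (lin A w)"
proof -
  have e: "lin A (lin (VV x y) z) = lin (VV x y) (lin A z)
     + lin (VV (blinfun_apply (fst A) x) y) z + lin (VV x (blinfun_apply (fst A) y)) z" for x y z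
    using arg_cong[OF k_VV[OF A, of x y], of "\<lambda>B. lin B z"]
    by (simp add: fst_aff_bracket blinfun.add_left algebra_simps)
  show ?thesis by (simp add: jac_def blinfun.add_right e)
qed

text \<open>For \<open>X\<close> in \<open>m\<close> and tangent \<open>y\<close>, equivariance and
  \<open>jac_tangent\<close> give \<open>jac (X y) v w = 0\<close>, because the other terms contain the
  tangent vector \<open>y\<close>. By \<open>normal_spanned\<close> these vectors and the tangent vectors
  span everything.\<close>

theorem jac_zero: "jac u v w = 0"
proof -
  have gen: "jac (lin X y) v w = 0" if "X \<in> m" "y \<in> T 0" for X y
    using jac_equivariant[OF m_k[OF that(1)], of y v w] by (simp add: jac_tangent[OF that(2)] blinfun.zero_right)
  have sub: "subspace {u. jac u v w = 0}"
    unfolding subspace_def using jac_linear(2)[of 0 0 v w] by (simp add: jac_linear)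
  obtain t n where tn: "u = t + n" "t \<in> T 0" "n \<in> span {lin X y | X y. X \<in> m \<and> y \<in> T 0}"
    using normal_spanned by blast
  have "span {lin X y | X y. X \<in> m \<and> y \<in> T 0} \<subseteq> {u. jac u v w = 0}"
    by (rule span_minimal[OF _ sub]) (use gen in blast)
  then have "jac n v w = 0" using tn(3) by blast
  then show ?thesis by (simp add: tn(1) jac_linear jac_tangent[OF tn(2)])
qed

section \<open>The triple\<close>

abbreviation gg where "gg \<equiv> g_alg b M"
abbreviation br where "br \<equiv> g_bracket b M"
abbreviation gD where "gD \<equiv> g_D b M"
abbreviation gB where "gB \<equiv> g_form b M"

lemma g_iff [simp]: "(A, v) \<in> gg \<longleftrightarrow> A \<in> k" by (simp add: g_alg_def)

lemma br_eq [simp]: "br (A, v) (B, w) = (aff_bracket A B + VV v w, lin A w - lin B v)"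
  by (simp add: g_bracket_def)

lemma gB_eq [simp]: "gB (A, v) (B, w) = \<kappa> A B + b v w" by (simp add: g_form_def)

lemma theta_eq [simp]: "g_theta (A, v) = (A, - v)" by (simp add: g_theta_def)

lemma g_cases: assumes "x \<in> gg" obtains A v where "x = (A, v)" "A \<in> k"
  using assms by (cases x) simp

lemma br_in: "x \<in> gg \<Longrightarrow> y \<in> gg \<Longrightarrow> br x y \<in> gg"
  by (elim g_cases) (simp add: subspace_add[OF sub_k] k_bracket VV_in)

lemma linear_on_setI:
  "(\<And>x y. x \<in> U \<Longrightarrow> y \<in> U \<Longrightarrow> f (x + y) = f x + f y) \<Longrightarrow> (\<And>r x. x \<in> U \<Longrightarrow> f (r *\<^sub>R x) = r *\<^sub>R f x) \<Longrightarrow> linear_on_set U f"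
  by (simp add: linear_on_set_def)

lemma bilinear_br: "bilinear_on_set gg br"
  unfolding bilinear_on_set_def
  by (intro conjI ballI linear_on_setI; elim g_cases)
    (simp_all add: aff_bracket_linear VV_linear blinfun.bilinear_simps scaleR_diff_right scaleR_add_right)

lemma sub_g: "subspace gg"
  unfolding g_alg_def by (rule subspace_Times[OF sub_k subspace_UNIV])

text \<open>The Jacobi identity has the types \<open>kkk\<close>, \<open>kkV\<close>, \<open>kVV\<close>
  (\<open>k_VV\<close>) and \<open>VVV\<close> (\<open>jac_zero\<close>).\<close>

lemma lie_algebra_g: "lie_algebra gg br"
  unfolding lie_algebra_def
proof (intro conjI ballI)
  show "\<exists>Bs. finite Bs \<and> gg = span Bs"
  proof -
    obtain Bs where Bs: "finite Bs" "span Bs = k" using aff_subspace_basis[OF sub_k] by metis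
    let ?C = "(\<lambda>A. (A, 0)) ` Bs \<union> Pair 0 ` (Basis :: 'a set)"
    have l1: "linear (\<lambda>A::'a aff. (A, 0::'a))" and l2: "linear (Pair (0::'a aff) :: 'a \<Rightarrow> _)"
      by (auto intro!: linearI)
    have sp: "span ?C = {x + y | x y. x \<in> (\<lambda>A. (A, 0)) ` k \<and> y \<in> range (Pair 0)}"
      by (simp add: span_Un linear_span_image[OF l1] linear_span_image[OF l2] Bs(2))
    have "gg = span ?C"
    proof (rule Set.set_eqI)
      fix x :: "'a aff \<times> 'a"
      obtain A v where x: "x = (A, v)" by (cases x)
      have "A \<in> k" if xs: "x \<in> span ?C"
      proof -
        obtain A' w where "A' \<in> k" "x = (A', 0) + (0, w)" using xs unfolding sp by blast
        then show ?thesis by (simp add: x)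
      qed
      moreover have "x \<in> span ?C" if "A \<in> k"
      proof -
        have "x = (A, 0) + (0, v)" by (simp add: x)
        then show ?thesis using that unfolding sp by blast
      qed
      ultimately have "x \<in> span ?C \<longleftrightarrow> A \<in> k" by blast
      then show "x \<in> gg \<longleftrightarrow> x \<in> span ?C" by (simp add: x)
    qed
    then show ?thesis using Bs(1) by (intro exI[of _ ?C]) simp
  qed
  show "br x y \<in> gg" if "x \<in> gg" "y \<in> gg" for x y using that by (rule br_in)
  show "br x x = 0" if "x \<in> gg" for x using that by (elim g_cases) (simp add: VV_linear zero_prod_def)
  fix x y z assume "x \<in> gg" "y \<in> gg" "z \<in> gg"
  then obtain A u B v C w where x: "x = (A, u)" and A: "A \<in> k" and y: "y = (B, v)" and B: "B \<in> k"
    and z: "z = (C, w)" and C: "C \<in> k"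
    by (metis g_cases)
  have j1: "aff_bracket A (aff_bracket B C) + aff_bracket B (aff_bracket C A) + aff_bracket C (aff_bracket A B) = 0"
    using aff_bracket_jacobi[of A B C] aff_bracket_skew[of "aff_bracket A B" C] aff_bracket_skew[of C A]
    by (simp add: aff_bracket_linear)
  have j2: "lin (VV v w) u + lin (VV w u) v + lin (VV u v) w = 0"
    using jac_zero[of u v w] by (simp add: jac_def)
  have f1: "aff_bracket A (aff_bracket B C + VV v w) + VV u (lin B w - lin C v)
      + (aff_bracket B (aff_bracket C A + VV w u) + VV v (lin C u - lin A w))
      + (aff_bracket C (aff_bracket A B + VV u v) + VV w (lin A v - lin B u)) = 0"
    using j1 VV_skew[of w "lin A v"] VV_skew[of w "lin B u"] VV_skew[of u "lin B w"]
      VV_skew[of u "lin C v"] VV_skew[of v "lin C u"] VV_skew[of v "lin A w"]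
    by (simp add: aff_bracket_linear k_VV A B C VV_linear algebra_simps)
  have f2: "lin A (lin B w - lin C v) - lin (aff_bracket B C + VV v w) u
      + (lin B (lin C u - lin A w) - lin (aff_bracket C A + VV w u) v)
      + (lin C (lin A v - lin B u) - lin (aff_bracket A B + VV u v) w) = 0"
  proof -
    have "?thesis \<longleftrightarrow> lin (VV v w) u + lin (VV w u) v + lin (VV u v) w = 0"
      by (simp add: blinfun.bilinear_simps fst_aff_bracket) (simp add: algebra_simps neg_eq_iff_add_eq_0)
    then show ?thesis using j2 by blast
  qed
  show "br x (br y z) + br y (br z x) + br z (br x y) = 0"
    unfolding x y z br_eq by (simp add: f1 f2 zero_prod_def del: fst_add snd_add)
qed (rule sub_g, rule bilinear_br)

lemma self_eq_neg_iff: "(v::'v::real_vector) = - v \<longleftrightarrow> v = 0"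
proof
  assume "v = - v"
  then have "v + v = 0" using eq_neg_iff_add_eq_0 by blast
  then have "2 *\<^sub>R v = 0" by (simp only: scaleR_2)
  then show "v = 0" by simp
qed simp

lemma plus_g: "plus_space gg g_theta = k \<times> {0}"
proof -
  have "(A, v) \<in> plus_space gg g_theta \<longleftrightarrow> (A, v) \<in> k \<times> {0}" for A v
    using self_eq_neg_iff[of v] by (simp only: plus_space_def mem_Collect_eq g_iff theta_eq prod.inject mem_Times_iff fst_conv snd_conv singleton_iff) metis
  then show ?thesis by (intro Set.set_eqI) (metis surj_pair)
qed

lemma minus_g: "minus_space gg g_theta = {0} \<times> UNIV"
proof -
  have "(A, v) \<in> minus_space gg g_theta \<longleftrightarrow> (A, v) \<in> {0} \<times> UNIV" for A v
    using self_eq_neg_iff[of A] subspace_0[OF sub_k]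
    by (simp only: minus_space_def mem_Collect_eq g_iff theta_eq prod.inject uminus_Pair mem_Times_iff fst_conv snd_conv singleton_iff UNIV_I) metis
  then show ?thesis by (intro Set.set_eqI) (metis surj_pair)
qed

lemma gD_in: "x \<in> gg \<Longrightarrow> gD x \<in> gg"
  by (elim g_cases) (simp add: g_D_eq m_k \<tau>(1) P0_in)

text \<open>So \<open>D\<^sup>2\<close> is minus the projection onto \<open>m \<times> T
  0\<close>.\<close>

lemma gD_gD: "A \<in> k \<Longrightarrow> gD (gD (A, v)) = (- minus_part A, - P 0 v)"
proof -
  assume A: "A \<in> k"
  have t: "\<tau> (aff_app A 0) = minus_part A"
    using \<tau>_value[OF minus_part_in[OF A]] by (simp add: value_minus_part[OF A])
  have A0: "aff_app A 0 \<in> T 0" by (rule k_tangent[OF A zero])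
  have "P 0 (- aff_app A 0) = - aff_app A 0" by (rule P_tangent[OF zero subspace_neg[OF sub_T[OF zero] A0]])
  then show ?thesis
    by (simp add: g_D_eq A m_k[OF \<tau>(1)[OF P0_in]] \<tau>_linear(4)[OF A0] t \<tau>(2)[OF P0_in])
qed

lemma D_plus_g: "plus_space gg g_theta \<inter> D_plus gg gD = kplus \<times> {0}"
proof -
  have "(A, v) \<in> plus_space gg g_theta \<inter> D_plus gg gD \<longleftrightarrow> (A, v) \<in> kplus \<times> {0}" for A v
  proof -
    have "aff_app A 0 = 0 \<longleftrightarrow> A \<in> kplus" if A: "A \<in> k"
    proof
      assume "aff_app A 0 = 0"
      then have "minus_part A = 0"
        by (intro m_eqI minus_part_in A subspace_0[OF sub_kminus]) (simp add: value_minus_part[OF A])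
      then show "A \<in> kplus" using plus_part_in[OF A] by (simp add: plus_part_def)
    qed (rule value_kplus)
    then show ?thesis
      using kplus_k[of A] unfolding plus_g D_plus_def by (auto simp: g_D_eq zero_prod_def linear_0[OF linear_P[OF zero]] \<tau>_linear(5))
  qed
  then show ?thesis by (intro Set.set_eqI) (metis surj_pair)
qed

lemma D_minus_g:
  "plus_space gg g_theta \<inter> D_minus gg gD = m \<times> {0}"
  "minus_space gg g_theta \<inter> D_minus gg gD = {0} \<times> T 0"
proof -
  have k: "minus_part A = A \<longleftrightarrow> A \<in> m" if "A \<in> k" for A using minus_part_m[of A] minus_part_in[OF that] by metis
  have v: "P 0 v = v \<longleftrightarrow> v \<in> T 0" for v using P_tangent[OF zero, of v] P0_in[of v] by metis
  have p: "(A, v) \<in> plus_space gg g_theta \<inter> D_minus gg gD \<longleftrightarrow> (A, v) \<in> m \<times> {0}" for A v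
    using m_k[of A] k[of A] unfolding plus_g D_minus_def by (auto simp: gD_gD linear_0[OF linear_P[OF zero]])
  have q: "(A, v) \<in> minus_space gg g_theta \<inter> D_minus gg gD \<longleftrightarrow> (A, v) \<in> {0} \<times> T 0" for A v
    using subspace_0[OF sub_k] v[of v] minus_part_m[OF subspace_0[OF sub_kminus]] unfolding minus_g D_minus_def by (auto simp: gD_gD)
  show "plus_space gg g_theta \<inter> D_minus gg gD = m \<times> {0}" using p by (intro Set.set_eqI) (metis surj_pair)
  show "minus_space gg g_theta \<inter> D_minus gg gD = {0} \<times> T 0" using q by (intro Set.set_eqI) (metis surj_pair)
qed

text \<open>This is \<open>kplus_eq\<close>.\<close>

lemma span_brackets_g:
  "span {br x y | x y. x \<in> plus_space gg g_theta \<inter> D_minus gg gD \<and> y \<in> plus_space gg g_theta \<inter> D_minus gg gD}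
    = plus_space gg g_theta \<inter> D_plus gg gD"
proof -
  let ?B = "{aff_bracket X Y | X Y. X \<in> m \<and> Y \<in> m}"
  have eq: "{br x y | x y. x \<in> m \<times> {0} \<and> y \<in> m \<times> {0}} = (\<lambda>A. (A, 0)) ` ?B"
  proof (intro subset_antisym subsetI)
    fix z assume "z \<in> {br x y | x y. x \<in> m \<times> {0} \<and> y \<in> m \<times> {0}}"
    then obtain X Y where "X \<in> m" "Y \<in> m" "z = br (X, 0) (Y, 0)" by blast
    moreover from this have "z = (aff_bracket X Y, 0)" by (simp add: VV_linear blinfun.zero_right)
    ultimately show "z \<in> (\<lambda>A. (A, 0)) ` ?B" by blast
  next
    fix z :: "'a aff \<times> 'a" assume "z \<in> (\<lambda>A. (A, 0)) ` ?B"
    then obtain X Y where XY: "X \<in> m" "Y \<in> m" "z = (aff_bracket X Y, 0)" by blast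
    have "z = br (X, 0) (Y, 0)" by (simp add: XY(3) VV_linear blinfun.zero_right)
    then show "z \<in> {br x y | x y. x \<in> m \<times> {0} \<and> y \<in> m \<times> {0}}" using XY(1,2) by blast
  qed
  have lin: "linear (\<lambda>A::'a aff. (A, 0::'a))" by (auto intro!: linearI)
  have "span ((\<lambda>A. (A, 0::'a)) ` ?B) = (\<lambda>A. (A, 0)) ` kplus"
    by (simp only: linear_span_image[OF lin] l_def[symmetric] kplus_eq)
  also have "\<dots> = kplus \<times> {0}" by blast
  finally show ?thesis unfolding D_minus_g D_plus_g eq .
qed

lemma gB_bilinear: "sym_bilinear_on gg gB"
  unfolding sym_bilinear_on_def bilinear_on_set_def
  by (intro conjI ballI linear_on_setI; elim g_cases)
    (simp_all add: \<kappa>_simps b_simps distrib_left \<kappa>_sym b_sym)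

lemma gB_ad: "ad_invariant gg br gB"
  unfolding ad_invariant_def
proof (intro ballI)
  fix x y z assume "x \<in> gg" "y \<in> gg" "z \<in> gg"
  then obtain A u B v C w where x: "x = (A, u)" and A: "A \<in> k" and y: "y = (B, v)" and B: "B \<in> k"
    and z: "z = (C, w)" and C: "C \<in> k"
    by (metis g_cases)
  have 1: "\<kappa> (aff_bracket A B) C + \<kappa> B (aff_bracket A C) = 0"
    using \<kappa>_ad A B C unfolding ad_invariant_def by blast
  have 2: "\<kappa> (VV u v) C = b (lin C u) v" "\<kappa> B (VV u w) = b (lin B u) w"
    using VV_char[OF C, of u v] VV_char[OF B, of u w] \<kappa>_sym[OF C VV_in] by simp_all
  show "gB (br x y) z + gB y (br x z) = 0"
    unfolding x y z br_eq gB_eq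
    using 1 2 k_skew[OF A, of v w] b_sym[of v "lin C u"]
    by (simp add: \<kappa>_simps A B C k_bracket VV_in b_simps)
qed

lemma gD_skew: "x \<in> gg \<Longrightarrow> y \<in> gg \<Longrightarrow> gB (gD x) y = - gB x (gD y)"
proof -
  have t: "\<kappa> (\<tau> (P 0 v)) B = b v (aff_app B 0)" if B: "B \<in> k" for v B
  proof -
    have p: "\<tau> (P 0 v) \<in> m" by (rule \<tau>(1)[OF P0_in])
    have "\<kappa> (\<tau> (P 0 v)) B = \<kappa> (\<tau> (P 0 v)) (minus_part B) + \<kappa> (\<tau> (P 0 v)) (plus_part B)"
      using \<kappa>_simps(1)[OF m_k[OF p] m_k[OF minus_part_in[OF B]] kplus_k[OF plus_part_in[OF B]]] k_split[of B] by simp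
    also have "\<dots> = b (P 0 v) (aff_app B 0)"
      by (simp add: \<kappa>_orth(2)[OF plus_part_in[OF B] p] \<kappa>_m[OF p minus_part_in[OF B]] \<tau>(2)[OF P0_in] value_minus_part[OF B])
    also have "\<dots> = b (P 0 v) (aff_app B 0) + b (v - P 0 v) (aff_app B 0)"
      using b_normal(2)[OF P0_normal k_tangent[OF B zero]] by simp
    finally show ?thesis by (simp add: b_simps)
  qed
  assume "x \<in> gg" "y \<in> gg"
  then obtain A u B v where x: "x = (A, u)" and A: "A \<in> k" and y: "y = (B, v)" and B: "B \<in> k"
    by (metis g_cases)
  show ?thesis
    using t[OF B, of u] t[OF A, of v] \<kappa>_sym[OF A m_k[OF \<tau>(1)[OF P0_in]], of v] b_sym[of v "aff_app A 0"]
    by (simp add: x y g_D_eq A B b_simps)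
qed

lemma gD_derivation: "derivation gg br gD"
  unfolding derivation_def
proof (intro conjI ballI linear_on_setI)
  fix x y :: "'a aff \<times> 'a" and r :: real assume x: "x \<in> gg"
  obtain A u where xe: "x = (A, u)" and A: "A \<in> k" using g_cases[OF x] .
  show "gD x \<in> gg" by (rule gD_in[OF x])
  show "gD (r *\<^sub>R x) = r *\<^sub>R gD x"
    using A subspace_scale[OF sub_k A] by (simp add: xe g_D_eq P_scale[OF zero] \<tau>_linear(3)[OF P0_in])
  assume y: "y \<in> gg"
  obtain B v where ye: "y = (B, v)" and B: "B \<in> k" using g_cases[OF y] .
  show "gD (x + y) = gD x + gD y"
    using A B subspace_add[OF sub_k A B] by (simp add: xe ye g_D_eq P_add[OF zero] \<tau>_linear(1)[OF P0_in P0_in])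
  have in_k: "aff_bracket A B + VV u v \<in> k" by (intro subspace_add[OF sub_k] k_bracket A B VV_in)
  have first: "\<tau> (P 0 (lin A v - lin B u))
      = aff_bracket (\<tau> (P 0 u)) B + VV (- aff_app A 0) v + (aff_bracket A (\<tau> (P 0 v)) + VV u (- aff_app B 0))"
    using aff_bracket_skew[of B "\<tau> (P 0 u)"] VV_skew[of "aff_app B 0" u]
    by (simp add: linear_diff[OF linear_P[OF zero]] \<tau>_linear(2)[OF P0_in P0_in] derivation_kV A B VV_linear)
  have second: "- aff_app (aff_bracket A B + VV u v) 0
      = lin (\<tau> (P 0 u)) v - lin B (- aff_app A 0)
        + (lin A (- aff_app B 0) - lin (\<tau> (P 0 v)) u)"
    using derivation_VV[of u v] by (simp add: aff_app_bracket blinfun.minus_right algebra_simps)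
  show "gD (br x y) = br (gD x) y + br x (gD y)"
    unfolding xe ye br_eq g_D_eq[OF A] g_D_eq[OF B] g_D_eq[OF in_k] add_Pair first second ..
qed

lemma theta_automorphism: "involutive_automorphism gg br g_theta"
  unfolding involutive_automorphism_def
  by (intro conjI ballI linear_on_setI; elim g_cases) (simp_all add: VV_linear blinfun.minus_right)

theorem pre_triple_g: "pre_triple gg br gB gD g_theta"
  unfolding pre_triple_def
proof (intro conjI ballI)
  show "span {br x y | x y. x \<in> plus_space gg g_theta \<inter> D_minus gg gD \<and> y \<in> plus_space gg g_theta \<inter> D_minus gg gD}
    = plus_space gg g_theta \<inter> D_plus gg gD" by (rule span_brackets_g)
  fix x assume x: "x \<in> gg"
  obtain A u where xe: "x = (A, u)" and A: "A \<in> k" using g_cases[OF x] .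
  show "gD (g_theta x) = - g_theta (gD x)"
    by (simp add: xe g_D_eq A linear_neg[OF linear_P[OF zero]] \<tau>_linear(4)[OF P0_in])
  have "gD (gD (gD x)) = gD (- minus_part A, - P 0 u)" by (simp add: xe gD_gD[OF A])
  then show "gD (gD (gD x)) = - gD x"
    by (simp add: xe g_D_eq A m_k[OF minus_part_in[OF A]] subspace_neg[OF sub_k] value_minus_part[OF A]
        linear_neg[OF linear_P[OF zero]] P_P[OF zero] \<tau>_linear(4)[OF P0_in])
  fix y assume y: "y \<in> gg"
  obtain B v where ye: "y = (B, v)" using g_cases[OF y] .
  show "gB (g_theta x) (g_theta y) = gB x y" by (simp add: xe ye b_simps)
  show "gB (gD x) y = - gB x (gD y)" by (rule gD_skew[OF x y])
qed (rule lie_algebra_g gB_bilinear gB_ad theta_automorphism gD_derivation)+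

theorem weak_triple_g: "weak_extrinsic_symmetric_triple gg br gB gD g_theta"
  unfolding weak_extrinsic_symmetric_triple_def
proof
  have "{x + y | x y. x \<in> plus_space gg g_theta \<and> y \<in> minus_space gg g_theta \<inter> D_minus gg gD} = k \<times> T 0"
    unfolding plus_g D_minus_g(2)
  proof (intro subset_antisym subsetI)
    fix x assume "x \<in> {x + y | x y. x \<in> k \<times> {0} \<and> y \<in> {0} \<times> T 0}"
    then obtain A u where "A \<in> k" "u \<in> T 0" "x = (A, 0) + (0, u)" by blast
    then show "x \<in> k \<times> T 0" by simp
  next
    fix x assume "x \<in> k \<times> T 0"
    then obtain A u where "A \<in> k" "u \<in> T 0" "x = (A, u)" by blast
    moreover from this have "x = (A, 0) + (0, u)" by simp
    ultimately show "x \<in> {x + y | x y. x \<in> k \<times> {0} \<and> y \<in> {0} \<times> T 0}" by blast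
  qed
  moreover have "nondegenerate_on (k \<times> T 0) gB"
    unfolding nondegenerate_on_def
  proof (intro ballI impI)
    fix x assume "x \<in> k \<times> T 0" and 0: "\<forall>y\<in>k \<times> T 0. gB x y = 0"
    then obtain A u where x: "x = (A, u)" "A \<in> k" "u \<in> T 0" by blast
    have "\<kappa> A B = 0" if "B \<in> k" for B
      using 0[rule_format, of "(B, 0)"] that subspace_0[OF sub_T[OF zero]] by (simp add: x(1) b_simps)
    then have "A = 0" using \<kappa>_nondegenerate x(2) unfolding nondegenerate_on_def by blast
    moreover have "b u v = 0" if "v \<in> T 0" for v
      using 0[rule_format, of "(0, v)"] that subspace_0[OF sub_k] by (simp add: x(1) \<kappa>_simps(7)[OF x(2)])
    then have "u = 0" using nd_T[OF zero] x(3) unfolding nondegenerate_on_def by blast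
    ultimately show "x = 0" by (simp add: x(1) zero_prod_def)
  qed
  ultimately show "nondegenerate_on {x + y | x y. x \<in> plus_space gg g_theta \<and> y \<in> minus_space gg g_theta \<inter> D_minus gg gD} gB"
    by simp
qed (rule pre_triple_g)

theorem triple_g:
  assumes "nondegenerate_on UNIV b"
  shows "extrinsic_symmetric_triple gg br gB gD g_theta"
  unfolding extrinsic_symmetric_triple_def
proof
  show "nondegenerate_on gg gB"
    unfolding nondegenerate_on_def
  proof (intro ballI impI)
    fix x assume "x \<in> gg" and 0: "\<forall>y\<in>gg. gB x y = 0"
    then obtain A u where x: "x = (A, u)" "A \<in> k" by (metis g_cases)
    have "\<kappa> A B = 0" if "B \<in> k" for B
      using 0[rule_format, of "(B, 0)"] that by (simp add: x(1) b_simps)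
    then have "A = 0" using \<kappa>_nondegenerate x(2) unfolding nondegenerate_on_def by blast
    moreover have "b u v = 0" for v
      using 0[rule_format, of "(0, v)"] subspace_0[OF sub_k] by (simp add: x(1) \<kappa>_simps(7)[OF x(2)])
    then have "u = 0" using assms unfolding nondegenerate_on_def by blast
    ultimately show "x = 0" by (simp add: x(1) zero_prod_def)
  qed
qed (rule pre_triple_g)

section \<open>The orbit of the origin under the group of the triple\<close>

text \<open>The subspace of vectors \<open>(0, v)\<close> is preserved, and in homogeneous coordinates
  the map in \<open>affine_exp\<close> is \<open>lie_mat A\<close> on it: \<open>A\<close> has the
  translation part \<open>A(0) = - D A\<close>.\<close>

lemma affine_exp_phi:
  assumes A: "A \<in> k"
  shows "affine_exp (phi br gD (A, 0)) (0, v) = (0, aff_app (aexp A) v)"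
proof -
  let ?F = "phi br gD (A, 0)"
  let ?N = "\<lambda>(z, t). (fst ?F z + t *\<^sub>R snd ?F, 0::real)"
  let ?inc = "\<lambda>q :: 'a \<times> real. ((0 :: 'a aff, fst q), snd q)"
  have step: "?N (?inc q) = ?inc (emap (lie_mat A) q)" for q
    by (simp add: phi_def g_D_eq[OF A] VV_linear blinfun.zero_right aff_bracket_linear linear_0[OF linear_P[OF zero]] \<tau>_linear(5) aff_app_def[of A])
  have pow: "(?N ^^ n) ((0, v), 1) = ?inc (emap (lie_mat A ^ n) (v, 1))" for n
  proof (induction n)
    case (Suc n)
    then show ?case by (simp only: funpow.simps comp_apply step power_Suc emap_simps)
  qed simp
  have inc: "bounded_linear ?inc"
    by (intro bounded_linear_Pair bounded_linear_zero bounded_linear_fst bounded_linear_snd)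
  have ev: "bounded_linear (\<lambda>X. ?inc (emap X (v, 1)))"
    by (rule bounded_linear_compose[OF inc bounded_bilinear.bounded_linear_left[OF bounded_bilinear_emap]])
  have "(\<lambda>n. ?inc (emap (lie_mat A ^ n /\<^sub>R fact n) (v, 1))) sums ?inc (emap (exp (lie_mat A)) (v, 1))"
    by (rule bounded_linear.sums[OF ev exp_converges])
  moreover have "?inc (emap (lie_mat A ^ n /\<^sub>R fact n) (v, 1)) = (?N ^^ n) ((0, v), 1) /\<^sub>R fact n" for n
    unfolding pow emap_simps by (simp only: fst_scaleR snd_scaleR scaleR_Pair scaleR_zero_right)
  ultimately have "(\<lambda>n. (?N ^^ n) ((0, v), 1) /\<^sub>R fact n) sums ?inc (emap (exp (lie_mat A)) (v, 1))"
    by (simp only:)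
  from sums_unique[OF this]
  have "affine_exp ?F (0, v) = fst (?inc (emap (exp (lie_mat A)) (v, 1)))"
    unfolding affine_exp_def by (simp only:)
  also have "\<dots> = (0, aff_app (aexp A) v)"
    by (simp only: aff_app_eq_emap grp_mat_aexp fst_conv)
  finally show ?thesis .
qed

text \<open>The action of an affine map of \<open>V\<close> on \<open>{0} \<times> V\<close>, with the
  value \<open>undefined\<close> elsewhere as in \<open>BijGroup\<close>.\<close>

definition on_V :: "'a aff \<Rightarrow> 'a aff \<times> 'a \<Rightarrow> 'a aff \<times> 'a" where
  "on_V B = restrict (\<lambda>x. (0, aff_app B (snd x))) (minus_space gg g_theta)"

lemma on_V_apply [simp]: "on_V B (0, v) = (0, aff_app B v)"
  by (simp add: on_V_def minus_g)

lemma on_V_eqI: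
  assumes "h \<in> extensional (minus_space gg g_theta)" "\<And>v. h (0, v) = (0, aff_app B v)"
  shows "h = on_V B"
proof (rule extensionalityI[OF assms(1)])
  show "on_V B \<in> extensional (minus_space gg g_theta)" by (simp add: on_V_def)
  show "h x = on_V B x" if "x \<in> minus_space gg g_theta" for x
    using that assms(2) unfolding minus_g by (cases x) simp
qed

lemma on_V_Bij:
  assumes "aff_comp B C = aff_id" "aff_comp C B = aff_id"
  shows "on_V B \<in> Bij (minus_space gg g_theta)"
    and "inv\<^bsub>BijGroup (minus_space gg g_theta)\<^esub> on_V B = on_V C"
proof -
  let ?S = "minus_space gg g_theta"
  have BC: "aff_app B (aff_app C y) = y" "aff_app C (aff_app B y) = y" for y
    by (simp_all only: aff_app_comp[symmetric] assms aff_app_id)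
  have bij: "bij_betw (on_V B) ?S ?S"
    by (rule bij_betwI[of _ _ _ "on_V C"]) (auto simp: minus_g BC)
  then show B: "on_V B \<in> Bij ?S" by (simp add: Bij_def on_V_def)
  have "inv\<^bsub>BijGroup ?S\<^esub> on_V B = (\<lambda>x\<in>?S. inv_into ?S (on_V B) x)" by (rule inv_BijGroup[OF B])
  also have "\<dots> = on_V C"
  proof (rule on_V_eqI)
    fix v
    have "inv_into ?S (on_V B) (on_V B (0, aff_app C v)) = (0, aff_app C v)"
      by (rule inv_into_f_f[OF bij_betw_imp_inj_on[OF bij]]) (simp add: minus_g)
    then show "(\<lambda>x\<in>?S. inv_into ?S (on_V B) x) (0, v) = (0, aff_app C v)" by (simp add: BC minus_g)
  qed simp
  finally show "inv\<^bsub>BijGroup ?S\<^esub> on_V B = on_V C" .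
qed

lemma exp_k_inverse:
  assumes "A \<in> aexp_group k"
  obtains B where "B \<in> aexp_group k" "aff_comp A B = aff_id" "aff_comp B A = aff_id"
  using aexp_group_inverse[OF assms] subspace_neg[OF sub_k] by blast

lemma on_V_mult:
  assumes "A \<in> aexp_group k" "B \<in> aexp_group k"
  shows "on_V A \<otimes>\<^bsub>BijGroup (minus_space gg g_theta)\<^esub> on_V B = on_V (aff_comp A B)"
proof (rule on_V_eqI)
  obtain A' B' where "aff_comp A A' = aff_id" "aff_comp A' A = aff_id" "aff_comp B B' = aff_id" "aff_comp B' B = aff_id"
    using exp_k_inverse[OF assms(1)] exp_k_inverse[OF assms(2)] by metis
  then have *: "on_V A \<in> Bij (minus_space gg g_theta)" "on_V B \<in> Bij (minus_space gg g_theta)"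
    by (metis on_V_Bij(1))+
  then show "on_V A \<otimes>\<^bsub>BijGroup (minus_space gg g_theta)\<^esub> on_V B \<in> extensional (minus_space gg g_theta)"
    by (simp add: BijGroup_def compose_def)
  show "(on_V A \<otimes>\<^bsub>BijGroup (minus_space gg g_theta)\<^esub> on_V B) (0, v) = (0, aff_app (aff_comp A B) v)" for v
    using * by (simp add: BijGroup_def compose_def) (simp add: minus_g)
qed

lemma on_V_one: "\<one>\<^bsub>BijGroup (minus_space gg g_theta)\<^esub> = on_V aff_id"
  by (rule on_V_eqI) (simp_all add: BijGroup_def minus_g)

lemma on_V_generator:
  assumes "A \<in> k"
  shows "restrict (affine_exp (phi br gD (A, 0))) (minus_space gg g_theta) = on_V (aexp A)"
  by (rule on_V_eqI) (simp_all add: minus_g affine_exp_phi[OF assms])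

lemma G_plus_eq: "G_plus gg br gD g_theta = on_V ` aexp_group k"
proof -
  let ?H = "{restrict (affine_exp (phi br gD X)) (minus_space gg g_theta) | X. X \<in> plus_space gg g_theta}"
  have H: "h \<in> ?H \<longleftrightarrow> (\<exists>A\<in>k. h = on_V (aexp A))" for h
  proof
    assume "h \<in> ?H"
    then obtain A where "A \<in> k" "h = restrict (affine_exp (phi br gD (A, 0))) (minus_space gg g_theta)"
      unfolding plus_g by blast
    then show "\<exists>A\<in>k. h = on_V (aexp A)" using on_V_generator by blast
  next
    assume "\<exists>A\<in>k. h = on_V (aexp A)"
    then obtain A where "A \<in> k" "h = restrict (affine_exp (phi br gD (A, 0))) (minus_space gg g_theta)"
      using on_V_generator by metis
    then show "h \<in> ?H" unfolding plus_g by blast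
  qed
  have 1: "h \<in> on_V ` aexp_group k" if "h \<in> generate (BijGroup (minus_space gg g_theta)) ?H" for h
    using that
  proof (induction rule: generate.induct)
    case one
    show ?case unfolding on_V_one by (rule imageI[OF aexp_group_id])
  next
    case (incl h)
    then show ?case using H aexp_group_generator by blast
  next
    case (inv h)
    then obtain A where A: "A \<in> k" "h = on_V (aexp A)" using H by blast
    show ?case
      unfolding A(2) on_V_Bij(2)[OF aexp_minus] by (rule imageI[OF aexp_group_generator[OF subspace_neg[OF sub_k A(1)]]])
  next
    case (eng h1 h2)
    then obtain A B where "A \<in> aexp_group k" "B \<in> aexp_group k" "h1 = on_V A" "h2 = on_V B" by blast
    then show ?case using on_V_mult[of A B] aexp_group_comp[of A k B] by simp
  qed
  have 2: "on_V A \<in> generate (BijGroup (minus_space gg g_theta)) ?H" if "A \<in> aexp_group k" for A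
    using that
  proof (induction rule: aexp_group.induct)
    case aexp_group_id
    show ?case unfolding on_V_one[symmetric] by (rule generate.one)
  next
    case (aexp_group_mult X A)
    have "on_V (aexp X) \<in> generate (BijGroup (minus_space gg g_theta)) ?H"
      by (rule generate.incl) (use H aexp_group_mult(1) in blast)
    from generate.eng[OF this aexp_group_mult(3)] show ?case
      by (simp only: on_V_mult[OF aexp_group_generator[OF aexp_group_mult(1)] aexp_group_mult(2)])
  qed
  show ?thesis unfolding G_plus_def using 1 2 by blast
qed

text \<open>The group consists of products of exponentials of \<open>k\<close>. They preserve
  \<open>M\<close> by \<open>aexp_k_M\<close>, and those of \<open>m\<close> are transitive on
  \<open>M\<close> by \<open>orbit\<close>.\<close>

theorem M_of_triple_eq: "M_of_triple gg br gD g_theta = Pair 0 ` M"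
proof -
  have e: "on_V A 0 = (0, aff_app A 0)" for A using on_V_apply[of A 0] by (simp add: zero_prod_def)
  have 1: "aff_app A 0 \<in> M" if "A \<in> aexp_group k" for A
    using that
  proof (induction rule: aexp_group.induct)
    case (aexp_group_mult X A)
    then show ?case using aexp_k_M by simp
  qed (simp add: zero)
  have 2: "A \<in> aexp_group k" if "A \<in> aexp_group m" for A
    using that by (induction rule: aexp_group.induct) (auto intro: aexp_group.intros m_k)
  show ?thesis
  proof (intro subset_antisym subsetI)
    fix x assume "x \<in> M_of_triple gg br gD g_theta"
    then obtain A where "A \<in> aexp_group k" "x = on_V A 0" unfolding M_of_triple_def G_plus_eq by blast
    then show "x \<in> Pair 0 ` M" using 1 by (simp add: e)
  next
    fix x :: "'a aff \<times> 'a" assume "x \<in> Pair 0 ` M"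
    then obtain y where y: "y \<in> M" "x = (0, y)" by blast
    obtain A where A: "A \<in> aexp_group m" "y = aff_app A 0" using orbit[OF y(1)] .
    have "x = on_V A 0" by (simp only: e y(2) A(2))
    then show "x \<in> M_of_triple gg br gD g_theta" unfolding M_of_triple_def G_plus_eq using 2[OF A(1)] by blast
  qed
qed

end

theorem theorem5p1:
  fixes b :: "'a::euclidean_space \<Rightarrow> 'a \<Rightarrow> real" and M :: "'a set"
  assumes "inner_product b"
    and "extrinsic_symmetric b M"
    and "full M"
    and "0 \<in> M"
  shows "weak_extrinsic_symmetric_triple
           (g_alg b M) (g_bracket b M) (g_form b M) (g_D b M) g_theta \<and>
         M_of_triple (g_alg b M) (g_bracket b M) (g_D b M) g_theta = Pair 0 ` M \<and>
         (nondegenerate_on UNIV b \<longrightarrow>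
            extrinsic_symmetric_triple
              (g_alg b M) (g_bracket b M) (g_form b M) (g_D b M) g_theta)"
proof -
  interpret full_space b M
    using assms by (intro full_space.intro extrinsic_space.intro full_space_axioms.intro)
  show ?thesis using weak_triple_g M_of_triple_eq triple_g by blast
qed

end
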